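(* Let $g\ge1$ be an integer. 1) Every representation $V\in\mathcal C(\mathfrak{sl}_2)$ admits a deformation $V^{h,h'}$ in $\mathcal C^{h,h'}(\mathfrak{sl}_2,g)$. 2) Two representations in $\mathcal C^{h,h'}(\mathfrak{sl}_2,g)$ are isomorphic if and only if their classical limits are. 3) The functor $\lim_{h,h'\to0}:\mathcal C^{h,h'}(\mathfrak{sl}_2,g)\to\mathcal C(\mathfrak{sl}_2)$ induces an additive isomorphism $$\Big[\lim_{h,h'\to0}\Big]:\ \mathrm{Rep}^{h,h'}(\mathfrak{sl}_2,g)\ \stackrel{\sim}{\longrightarrow}\ \mathrm{Rep}(\mathfrak{sl}_2)$$ from the Grothendieck group $\mathrm{Rep}^{h,h'}(\mathfrak{sl}_2,g)$ onto the Grothendieck group $\mathrm{Rep}(\mathfrak{sl}_2)$. 4) The category $\mathcal C^{h,h'}(\mathfrak{sl}_2,g)$ has the Krull-Schmidt property. 5) For every $n\in\mathbb N$, the finite rank representation $L^{h,h'}(n,g)$ is indecomposable. For every indecomposable finite rank representation $V^{h,h'}$ of $U_{h,h'}(\mathfrak{sl}_2,g)$, there is a unique $n\in\mathbb N$ such that $V^{h,h'}$ is isomorphic to $L^{h,h'}(n,g)$. 6) Every representation in $\mathcal C^{h,h'}(\mathfrak{sl}_2,g)$ is a weight representation.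
   Context: $\mathbb N=\{0,1,2,\dots\}$. For a vector space $V$, $V[[h,h']]$ is the space of formal power series with coefficients in $V$. The $\mathbb C[[h,h']]$-algebra topologically generated by a set $X$ with relations $\mathcal R$ is $\mathbb C\langle X\rangle[[h,h']]$ modulo the $(h,h')$-adic closure of the two-sided ideal generated by $\mathcal R$. Definition of $U_{h,h'}(\mathfrak{sl}_2,g)$. Let $\varepsilon=\exp(i\pi/g)$, $Q=\exp(h)$, $T=\exp(h')$, $$P(u)=\tfrac12\left(u^{g-1}+u^{1-g}\right)\prod_{k=1}^{g-1}\frac{\varepsilon^k u-\varepsilon^{-k}u^{-1}}{\varepsilon^k-\varepsilon^{-k}}.$$ $U_{h,h'}(\mathfrak{sl}_2,g)$ is the $\mathbb C[[h,h']]$-algebra topologically generated by $X^+,X^-,H,C$ with relations $[C,X^\pm]=[C,H]=0$, $[H,X^\pm]=\pm2X^\pm$, $$X^\pm X^\mp=\prod_{e=1,-1}\frac{\left(Q\,T^{\{H_e^\pm\}_Q}\right)^{H_e^\pm}-\left(Q\,T^{\{H_e^\pm\}_Q}\right)^{-H_e^\pm}}{Q\,T^{\{H_e^\pm\}_Q}-Q^{-1}T^{-\{H_e^\pm\}_Q}},$$ where $H_e^\pm=\frac12(\sqrt C+eH\mp e)$, $\{H_e^\pm\}_Q=P(Q^{H_e^\pm})$. Numerator and denominator are series in $\mathbb C[H,\sqrt C][[h,h']]$, each divided by $h+h'\{H_e^\pm\}_Q$ before the quotient is taken; the product over $e$ is invariant under $\sqrt C\mapsto-\sqrt C$, and $(\sqrt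 C)^2$ is replaced by $C$. Modulo $(h,h')$ this algebra is $U(\mathfrak{sl}_2)$, with $X^\pm,H$ reducing to the standard generators $\bar X^\pm,\bar H$ ($[\bar H,\bar X^\pm]=\pm2\bar X^\pm$, $[\bar X^+,\bar X^-]=\bar H$). A representation $V^{h,h'}$ of $U_{h,h'}(\mathfrak{sl}_2,g)$ is a $\mathbb C$-vector space $V$ with a $\mathbb C[[h,h']]$-algebra morphism $U_{h,h'}(\mathfrak{sl}_2,g)\to\mathrm{End}_{\mathbb C[[h,h']]}(V[[h,h']])$; it has finite rank if $\dim V<\infty$. Its classical limit $\lim_{h,h'\to0}V^{h,h'}$ is the representation of $U(\mathfrak{sl}_2)$ on $V$ induced modulo $(h,h')$, and $V^{h,h'}$ is called a deformation of it. $\mathcal C^{h,h'}(\mathfrak{sl}_2,g)$ is the additive category of finite rank representations of $U_{h,h'}(\mathfrak{sl}_2,g)$ (direct sum given by $(V\oplus W)[[h,h']]$); $\mathcal C(\mathfrak{sl}_2)$ is the category of finite dimensional complex representations of $\mathfrak{sl}_2$. $\mathrm{Rep}^{h,h'}(\mathfrak{sl}_2,g)$ and $\mathrm{Rep}(\mathfrak{sl}_2)$ are the Grothendieck groups of these additive categories. An additive category has the Krull-Schmidt property if every object is a direct sum of indecomposable objects, the summands being unique up to isomorphism and order. An indecomposable representation is an indecomposable object of the additive category of representations. A representation $V^{h,h'}$ is a weight representation if $V^{h,h'}=\bigoplus_{n\in\mathbb Z}V^{h,h'}_n$ with $V^{h,h'}_n=\{f:Hf=nf\}$. $L^{h,h'}(n,g)$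 ($n\in\mathbb N$) is $\big(\bigoplus_{0\le j\le n}\mathbb C m_j\big)[[h,h']]$ with $Hm_j=(n-2j)m_j$, $Cm_j=(n+1)^2m_j$, $X^-m_j=m_{j+1}$, $X^+m_j=[j]_{QT^{\{j\}}}[n-j+1]_{QT^{\{n-j+1\}}}m_{j-1}$ ($m_{-1}=m_{n+1}=0$), where $\{a\}=P(Q^a)$ and $[a]_q=\frac{q^a-q^{-a}}{q-q^{-1}}$. *)

theory Defs
  imports
    "HOL-Analysis.Determinants"
    "HOL-Computational_Algebra.Formal_Power_Series"
    "HOL-Algebra.Algebraic_Closure_Type"
    "HOL-Algebra.Free_Abelian_Groups"
begin

no_notation fps_nth (infixl "$" 75)

section \<open>Series in two variables\<close>

text \<open>\<open>A[[h,h']]\<close> is \<^typ>\<open>'a fps fps\<close>, read as \<open>A[[h]][[h']]\<close>: the outer variable is \<open>h'\<close>.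
  \<open>hcoeff F k l\<close> is the coefficient of \<open>h^k h'^l\<close>.\<close>

definition hcoeff :: "'a fps fps \<Rightarrow> nat \<Rightarrow> nat \<Rightarrow> 'a" where
  "hcoeff F k l = fps_nth (fps_nth F l) k"

definition hseries :: "(nat \<Rightarrow> nat \<Rightarrow> 'a) \<Rightarrow> 'a fps fps" where
  "hseries c = Abs_fps (\<lambda>l. Abs_fps (\<lambda>k. c k l))"

definition hconst :: "'a::zero \<Rightarrow> 'a fps fps" where
  "hconst a = fps_const (fps_const a)"

definition var_h :: "'a::{zero,one} fps fps" where
  "var_h = fps_const fps_X"

definition var_h' :: "'a::{zero,one} fps fps" where
  "var_h' = fps_X"

text \<open>In what follows \<open>\<iota> : \<complex> \<rightarrow> A\<close> is the structure map of a commutative \<open>\<complex>\<close>-algebra \<open>A\<close>.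
  \<open>hexp \<iota> f\<close> is the exponential of a series \<open>f\<close> without constant term; for such \<open>f\<close> the power
  \<open>f^n\<close> has no terms of total degree less than \<open>n\<close>, hence the finite sum.\<close>

definition hexp :: "(complex \<Rightarrow> 'a::idom) \<Rightarrow> 'a fps fps \<Rightarrow> 'a fps fps" where
  "hexp \<iota> f = hseries (\<lambda>k l. \<Sum>n\<le>k+l. hcoeff (hconst (\<iota> (1 / fact n)) * f ^ n) k l)"

definition exact_div :: "'a::idom \<Rightarrow> 'a \<Rightarrow> 'a" where
  "exact_div a b = (THE c. a = b * c)"

text \<open>\<open>Plaurent \<iota> g u u'\<close> is \<open>P(u)\<close>, where \<open>u'\<close> is the inverse of \<open>u\<close>.\<close>

definition eps :: "nat \<Rightarrow> complex" where
  "eps g = exp (\<i> * of_real pi / of_nat g)"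

definition Plaurent ::
    "(complex \<Rightarrow> 'a::idom) \<Rightarrow> nat \<Rightarrow> 'a fps fps \<Rightarrow> 'a fps fps \<Rightarrow> 'a fps fps" where
  "Plaurent \<iota> g u u' =
     hconst (\<iota> (1/2)) * (u ^ (g - 1) + u' ^ (g - 1)) *
     (\<Prod>k=1..g-1.
        (hconst (\<iota> (eps g ^ k)) * u - hconst (\<iota> (inverse (eps g ^ k))) * u') *
        hconst (\<iota> (1 / (eps g ^ k - inverse (eps g ^ k)))))"

text \<open>\<open>curly \<iota> g a\<close> is \<open>{a}\<^sub>Q = P(Q^a)\<close> with \<open>Q^a = exp (h a)\<close>, and \<open>log_base \<iota> g a\<close> is
  \<open>h + h'{a}\<^sub>Q\<close>, so that \<open>(Q T^{{a}})^b = exp (b (h + h'{a}))\<close>.\<close>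

definition curly :: "(complex \<Rightarrow> 'a::idom) \<Rightarrow> nat \<Rightarrow> 'a \<Rightarrow> 'a fps fps" where
  "curly \<iota> g a = Plaurent \<iota> g (hexp \<iota> (var_h * hconst a)) (hexp \<iota> (- (var_h * hconst a)))"

definition log_base :: "(complex \<Rightarrow> 'a::idom) \<Rightarrow> nat \<Rightarrow> 'a \<Rightarrow> 'a fps fps" where
  "log_base \<iota> g a = var_h + var_h' * curly \<iota> g a"

text \<open>\<open>qbracket \<iota> g a\<close> is \<open>[a]\<^sub>q\<close> at \<open>q = Q T^{{a}}\<close>.\<close>

definition qbracket :: "(complex \<Rightarrow> 'a::idom) \<Rightarrow> nat \<Rightarrow> 'a \<Rightarrow> 'a fps fps" where
  "qbracket \<iota> g a =
     (let z = log_base \<iota> g a in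
      exact_div
        (exact_div (hexp \<iota> (hconst a * z) - hexp \<iota> (- (hconst a * z))) z)
        (exact_div (hexp \<iota> z - hexp \<iota> (- z)) z))"

section \<open>The algebra \<open>U\<^sub>h\<^sub>,\<^sub>h\<^sub>'(sl\<^sub>2,g)\<close>\<close>

datatype gen = Gen_Xp | Gen_Xm | Gen_H | Gen_C

datatype gword = Word "gen list"

instantiation gword :: monoid_add
begin

definition zero_gword :: gword where
  "zero_gword = Word []"

fun plus_gword :: "gword \<Rightarrow> gword \<Rightarrow> gword" where
  "plus_gword (Word v) (Word w) = Word (v @ w)"

instance
proof
  fix a b c :: gword
  show "a + b + c = a + (b + c)" by (cases a; cases b; cases c) simp
  show "0 + a = a" by (cases a) (simp add: zero_gword_def)
  show "a + 0 = a" by (cases a) (simp add: zero_gword_def)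
qed

end

text \<open>The product of \<open>'a \<Rightarrow>\<^sub>0 complex\<close> is convolution over the additively written monoid \<open>'a\<close>;
  over words this is the free algebra on the generators.\<close>

type_synonym free_alg = "gword \<Rightarrow>\<^sub>0 complex"

definition gen_el :: "gen \<Rightarrow> free_alg fps fps" where
  "gen_el x = hconst (Poly_Mapping.single (Word [x]) 1)"

definition free_ring :: "free_alg fps fps ring" where
  "free_ring = ring_of_type_algebra"

text \<open>\<open>\<complex>[H,\<surd>C]\<close> is \<^typ>\<open>complex poly poly\<close>: the outer variable is \<open>H\<close>, the inner one \<open>\<surd>C\<close>.\<close>

definition cA :: "complex \<Rightarrow> complex poly poly" where
  "cA c = [:[:c:]:]"

definition var_H :: "complex poly poly" where
  "var_H = [:0, 1:]"

definition sqrt_C :: "complex poly poly" where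
  "sqrt_C = [:[:0, 1:]:]"

text \<open>\<open>H\<^sub>e\<^sup>\<plusminus>\<close>, with \<open>\<sigma> = \<plusminus>1\<close> for the upper sign.\<close>

definition H_shift :: "complex \<Rightarrow> complex \<Rightarrow> complex poly poly" where
  "H_shift \<sigma> e = cA (1/2) * (sqrt_C + cA e * var_H - cA (\<sigma> * e))"

definition rel_series :: "nat \<Rightarrow> complex \<Rightarrow> complex poly poly fps fps" where
  "rel_series g \<sigma> = (\<Prod>e\<in>{1, -1}. qbracket cA g (H_shift \<sigma> e))"

text \<open>Substitution of \<open>C\<close> for \<open>(\<surd>C)\<^sup>2\<close> in a polynomial that is even in \<open>\<surd>C\<close> (the odd
  coefficients are ignored), written in the free algebra with \<open>H\<close> to the left of \<open>C\<close>;
  the order is immaterial since \<open>[C,H] = 0\<close> is one of the relations.\<close>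

definition even_subst :: "complex poly poly \<Rightarrow> free_alg" where
  "even_subst f =
     (\<Sum>p\<le>Polynomial.degree f. \<Sum>q\<le>Polynomial.degree (Polynomial.coeff f p).
        Poly_Mapping.single (Word (replicate p Gen_H @ replicate q Gen_C))
          (Polynomial.coeff (Polynomial.coeff f p) (2 * q)))"

definition rel_rhs :: "nat \<Rightarrow> complex \<Rightarrow> free_alg fps fps" where
  "rel_rhs g \<sigma> = hseries (\<lambda>k l. even_subst (hcoeff (rel_series g \<sigma>) k l))"

definition relators :: "nat \<Rightarrow> free_alg fps fps set" where
  "relators g =
     (let Xp = gen_el Gen_Xp; Xm = gen_el Gen_Xm; H = gen_el Gen_H; C = gen_el Gen_C in
      {C * Xp - Xp * C, C * Xm - Xm * C, C * H - H * C,
       (H * Xp - Xp * H) - 2 * Xp, (H * Xm - Xm * H) + 2 * Xm,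
       Xp * Xm - rel_rhs g 1, Xm * Xp - rel_rhs g (-1)})"

definition adic_closure :: "'a fps fps set \<Rightarrow> 'a fps fps set" where
  "adic_closure I =
     {x. \<forall>n. \<exists>y\<in>I. \<forall>k l. k + l < n \<longrightarrow> hcoeff x k l = hcoeff y k l}"

definition rel_ideal :: "nat \<Rightarrow> free_alg fps fps set" where
  "rel_ideal g = adic_closure (genideal free_ring (relators g))"

definition Uhh :: "nat \<Rightarrow> free_alg fps fps set ring" where
  "Uhh g = FactRing free_ring (rel_ideal g)"

definition ucls :: "nat \<Rightarrow> free_alg fps fps \<Rightarrow> free_alg fps fps set" where
  "ucls g x = a_r_coset free_ring (rel_ideal g) x"

text \<open>The structure map \<open>\<complex>[[h,h']] \<rightarrow> U\<^sub>h\<^sub>,\<^sub>h\<^sub>'(sl\<^sub>2,g)\<close>.\<close>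

definition uscalar :: "nat \<Rightarrow> complex fps fps \<Rightarrow> free_alg fps fps set" where
  "uscalar g c = ucls g (hseries (\<lambda>k l. Poly_Mapping.single 0 (hcoeff c k l)))"

section \<open>Modules\<close>

text \<open>The multiplication and unit fields of the module records below play no role.\<close>

definition CR :: "complex ring" where
  "CR = ring_of_type_algebra"

definition KR :: "complex fps fps ring" where
  "KR = ring_of_type_algebra"

definition fin_dim :: "(complex, 'v) module \<Rightarrow> bool" where
  "fin_dim V \<longleftrightarrow> (\<exists>B. finite B \<and> B \<subseteq> carrier V \<and>
     (\<forall>v\<in>carrier V. \<exists>c. v = (\<Oplus>\<^bsub>V\<^esub>b\<in>B. c b \<odot>\<^bsub>V\<^esub> b)))"

text \<open>\<open>V[[h,h']]\<close>; \<open>f k l\<close> is the coefficient of \<open>h^k h'^l\<close>.\<close>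

definition ps_mod ::
    "(complex, 'v) module \<Rightarrow> (complex fps fps, nat \<Rightarrow> nat \<Rightarrow> 'v) module" where
  "ps_mod V =
     \<lparr>carrier = {f. \<forall>k l. f k l \<in> carrier V}, mult = undefined, one = undefined,
      ring.zero = (\<lambda>k l. \<zero>\<^bsub>V\<^esub>), ring.add = (\<lambda>f f' k l. f k l \<oplus>\<^bsub>V\<^esub> f' k l),
      module.smult = (\<lambda>c f k l. \<Oplus>\<^bsub>V\<^esub>i\<in>{..k}. \<Oplus>\<^bsub>V\<^esub>j\<in>{..l}. hcoeff c i j \<odot>\<^bsub>V\<^esub> f (k - i) (l - j))\<rparr>"

definition ps_const :: "(complex, 'v) module \<Rightarrow> 'v \<Rightarrow> nat \<Rightarrow> nat \<Rightarrow> 'v" where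
  "ps_const V v = (\<lambda>k l. if k = 0 \<and> l = 0 then v else \<zero>\<^bsub>V\<^esub>)"

definition lin_maps :: "'r ring \<Rightarrow> ('r, 'v) module \<Rightarrow> ('r, 'w) module \<Rightarrow> ('v \<Rightarrow> 'w) set" where
  "lin_maps R M N =
     {\<phi> \<in> carrier M \<rightarrow>\<^sub>E carrier N.
        (\<forall>x\<in>carrier M. \<forall>y\<in>carrier M. \<phi> (x \<oplus>\<^bsub>M\<^esub> y) = \<phi> x \<oplus>\<^bsub>N\<^esub> \<phi> y) \<and>
        (\<forall>c\<in>carrier R. \<forall>x\<in>carrier M. \<phi> (c \<odot>\<^bsub>M\<^esub> x) = c \<odot>\<^bsub>N\<^esub> \<phi> x)}"

definition End_ring :: "'r ring \<Rightarrow> ('r, 'v) module \<Rightarrow> ('v \<Rightarrow> 'v) ring" where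
  "End_ring R M =
     \<lparr>carrier = lin_maps R M M, mult = compose (carrier M), one = (\<lambda>x\<in>carrier M. x),
      ring.zero = (\<lambda>x\<in>carrier M. \<zero>\<^bsub>M\<^esub>), ring.add = (\<lambda>\<phi> \<psi>. \<lambda>x\<in>carrier M. \<phi> x \<oplus>\<^bsub>M\<^esub> \<psi> x)\<rparr>"

definition mod_dsum :: "('r, 'v) module list \<Rightarrow> ('r, nat \<Rightarrow> 'v) module" where
  "mod_dsum Vs =
     \<lparr>carrier = (\<Pi>\<^sub>E i\<in>{..<length Vs}. carrier (Vs ! i)), mult = undefined, one = undefined,
      ring.zero = (\<lambda>i\<in>{..<length Vs}. \<zero>\<^bsub>Vs ! i\<^esub>),
      ring.add = (\<lambda>x y. \<lambda>i\<in>{..<length Vs}. x i \<oplus>\<^bsub>Vs ! i\<^esub> y i),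
      module.smult = (\<lambda>c x. \<lambda>i\<in>{..<length Vs}. c \<odot>\<^bsub>Vs ! i\<^esub> x i)\<rparr>"

section \<open>The category \<open>\<C>\<^sup>h\<^sup>,\<^sup>h\<^sup>'(sl\<^sub>2,g)\<close>\<close>

record 'v hrep =
  hspace :: "(complex, 'v) module"
  hact :: "free_alg fps fps set \<Rightarrow> (nat \<Rightarrow> nat \<Rightarrow> 'v) \<Rightarrow> nat \<Rightarrow> nat \<Rightarrow> 'v"

definition hrep_obj :: "nat \<Rightarrow> 'v hrep \<Rightarrow> bool" where
  "hrep_obj g W \<longleftrightarrow>
     Module.module CR (hspace W) \<and> fin_dim (hspace W) \<and>
     hact W \<in> extensional (carrier (Uhh g)) \<and>
     hact W \<in> ring_hom (Uhh g) (End_ring KR (ps_mod (hspace W))) \<and>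
     (\<forall>c. hact W (uscalar g c) =
        (\<lambda>f\<in>carrier (ps_mod (hspace W)). c \<odot>\<^bsub>ps_mod (hspace W)\<^esub> f))"

definition hrep_hom ::
    "nat \<Rightarrow> 'v hrep \<Rightarrow> 'w hrep \<Rightarrow> ((nat \<Rightarrow> nat \<Rightarrow> 'v) \<Rightarrow> nat \<Rightarrow> nat \<Rightarrow> 'w) set" where
  "hrep_hom g V W =
     {\<phi> \<in> lin_maps KR (ps_mod (hspace V)) (ps_mod (hspace W)).
        \<forall>u\<in>carrier (Uhh g). \<forall>f\<in>carrier (ps_mod (hspace V)).
          \<phi> (hact V u f) = hact W u (\<phi> f)}"

definition hrep_iso :: "nat \<Rightarrow> 'v hrep \<Rightarrow> 'w hrep \<Rightarrow> bool" where
  "hrep_iso g V W \<longleftrightarrow>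
     (\<exists>\<phi>\<in>hrep_hom g V W.
        bij_betw \<phi> (carrier (ps_mod (hspace V))) (carrier (ps_mod (hspace W))))"

definition hrep_dsum :: "nat \<Rightarrow> 'v hrep list \<Rightarrow> (nat \<Rightarrow> 'v) hrep" where
  "hrep_dsum g Ws =
     \<lparr>hspace = mod_dsum (map hspace Ws),
      hact = (\<lambda>u\<in>carrier (Uhh g). \<lambda>f\<in>carrier (ps_mod (mod_dsum (map hspace Ws))).
        \<lambda>k l. \<lambda>i\<in>{..<length Ws}. hact (Ws ! i) u (\<lambda>k' l'. f k' l' i) k l)\<rparr>"

definition hrep_indecomposable :: "nat \<Rightarrow> 'v hrep \<Rightarrow> bool" where
  "hrep_indecomposable g W \<longleftrightarrow>
     hrep_obj g W \<and> carrier (hspace W) \<noteq> {\<zero>\<^bsub>hspace W\<^esub>} \<and>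
     (\<forall>(A :: 'v hrep) (B :: 'v hrep). hrep_obj g A \<and> hrep_obj g B \<and> hrep_iso g W (hrep_dsum g [A, B]) \<longrightarrow>
        carrier (hspace A) = {\<zero>\<^bsub>hspace A\<^esub>} \<or> carrier (hspace B) = {\<zero>\<^bsub>hspace B\<^esub>})"

definition weight_space :: "nat \<Rightarrow> 'v hrep \<Rightarrow> int \<Rightarrow> (nat \<Rightarrow> nat \<Rightarrow> 'v) set" where
  "weight_space g W n =
     {f \<in> carrier (ps_mod (hspace W)).
        hact W (ucls g (gen_el Gen_H)) f = of_int n \<odot>\<^bsub>ps_mod (hspace W)\<^esub> f}"

definition weight_rep :: "nat \<Rightarrow> 'v hrep \<Rightarrow> bool" where
  "weight_rep g W \<longleftrightarrow>
     (\<forall>f\<in>carrier (ps_mod (hspace W)).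
        \<exists>!w. (\<forall>n. w n \<in> weight_space g W n) \<and>
             finite {n. w n \<noteq> \<zero>\<^bsub>ps_mod (hspace W)\<^esub>} \<and>
             f = (\<Oplus>\<^bsub>ps_mod (hspace W)\<^esub>n\<in>{n. w n \<noteq> \<zero>\<^bsub>ps_mod (hspace W)\<^esub>}. w n))"

section \<open>The representations \<open>L\<^sup>h\<^sup>,\<^sup>h\<^sup>'(n,g)\<close>\<close>

definition L_space :: "nat \<Rightarrow> (complex, nat \<Rightarrow> complex) module" where
  "L_space n =
     \<lparr>carrier = {x. \<forall>j>n. x j = 0}, mult = undefined, one = undefined,
      ring.zero = (\<lambda>j. 0), ring.add = (\<lambda>x y j. x j + y j), module.smult = (\<lambda>c x j. c * x j)\<rparr>"

definition L_basis :: "nat \<Rightarrow> nat \<Rightarrow> nat \<Rightarrow> nat \<Rightarrow> nat \<Rightarrow> complex" where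
  "L_basis n j = ps_const (L_space n) (\<lambda>i. if i = j \<and> j \<le> n then 1 else 0)"

text \<open>The generators determine the morphism from \<open>U\<^sub>h\<^sub>,\<^sub>h\<^sub>'(sl\<^sub>2,g)\<close> uniquely. Note that
  \<open>L_basis n (n + 1)\<close> is zero.\<close>

definition L_rep :: "nat \<Rightarrow> nat \<Rightarrow> (nat \<Rightarrow> complex) hrep" where
  "L_rep g n =
     \<lparr>hspace = L_space n,
      hact = (THE \<rho>.
        hrep_obj g \<lparr>hspace = L_space n, hact = \<rho>\<rparr> \<and>
        (\<forall>j\<le>n.
          \<rho> (ucls g (gen_el Gen_H)) (L_basis n j) =
            (of_nat n - 2 * of_nat j) \<odot>\<^bsub>ps_mod (L_space n)\<^esub> L_basis n j \<and>
          \<rho> (ucls g (gen_el Gen_C)) (L_basis n j) =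
            (of_nat (n + 1))\<^sup>2 \<odot>\<^bsub>ps_mod (L_space n)\<^esub> L_basis n j \<and>
          \<rho> (ucls g (gen_el Gen_Xm)) (L_basis n j) = L_basis n (j + 1) \<and>
          \<rho> (ucls g (gen_el Gen_Xp)) (L_basis n j) =
            (if j = 0 then \<zero>\<^bsub>ps_mod (L_space n)\<^esub>
             else (qbracket (\<lambda>c. c) g (of_nat j) * qbracket (\<lambda>c. c) g (of_nat (n - j + 1)))
                    \<odot>\<^bsub>ps_mod (L_space n)\<^esub> L_basis n (j - 1))))\<rparr>"

section \<open>The category \<open>\<C>(sl\<^sub>2)\<close> and the classical limit\<close>

definition sl2 :: "(complex^2^2) set" where
  "sl2 = {A. trace A = 0}"

record 'v sl2_rep =
  sspace :: "(complex, 'v) module"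
  sact :: "complex^2^2 \<Rightarrow> 'v \<Rightarrow> 'v"

definition sl2_obj :: "'v sl2_rep \<Rightarrow> bool" where
  "sl2_obj V \<longleftrightarrow>
     Module.module CR (sspace V) \<and> fin_dim (sspace V) \<and>
     sact V \<in> sl2 \<rightarrow>\<^sub>E lin_maps CR (sspace V) (sspace V) \<and>
     (\<forall>A\<in>sl2. \<forall>B\<in>sl2. \<forall>c. \<forall>v\<in>carrier (sspace V).
        sact V (A + B) v = sact V A v \<oplus>\<^bsub>sspace V\<^esub> sact V B v \<and>
        sact V (\<chi> i j. c * A $ i $ j) v = c \<odot>\<^bsub>sspace V\<^esub> sact V A v \<and>
        sact V (A ** B - B ** A) v =
          sact V A (sact V B v) \<ominus>\<^bsub>sspace V\<^esub> sact V B (sact V A v))"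

definition sl2_hom :: "'v sl2_rep \<Rightarrow> 'w sl2_rep \<Rightarrow> ('v \<Rightarrow> 'w) set" where
  "sl2_hom V W =
     {\<phi> \<in> lin_maps CR (sspace V) (sspace W).
        \<forall>A\<in>sl2. \<forall>v\<in>carrier (sspace V). \<phi> (sact V A v) = sact W A (\<phi> v)}"

definition sl2_iso :: "'v sl2_rep \<Rightarrow> 'w sl2_rep \<Rightarrow> bool" where
  "sl2_iso V W \<longleftrightarrow>
     (\<exists>\<phi>\<in>sl2_hom V W. bij_betw \<phi> (carrier (sspace V)) (carrier (sspace W)))"

definition sl2_dsum :: "'v sl2_rep list \<Rightarrow> (nat \<Rightarrow> 'v) sl2_rep" where
  "sl2_dsum Vs =
     \<lparr>sspace = mod_dsum (map sspace Vs),
      sact = (\<lambda>A\<in>sl2. \<lambda>x\<in>carrier (mod_dsum (map sspace Vs)).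
        \<lambda>i\<in>{..<length Vs}. sact (Vs ! i) A (x i))\<rparr>"

text \<open>An element of \<open>U\<^sub>h\<^sub>,\<^sub>h\<^sub>'(sl\<^sub>2,g)\<close> acts modulo \<open>(h,h')\<close> on \<open>V = V[[h,h']]/(h,h')V[[h,h']]\<close>;
  the classes of \<open>H, X\<^sup>+, X\<^sup>-\<close> are identified with the standard generators
  \<open>E\<^sub>1\<^sub>1 - E\<^sub>2\<^sub>2, E\<^sub>1\<^sub>2, E\<^sub>2\<^sub>1\<close> of \<open>sl\<^sub>2\<close>.\<close>

definition hact_mod :: "nat \<Rightarrow> 'v hrep \<Rightarrow> gen \<Rightarrow> 'v \<Rightarrow> 'v" where
  "hact_mod g W x v = hact W (ucls g (gen_el x)) (ps_const (hspace W) v) 0 0"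

definition class_lim :: "nat \<Rightarrow> 'v hrep \<Rightarrow> 'v sl2_rep" where
  "class_lim g W =
     \<lparr>sspace = hspace W,
      sact = (\<lambda>A\<in>sl2. \<lambda>v\<in>carrier (hspace W).
        A $ 1 $ 1 \<odot>\<^bsub>hspace W\<^esub> hact_mod g W Gen_H v \<oplus>\<^bsub>hspace W\<^esub>
        A $ 1 $ 2 \<odot>\<^bsub>hspace W\<^esub> hact_mod g W Gen_Xp v \<oplus>\<^bsub>hspace W\<^esub>
        A $ 2 $ 1 \<odot>\<^bsub>hspace W\<^esub> hact_mod g W Gen_Xm v)\<rparr>"

definition class_lim_mor ::
    "'v hrep \<Rightarrow> ((nat \<Rightarrow> nat \<Rightarrow> 'v) \<Rightarrow> nat \<Rightarrow> nat \<Rightarrow> 'w) \<Rightarrow> 'v \<Rightarrow> 'w" where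
  "class_lim_mor V \<phi> = (\<lambda>v\<in>carrier (hspace V). \<phi> (ps_const (hspace V) v) 0 0)"

section \<open>Grothendieck groups of additive categories\<close>

text \<open>The free abelian group on the isomorphism classes of objects, modulo \<open>[D] - [A] - [B]\<close>
  for all \<open>D\<close> isomorphic to \<open>A \<oplus> B\<close>.\<close>

definition iso_class :: "('o \<Rightarrow> bool) \<Rightarrow> ('o \<Rightarrow> 'o \<Rightarrow> bool) \<Rightarrow> 'o \<Rightarrow> 'o set" where
  "iso_class Ob eqv V = {W. Ob W \<and> eqv V W}"

definition groth_free ::
    "('o \<Rightarrow> bool) \<Rightarrow> ('o \<Rightarrow> 'o \<Rightarrow> bool) \<Rightarrow> ('o set \<Rightarrow>\<^sub>0 int) monoid" where
  "groth_free Ob eqv = free_Abelian_group {iso_class Ob eqv V | V. Ob V}"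

definition groth_rel ::
    "('o \<Rightarrow> bool) \<Rightarrow> ('o \<Rightarrow> 'o \<Rightarrow> bool) \<Rightarrow> ('o \<Rightarrow> 'o \<Rightarrow> 'o \<Rightarrow> bool) \<Rightarrow> ('o set \<Rightarrow>\<^sub>0 int) set" where
  "groth_rel Ob eqv is_sum =
     generate (groth_free Ob eqv)
       {frag_of (iso_class Ob eqv D) - frag_of (iso_class Ob eqv A) - frag_of (iso_class Ob eqv B)
        | D A B. Ob D \<and> Ob A \<and> Ob B \<and> is_sum D A B}"

definition groth_group ::
    "('o \<Rightarrow> bool) \<Rightarrow> ('o \<Rightarrow> 'o \<Rightarrow> bool) \<Rightarrow> ('o \<Rightarrow> 'o \<Rightarrow> 'o \<Rightarrow> bool) \<Rightarrow>
     ('o set \<Rightarrow>\<^sub>0 int) set monoid" where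
  "groth_group Ob eqv is_sum = groth_free Ob eqv Mod groth_rel Ob eqv is_sum"

definition groth_class ::
    "('o \<Rightarrow> bool) \<Rightarrow> ('o \<Rightarrow> 'o \<Rightarrow> bool) \<Rightarrow> ('o \<Rightarrow> 'o \<Rightarrow> 'o \<Rightarrow> bool) \<Rightarrow> 'o \<Rightarrow>
     ('o set \<Rightarrow>\<^sub>0 int) set" where
  "groth_class Ob eqv is_sum V =
     r_coset (groth_free Ob eqv) (groth_rel Ob eqv is_sum) (frag_of (iso_class Ob eqv V))"

definition Rep_hh :: "nat \<Rightarrow> ('v hrep set \<Rightarrow>\<^sub>0 int) set monoid" where
  "Rep_hh g = groth_group (hrep_obj g) (hrep_iso g) (\<lambda>D A B. hrep_iso g D (hrep_dsum g [A, B]))"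

definition Rep_hh_class :: "nat \<Rightarrow> 'v hrep \<Rightarrow> ('v hrep set \<Rightarrow>\<^sub>0 int) set" where
  "Rep_hh_class g =
     groth_class (hrep_obj g) (hrep_iso g) (\<lambda>D A B. hrep_iso g D (hrep_dsum g [A, B]))"

definition Rep_sl2 :: "('v sl2_rep set \<Rightarrow>\<^sub>0 int) set monoid" where
  "Rep_sl2 = groth_group sl2_obj sl2_iso (\<lambda>D A B. sl2_iso D (sl2_dsum [A, B]))"

definition Rep_sl2_class :: "'v sl2_rep \<Rightarrow> ('v sl2_rep set \<Rightarrow>\<^sub>0 int) set" where
  "Rep_sl2_class = groth_class sl2_obj sl2_iso (\<lambda>D A B. sl2_iso D (sl2_dsum [A, B]))"

section \<open>The Krull-Schmidt property of \<open>\<C>\<^sup>h\<^sup>,\<^sup>h\<^sup>'(sl\<^sub>2,g)\<close>\<close>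

definition krull_schmidt :: "nat \<Rightarrow> 'v itself \<Rightarrow> bool" where
  "krull_schmidt g _ \<longleftrightarrow>
     (\<forall>V :: 'v hrep. hrep_obj g V \<longrightarrow>
        (\<exists>As :: 'v hrep list. (\<forall>A\<in>set As. hrep_indecomposable g A) \<and>
           hrep_iso g V (hrep_dsum g As)) \<and>
        (\<forall>(As :: 'v hrep list) (Bs :: 'v hrep list).
           (\<forall>A\<in>set As. hrep_indecomposable g A) \<and> (\<forall>B\<in>set Bs. hrep_indecomposable g B) \<and>
           hrep_iso g V (hrep_dsum g As) \<and> hrep_iso g V (hrep_dsum g Bs) \<longrightarrow>
           length As = length Bs \<and>
           (\<exists>\<pi>. bij_betw \<pi> {..<length As} {..<length Bs} \<and>
              (\<forall>i<length As. hrep_iso g (As ! i) (Bs ! \<pi> i)))))"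

end

theory Submission
  imports Defs "HOL-Library.Function_Algebras" "HOL-Computational_Algebra.Fundamental_Theorem_Algebra"
begin

text \<open>
Why the theorem holds. The defining relations prescribe \<open>X\<^sup>+X\<^sup>-\<close> as a product of two brackets, and a bracket [a] is
a times a series with constant coefficient 1 that is even in a. So \<open>X\<^sup>+X\<^sup>-\<close> is the classical value \<open>(C - (H-1)\<^sup>2)/4\<close>
times an invertible series in H and C. Dividing \<open>X\<^sup>+\<close> by that series yields \<open>\<complex>[[h,h']]\<close>-linear operators
e, \<open>f = X\<^sup>-\<close>, H that satisfy the relations of \<open>sl\<^sub>2\<close> and have Casimir operator C (hops.triple), and the process can
be reversed (deform_hops). Representations on V[[h,h']] are thus \<open>sl\<^sub>2\<close>-triples of linear operators on
V[[h,h']]; those constant in h and h' deform a given representation of \<open>sl\<^sub>2\<close>.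

Such triples are rigid. On V[[h,h']] the operators e and f are nilpotent, since they shift weights, and an
\<open>sl\<^sub>2\<close>-triple with nilpotent e, f on any complex vector space is a finite sum of joint eigenspaces of H and C,
with projectors polynomial in H and C (sl2_nil.decomp). On the representation itself this is the
decomposition into weight spaces. On the space of linear maps between two representations it provides a projector
onto intertwiners, which lifts every intertwiner of the limits (rigidity, hops_lift); a map whose limit is bijective is
bijective (kop_bij). Hence the classical limit detects isomorphism, and with the existence of deformations the
statement on Grothendieck groups is formal (groth_iso).

It remains to classify the limits. A finite-dimensional representation of \<open>sl\<^sub>2\<close> has a basis of strings \<open>f\<^sup>j v\<close> over
highest weight vectors v (frame), and the number tp V n of strings of weight n is a complete invariant
(tp_iso), additive on direct sums (tp_dsum), every smaller function being the invariant of some representation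
(tp_sub). Indecomposability and the Krull-Schmidt property are read off from it, and the limit of
\<open>L\<^sup>h\<^sup>,\<^sup>h\<^sup>'(n,g)\<close> has a single string of weight n (L_rep_type).
\<close>

type_synonym 'a dser = "nat => nat => 'a"

abbreviation psc :: "(complex, 'v) module => (nat => nat => 'v) set" where "psc V == carrier (ps_mod V)"

text \<open>The spaces of the statement are records over an arbitrary carrier type. The arguments below take place in subspaces of
types that carry a complex vector space structure; an arbitrary finite-dimensional space is moved there by a choice of
coordinates.\<close>

class cvec = ab_group_add +
 fixes csc :: "complex => 'a => 'a" (infixr "\<cdot>" 75)
 assumes csc_add_right: "a \<cdot> (x + y) = a \<cdot> x + a \<cdot> y"
  and csc_add_left: "(a + b) \<cdot> x = a \<cdot> x + b \<cdot> x"
  and csc_csc: "a \<cdot> (b \<cdot> x) = (a * b) \<cdot> x"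
  and csc_one: "1 \<cdot> x = x"

instantiation complex :: cvec
begin
definition csc_complex :: "complex => complex => complex" where "csc_complex = (*)"
instance by standard (auto simp: csc_complex_def algebra_simps)
end

instantiation "fun" :: (type, cvec) cvec
begin
definition csc_fun :: "complex => ('a => 'b) => 'a => 'b" where "csc_fun = (%a f x. a \<cdot> f x)"
instance
 by standard (auto simp: csc_fun_def fun_eq_iff csc_add_right csc_add_left csc_csc csc_one)
end

lemma csc_fun_apply [simp]: "(a \<cdot> f) x = a \<cdot> f x"
 by (simp add: csc_fun_def)

interpretation cv: vector_space "csc :: complex => 'a::cvec => 'a"
 by unfold_locales (auto simp: csc_add_right csc_add_left csc_csc csc_one)

declare csc_one [simp]

section \<open>Coefficients of double series\<close>

lemma hcoeff_eqI: "(!!k l. hcoeff x k l = hcoeff y k l) ==> x = y"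
 unfolding hcoeff_def by (intro fps_ext) auto

lemma hcoeff_hseries [simp]: "hcoeff (hseries c) k l = c k l"
 by (simp add: hcoeff_def hseries_def)

lemma hcoeff_0 [simp]: "hcoeff 0 k l = 0"
 by (simp add: hcoeff_def)

lemma hcoeff_1: "hcoeff 1 k l = (if k = 0 & l = 0 then 1 else 0)"
 by (simp add: hcoeff_def)

lemma hcoeff_add [simp]: "hcoeff (x + y) k l = hcoeff x k l + hcoeff y k l"
 by (simp add: hcoeff_def)

lemma hcoeff_diff [simp]: "hcoeff (x - y) k l = hcoeff (x :: 'a::ab_group_add fps fps) k l - hcoeff y k l"
 by (simp add: hcoeff_def)

lemma hcoeff_sum: "hcoeff (sum F A) k l = (\<Sum>a\<in>A. hcoeff (F a) k l)"
 by (simp add: hcoeff_def fps_sum_nth)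

lemma hcoeff_hconst: "hcoeff (hconst a) k l = (if k = 0 & l = 0 then a else 0)"
 by (simp add: hcoeff_def hconst_def)

lemma hcoeff_mult:
 "hcoeff (x * y) k l = (\<Sum>j\<le>l. \<Sum>i\<le>k. hcoeff x i j * hcoeff (y :: 'a::semiring_0 fps fps) (k - i) (l - j))"
 by (simp add: hcoeff_def fps_mult_nth fps_sum_nth atMost_atLeast0)

lemma hcoeff_mult_00 [simp]: "hcoeff (x * y) 0 0 = hcoeff x 0 0 * hcoeff (y :: 'a::semiring_0 fps fps) 0 0"
 by (simp add: hcoeff_mult)

lemma hconst_mult: "hconst (a * b) = hconst a * hconst (b :: 'a::semiring_0)"
 by (simp add: hconst_def)

lemma hconst_add: "hconst (a + b) = hconst a + hconst (b :: 'a::monoid_add)"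
 by (simp add: hconst_def)

lemma hconst_uminus: "hconst (- a) = - hconst (a :: 'a::ab_group_add)"
 by (simp add: hconst_def)

lemma hconst_0 [simp]: "hconst 0 = 0"
 by (simp add: hconst_def)

lemma hconst_1 [simp]: "hconst 1 = 1"
 by (simp add: hconst_def)

lemma hcoeff_hconst_mult [simp]: "hcoeff (hconst a * y) k l = a * hcoeff (y :: 'a::semiring_0 fps fps) k l"
 by (simp add: hcoeff_def hconst_def)

definition hsh :: "(nat => nat => 'a::zero) => 'a dser" where
 "hsh f = (%k l. case k of 0 => 0 | Suc k' => f k' l)"

definition vsh :: "(nat => nat => 'a::zero) => 'a dser" where
 "vsh f = (%k l. case l of 0 => 0 | Suc l' => f k l')"

definition mconst :: "'a::zero => 'a dser" where
 "mconst v = (%k l. if k = 0 & l = 0 then v else 0)"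

lemma hsh_simps [simp]: "hsh f 0 l = 0" "hsh f (Suc k) l = f k l"
 by (simp_all add: hsh_def)

lemma vsh_simps [simp]: "vsh f k 0 = 0" "vsh f k (Suc l) = f k l"
 by (simp_all add: vsh_def)

lemma mconst_00 [simp]: "mconst v 0 0 = v"
 by (simp add: mconst_def)

lemma mconst_0 [simp]: "mconst 0 = 0"
 by (simp add: mconst_def fun_eq_iff)

lemma mconst_add: "mconst (v + w) = mconst v + mconst (w::'a::cvec)"
 by (simp add: mconst_def fun_eq_iff)

lemma mconst_csc: "mconst (a \<cdot> v) = a \<cdot> mconst v"
 by (simp add: mconst_def fun_eq_iff)

lemma hsh_add: "hsh (f + f') = hsh f + hsh (f' :: nat => nat => 'a::cvec)"
 by (auto simp: hsh_def fun_eq_iff split: nat.splits)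

lemma vsh_add: "vsh (f + f') = vsh f + vsh (f' :: nat => nat => 'a::cvec)"
 by (auto simp: vsh_def fun_eq_iff split: nat.splits)

lemma hsh_diff: "hsh (f - f') = hsh f - hsh (f' :: nat => nat => 'a::cvec)"
 by (auto simp: hsh_def fun_eq_iff split: nat.splits)

lemma vsh_diff: "vsh (f - f') = vsh f - vsh (f' :: nat => nat => 'a::cvec)"
 by (auto simp: vsh_def fun_eq_iff split: nat.splits)

lemma hsh_csc: "hsh (a \<cdot> f) = a \<cdot> hsh f"
 by (auto simp: hsh_def fun_eq_iff split: nat.splits)

lemma vsh_csc: "vsh (a \<cdot> f) = a \<cdot> vsh f"
 by (auto simp: vsh_def fun_eq_iff split: nat.splits)

lemma hsh_0 [simp]: "hsh 0 = 0" and vsh_0 [simp]: "vsh 0 = 0"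
 by (auto simp: hsh_def vsh_def fun_eq_iff split: nat.splits)

lemma hsh_vsh: "hsh (vsh f) = vsh (hsh f)"
 by (auto simp: hsh_def vsh_def fun_eq_iff split: nat.splits)

lemma hcoeff_var_h_mult: "hcoeff (var_h * x) = hsh (hcoeff (x :: 'a::ring_1 fps fps))"
 by (auto simp: fun_eq_iff hsh_def hcoeff_def var_h_def split: nat.splits)

lemma hcoeff_var_h'_mult: "hcoeff (var_h' * x) = vsh (hcoeff (x :: 'a::ring_1 fps fps))"
 by (auto simp: fun_eq_iff vsh_def hcoeff_def var_h'_def split: nat.splits)

lemma mult_var_h: "x * var_h = var_h * (x :: 'a::ring_1 fps fps)"
proof (rule fps_ext)
 fix n show "fps_nth (x * var_h) n = fps_nth (var_h * x) n"
  by (simp add: var_h_def fps_mult_fps_X_commute)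
qed

lemma mult_var_h': "x * var_h' = var_h' * (x :: 'a::ring_1 fps fps)"
 by (simp add: var_h'_def fps_mult_fps_X_commute)

text \<open>Every argument by order of vanishing rests on the decomposition of a series into its constant term, h
times a series and h' times a series.\<close>

definition hpart :: "('a dser) => 'a dser" where
 "hpart f = (%k l. f (Suc k) l)"

definition vpart :: "(nat => nat => 'a::zero) => 'a dser" where
 "vpart f = (%k l. if k = 0 then f 0 (Suc l) else 0)"

lemma peel: "f = mconst (f 0 0) + hsh (hpart f) + vsh (vpart (f :: nat => nat => 'a::monoid_add))"
 by (auto simp: fun_eq_iff mconst_def hpart_def vpart_def hsh_def vsh_def split: nat.splits)

lemma peel_series:
 "x = hconst (hcoeff x 0 0) + var_h * hseries (hpart (hcoeff x)) + var_h' * hseries (vpart (hcoeff (x :: 'a::ring_1 fps fps)))"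
proof (rule hcoeff_eqI)
 fix k l
 have "hcoeff x k l = (mconst (hcoeff x 0 0) + hsh (hpart (hcoeff x)) + vsh (vpart (hcoeff x))) k l"
  by (rule fun_cong[OF fun_cong[OF peel]])
 moreover have "hcoeff (hseries c) = c" for c :: "'a dser" by (simp add: fun_eq_iff)
 ultimately show "hcoeff x k l = hcoeff (hconst (hcoeff x 0 0) + var_h * hseries (hpart (hcoeff x)) + var_h' * hseries (vpart (hcoeff x))) k l"
  by (simp only: hcoeff_add hcoeff_var_h_mult hcoeff_var_h'_mult hcoeff_hconst plus_fun_apply mconst_def)
qed

lemma series_map_zero:
 fixes D :: "'b::ring_1 fps fps => nat => nat => 'a::cvec"
 assumes "!!x y. D (x + y) = D x + D y" "!!x. D (var_h * x) = hsh (D x)"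
  "!!x. D (var_h' * x) = vsh (D x)" "!!b. D (hconst b) = 0"
 shows "D x = 0"
proof -
 have "D x k l = 0" if "k + l = n" for n k l x
  using that
 proof (induction n arbitrary: k l x rule: less_induct)
  case (less n)
  have "D x k l = hsh (D (hseries (hpart (hcoeff x)))) k l + vsh (D (hseries (vpart (hcoeff x)))) k l"
   by (subst peel_series[of x]) (simp add: assms)
  moreover have "D y i j = 0" if "i + j < n" for i j y using less.IH[OF that] by blast
  ultimately show ?case using less.prems by (cases k; cases l) auto
 qed
 then show ?thesis by (auto simp: fun_eq_iff)
qed

definition MS :: "'a set => ('a dser) set" where
 "MS S = {f. ALL k l. f k l \<in> S}"

lemma MS_I: "(!!k l. f k l \<in> S) ==> f \<in> MS S" and MS_D: "f \<in> MS S ==> f k l \<in> S"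
 by (auto simp: MS_def)

lemma subspace_MS: "cv.subspace S ==> cv.subspace (MS S)"
 unfolding cv.subspace_def MS_def by auto

lemma MS_hsh: "cv.subspace S ==> f \<in> MS S ==> hsh f \<in> MS S"
 and MS_vsh: "cv.subspace S ==> f \<in> MS S ==> vsh f \<in> MS S"
 and MS_mconst: "cv.subspace S ==> v \<in> S ==> mconst v \<in> MS S"
 and MS_vpart: "cv.subspace S ==> f \<in> MS S ==> vpart f \<in> MS S"
 by (auto simp: MS_def hsh_def vsh_def mconst_def vpart_def cv.subspace_0 split: nat.splits)

lemma MS_hpart: "f \<in> MS S ==> hpart f \<in> MS S"
 by (auto simp: MS_def hpart_def)

lemma module_map_zero:
 fixes D :: "(nat => nat => 'b::cvec) => nat => nat => 'a::cvec"
 assumes S: "cv.subspace S" and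
  "!!x y. x \<in> MS S ==> y \<in> MS S ==> D (x + y) = D x + D y" "!!x. x \<in> MS S ==> D (hsh x) = hsh (D x)"
  "!!x. x \<in> MS S ==> D (vsh x) = vsh (D x)" "!!b. b \<in> S ==> D (mconst b) = 0"
  and "f \<in> MS S"
 shows "D f = 0"
proof -
 have "D f k l = 0" if "k + l = n" "f \<in> MS S" for n k l f
  using that
 proof (induction n arbitrary: k l f rule: less_induct)
  case (less n)
  have *: "mconst (f 0 0) \<in> MS S" "hsh (hpart f) \<in> MS S" "vsh (vpart f) \<in> MS S" "hpart f \<in> MS S" "vpart f \<in> MS S" "f 0 0 \<in> S"
   "mconst (f 0 0) + hsh (hpart f) \<in> MS S"
   using less.prems S by (auto intro!: MS_hsh MS_vsh MS_vpart MS_hpart MS_mconst cv.subspace_add[OF subspace_MS] simp: MS_D)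
  have "D f k l = hsh (D (hpart f)) k l + vsh (D (vpart f)) k l"
   by (subst peel[of f]) (simp add: assms *)
  moreover have "D y i j = 0" if "i + j < n" "y \<in> MS S" for i j y using less.IH[OF that(1)] that(2) by blast
  ultimately show ?case using less.prems * by (cases k; cases l) auto
 qed
 then show ?thesis using assms by (auto simp: fun_eq_iff)
qed

section \<open>Linear maps and ring actions on subspaces\<close>

definition clin :: "'a::cvec set => 'b::cvec set => ('a => 'b) => bool" where
 "clin S S' T \<longleftrightarrow> (\<forall>v\<in>S. T v \<in> S') & (\<forall>v\<in>S. \<forall>w\<in>S. T (v + w) = T v + T w) & (ALL a. \<forall>v\<in>S. T (a \<cdot> v) = a \<cdot> T v)"

lemma clinI: "(!!v. v \<in> S ==> T v \<in> S') ==> (!!v w. v \<in> S ==> w \<in> S ==> T (v + w) = T v + T w) ==>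
  (!!a v. v \<in> S ==> T (a \<cdot> v) = a \<cdot> T v) ==> clin S S' T"
 by (auto simp: clin_def)

lemma clin_in: "clin S S' T ==> v \<in> S ==> T v \<in> S'"
 and clin_add: "clin S S' T ==> v \<in> S ==> w \<in> S ==> T (v + w) = T v + T w"
 and clin_csc: "clin S S' T ==> v \<in> S ==> T (a \<cdot> v) = a \<cdot> T v"
 by (auto simp: clin_def)

lemma clin_0: "clin S S' T ==> cv.subspace S ==> T 0 = 0"
 using clin_csc[of S S' T 0 0] by (simp add: cv.subspace_0)

lemma clin_minus: "clin S S' T ==> v \<in> S ==> T (- v) = - T v"
 using clin_csc[of S S' T v "-1"] by simp

lemma clin_diff: "clin S S' T ==> cv.subspace S ==> v \<in> S ==> w \<in> S ==> T (v - w) = T v - T w"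
 using clin_add[of S S' T v "-w"] clin_minus[of S S' T w] by (simp add: cv.subspace_neg)

lemma clin_sum:
 assumes "clin S S' T" "cv.subspace S" "!!i. i \<in> I ==> v i \<in> S"
 shows "T (sum v I) = (\<Sum>i\<in>I. T (v i))"
 using assms(3)
proof (induction I rule: infinite_finite_induct)
 case (insert x F)
 then show ?case using assms
  by (simp add: clin_add[OF assms(1)] cv.subspace_sum)
qed (use assms in \<open>auto simp: clin_0\<close>)

lemma clin_comp: "clin S S' T ==> clin S' S'' T' ==> clin S S'' (%v. T' (T v))"
 by (auto simp: clin_def)

lemma clin_funpow: "clin S S T ==> clin S S (T ^^ n)"
 by (induction n) (auto simp: clin_def)

lemma clin_plus: "cv.subspace S' ==> clin S S' T ==> clin S S' T' ==> clin S S' (%v. T v + T' v)"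
 by (auto simp: clin_def cv.subspace_add algebra_simps csc_add_right)

lemma clin_scale: "cv.subspace S' ==> clin S S' T ==> clin S S' (%v. a \<cdot> T v)"
 by (auto simp: clin_def cv.subspace_scale csc_add_right csc_csc mult.commute)

lemma clin_minus': "cv.subspace S' ==> clin S S' T ==> clin S S' T' ==> clin S S' (%v. T v - T' v)"
 by (auto simp: clin_def cv.subspace_diff algebra_simps cv.scale_right_diff_distrib)

lemma clin_csc_id: "cv.subspace S ==> clin S S (%v. a \<cdot> v)"
 by (auto simp: clin_def cv.subspace_scale csc_add_right csc_csc mult.commute)

definition ract :: "'m::cvec set => ('b::ring_1 => 'm => 'm) => bool" where
 "ract S \<alpha> \<longleftrightarrow> (ALL b. clin S S (\<alpha> b)) & (ALL b c. \<forall>v\<in>S. \<alpha> (b + c) v = \<alpha> b v + \<alpha> c v) &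
   (ALL b c. \<forall>v\<in>S. \<alpha> (b * c) v = \<alpha> b (\<alpha> c v)) & (\<forall>v\<in>S. \<alpha> 1 v = v)"

lemma ract_clin: "ract S \<alpha> ==> clin S S (\<alpha> b)"
 and ract_add: "ract S \<alpha> ==> v \<in> S ==> \<alpha> (b + c) v = \<alpha> b v + \<alpha> c v"
 and ract_mult: "ract S \<alpha> ==> v \<in> S ==> \<alpha> (b * c) v = \<alpha> b (\<alpha> c v)"
 and ract_one: "ract S \<alpha> ==> v \<in> S ==> \<alpha> 1 v = v"
 by (auto simp: ract_def)

lemma ract_in: "ract S \<alpha> ==> v \<in> S ==> \<alpha> b v \<in> S"
 using ract_clin clin_in by metis

lemma ract_zero: "ract S \<alpha> ==> v \<in> S ==> \<alpha> 0 v = 0"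
 using ract_add[of S \<alpha> v 0 0] by simp

lemma ract_uminus: "ract S \<alpha> ==> v \<in> S ==> \<alpha> (- b) v = - \<alpha> b v"
 using ract_add[of S \<alpha> v b "-b"] ract_zero[of S \<alpha> v] by (simp add: eq_neg_iff_add_eq_0 add.commute)

lemma ract_diff: "ract S \<alpha> ==> v \<in> S ==> \<alpha> (b - c) v = \<alpha> b v - \<alpha> c v"
 using ract_add[of S \<alpha> v b "-c"] ract_uminus[of S \<alpha> v c] by simp

lemma ract_sum: "ract S \<alpha> ==> v \<in> S ==> \<alpha> (sum F I) v = (\<Sum>i\<in>I. \<alpha> (F i) v)"
 by (induction I rule: infinite_finite_induct) (auto simp: ract_zero ract_add)

lemma ract_csc: "cv.subspace S ==> ract S (csc :: complex => 'm::cvec => 'm)"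
 by (auto simp: ract_def clin_csc_id csc_add_left csc_csc)

lemma ract_funpow: "ract S \<alpha> ==> v \<in> S ==> \<alpha> (b ^ n) v = (\<alpha> b ^^ n) v"
 by (induction n) (auto simp: ract_one ract_mult)

text \<open>With \<open>\<alpha>\<close> an action of \<open>\<complex>[C]\<close> and T the operator
H this is the action of \<open>\<complex>[C][H]\<close>; with \<open>\<alpha>\<close> the scalars it is
evaluation of a polynomial at an operator.\<close>

definition pact :: "('b::comm_ring_1 => 'm::cvec => 'm) => ('m => 'm) => 'b poly => 'm => 'm" where
 "pact \<alpha> T p v = (\<Sum>i\<le>Polynomial.degree p. \<alpha> (Polynomial.coeff p i) ((T ^^ i) v))"

context
 fixes S :: "'m::cvec set" and \<alpha> :: "'b::comm_ring_1 => 'm => 'm" and T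
 assumes S: "cv.subspace S" and \<alpha>: "ract S \<alpha>" and T: "clin S S T"
  and comm: "!!b v. v \<in> S ==> T (\<alpha> b v) = \<alpha> b (T v)"
begin

lemma funpow_in: "v \<in> S ==> (T ^^ i) v \<in> S"
 using clin_in[OF clin_funpow[OF T]] .

lemma pact_bound:
 assumes "v \<in> S" "Polynomial.degree p \<le> n"
 shows "pact \<alpha> T p v = (\<Sum>i\<le>n. \<alpha> (Polynomial.coeff p i) ((T ^^ i) v))"
 unfolding pact_def using assms
 by (intro sum.mono_neutral_left) (auto simp: coeff_eq_0 ract_zero[OF \<alpha>] funpow_in)

lemma pact_add: "v \<in> S ==> pact \<alpha> T (p + q) v = pact \<alpha> T p v + pact \<alpha> T q v"
 by (simp add: pact_bound[of v _ "max (Polynomial.degree p) (Polynomial.degree q)"] degree_add_le_max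
   ract_add[OF \<alpha>] funpow_in sum.distrib)

lemma pact_0: "v \<in> S ==> pact \<alpha> T 0 v = 0"
 by (simp add: pact_def ract_zero[OF \<alpha>])

lemma pact_clin: "clin S S (pact \<alpha> T p)"
proof -
 have *: "clin S S (%v. \<alpha> b ((T ^^ i) v))" for b i
  using clin_comp[OF clin_funpow[OF T] ract_clin[OF \<alpha>]] .
 have "clin S S (%v. \<Sum>i\<in>I. \<alpha> (Polynomial.coeff p i) ((T ^^ i) v))" if "finite I" for I
  using that
 proof induction
  case empty
  then show ?case using S by (auto simp: clin_def cv.subspace_0)
 next
  case (insert x F)
  then show ?case by (simp add: clin_plus[OF S *])
 qed
 then show ?thesis unfolding pact_def[abs_def] by blast
qed

lemma pact_pCons: assumes v: "v \<in> S" shows "pact \<alpha> T (pCons b p) v = \<alpha> b v + T (pact \<alpha> T p v)"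
proof -
 have "pact \<alpha> T (pCons b p) v = (\<Sum>i\<le>Suc (Polynomial.degree p). \<alpha> (Polynomial.coeff (pCons b p) i) ((T ^^ i) v))"
  using v by (intro pact_bound) (auto simp: degree_pCons_le)
 also have "\<dots> = \<alpha> b v + (\<Sum>i\<le>Polynomial.degree p. \<alpha> (Polynomial.coeff p i) (T ((T ^^ i) v)))"
  by (simp add: sum.atMost_Suc_shift del: sum.atMost_Suc)
 also have "(\<Sum>i\<le>Polynomial.degree p. \<alpha> (Polynomial.coeff p i) (T ((T ^^ i) v))) = T (pact \<alpha> T p v)"
  unfolding pact_def
  by (subst clin_sum[OF T S]) (auto simp: comm funpow_in v ract_in[OF \<alpha>])
 finally show ?thesis .
qed

lemma pact_const: "v \<in> S ==> pact \<alpha> T [:b:] v = \<alpha> b v"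
 by (simp add: pact_pCons pact_0 clin_0[OF T S])

lemma pact_X: "v \<in> S ==> pact \<alpha> T [:0, 1:] v = T v"
 by (simp add: pact_pCons pact_0 clin_0[OF T S] ract_zero[OF \<alpha>] ract_one[OF \<alpha>])

lemma pact_in: "v \<in> S ==> pact \<alpha> T p v \<in> S"
 using clin_in[OF pact_clin] .

lemma pact_smult: "v \<in> S ==> pact \<alpha> T (Polynomial.smult b p) v = \<alpha> b (pact \<alpha> T p v)"
proof -
 assume v: "v \<in> S"
 have "pact \<alpha> T (Polynomial.smult b p) v = (\<Sum>i\<le>Polynomial.degree p. \<alpha> (Polynomial.coeff (Polynomial.smult b p) i) ((T ^^ i) v))"
  using v by (intro pact_bound) (auto simp: degree_smult_le)
 also have "\<dots> = \<alpha> b (pact \<alpha> T p v)"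
  unfolding pact_def
  by (subst clin_sum[OF ract_clin[OF \<alpha>] S]) (auto simp: v funpow_in ract_in[OF \<alpha>] ract_mult[OF \<alpha>])
 finally show ?thesis .
qed

lemma pact_mult: "v \<in> S ==> pact \<alpha> T (p * q) v = pact \<alpha> T p (pact \<alpha> T q v)"
proof (induction p)
 case 0
 then show ?case by (simp add: pact_0 pact_in)
next
 case (pCons a p)
 then show ?case
  by (simp add: pact_add pact_smult pact_pCons pact_in ract_zero[OF \<alpha>])
qed

lemma ract_pact: "ract S (pact \<alpha> T)"
 unfolding ract_def
 using pact_clin pact_add pact_mult pact_const[of _ 1] ract_one[OF \<alpha>] by (auto simp: one_pCons)

lemma pact_commute:
 assumes T': "clin S S' T'" and "!!b v. v \<in> S ==> T' (\<alpha> b v) = \<alpha>' b (T' v)" "!!v. v \<in> S ==> T' (T v) = U (T' v)"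
  and v: "v \<in> S"
 shows "T' (pact \<alpha> T p v) = pact \<alpha>' U p (T' v)"
proof -
 have "T' ((T ^^ i) v) = (U ^^ i) (T' v)" for i
  by (induction i) (auto simp: assms funpow_in)
 then show ?thesis unfolding pact_def
  by (subst clin_sum[OF T' S]) (auto simp: assms funpow_in ract_in[OF \<alpha>])
qed

end

lemma cA_simps:
 "cA (a + b) = cA a + cA b" "cA (a * b) = cA a * cA b" "cA (a - b) = cA a - cA b"
 "cA 0 = 0" "cA 1 = 1" "cA (- a) = - cA a"
 by (auto simp: cA_def one_pCons)

lemma cA_of_nat: "cA (of_nat n) = of_nat n"
 by (induction n) (auto simp: cA_simps)

lemma cA_numeral: "cA (numeral n) = numeral n"
 using cA_of_nat[of "numeral n"] by simp

text \<open>Expand the product over k first: a combination of a j and b k for each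
k multiplies up to a combination of a j and the product of all b k.
Expanding over j then gives a combination of the two full products.\<close>

lemma ideal_selection:
 fixes A :: "'r::comm_ring_1 set" and m n :: nat
 assumes add: "!!x y. x \<in> A ==> y \<in> A ==> x + y \<in> A" and mult: "!!r x. x \<in> A ==> r * x \<in> A"
  and a: "(\<Prod>j<m. a j) \<in> A" and b: "(\<Prod>k<n. b k) \<in> A"
  and s: "!!j k. j < m ==> k < n ==> EX x y. s j k = x * a j + y * b k"
 shows "(\<Prod>j<m. \<Prod>k<n. s j k) \<in> A"
proof -
 have row: "EX x y. (\<Prod>k<n'. s j k) = x * a j + y * (\<Prod>k<n'. b k)" if jm: "j < m" and n': "n' \<le> n" for j n'
  using n'
 proof (induction n')
  case 0
  show ?case by (intro exI[of _ 0] exI[of _ 1]) simp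
 next
  case (Suc n')
  then obtain x y where 1: "(\<Prod>k<n'. s j k) = x * a j + y * (\<Prod>k<n'. b k)" by auto
  obtain x' y' where 2: "s j n' = x' * a j + y' * b n'" using s[OF jm, of n'] Suc.prems by auto
  have "(\<Prod>k<Suc n'. s j k) = (x * (x' * a j + y' * b n') + y * (\<Prod>k<n'. b k) * x') * a j + y * y' * (\<Prod>k<Suc n'. b k)"
   by (simp add: 1 2 algebra_simps)
  then show ?case by blast
 qed
 have "EX x y. (\<Prod>j<m'. \<Prod>k<n. s j k) = x * (\<Prod>j<m'. a j) + y * (\<Prod>k<n. b k)" if "m' \<le> m" for m'
  using that
 proof (induction m')
  case 0
  show ?case by (intro exI[of _ 1] exI[of _ 0]) simp
 next
  case (Suc m')
  let ?B = "\<Prod>k<n. b k"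
  obtain x y where 1: "(\<Prod>j<m'. \<Prod>k<n. s j k) = x * (\<Prod>j<m'. a j) + y * ?B" using Suc by auto
  obtain x' y' where 2: "(\<Prod>k<n. s m' k) = x' * a m' + y' * ?B" using row[of m' n] Suc.prems by auto
  have "(\<Prod>j<Suc m'. \<Prod>k<n. s j k) = x * x' * (\<Prod>j<Suc m'. a j) + (x * (\<Prod>j<m'. a j) * y' + y * (x' * a m' + y' * ?B)) * ?B"
   by (simp add: 1 2 algebra_simps)
  then show ?case by blast
 qed
 from this[of m] obtain x y where "(\<Prod>j<m. \<Prod>k<n. s j k) = x * (\<Prod>j<m. a j) + y * (\<Prod>k<n. b k)" by auto
 then show ?thesis using add mult a b by auto
qed

text \<open>Lagrange interpolation of the constant 1 at the points z p.\<close>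

lemma lagrange_partition:
 fixes z :: "'i => complex"
 assumes P: "finite P" "P ~= {}" and inj: "inj_on z P"
 shows "(\<Sum>p\<in>P. \<Prod>q\<in>P - {p}. [:- z q, 1:] * [:1 / (z p - z q):]) = 1"
proof (rule poly_eqI_degree[where A = "z ` P"])
 have card: "card (z ` P) = card P" using card_image[OF inj] .
 have "Polynomial.degree (\<Prod>q\<in>P - {p}. [:- z q, 1:] * [:1 / (z p - z q):]) \<le> card P - 1" if "p \<in> P" for p
 proof -
  have "Polynomial.degree (\<Prod>q\<in>P - {p}. [:- z q, 1:] * [:1 / (z p - z q):])
    \<le> (\<Sum>q\<in>P - {p}. Polynomial.degree ([:- z q, 1:] * [:1 / (z p - z q):]))"
   using degree_prod_sum_le[of "P - {p}" "%q. [:- z q, 1:] * [:1 / (z p - z q):]"] P(1)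
   by (simp only: o_def finite_Diff)
  also have "\<dots> \<le> (\<Sum>q\<in>P - {p}. 1)"
  proof (rule sum_mono)
   show "Polynomial.degree ([:- z q, 1:] * [:1 / (z p - z q):]) \<le> 1" for q
    by (rule order.trans[OF degree_mult_le]) simp
  qed
  finally show ?thesis using P that by (simp add: card_Diff_singleton)
 qed
 then have "Polynomial.degree (\<Sum>p\<in>P. \<Prod>q\<in>P - {p}. [:- z q, 1:] * [:1 / (z p - z q):]) \<le> card P - 1"
  by (intro degree_sum_le P) auto
 moreover have "card P > 0" using P by (simp add: card_gt_0_iff)
 ultimately show "Polynomial.degree (\<Sum>p\<in>P. \<Prod>q\<in>P - {p}. [:- z q, 1:] * [:1 / (z p - z q):]) < card (z ` P)"
  by (simp add: card)
 show "Polynomial.degree 1 < card (z ` P)" using card \<open>card P > 0\<close> by simp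
next
 fix x assume "x \<in> z ` P"
 then obtain r where r: "r \<in> P" "x = z r" by auto
 have "poly (\<Prod>q\<in>P - {p}. [:- z q, 1:] * [:1 / (z p - z q):]) x = (if p = r then 1 else 0)" if "p \<in> P" for p
 proof (cases "p = r")
  case True
  have "z p - z q ~= 0" if "q \<in> P - {p}" for q using inj that \<open>p \<in> P\<close> by (auto simp: inj_on_def)
  then have "\<forall>q\<in>P - {p}. poly ([:- z q, 1:] * [:1 / (z p - z q):]) x = 1"
   using True r by (auto simp: diff_divide_distrib[symmetric])
  then show ?thesis unfolding poly_prod using True by (simp only: prod.neutral if_True simp_thms)
 next
  case False
  then have "r \<in> P - {p}" using r by auto
  then show ?thesis using False r P by (auto simp: poly_prod intro!: prod_zero bexI[of _ r])
 qed
 then show "poly (\<Sum>p\<in>P. \<Prod>q\<in>P - {p}. [:- z q, 1:] * [:1 / (z p - z q):]) x = poly 1 x"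
  using r P by (simp add: poly_sum sum.delta)
qed

lemma csc_2: "2 \<cdot> x = x + (x::'a::cvec)"
 using csc_add_left[of 1 1 x] by simp

lemma csc_4: "4 \<cdot> x = x + x + x + (x::'a::cvec)"
 using csc_add_left[of 2 2 x] by (simp add: csc_2 add.assoc)

abbreviation var_C :: "complex poly poly" where "var_C \<equiv> [:[:0, 1:]:]"

definition evalHC :: "complex => complex => complex poly poly => complex" where
 "evalHC x y p = poly (poly p [:x:]) y"

lemma evalHC_simps [simp]:
 "evalHC x y (p + q) = evalHC x y p + evalHC x y q" "evalHC x y (p - q) = evalHC x y p - evalHC x y q"
 "evalHC x y (p * q) = evalHC x y p * evalHC x y q" "evalHC x y 1 = 1" "evalHC x y 0 = 0"
 "evalHC x y (cA a) = a" "evalHC x y var_C = y" "evalHC x y var_H = x"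
 "evalHC x y (prod F A) = (\<Prod>a\<in>A. evalHC x y (F a))"
 by (auto simp: evalHC_def cA_def var_H_def poly_prod)

definition hshift :: "complex => complex poly poly => complex poly poly" where
 "hshift s p = pcompose p [:[:s:], 1:]"

lemma hshift_mult: "hshift s (p * q) = hshift s p * hshift s q"
 and hshift_add: "hshift s (p + q) = hshift s p + hshift s q"
 and hshift_0 [simp]: "hshift s 0 = 0" and hshift_1 [simp]: "hshift s 1 = 1"
 by (auto simp: hshift_def pcompose_mult pcompose_add) (metis one_pCons pcompose_const)

lemma hshift_basic: "hshift s var_C = var_C" "hshift s var_H = var_H + cA s" "hshift s (cA a) = cA a"
  "hshift s (p - q) = hshift s p - hshift s q"
 by (auto simp: hshift_def var_H_def cA_def pcompose_pCons pcompose_diff)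

locale HCpair =
 fixes S :: "'m::cvec set" and c h
 assumes S: "cv.subspace S" and c: "clin S S c" and h: "clin S S h" and hc: "!!v. v \<in> S ==> h (c v) = c (h v)"
begin

lemmas HC_simps [simp] = clin_in[OF c] clin_in[OF h] cv.subspace_add[OF S] cv.subspace_diff[OF S]
 cv.subspace_scale[OF S] cv.subspace_neg[OF S] cv.subspace_0[OF S]
lemmas h_simps = clin_add[OF h] clin_diff[OF h S] clin_csc[OF h] clin_minus[OF h]

definition act :: "complex poly poly => 'm => 'm" where "act = pact (pact csc c) h"

lemma ract_C: "ract S (pact csc c)"
 by (rule ract_pact[OF S ract_csc[OF S] c]) (simp add: clin_csc[OF c])

lemma C_commute: "clin S S T ==> (!!v. v \<in> S ==> T (c v) = c (T v)) ==> v \<in> S ==>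
  T (pact csc c p v) = pact csc c p (T v)"
 using pact_commute[OF S ract_csc[OF S] c _ _ _ _, of S T csc c v p] by (simp add: clin_csc[OF c] clin_csc)

lemma h_C: "v \<in> S ==> h (pact csc c p v) = pact csc c p (h v)"
 by (rule C_commute[OF h hc])

lemma ract_act: "ract S act"
 unfolding act_def by (rule ract_pact[OF S ract_C h h_C])

lemma act_pCons: "v \<in> S ==> act (pCons b p) v = pact csc c b v + h (act p v)"
 unfolding act_def by (rule pact_pCons[OF S ract_C h h_C])

lemma act_in [simp]: "v \<in> S ==> act p v \<in> S"
 using ract_in[OF ract_act] .

lemma act_const: "v \<in> S ==> act [:b:] v = pact csc c b v"
 unfolding act_def by (rule pact_const[OF S ract_C h h_C])

lemma act_cA: "v \<in> S ==> act (cA a) v = a \<cdot> v"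
 unfolding cA_def
 by (simp add: act_const) (rule pact_const[OF S ract_csc[OF S] c], auto simp: clin_csc[OF c])

lemma act_H: "v \<in> S ==> act var_H v = h v"
 unfolding act_def var_H_def by (rule pact_X[OF S ract_C h h_C])

lemma act_C: "v \<in> S ==> act var_C v = c v"
 by (simp add: act_const) (rule pact_X[OF S ract_csc[OF S] c], auto simp: clin_csc[OF c])

lemmas act_mult = ract_mult[OF ract_act] and act_add = ract_add[OF ract_act] and act_diff = ract_diff[OF ract_act]
 and act_one = ract_one[OF ract_act] and act_zero = ract_zero[OF ract_act] and act_sum = ract_sum[OF ract_act]

lemma act_shift:
 assumes T: "clin S S T" and Tc: "!!v. v \<in> S ==> T (c v) = c (T v)"
  and hT: "!!v. v \<in> S ==> h (T v) = T (h v) + s \<cdot> T v" and v: "v \<in> S"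
 shows "act p (T v) = T (act (hshift s p) v)"
proof (induction p)
 case 0
 then show ?case using v by (simp add: act_zero clin_0[OF T S] clin_in[OF T])
next
 case (pCons q p)
 have "act [:[:s:], 1:] w = s \<cdot> w + h w" if "w \<in> S" for w
  using that by (simp add: act_pCons act_const act_zero h_simps clin_0[OF h S])
   (metis act_const act_cA cA_def act_one one_pCons that)
 moreover have "hshift s (pCons q p) = [:q:] + [:[:s:], 1:] * hshift s p"
  by (simp add: hshift_def pcompose_pCons)
 ultimately have "act (hshift s (pCons q p)) v = pact csc c q v + (s \<cdot> act (hshift s p) v + h (act (hshift s p) v))"
  using v by (simp only: act_add act_mult act_const act_in)
 then show ?case using v
  by (simp add: act_pCons clin_in[OF T] pCons.IH hT C_commute[OF T Tc] clin_add[OF T] clin_csc[OF T] ract_in[OF ract_C] add_ac)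
qed

lemma act_eigen_mod:
 assumes U: "cv.subspace U" "U \<subseteq> S" and hU: "!!u. u \<in> U ==> h u \<in> U" and cU: "!!u. u \<in> U ==> c u \<in> U"
  and v: "v \<in> S" and hv: "h v - x \<cdot> v \<in> U" and cv: "c v - y \<cdot> v \<in> U"
 shows "act p v - evalHC x y p \<cdot> v \<in> U"
proof -
 have C: "pact csc c q v - poly q y \<cdot> v \<in> U" for q
 proof (induction q)
  case 0
  then show ?case using pact_0[OF S ract_csc[OF S] c] v U cv.subspace_0 clin_csc[OF c] by simp
 next
  case (pCons a q)
  have "pact csc c (pCons a q) v - poly (pCons a q) y \<cdot> v
    = c (pact csc c q v - poly q y \<cdot> v) + poly q y \<cdot> (c v - y \<cdot> v)"
   using pact_pCons[OF S ract_csc[OF S] c, of v a q] v ract_in[OF ract_C v, of q]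
   by (simp add: clin_csc[OF c] clin_diff[OF c S] csc_csc csc_add_left cv.scale_right_diff_distrib mult.commute)
  then show ?case using cU[OF pCons.IH] cv cv.subspace_add[OF U(1)] cv.subspace_scale[OF U(1)] by simp
 qed
 show ?thesis
 proof (induction p)
  case 0
  then show ?case using v U by (simp add: act_zero cv.subspace_0)
 next
  case (pCons q p)
  have "act (pCons q p) v - evalHC x y (pCons q p) \<cdot> v
    = (pact csc c q v - poly q y \<cdot> v) + (h (act p v - evalHC x y p \<cdot> v) + evalHC x y p \<cdot> (h v - x \<cdot> v))"
   using v by (simp add: act_pCons h_simps evalHC_def csc_csc csc_add_left cv.scale_right_diff_distrib mult.commute)
  then show ?case using C hU[OF pCons.IH] hv cv.subspace_add[OF U(1)] cv.subspace_scale[OF U(1)] by simp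
 qed
qed

lemma act_eigen:
 assumes v: "v \<in> S" and "h v = x \<cdot> v" "c v = y \<cdot> v"
 shows "act p v = evalHC x y p \<cdot> v"
 using act_eigen_mod[of "{0}" v x y p] assms cv.subspace_single_0 clin_0[OF h S] clin_0[OF c S] by simp

end

locale sl2_module =
 fixes S :: "'m::cvec set" and e f h
 assumes S: "cv.subspace S" and e: "clin S S e" and f: "clin S S f" and h: "clin S S h"
  and he: "!!v. v \<in> S ==> h (e v) = e (h v) + 2 \<cdot> e v"
  and hf: "!!v. v \<in> S ==> h (f v) = f (h v) - 2 \<cdot> f v"
  and ef: "!!v. v \<in> S ==> e (f v) - f (e v) = h v"
begin

definition cas :: "'m => 'm" where "cas v = 4 \<cdot> e (f v) + h (h v) - 2 \<cdot> h v + v"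

lemmas S_simps [simp] = clin_in[OF e] clin_in[OF f] clin_in[OF h] cv.subspace_add[OF S] cv.subspace_diff[OF S]
 cv.subspace_scale[OF S] cv.subspace_neg[OF S] cv.subspace_0[OF S]
lemmas L_simps = clin_add[OF e] clin_add[OF f] clin_add[OF h] clin_diff[OF e S] clin_diff[OF f S] clin_diff[OF h S]
 clin_csc[OF e] clin_csc[OF f] clin_csc[OF h] clin_minus[OF e] clin_minus[OF f] clin_minus[OF h]

lemma cas_alt: "v \<in> S ==> cas v = 4 \<cdot> f (e v) + h (h v) + 2 \<cdot> h v + v"
proof -
 assume v: "v \<in> S"
 have "e (f v) = f (e v) + h v" using ef[OF v] by (simp add: algebra_simps)
 then show ?thesis unfolding cas_def by (simp add: csc_2 csc_4 algebra_simps)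
qed

lemma cas_clin: "clin S S cas"
 unfolding cas_def
 by (intro clin_plus clin_minus' clin_scale S clin_comp[OF f e] clin_comp[OF h h] h) (simp add: clin_def S)

lemma h_cas: "v \<in> S ==> h (cas v) = cas (h v)"
 unfolding cas_def by (simp add: L_simps he hf csc_2 csc_4 algebra_simps)

sublocale HCpair S cas h
 by unfold_locales (rule S cas_clin h h_cas; assumption?)+

lemma e_cas: "v \<in> S ==> e (cas v) = cas (e v)"
 by (subst cas_alt) (simp_all add: cas_def L_simps he csc_2 csc_4 algebra_simps)

lemma f_cas: "v \<in> S ==> f (cas v) = cas (f v)"
 by (subst (2) cas_alt) (simp_all add: cas_def L_simps hf csc_2 csc_4 algebra_simps)

lemma act_f: "v \<in> S ==> act p (f v) = f (act (hshift (-2) p) v)"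
 by (rule act_shift[OF f f_cas]) (simp_all add: hf csc_2 algebra_simps)

lemma act_e: "v \<in> S ==> act p (e v) = e (act (hshift 2 p) v)"
 by (rule act_shift[OF e e_cas]) (simp_all add: he)

definition rtA :: "nat => complex poly poly" where "rtA j = var_C - (var_H - cA (of_nat (1 + 2 * j))) * (var_H - cA (of_nat (1 + 2 * j)))"
definition rtB :: "nat => complex poly poly" where "rtB j = var_C - (var_H + cA (of_nat (1 + 2 * j))) * (var_H + cA (of_nat (1 + 2 * j)))"

lemma hshift_rtA: "hshift (-2) (rtA j) = rtA (Suc j)"
 by (simp only: rtA_def hshift_basic hshift_mult hshift_add) (simp add: cA_simps cA_of_nat cA_numeral algebra_simps)

lemma hshift_rtB: "hshift 2 (rtB j) = rtB (Suc j)"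
 by (simp only: rtB_def hshift_basic hshift_mult hshift_add) (simp add: cA_simps cA_of_nat cA_numeral algebra_simps)

lemma act_rtA0: assumes v: "v \<in> S" shows "act (rtA 0) v = 4 \<cdot> e (f v)"
proof -
 have "act (rtA 0) v = act (var_C - (var_H - 1) * (var_H - 1)) v" by (simp add: rtA_def cA_simps)
 also have "\<dots> = cas v - (h (h v - v) - (h v - v))"
  using v by (simp only: act_diff act_mult act_C act_H act_one S_simps)
 finally show ?thesis using v by (simp add: L_simps cas_def csc_2 algebra_simps)
qed

lemma act_rtB0: assumes v: "v \<in> S" shows "act (rtB 0) v = 4 \<cdot> f (e v)"
proof -
 have "act (rtB 0) v = act (var_C - (var_H + 1) * (var_H + 1)) v" by (simp add: rtB_def cA_simps)
 also have "\<dots> = cas v - (h (h v + v) + (h v + v))"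
  using v by (simp only: act_diff act_add act_mult act_C act_H act_one S_simps)
 finally show ?thesis using v by (simp add: L_simps cas_alt csc_2 algebra_simps)
qed

lemma act_rtA_funpow: "v \<in> S ==> act (rtA j) ((f ^^ n) v) = (f ^^ n) (act (rtA (j + n)) v)"
 by (induction n arbitrary: j) (simp_all add: act_f clin_in[OF clin_funpow[OF f]] hshift_rtA)

lemma act_rtB_funpow: "v \<in> S ==> act (rtB j) ((e ^^ n) v) = (e ^^ n) (act (rtB (j + n)) v)"
 by (induction n arbitrary: j) (simp_all add: act_e clin_in[OF clin_funpow[OF e]] hshift_rtB)

lemma ef_funpow: "v \<in> S ==> act (\<Prod>j<n. rtA j) v = 4 ^ n \<cdot> (e ^^ n) ((f ^^ n) v)"
proof (induction n arbitrary: v)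
 case 0
 then show ?case by (simp add: act_one)
next
 case (Suc n)
 let ?fn = "(f ^^ n) v" and ?w = "act (rtA n) v"
 have in1: "?fn \<in> S" using clin_in[OF clin_funpow[OF f]] Suc.prems by blast
 have "(e ^^ Suc n) ((f ^^ Suc n) v) = (e ^^ n) (e (f ?fn))" by (simp add: funpow_swap1)
 moreover have "4 \<cdot> (e ^^ n) (e (f ?fn)) = (e ^^ n) (act (rtA 0) ?fn)"
  using in1 by (simp add: act_rtA0 clin_csc[OF clin_funpow[OF e]])
 moreover have "act (rtA 0) ?fn = (f ^^ n) ?w" using act_rtA_funpow[OF Suc.prems, of 0 n] by simp
 ultimately have "4 \<cdot> (e ^^ Suc n) ((f ^^ Suc n) v) = (e ^^ n) ((f ^^ n) ?w)" by simp
 then have "4 ^ n \<cdot> (4 \<cdot> (e ^^ Suc n) ((f ^^ Suc n) v)) = act (\<Prod>j<n. rtA j) ?w"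
  using Suc.IH[of ?w] Suc.prems by simp
 then show ?case using Suc.prems by (simp only: prod.lessThan_Suc act_mult csc_csc power_Suc2)
qed

lemma fe_funpow: "v \<in> S ==> act (\<Prod>j<n. rtB j) v = 4 ^ n \<cdot> (f ^^ n) ((e ^^ n) v)"
proof (induction n arbitrary: v)
 case 0
 then show ?case by (simp add: act_one)
next
 case (Suc n)
 let ?fn = "(e ^^ n) v" and ?w = "act (rtB n) v"
 have in1: "?fn \<in> S" using clin_in[OF clin_funpow[OF e]] Suc.prems by blast
 have "(f ^^ Suc n) ((e ^^ Suc n) v) = (f ^^ n) (f (e ?fn))" by (simp add: funpow_swap1)
 moreover have "4 \<cdot> (f ^^ n) (f (e ?fn)) = (f ^^ n) (act (rtB 0) ?fn)"
  using in1 by (simp add: act_rtB0 clin_csc[OF clin_funpow[OF f]])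
 moreover have "act (rtB 0) ?fn = (e ^^ n) ?w" using act_rtB_funpow[OF Suc.prems, of 0 n] by simp
 ultimately have "4 \<cdot> (f ^^ Suc n) ((e ^^ Suc n) v) = (f ^^ n) ((e ^^ n) ?w)" by simp
 then have "4 ^ n \<cdot> (4 \<cdot> (f ^^ Suc n) ((e ^^ Suc n) v)) = act (\<Prod>j<n. rtB j) ?w"
  using Suc.IH[of ?w] Suc.prems by simp
 then show ?case using Suc.prems by (simp only: prod.lessThan_Suc act_mult csc_csc power_Suc2)
qed

end

text \<open>The pair (j,k) stands for the vector k steps below the top of the simple module of
highest weight j + k; ptH and ptC are its weight and its eigenvalue under
the Casimir element, normalised to be \<open>(n+1)\<^sup>2\<close> in highest weight n.\<close>

definition ptH :: "nat \<times> nat => complex" where "ptH p = of_int (int (fst p) - int (snd p))"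
definition ptC :: "nat \<times> nat => complex" where "ptC p = of_nat (Suc (fst p + snd p)) * of_nat (Suc (fst p + snd p))"

lemma pt_cases: "ptH p = of_int a ==> ptC p = of_nat (Suc b) * of_nat (Suc b) ==> int (fst p) - int (snd p) = a & fst p + snd p = b"
proof -
 assume 1: "ptH p = of_int a" and "ptC p = of_nat (Suc b) * of_nat (Suc b)"
 then have "(of_nat (Suc (fst p + snd p) * Suc (fst p + snd p)) :: complex) = of_nat (Suc b * Suc b)"
  unfolding ptC_def by (simp only: of_nat_mult)
 then have "Suc (fst p + snd p) * Suc (fst p + snd p) = Suc b * Suc b" by (simp only: of_nat_eq_iff)
 then have "Suc (fst p + snd p) = Suc b" by (metis nat_mult_eq_cancel1 nat_neq_iff mult_less_mono1 mult_less_mono2 zero_less_Suc less_trans)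
 moreover have "int (fst p) - int (snd p) = a" using 1 unfolding ptH_def by (simp only: of_int_eq_iff)
 ultimately show ?thesis by auto
qed

definition ptZ :: "nat \<times> nat => complex" where "ptZ p = ptH p + \<i> * ptC p"

lemma pt_inj: "ptH p = ptH q ==> ptC p = ptC q ==> p = q"
proof -
 assume "ptH p = ptH q" "ptC p = ptC q"
 then have "int (fst p) - int (snd p) = int (fst q) - int (snd q) & fst p + snd p = fst q + snd q"
  by (intro pt_cases) (simp_all add: ptH_def ptC_def)
 then show "p = q" by (auto simp: prod_eq_iff)
qed

lemma ptZ_inj: "inj ptZ"
proof (rule injI)
 fix p q assume *: "ptZ p = ptZ q"
 obtain a b :: real where p: "ptH p = of_real a" "ptC p = of_real b"
  unfolding ptH_def ptC_def by (metis of_real_of_int_eq of_real_of_nat_eq of_real_mult)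
 obtain c d :: real where q: "ptH q = of_real c" "ptC q = of_real d"
  unfolding ptH_def ptC_def by (metis of_real_of_int_eq of_real_of_nat_eq of_real_mult)
 have "a = c & b = d" using * unfolding ptZ_def p q by (auto simp: complex_eq_iff)
 then show "p = q" using p q by (intro pt_inj) auto
qed

text \<open>Nilpotency of e and f replaces finite dimension, so that the results apply to spaces of
power series and to spaces of linear maps. The identities \<open>f\<^sup>N e\<^sup>N = 0\<close> and \<open>e\<^sup>N
f\<^sup>N = 0\<close> are polynomial identities in H and C.\<close>

locale sl2_nil = sl2_module +
 fixes N :: nat
 assumes eN: "!!v. v \<in> S ==> (e ^^ N) v = 0" and fN: "!!v. v \<in> S ==> (f ^^ N) v = 0" and N0: "0 < N"
begin

definition pts :: "(nat \<times> nat) set" where "pts = {..<N} \<times> {..<N}"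

lemma pts_fin [simp]: "finite pts" "pts ~= {}" using N0 by (auto simp: pts_def)

text \<open>H and C have real eigenvalues here, so the single element H + i C
separates the joint eigenvalues, and the projectors are Lagrange polynomials in it.\<close>

definition var_Z :: "complex poly poly" where "var_Z = var_H + cA \<i> * var_C"

definition proj :: "nat \<times> nat => complex poly poly" where
 "proj p = (\<Prod>q\<in>pts - {p}. (var_Z - cA (ptZ q)) * cA (1 / (ptZ p - ptZ q)))"

lemma ptZ_diff: "p ~= q ==> ptZ p - ptZ q ~= 0"
 using inj_eq[OF ptZ_inj, of p q] by simp

definition Ann :: "complex poly poly set" where "Ann = {p. \<forall>v\<in>S. act p v = 0}"

text \<open>For each j, k the ideal generated by \<open>C - (H - 1 - 2j)\<^sup>2\<close> and
\<open>C - (H + 1 + 2k)\<^sup>2\<close> contains H - (j - k) and \<open>C - (j + k +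
1)\<^sup>2\<close>, because the difference of the generators is a nonzero multiple of the first.\<close>

lemma selection:
 assumes "!!p. p \<in> pts ==> s p \<in> {var_H - cA (ptH p), var_C - cA (ptC p), var_Z - cA (ptZ p)}"
 shows "(\<Prod>p\<in>pts. s p) \<in> Ann"
proof -
 have "(\<Prod>j<N. \<Prod>k<N. s (j, k)) \<in> Ann"
 proof (rule ideal_selection[where a = rtA and b = rtB])
  show "x + y \<in> Ann" if "x \<in> Ann" "y \<in> Ann" for x y using that by (auto simp: Ann_def act_add)
  show "r * x \<in> Ann" if "x \<in> Ann" for r x using that by (auto simp: Ann_def mult.commute[of r] act_mult)
  show "(\<Prod>j<N. rtA j) \<in> Ann" by (auto simp: Ann_def ef_funpow fN clin_0[OF clin_funpow[OF e] S])
  show "(\<Prod>j<N. rtB j) \<in> Ann" by (auto simp: Ann_def fe_funpow eN clin_0[OF clin_funpow[OF f] S])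
  fix j k assume jk: "j < N" "k < N"
  let ?n = "of_nat (1 + j + k) :: complex"
  let ?r = "cA (1 / (4 * ?n))"
  have n: "?n ~= 0" by (metis Suc_eq_plus1_left add_Suc of_nat_eq_0_iff old.nat.distinct(2))
  have "cA (1 / (4 * ?n)) * (4 * of_nat (1 + j + k)) = cA ((1 / (4 * ?n)) * (4 * ?n))"
   by (simp only: cA_simps cA_numeral cA_of_nat)
  also have "\<dots> = 1" using n by (simp add: cA_simps del: of_nat_add of_nat_Suc)
  finally have r: "?r * (4 * of_nat (1 + j + k)) = 1" .
  have "rtA j - rtB k = (4 * of_nat (1 + j + k)) * (var_H - cA (ptH (j, k)))"
   by (simp add: rtA_def rtB_def ptH_def cA_simps cA_of_nat cA_numeral algebra_simps)
  then have 1: "var_H - cA (ptH (j, k)) = ?r * rtA j + (- ?r) * rtB k"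
   using r by (metis (no_types, lifting) diff_conv_add_uminus minus_mult_left mult.assoc mult_1 right_diff_distrib')
  let ?u = "var_H - of_nat (2 + 3 * j + k)"
  have "var_C - cA (ptC (j, k)) = rtA j + ?u * (var_H - cA (ptH (j, k)))"
   by (simp add: rtA_def ptC_def ptH_def cA_simps cA_of_nat cA_numeral algebra_simps)
  then have 2: "var_C - cA (ptC (j, k)) = (1 + ?u * ?r) * rtA j + (- ?u * ?r) * rtB k"
   unfolding 1 by (simp add: algebra_simps)
  have 3: "var_Z - cA (ptZ (j, k)) = (?r + cA \<i> * (1 + ?u * ?r)) * rtA j + (- ?r + cA \<i> * (- ?u * ?r)) * rtB k"
  proof -
   have "var_Z - cA (ptZ (j, k)) = (var_H - cA (ptH (j, k))) + cA \<i> * (var_C - cA (ptC (j, k)))"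
    by (simp add: var_Z_def ptZ_def cA_simps algebra_simps)
   also have "\<dots> = (?r * rtA j + (- ?r) * rtB k) + cA \<i> * ((1 + ?u * ?r) * rtA j + (- ?u * ?r) * rtB k)"
    by (simp only: 1[symmetric] 2[symmetric])
   also have "\<dots> = (?r + cA \<i> * (1 + ?u * ?r)) * rtA j + (- ?r + cA \<i> * (- ?u * ?r)) * rtB k"
    by (simp only: ring_distribs mult.assoc add_ac)
   finally show ?thesis .
  qed
  show "EX x y. s (j, k) = x * rtA j + y * rtB k"
  proof -
   have "s (j, k) = var_H - cA (ptH (j, k)) \<or> s (j, k) = var_C - cA (ptC (j, k)) \<or> s (j, k) = var_Z - cA (ptZ (j, k))"
    using assms[of "(j, k)"] jk by (simp only: pts_def) blast
   then show ?thesis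
    by (elim disjE; simp only:) (rule exI, rule exI, rule 1, rule exI, rule exI, rule 2, rule exI, rule exI, rule 3)
  qed
 qed
 then show ?thesis by (simp add: pts_def prod.cartesian_product)
qed

lemma proj_eigen:
 assumes p: "p \<in> pts" and v: "v \<in> S"
 shows "h (act (proj p) v) = ptH p \<cdot> act (proj p) v" "cas (act (proj p) v) = ptC p \<cdot> act (proj p) v"
proof -
 have *: "act ((x - cA a) * proj p) v = 0"
  if "x - cA a \<in> {var_H - cA (ptH p), var_C - cA (ptC p)}" for x a
 proof -
  let ?s = "%q. if q = p then x - cA a else var_Z - cA (ptZ q)"
  have "(\<Prod>q\<in>pts. ?s q) = (x - cA a) * (\<Prod>q\<in>pts - {p}. var_Z - cA (ptZ q))"
   using p by (subst prod.remove[of _ p]) auto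
  then have "(x - cA a) * (\<Prod>q\<in>pts - {p}. var_Z - cA (ptZ q)) \<in> Ann"
   using that selection[of ?s] by auto
  then have B: "act ((x - cA a) * (\<Prod>q\<in>pts - {p}. var_Z - cA (ptZ q))) v = 0"
   using v unfolding Ann_def by blast
  have eq: "(x - cA a) * proj p = (\<Prod>q\<in>pts - {p}. cA (1 / (ptZ p - ptZ q))) * ((x - cA a) * (\<Prod>q\<in>pts - {p}. var_Z - cA (ptZ q)))"
   unfolding proj_def prod.distrib by (simp only: mult_ac)
  show ?thesis unfolding eq
   by (subst act_mult[OF v]) (simp only: B clin_0[OF ract_clin[OF ract_act] S])
 qed
 have H: "act ((var_H - cA (ptH p)) * proj p) v = 0" and C: "act ((var_C - cA (ptC p)) * proj p) v = 0"
  by (rule *, blast)+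
 show "h (act (proj p) v) = ptH p \<cdot> act (proj p) v"
  using H unfolding act_mult[OF v] act_diff[OF act_in[OF v]] act_H[OF act_in[OF v]] act_cA[OF act_in[OF v]] by simp
 show "cas (act (proj p) v) = ptC p \<cdot> act (proj p) v"
  using C unfolding act_mult[OF v] act_diff[OF act_in[OF v]] act_C[OF act_in[OF v]] act_cA[OF act_in[OF v]] by simp
qed

text \<open>Complete reducibility in the form needed: the projectors are polynomials in H and C that
add up to 1.\<close>

lemma decomp:
 assumes v: "v \<in> S"
 shows "(\<Sum>p\<in>pts. act (proj p) v) = v"
proof -
 define Zop where "Zop v = h v + \<i> \<cdot> cas v" for v
 have Z: "clin S S Zop" unfolding Zop_def by (intro clin_plus clin_scale S h cas_clin)
 have ZC: "Zop (b \<cdot> v) = b \<cdot> Zop v" if "v \<in> S" for b v using clin_csc[OF Z that] .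
 note za = ract_pact[OF S ract_csc[OF S] Z ZC]
 have Zop_act: "act (var_Z - cA a) w = Zop w - a \<cdot> w" if "w \<in> S" for w a
  using that by (simp only: act_diff act_cA var_Z_def act_add act_mult act_H act_C act_in Zop_def)
   (simp add: act_cA act_C)
 have lin: "pact csc Zop ([:- a, 1:] * [:b:]) w = act ((var_Z - cA a) * cA b) w" if "w \<in> S" for a b w
 proof -
  have "[:- a, 1:] * [:b:] = Polynomial.smult b [:- a, 1:]" by simp
  moreover have "pact csc Zop [:- a, 1:] w = Zop w - a \<cdot> w"
  proof -
   have "pact csc Zop [:1:] w = w"
    using pact_const[OF S ract_csc[OF S] Z ZC that, of 1] by simp
   then show ?thesis using pact_pCons[OF S ract_csc[OF S] Z ZC that, of "-a" "[:1:]"] that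
    by (simp add: cv.scale_minus_left)
  qed
  ultimately have 1: "pact csc Zop ([:- a, 1:] * [:b:]) w = b \<cdot> (Zop w - a \<cdot> w)"
   using pact_smult[OF S ract_csc[OF S] Z ZC that, of b "[:- a, 1:]"] by simp
  have "act ((var_Z - cA a) * cA b) w = act (cA b) (act (var_Z - cA a) w)"
   using that by (simp only: mult.commute[of _ "cA b"] act_mult)
  also have "\<dots> = b \<cdot> (Zop w - a \<cdot> w)"
   using that act_in[OF that, of "var_Z - cA a"] by (simp only: Zop_act act_cA)
  finally show ?thesis using 1 by simp
 qed
 have prd: "pact csc Zop (\<Prod>q\<in>Q. [:- a q, 1:] * [:b q:]) w = act (\<Prod>q\<in>Q. (var_Z - cA (a q)) * cA (b q)) w"
  if "w \<in> S" "finite Q" for w a b and Q :: "(nat \<times> nat) set"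
  using that(2)
 proof induction
  case empty
  then show ?case using that(1) ract_one[OF za] by (simp add: act_one)
 next
  case (insert x F)
  show ?case unfolding prod.insert[OF insert.hyps]
   using that(1) insert.IH
   by (simp only: ract_mult[OF za that(1)] act_mult[OF that(1)] lin[OF act_in[OF that(1)]])
 qed
 have "(\<Sum>p\<in>pts. act (proj p) v) = (\<Sum>p\<in>pts. pact csc Zop (\<Prod>q\<in>pts - {p}. [:- ptZ q, 1:] * [:1 / (ptZ p - ptZ q):]) v)"
  unfolding proj_def
  by (intro sum.cong refl prd[symmetric, where a = ptZ, OF v finite_Diff[OF pts_fin(1)]])
 also have "\<dots> = pact csc Zop (\<Sum>p\<in>pts. \<Prod>q\<in>pts - {p}. [:- ptZ q, 1:] * [:1 / (ptZ p - ptZ q):]) v"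
  by (rule ract_sum[OF za v, symmetric])
 also have "\<dots> = pact csc Zop 1 v"
  by (simp only: lagrange_partition[OF pts_fin inj_on_subset[OF ptZ_inj subset_UNIV]])
 finally show ?thesis using ract_one[OF za v] by simp
qed

lemma eval_proj:
 assumes "p \<in> pts" "q \<in> pts"
 shows "evalHC (ptH q) (ptC q) (proj p) = (if p = q then 1 else 0)"
proof -
 have Z: "evalHC (ptH q) (ptC q) var_Z = ptZ q"
  by (simp only: var_Z_def ptZ_def evalHC_simps)
 show ?thesis
 proof (cases "p = q")
  case True
  have "evalHC (ptH q) (ptC q) ((var_Z - cA (ptZ r)) * cA (1 / (ptZ p - ptZ r))) = 1" if "r \<in> pts - {p}" for r
   using ptZ_diff[of p r] that True by (simp only: evalHC_simps Z) auto
  then have "(\<Prod>r\<in>pts - {p}. evalHC (ptH q) (ptC q) ((var_Z - cA (ptZ r)) * cA (1 / (ptZ p - ptZ r)))) = 1"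
   by (intro prod.neutral ballI) (simp only: True)
  then show ?thesis using True unfolding proj_def by (simp only: evalHC_simps(9) if_True simp_thms)
 next
  case False
  then show ?thesis using assms by (auto simp: proj_def Z intro!: prod_zero bexI[of _ q])
 qed
qed

lemma eigen_zero:
 assumes v: "v \<in> S" "h v = x \<cdot> v" "cas v = y \<cdot> v" and "!!p. p \<in> pts ==> (ptH p, ptC p) ~= (x, y)"
 shows "v = 0"
proof -
 have "act (proj p) v = 0" if p: "p \<in> pts" for p
 proof -
  define w where "w = evalHC x y (proj p) \<cdot> v"
  have 1: "act (proj p) v = w" unfolding w_def by (rule act_eigen[OF v])
  have "h w = x \<cdot> w" "cas w = y \<cdot> w" unfolding w_def
   by (simp_all only: clin_csc[OF h v(1)] clin_csc[OF cas_clin v(1)] v(2,3) csc_csc mult.commute)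
  moreover have "h w = ptH p \<cdot> w" "cas w = ptC p \<cdot> w"
   using proj_eigen[OF p v(1)] unfolding 1 .
  ultimately have "x \<cdot> w = ptH p \<cdot> w" "y \<cdot> w = ptC p \<cdot> w"
   by metis+
  then have "w = 0" using assms(4)[OF p] by (metis cv.scale_cancel_right)
  then show ?thesis using 1 by simp
 qed
 then have "(\<Sum>p\<in>pts. act (proj p) v) = 0" by (intro sum.neutral ballI)
 with decomp[OF v(1)] show ?thesis by (rule trans[OF sym])
qed

lemma invariant:
 assumes v: "v \<in> S" "h v = 0" "cas v = v"
 shows "e v = 0" "f v = 0"
proof -
 have np: "(ptH p, ptC p) ~= (of_int (2 * s), 1)" if "s = 1 \<or> s = -1" for p s
 proof
  assume "(ptH p, ptC p) = (of_int (2 * s), 1)"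
  then have "int (fst p) - int (snd p) = 2 * s & fst p + snd p = 0"
   by (intro pt_cases) (simp_all only: prod.inject, simp)
  then show False using that by auto
 qed
 have "h (e v) = 2 \<cdot> e v" "h (f v) = (-2) \<cdot> f v"
  using he[OF v(1)] hf[OF v(1)] v clin_0[OF e S] clin_0[OF f S] by (simp_all add: csc_2)
 moreover have "cas (e v) = 1 \<cdot> e v" "cas (f v) = 1 \<cdot> f v"
  using e_cas[OF v(1)] f_cas[OF v(1)] v(3) by (metis csc_one)+
 ultimately show "e v = 0" "f v = 0"
  using eigen_zero[OF clin_in[OF e v(1)], of 2 1] eigen_zero[OF clin_in[OF f v(1)], of "-2" 1] np[of 1] np[of "-1"]
  by simp_all
qed

end

definition fd :: "'a::cvec set => bool" where
 "fd S \<longleftrightarrow> cv.subspace S & (EX B. finite B & S \<subseteq> cv.span B)"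

lemma fd_subspace: "fd S ==> cv.subspace S"
 by (simp add: fd_def)

lemma annihilating_poly_vector:
 assumes "fd S" and T: "clin S S T" and v: "v \<in> S"
 shows "EX p. p ~= 0 & pact csc T p v = 0"
proof -
 obtain B where B: "finite B" "S \<subseteq> cv.span B" using assms by (auto simp: fd_def)
 note S = fd_subspace[OF assms(1)]
 have in': "(T ^^ i) v \<in> S" for i using clin_in[OF clin_funpow[OF T] v] .
 have pact: "pact csc T p v = (\<Sum>i\<le>n. Polynomial.coeff p i \<cdot> (T ^^ i) v)" if "Polynomial.degree p \<le> n" for p n
  using pact_bound[OF S ract_csc[OF S] T _ v that] clin_csc[OF T] by simp
 let ?n = "card B" and ?F = "%i. (T ^^ i) v"
 have "EX c. (\<exists>i\<le>?n. c i ~= 0) & (\<Sum>i\<le>?n. c i \<cdot> ?F i) = 0"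
 proof (cases "inj_on ?F {..?n}")
  case True
  have "cv.dependent (?F ` {..?n})"
  proof (rule ccontr)
   assume "\<not> cv.dependent (?F ` {..?n})"
   then have "card (?F ` {..?n}) \<le> card B" using B in'
    by (intro conjunct2[OF cv.independent_span_bound]) auto
   then show False using card_image[OF True] by simp
  qed
  then obtain u where u: "(\<exists>w\<in>?F ` {..?n}. u w ~= 0)" "(\<Sum>w\<in>?F ` {..?n}. u w \<cdot> w) = 0"
   using cv.dependent_finite[of "?F ` {..?n}"] by auto
  then show ?thesis by (intro exI[of _ "%i. u (?F i)"]) (auto simp: sum.reindex[OF True])
 next
  case False
  then obtain i j where ij: "i \<le> ?n" "j \<le> ?n" "i ~= j" "?F i = ?F j" by (auto simp: inj_on_def)
  let ?c = "%m. (if m = i then 1 else 0) + (if m = j then -1 else (0::complex))"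
  have 1: "(\<Sum>m\<le>?n. (if m = i then 1 else (0::complex)) \<cdot> ?F m) = ?F i" if "i \<le> ?n" for i
   using that by (subst sum.mono_neutral_right[of "{..?n}" "{i}"]) auto
  have 2: "(\<Sum>m\<le>?n. (if m = j then -1 else (0::complex)) \<cdot> ?F m) = - ?F j" if "j \<le> ?n" for j
   using that by (subst sum.mono_neutral_right[of "{..?n}" "{j}"]) auto
  have "(\<Sum>m\<le>?n. ?c m \<cdot> ?F m) = ?F i - ?F j"
   unfolding csc_add_left sum.distrib 1[OF ij(1)] 2[OF ij(2)] by simp
  then show ?thesis using ij by (intro exI[of _ ?c]) auto
 qed
 then obtain c where c: "\<exists>i\<le>?n. c i ~= 0" "(\<Sum>i\<le>?n. c i \<cdot> ?F i) = 0" by auto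
 define p where "p = (\<Sum>i\<le>?n. Polynomial.monom (c i) i)"
 have cp: "Polynomial.coeff p i = (if i \<le> ?n then c i else 0)" for i
  unfolding p_def by (simp add: coeff_sum)
 have "Polynomial.degree p \<le> ?n" by (rule degree_le) (simp add: cp)
 from pact[OF this] c(2) have "pact csc T p v = 0" by (simp add: cp)
 moreover have "p ~= 0" using c(1) cp by (metis coeff_0)
 ultimately show ?thesis by blast
qed

lemma annihilating_poly:
 assumes "fd S" and T: "clin S S T"
 shows "EX n root. \<forall>v\<in>S. pact csc T (\<Prod>i<n::nat. [:- root i, 1:]) v = 0"
proof -
 note S = fd_subspace[OF assms(1)]
 have comm: "v \<in> S ==> T (b \<cdot> v) = b \<cdot> T v" for b v using clin_csc[OF T] .
 note za = ract_pact[OF S ract_csc[OF S] T comm]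
 obtain B where B: "B \<subseteq> S" "cv.independent B" "S \<subseteq> cv.span B" using cv.basis_exists[of S] by metis
 have fin: "finite B"
  using cv.independent_span_bound[OF _ B(2)] assms(1) B(1) by (auto simp: fd_def)
 have "\<forall>b\<in>B. EX p. p ~= 0 & pact csc T p b = 0"
  using annihilating_poly_vector[OF assms] B by auto
 then obtain p where p: "!!b. b \<in> B ==> p b ~= 0 & pact csc T (p b) b = 0" by metis
 define P where "P = (\<Prod>b\<in>B. p b)"
 have P0: "P ~= 0" using p fin by (auto simp: P_def)
 have Pb: "pact csc T P b = 0" if "b \<in> B" for b
 proof -
  have "P = (\<Prod>b\<in>B - {b}. p b) * p b" unfolding P_def using fin that by (simp add: prod.remove mult.commute)
  then show ?thesis using that B p[OF that] ract_mult[OF za, of b] clin_0[OF ract_clin[OF za] S] by auto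
 qed
 have PS: "pact csc T P v = 0" if "v \<in> S" for v
 proof -
  have "v \<in> cv.span B" using that B by auto
  then obtain u where "v = (\<Sum>b\<in>B. u b \<cdot> b)" using cv.span_finite[OF fin] by auto
  moreover have "pact csc T P (\<Sum>b\<in>B. u b \<cdot> b) = (\<Sum>b\<in>B. pact csc T P (u b \<cdot> b))"
   using B cv.subspace_scale[OF S] by (intro clin_sum[OF ract_clin[OF za] S]) auto
  moreover have "\<dots> = 0" using B Pb by (intro sum.neutral) (auto simp: clin_csc[OF ract_clin[OF za]])
  ultimately show ?thesis by simp
 qed
 obtain root where root: "Polynomial.smult (lead_coeff P) (\<Prod>i<Polynomial.degree P. [:- root i, 1:]) = P"
  using complex_poly_decompose' by blast
 have "pact csc T (\<Prod>i<Polynomial.degree P. [:- root i, 1:]) v = 0" if "v \<in> S" for v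
  using PS[OF that] pact_smult[OF S ract_csc[OF S] T comm that, of "lead_coeff P" "\<Prod>i<Polynomial.degree P. [:- root i, 1:]"] P0
  unfolding root by simp
 then show ?thesis by blast
qed

text \<open>In finite dimension h has finitely many differences of eigenvalues, and s has to be one
of them unless T = 0. Indeed the annihilating polynomials of h and of its shift by
s are coprime for large s, and both annihilate T.\<close>

lemma large_weight_zero:
 assumes "fd S" and h: "clin S S h"
 shows "EX R. ALL s T. cmod s > R --> clin S S T --> (\<forall>v\<in>S. h (T v) = T (h v) + s \<cdot> T v) --> (\<forall>v\<in>S. T v = 0)"
proof -
 note S = fd_subspace[OF assms(1)]
 have comm: "v \<in> S ==> h (b \<cdot> v) = b \<cdot> h v" for b v using clin_csc[OF h] .
 note za = ract_pact[OF S ract_csc[OF S] h comm]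
 obtain n root where root: "!!v. v \<in> S ==> pact csc h (\<Prod>i<n::nat. [:- root i, 1:]) v = 0"
  using annihilating_poly[OF assms] by blast
 define R where "R = (\<Sum>i<n. 2 * cmod (root i))"
 have lin: "pact csc h [:a, 1:] w = a \<cdot> w + h w" if "w \<in> S" for a w
  using pact_pCons[OF S ract_csc[OF S] h comm that, of a 1] ract_one[OF za that] by (simp add: one_pCons)
 have "T v = 0" if s: "cmod s > R" and T: "clin S S T" and hT: "!!v. v \<in> S ==> h (T v) = T (h v) + s \<cdot> T v" and v: "v \<in> S" for s T v
 proof -
  define A where "A = {q. \<forall>v\<in>S. T (pact csc h q v) = 0}"
  have "(\<Prod>i<n. \<Prod>j<n. (1::complex poly)) \<in> A"
  proof (rule ideal_selection[where a = "%i. [:s - root i, 1:]" and b = "%i. [:- root i, 1:]"])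
   show "x + y \<in> A" if "x \<in> A" "y \<in> A" for x y
    using that by (simp add: A_def ract_add[OF za] clin_add[OF T] ract_in[OF za])
   show "r * x \<in> A" if "x \<in> A" for r x
    using that by (simp add: A_def mult.commute[of r] ract_mult[OF za] ract_in[OF za])
   show "(\<Prod>j<n. [:- root j, 1:]) \<in> A" by (simp add: A_def root clin_0[OF T S])
   have mv: "pact csc h (\<Prod>i<m. [:- root i, 1:]) (T v) = T (pact csc h (\<Prod>i<m. [:s - root i, 1:]) v)" if "v \<in> S" for m :: nat and v
    using that
   proof (induction m arbitrary: v)
    case 0
    then show ?case by (simp add: ract_one[OF za] clin_in[OF T])
   next
    case (Suc m)
    have "T (pact csc h [:s - root m, 1:] v) = (s - root m) \<cdot> T v + T (h v)"
     using Suc.prems by (simp add: lin clin_add[OF T] clin_in[OF h] cv.subspace_scale[OF S] clin_csc[OF T])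
    moreover have "pact csc h [:- root m, 1:] (T v) = (- root m) \<cdot> T v + (T (h v) + s \<cdot> T v)"
     using Suc.prems by (simp only: lin clin_in[OF T] hT)
    ultimately have "pact csc h [:- root m, 1:] (T v) = T (pact csc h [:s - root m, 1:] v)"
     by (simp add: cv.scale_left_diff_distrib)
    then show ?case using Suc.prems by (simp only: prod.lessThan_Suc ract_mult[OF za] clin_in[OF T] Suc.IH ract_in[OF za])
   qed
   show "(\<Prod>j<n. [:s - root j, 1:]) \<in> A" by (simp add: A_def mv[symmetric] root clin_in[OF T])
   fix i j assume ij: "i < n" "j < n"
   have "cmod (root i - root j) \<le> cmod (root i) + cmod (root j)" by (rule norm_triangle_ineq4)
   also have "cmod (root i) + cmod (root j) \<le> R"
   proof -
    have "2 * cmod (root i) \<le> R" "2 * cmod (root j) \<le> R"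
     unfolding R_def using ij by (auto intro!: member_le_sum[where f = "%i. 2 * cmod (root i)"])
    then show ?thesis by simp
   qed
   finally have "s ~= root i - root j" using s by auto
   then have "s - root i + root j ~= 0" by (simp add: algebra_simps eq_diff_eq)
   then have "1 = [:1 / (s - root i + root j):] * [:s - root i, 1:] + (- [:1 / (s - root i + root j):]) * [:- root j, 1:]"
    by (simp add: one_pCons diff_divide_distrib[symmetric] add_divide_distrib[symmetric])
   then show "EX x y. 1 = x * [:s - root i, 1:] + y * [:- root j, 1:]" by blast
  qed
  then show ?thesis using v by (simp add: A_def ract_one[OF za])
 qed
 then show ?thesis by blast
qed

section \<open>Maps linear over the double series\<close>

definition kop :: "'a::cvec set => 'b::cvec set => (('a dser) => 'b dser) => bool" where
 "kop S S' T \<longleftrightarrow> clin (MS S) (MS S') T & (\<forall>f\<in>MS S. T (hsh f) = hsh (T f)) & (\<forall>f\<in>MS S. T (vsh f) = vsh (T f))"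

lemma kop_clin: "kop S S' T ==> clin (MS S) (MS S') T"
 and kop_hsh: "kop S S' T ==> f \<in> MS S ==> T (hsh f) = hsh (T f)"
 and kop_vsh: "kop S S' T ==> f \<in> MS S ==> T (vsh f) = vsh (T f)"
 by (auto simp: kop_def)

lemmas kop_in = clin_in[OF kop_clin]

lemma kop_comp: "kop S S' T ==> kop S' S'' T' ==> kop S S'' (%f. T' (T f))"
 by (auto simp: kop_def clin_def)

lemma kop_funpow: "kop S S T ==> kop S S (T ^^ n)"
proof (induction n)
 case 0
 then show ?case by (simp add: kop_def clin_def)
next
 case (Suc n)
 then show ?case using kop_comp[of S S "T ^^ n" S T] by (simp add: comp_def)
qed

definition lim0 :: "((nat => nat => 'a::zero) => 'b dser) => 'a => 'b" where
 "lim0 T v = T (mconst v) 0 0"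

lemma peel_in:
 assumes "cv.subspace S" "f \<in> MS S"
 shows "mconst (f 0 0) \<in> MS S" "hsh (hpart f) \<in> MS S" "vsh (vpart f) \<in> MS S" "hpart f \<in> MS S" "vpart f \<in> MS S" "f 0 0 \<in> S"
   "mconst (f 0 0) + hsh (hpart f) \<in> MS S"
 using assms by (auto intro!: MS_hsh MS_vsh MS_vpart MS_hpart MS_mconst cv.subspace_add[OF subspace_MS] simp: MS_D)

lemma kop_peel:
 assumes S: "cv.subspace S" and T: "kop S S' T" and f: "f \<in> MS S"
 shows "T f = T (mconst (f 0 0)) + hsh (T (hpart f)) + vsh (T (vpart f))"
proof -
 note p = peel_in[OF S f]
 have "T f = T (mconst (f 0 0) + hsh (hpart f) + vsh (vpart f))" using arg_cong[OF peel[of f], of T] .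
 also have "\<dots> = T (mconst (f 0 0)) + hsh (T (hpart f)) + vsh (T (vpart f))"
  using p by (simp add: clin_add[OF kop_clin[OF T]] kop_hsh[OF T] kop_vsh[OF T])
 finally show ?thesis .
qed

lemma kop_00: "cv.subspace S ==> kop S S' T ==> f \<in> MS S ==> T f 0 0 = lim0 T (f 0 0)"
 by (subst kop_peel) (auto simp: lim0_def)

lemma clin_coeff:
 assumes S: "cv.subspace S" and T: "kop S S' T"
 shows "clin S S' (%v. T (mconst v) k l)"
 using clin_add[OF kop_clin[OF T]] clin_csc[OF kop_clin[OF T]] kop_in[OF T] MS_mconst[OF S]
 by (intro clinI) (auto simp: mconst_add mconst_csc MS_D)

lemma lim0_clin: "cv.subspace S ==> kop S S' T ==> clin S S' (lim0 T)"
 using clin_coeff[of S S' T 0 0] by (simp add: lim0_def[abs_def])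

lemma lim0_comp: "cv.subspace S ==> cv.subspace S' ==> kop S S' T ==> kop S' S'' T' ==> v \<in> S ==>
  lim0 (%f. T' (T f)) v = lim0 T' (lim0 T v)"
 unfolding lim0_def by (subst kop_00) (auto simp: kop_in MS_mconst lim0_def)

text \<open>Terms of lowest order see the limit of an operator only.\<close>

lemma kop_lead:
 assumes S: "cv.subspace S" and S': "cv.subspace S'" and T: "kop S S' T"
 shows "f \<in> MS S ==> (!!i j. i + j < k + l ==> f i j = 0) ==> T f k l = lim0 T (f k l)"
proof (induction "k + l" arbitrary: f k l rule: less_induct)
 case less
 note p = peel_in[OF S less.prems(1)]
 have T0: "T 0 = 0" using clin_0[OF kop_clin[OF T] subspace_MS[OF S]] .
 have l0: "lim0 T 0 = 0" by (simp add: lim0_def T0)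
 show ?case
 proof (cases "k + l = 0")
  case True
  then show ?thesis using kop_00[OF S T less.prems(1)] by simp
 next
  case False
  then have "f 0 0 = 0" using less.prems(2)[of 0 0] by simp
  then have 1: "T f k l = hsh (T (hpart f)) k l + vsh (T (vpart f)) k l"
   by (subst kop_peel[OF S T less.prems(1)]) (simp add: T0)
  have 2: "hsh (T (hpart f)) k l = (if k = 0 then 0 else lim0 T (f k l))"
  proof (cases k)
   case (Suc k')
   have "T (hpart f) k' l = lim0 T (hpart f k' l)"
    using less.prems(2) Suc by (intro less.hyps p) (auto simp: hpart_def)
   then show ?thesis using Suc by (simp add: hpart_def)
  qed simp
  have 3: "vsh (T (vpart f)) k l = (if k = 0 then lim0 T (f k l) else 0)"
  proof (cases l)
   case 0
   then show ?thesis using False by simp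
  next
   case (Suc l')
   have "T (vpart f) k l' = lim0 T (vpart f k l')"
    using less.prems(2) Suc by (intro less.hyps p) (auto simp: vpart_def)
   then show ?thesis using Suc by (simp add: vpart_def l0)
  qed
  show ?thesis unfolding 1 2 3 by simp
 qed
qed

lemma kop_large_weight_zero:
 assumes S: "cv.subspace S" and h: "kop S S h" and T: "kop S S T" and hT: "!!f. f \<in> MS S ==> h (T f) = T (h f) + s \<cdot> T f"
  and lw: "!!T. clin S S T ==> (!!v. v \<in> S ==> lim0 h (T v) = T (lim0 h v) + s \<cdot> T v) ==> (!!v. v \<in> S ==> T v = 0)"
  and f: "f \<in> MS S"
 shows "T f = 0"
proof -
 have "T f k l = 0" if "f \<in> MS S" for f k l
  using that
 proof (induction "k + l" arbitrary: f k l rule: less_induct)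
  case less
  have low: "T f i j = 0" if "i + j < k + l" "f \<in> MS S" for i j f using less.hyps that by blast
  have red: "T f k l = T (mconst (f 0 0)) k l" if "f \<in> MS S" for f
   using low[OF _ peel_in(4)[OF S that]] low[OF _ peel_in(5)[OF S that]]
   by (subst kop_peel[OF S T that]) (cases k; cases l; simp)
  have "T (mconst v) k l = 0" if "v \<in> S" for v
  proof (rule lw[of "%v. T (mconst v) k l", OF clin_coeff[OF S T] _ that])
   fix v assume v: "v \<in> S"
   note mv = MS_mconst[OF S v]
   have "lim0 h (T (mconst v) k l) = h (T (mconst v)) k l"
    using low[OF _ mv] by (intro kop_lead[OF S S h, symmetric] kop_in[OF T mv])
   also have "\<dots> = T (h (mconst v)) k l + s \<cdot> T (mconst v) k l" using hT[OF mv] by simp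
   also have "T (h (mconst v)) k l = T (mconst (lim0 h v)) k l" unfolding lim0_def by (rule red[OF kop_in[OF h mv]])
   finally show "lim0 h (T (mconst v) k l) = T (mconst (lim0 h v)) k l + s \<cdot> T (mconst v) k l" .
  qed
  then show ?case using red[OF less.prems] peel_in(6)[OF S less.prems] by simp
 qed
 then show ?thesis using f by (auto simp: fun_eq_iff)
qed

lemma sum_app: "sum G A x y = (\<Sum>a\<in>A. G a x (y::nat) :: 'a::comm_monoid_add)"
 by (induction A rule: infinite_finite_induct) auto

text \<open>Injectivity compares lowest order terms; for surjectivity let I be the constant extension of the
inverse of the limit: 1 - I T raises the order of vanishing, so its Neumann series converges.\<close>

lemma kop_bij:
 assumes S: "cv.subspace S" and S': "cv.subspace S'" and T: "kop S S' T" and bij: "bij_betw (lim0 T) S S'"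
 shows "bij_betw T (MS S) (MS S')"
proof -
 note c = kop_clin[OF T] and MSs = subspace_MS[OF S] and lc = lim0_clin[OF S T]
 have "f = 0" if f: "f \<in> MS S" and "T f = 0" for f
 proof -
  have "f k l = 0" for k l
  proof (induction "k + l" arbitrary: k l rule: less_induct)
   case less
   have "lim0 T (f k l) = T f k l" using less by (intro kop_lead[OF S S' T f, symmetric]) auto
   then have "lim0 T (f k l) = lim0 T 0" using that clin_0[OF lc S] by simp
   then show ?case using bij f by (auto simp: bij_betw_def inj_on_def MS_D cv.subspace_0[OF S])
  qed
  then show ?thesis by (auto simp: fun_eq_iff)
 qed
 then have "inj_on T (MS S)"
  by (intro inj_onI) (metis clin_diff[OF c MSs] cv.subspace_diff[OF MSs] eq_iff_diff_eq_0)
 moreover have "g \<in> T ` MS S" if g: "g \<in> MS S'" for g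
 proof -
  define vi where "vi = the_inv_into S (lim0 T)"
  have vi: "vi w \<in> S" "lim0 T (vi w) = w" if "w \<in> S'" for w
   using bij that the_inv_into_into[of "lim0 T" S w S] f_the_inv_into_f[of "lim0 T" S w] unfolding vi_def bij_betw_def by auto
  have invT: "vi (lim0 T v) = v" if "v \<in> S" for v
   using bij that by (simp add: vi_def bij_betw_def the_inv_into_f_f)
  have invc: "clin S' S vi"
  proof (rule clinI)
   fix v w a assume "v \<in> S'" "w \<in> S'"
   then show "vi v \<in> S" "vi (v + w) = vi v + vi w" "vi (a \<cdot> v) = a \<cdot> vi v"
    using invT[of "vi v + vi w"] invT[of "a \<cdot> vi v"] vi
    by (simp_all add: clin_add[OF lc] clin_csc[OF lc] cv.subspace_add[OF S] cv.subspace_scale[OF S])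
  qed
  define I where "I f = (%k l. vi (f k l))" for f :: "'b dser"
  have I: "kop S' S I"
   unfolding kop_def clin_def I_def using clin_0[OF invc S']
   by (auto simp: MS_def fun_eq_iff hsh_def vsh_def clin_add[OF invc] clin_csc[OF invc] vi split: nat.splits)
  define D where "D f = f - I (T f)" for f
  have ID: "clin (MS S) (MS S) D" unfolding D_def
   by (intro clin_minus' MSs clin_comp[OF c kop_clin[OF I]]) (simp add: clin_def)
  have D: "kop S S D" unfolding kop_def
   by (auto simp: ID) (auto simp: D_def hsh_diff vsh_diff kop_hsh[OF T] kop_vsh[OF T] kop_hsh[OF I] kop_vsh[OF I] kop_in[OF T])
  have D0: "lim0 D v = 0" if "v \<in> S" for v
   using that by (simp add: lim0_def D_def I_def invT[unfolded lim0_def])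
  have Dv: "D f k l = 0" if "f \<in> MS S" "!!i j. i + j < k + l ==> f i j = 0" for f k l
   using kop_lead[OF S S D that] D0 MS_D[OF that(1)] by auto
  let ?g = "I g"
  have Ig: "?g \<in> MS S" using kop_in[OF I g] .
  have Dn: "(D ^^ n) ?g \<in> MS S" for n using clin_in[OF clin_funpow[OF ID] Ig] .
  have Dnv: "(D ^^ n) ?g k l = 0" if "k + l < n" for n k l
   using that by (induction n arbitrary: k l) (auto intro!: Dv Dn)
  define f where "f = (%k l. \<Sum>n\<le>k+l. (D ^^ n) ?g k l)"
  have f: "f \<in> MS S" unfolding f_def MS_def using Dn by (auto intro!: cv.subspace_sum[OF S] simp: MS_D)
  have "D f k l = f k l - ?g k l" for k l
  proof -
   let ?s = "\<Sum>n\<le>k+l. (D ^^ n) ?g"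
   have sum: "?s \<in> MS S" using Dn by (intro cv.subspace_sum[OF MSs])
   have "D (f - ?s) k l = 0"
   proof (rule Dv)
    show "f - ?s \<in> MS S" using cv.subspace_diff[OF MSs f sum] .
    fix i j assume ij: "i + j < k + l"
    have "(\<Sum>n\<le>k+l. (D ^^ n) ?g i j) = (\<Sum>n\<le>i+j. (D ^^ n) ?g i j)"
     using ij Dnv by (intro sum.mono_neutral_right) auto
    then show "(f - ?s) i j = 0" by (simp add: f_def sum_app)
   qed
   then have "D f k l = D ?s k l" by (simp add: clin_diff[OF ID MSs f sum])
   also have "D ?s = (\<Sum>n\<le>k+l. (D ^^ Suc n) ?g)" using Dn by (simp add: clin_sum[OF ID MSs])
   also have "\<dots> k l = (\<Sum>n\<le>k+l. (D ^^ Suc n) ?g k l)" by (rule sum_app)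
   also have "\<dots> = (\<Sum>n\<le>Suc (k+l). (D ^^ n) ?g k l) - ?g k l"
    by (subst sum.atMost_Suc_shift) simp
   also have "\<dots> = f k l - ?g k l" using Dnv[of k l "Suc (k + l)"] by (simp add: f_def)
   finally show ?thesis .
  qed
  then have "I (T f) = ?g" unfolding D_def by (simp add: fun_eq_iff)
  then have "vi (T f k l) = vi (g k l)" for k l by (simp add: I_def fun_eq_iff)
  then have "T f k l = g k l" for k l using vi(2) MS_D[OF kop_in[OF T f]] MS_D[OF g] by metis
  then show ?thesis using f by (auto simp: fun_eq_iff image_iff intro!: bexI[of _ f])
 qed
 ultimately show ?thesis using kop_in[OF T] by (auto simp: bij_betw_def)
qed

lemma (in sl2_module) h_funpow:
 assumes "v \<in> S"
 shows "h ((e ^^ n) v) = (e ^^ n) (h v) + of_nat (2 * n) \<cdot> (e ^^ n) v"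
  "h ((f ^^ n) v) = (f ^^ n) (h v) + (- of_nat (2 * n)) \<cdot> (f ^^ n) v"
proof -
 have in': "(e ^^ n) v \<in> S" "(f ^^ n) v \<in> S" if "v \<in> S" for n v
  using that clin_in[OF clin_funpow[OF e]] clin_in[OF clin_funpow[OF f]] by auto
 show "h ((e ^^ n) v) = (e ^^ n) (h v) + of_nat (2 * n) \<cdot> (e ^^ n) v" using assms
  by (induction n) (simp_all add: he in' L_simps csc_add_left add_ac)
 show "h ((f ^^ n) v) = (f ^^ n) (h v) + (- of_nat (2 * n)) \<cdot> (f ^^ n) v" using assms
 proof (induction n)
  case (Suc n)
  have "h ((f ^^ Suc n) v) = f (h ((f ^^ n) v)) - 2 \<cdot> (f ^^ Suc n) v" using hf in' Suc.prems by simp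
  also have "f (h ((f ^^ n) v)) = (f ^^ Suc n) (h v) + (- of_nat (2 * n)) \<cdot> (f ^^ Suc n) v"
   using Suc in' by (simp only: Suc.IH L_simps S_simps) (simp add: L_simps in')
  finally show ?case by (simp add: csc_add_left algebra_simps)
 qed simp
qed

lemma (in sl2_module) nilpotent_fd:
 assumes "fd S" shows "EX N. sl2_nil S e f h N"
proof -
 obtain R where R: "!!s T v. cmod s > R ==> clin S S T ==> (!!v. v \<in> S ==> h (T v) = T (h v) + s \<cdot> T v) ==> v \<in> S ==> T v = 0"
  using large_weight_zero[OF assms h] by metis
 obtain N :: nat where N: "real N > max R 0" using reals_Archimedean2 by blast
 have N2: "R < cmod (of_nat (2 * N))" "R < cmod (- of_nat (2 * N))" using N by (auto simp: norm_mult)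
 show ?thesis
 proof (intro exI[of _ N] sl2_nil.intro sl2_nil_axioms.intro sl2_module_axioms)
  show "0 < N" using N by auto
  show "(e ^^ N) v = 0" if "v \<in> S" for v
   by (rule R[OF N2(1) clin_funpow[OF e] h_funpow(1) that])
  show "(f ^^ N) v = 0" if "v \<in> S" for v
   by (rule R[OF N2(2) clin_funpow[OF f] h_funpow(2) that])
 qed
qed

text \<open>The nilpotency of e and f on V[[h,h']] is a consequence:
\<open>e\<^sup>N\<close> shifts the weight by 2N, which is too much already for the coefficients of
\<open>e\<^sup>N\<close> on V.\<close>

locale sl2_deformed = sl2_module "MS S" e f h for S :: "'a::cvec set" and e f h +
 assumes fdS: "fd S" and ke: "kop S S e" and kf: "kop S S f" and kh: "kop S S h"
begin

lemma S0: "cv.subspace S" using fd_subspace[OF fdS] .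

lemma limit_module: "sl2_module S (lim0 e) (lim0 f) (lim0 h)"
proof
 fix v assume v: "v \<in> S"
 note c = lim0_comp[OF S0 S0 _ _ v, symmetric] and mv = MS_mconst[OF S0 v]
 show "lim0 h (lim0 e v) = lim0 e (lim0 h v) + 2 \<cdot> lim0 e v"
  unfolding c[OF ke kh] c[OF kh ke] by (simp add: lim0_def he[OF mv])
 show "lim0 h (lim0 f v) = lim0 f (lim0 h v) - 2 \<cdot> lim0 f v"
  unfolding c[OF kf kh] c[OF kh kf] by (simp add: lim0_def hf[OF mv])
 have "(e (f (mconst v)) - f (e (mconst v))) 0 0 = h (mconst v) 0 0" by (simp only: ef[OF mv])
 then show "lim0 e (lim0 f v) - lim0 f (lim0 e v) = lim0 h v"
  unfolding c[OF ke kf] c[OF kf ke] by (simp add: lim0_def)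
qed (auto simp: S0 lim0_clin[OF S0] ke kf kh)

lemma nilpotent_deformed: "EX N. sl2_nil (MS S) e f h N"
proof -
 interpret l: sl2_module S "lim0 e" "lim0 f" "lim0 h" by (rule limit_module)
 obtain R where R: "!!s T v. cmod s > R ==> clin S S T ==> (!!v. v \<in> S ==> lim0 h (T v) = T (lim0 h v) + s \<cdot> T v) ==> v \<in> S ==> T v = 0"
  using large_weight_zero[OF fdS l.h] by metis
 obtain N :: nat where N: "real N > max R 0" using reals_Archimedean2 by blast
 have N2: "R < cmod (of_nat (2 * N))" "R < cmod (- of_nat (2 * N))" using N by (auto simp: norm_mult)
 show ?thesis
 proof (intro exI[of _ N] sl2_nil.intro sl2_nil_axioms.intro sl2_module_axioms)
  show "0 < N" using N by auto
  show "(e ^^ N) v = 0" if "v \<in> MS S" for v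
   by (rule kop_large_weight_zero[OF S0 kh kop_funpow[OF ke, of N] h_funpow(1)[where n = N] _ that])
    (assumption, erule R[OF N2(1)], assumption+)
  show "(f ^^ N) v = 0" if "v \<in> MS S" for v
   by (rule kop_large_weight_zero[OF S0 kh kop_funpow[OF kf, of N] h_funpow(2)[where n = N] _ that])
    (assumption, erule R[OF N2(2)], assumption+)
 qed
qed

end

lemma eigen_indep:
 assumes S: "cv.subspace S" and T: "clin S S T" and "finite F"
 shows "(!!n. n \<in> F ==> w n \<in> S & T (w n) = c n \<cdot> w n) ==> inj_on c F ==> (\<Sum>n\<in>F. w n) = 0 ==> n \<in> F ==> w n = 0"
 using assms(3)
proof (induction F arbitrary: w n rule: finite_induct)
 case (insert a F)
 have wF: "sum w F \<in> S" using insert.prems(1) by (intro cv.subspace_sum[OF S]) auto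
 have wa: "w a = - sum w F" using insert by (simp add: eq_neg_iff_add_eq_0)
 have "(\<Sum>n\<in>F. (c n - c a) \<cdot> w n) = T (sum w F) - c a \<cdot> sum w F"
  using insert.prems(1)
  by (subst clin_sum[OF T S]) (auto simp: cv.scale_left_diff_distrib sum_subtractf cv.scale_sum_right)
 also have "\<dots> = - T (w a) + c a \<cdot> w a" unfolding wa by (simp add: clin_minus[OF T wF])
 also have "\<dots> = 0" using insert.prems(1)[of a] by simp
 finally have 0: "(\<Sum>n\<in>F. (c n - c a) \<cdot> w n) = 0" .
 have z: "(c n - c a) \<cdot> w n = 0" if "n \<in> F" for n
 proof (rule insert.IH[OF _ _ 0 that])
  show "(c n - c a) \<cdot> w n \<in> S & T ((c n - c a) \<cdot> w n) = c n \<cdot> (c n - c a) \<cdot> w n" if "n \<in> F" for n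
   using insert.prems(1)[of n] that cv.subspace_scale[OF S] by (simp add: clin_csc[OF T] csc_csc mult.commute)
  show "inj_on c F" using insert.prems(2) by auto
 qed
 have wz: "w n = 0" if n: "n \<in> F" for n
 proof -
  have "c n ~= c a" using inj_onD[OF insert.prems(2), of n a] insert.hyps(2) n by blast
  then show ?thesis using z[OF n] by simp
 qed
 then have "w a = 0" using sum.neutral[of F w] wa by simp
 then show ?case using wz insert.prems(4) by auto
qed simp

text \<open>Maps are extended by zero, so that the linear maps form a subspace of a type of functions and the theory of triples
applies to them.\<close>

definition homK :: "'a::cvec set => 'b::cvec set => (('a dser) => 'b dser) set" where
 "homK S S' = {T. kop S S' T & (ALL f. f \<notin> MS S --> T f = 0)}"

lemma kop_cong: "cv.subspace S ==> kop S S' T ==> (!!f. f \<in> MS S ==> T f = T' f) ==> kop S S' T'"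
 by (simp add: kop_def clin_def MS_hsh MS_vsh cv.subspace_add[OF subspace_MS] cv.subspace_scale[OF subspace_MS])

lemma kop_add: "cv.subspace S' ==> kop S S' T ==> kop S S' T' ==> kop S S' (%f. T f + T' f)"
 by (simp add: kop_def clin_plus[OF subspace_MS] hsh_add vsh_add)

lemma kop_scale: "cv.subspace S' ==> kop S S' T ==> kop S S' (%f. a \<cdot> T f)"
 by (simp add: kop_def clin_scale[OF subspace_MS] hsh_csc vsh_csc)

lemma kop_zero: "cv.subspace S' ==> kop S S' (%f. 0)"
 by (simp add: kop_def clin_def cv.subspace_0[OF subspace_MS])

lemma homK_I: "cv.subspace S ==> kop S S' T ==> (%f. if f \<in> MS S then T f else 0) \<in> homK S S'"
 unfolding homK_def by (auto intro: kop_cong)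

lemma homK_kop: "T \<in> homK S S' ==> kop S S' T" and homK_out: "T \<in> homK S S' ==> f \<notin> MS S ==> T f = 0"
 by (auto simp: homK_def)

lemmas homK_in = kop_in[OF homK_kop]
lemmas homK_clin = kop_clin[OF homK_kop]

lemma homK_eqI: "T \<in> homK S S' ==> T' \<in> homK S S' ==> (!!f. f \<in> MS S ==> T f = T' f) ==> T = T'"
 by (rule ext) (metis homK_out)

lemma subspace_homK: "cv.subspace S ==> cv.subspace S' ==> cv.subspace (homK S S')"
proof (rule cv.subspaceI)
 assume S: "cv.subspace S" and S': "cv.subspace S'"
 show "0 \<in> homK S S'" using kop_zero[OF S'] by (simp add: homK_def zero_fun_def)
 show "T + T' \<in> homK S S'" if "T \<in> homK S S'" "T' \<in> homK S S'" for T T'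
 proof -
  have "T + T' = (%f. T f + T' f)" by (rule ext) simp
  then show ?thesis using that kop_add[OF S', of S T T'] by (auto simp: homK_def)
 qed
 show "a \<cdot> T \<in> homK S S'" if "T \<in> homK S S'" for a T
 proof -
  have "a \<cdot> T = (%f. a \<cdot> T f)" by (rule ext) simp
  then show ?thesis using that kop_scale[OF S', of S T a] by (auto simp: homK_def)
 qed
qed

definition hom_op :: "'a::cvec set => (('a dser) => 'a dser) => ((nat => nat => 'b::cvec) => 'b dser)
  => (('a dser) => 'b dser) => ('a dser) => 'b dser" where
 "hom_op S a b T = (%f. if f \<in> MS S then b (T f) - T (a f) else 0)"

context
 fixes S :: "'a::cvec set" and S' :: "'b::cvec set"
 assumes S: "cv.subspace S" and S': "cv.subspace S'"
begin

lemma left_clin: 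
 assumes b: "kop S' S' b"
 shows "clin (homK S S') (homK S S') (%T f. if f \<in> MS S then b (T f) else 0)"
proof (rule clinI)
 fix T T' c assume T: "T \<in> homK S S'" and T': "T' \<in> homK S S'"
 show "(%f. if f \<in> MS S then b (T f) else 0) \<in> homK S S'"
  by (rule homK_I[OF S kop_comp[OF homK_kop[OF T] b]])
 show "(%f. if f \<in> MS S then b ((T + T') f) else 0) = (%f. if f \<in> MS S then b (T f) else 0) + (%f. if f \<in> MS S then b (T' f) else 0)"
  by (rule ext) (auto simp: clin_add[OF kop_clin[OF b]] homK_in[OF T] homK_in[OF T'])
 show "(%f. if f \<in> MS S then b ((c \<cdot> T) f) else 0) = c \<cdot> (%f. if f \<in> MS S then b (T f) else 0)"
  by (rule ext) (auto simp: clin_csc[OF kop_clin[OF b]] homK_in[OF T])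
qed

lemma right_clin: 
 assumes a: "kop S S a"
 shows "clin (homK S S') (homK S S') (%T f. if f \<in> MS S then T (a f) else 0)"
proof (rule clinI)
 fix T T' c assume T: "T \<in> homK S S'" and T': "T' \<in> homK S S'"
 show "(%f. if f \<in> MS S then T (a f) else 0) \<in> homK S S'"
  by (rule homK_I[OF S kop_comp[OF a homK_kop[OF T]]])
qed (auto simp: fun_eq_iff)

lemma hom_op_clin:
 assumes a: "kop S S a" and b: "kop S' S' b"
 shows "clin (homK S S') (homK S S') (hom_op S a b)"
proof -
 have "hom_op S a b = (%T. (%f. if f \<in> MS S then b (T f) else 0) - (%f. if f \<in> MS S then T (a f) else 0))"
  by (auto simp: hom_op_def fun_eq_iff)
 then show ?thesis using clin_minus'[OF subspace_homK[OF S S'] left_clin[OF b] right_clin[OF a]] by simp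
qed

text \<open>\<open>T \<mapsto> bT - Ta\<close> is a difference of two commuting nilpotent operators.\<close>

lemma hom_op_nilpotent:
 assumes a: "kop S S a" and b: "kop S' S' b" and aN: "!!f. f \<in> MS S ==> (a ^^ N) f = 0" and bN: "!!f. f \<in> MS S' ==> (b ^^ N') f = 0"
  and T: "T \<in> homK S S'"
 shows "(hom_op S a b ^^ (N + N')) T = 0"
proof -
 let ?M = "homK S S'"
 define L where "L T = (%f. if f \<in> MS S then b (T f) else 0)" for T :: "('a dser) => 'b dser"
 define R where "R T = (%f. if f \<in> MS S then T (a f) else 0)" for T :: "('a dser) => 'b dser"
 have L: "clin ?M ?M L" and R: "clin ?M ?M R" unfolding L_def R_def using left_clin[OF b] right_clin[OF a] by auto
 note M = subspace_homK[OF S S']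
 have RC: "R (c \<cdot> T) = c \<cdot> R T" if "T \<in> ?M" for c T using clin_csc[OF R that] .
 have rR: "ract ?M (pact csc R)" by (rule ract_pact[OF M ract_csc[OF M] R RC])
 have LR: "L (R T) = R (L T)" for T by (auto simp: L_def R_def fun_eq_iff kop_in[OF a])
 have LC: "L (pact csc R p T) = pact csc R p (L T)" if "T \<in> ?M" for p T
  by (rule pact_commute[OF M ract_csc[OF M] R RC L _ _ that], assumption, erule clin_csc[OF L], rule LR)
 define A where "A = pact (pact csc R) L"
 have rA: "ract ?M A" unfolding A_def by (rule ract_pact[OF M rR L]) (rule LC)
 have AH: "A var_H T = L T" if "T \<in> ?M" for T unfolding A_def var_H_def by (rule pact_X[OF M rR L _ that]) (rule LC)
 have AC: "A var_C T = R T" if "T \<in> ?M" for T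
 proof -
  have "A var_C T = pact csc R [:0, 1:] T" unfolding A_def by (rule pact_const[OF M rR L _ that]) (rule LC)
  also have "\<dots> = R T" by (rule pact_X[OF M ract_csc[OF M] R RC that])
  finally show ?thesis .
 qed
 have op: "hom_op S a b T = A (var_H - var_C) T" if "T \<in> ?M" for T
  using that by (simp only: ract_diff[OF rA] AH AC) (auto simp: hom_op_def L_def R_def fun_eq_iff)
 have opn: "(hom_op S a b ^^ n) T = A ((var_H - var_C) ^ n) T" for n
 proof (induction n)
  case 0
  then show ?case using T by (simp add: ract_one[OF rA])
 next
  case (Suc n)
  have "(hom_op S a b ^^ Suc n) T = hom_op S a b (A ((var_H - var_C) ^ n) T)" by (simp add: Suc.IH)
  also have "\<dots> = A (var_H - var_C) (A ((var_H - var_C) ^ n) T)" by (rule op[OF ract_in[OF rA T]])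
  finally show ?case using T by (simp only: power_Suc ract_mult[OF rA])
 qed
 have Ln: "(L ^^ n) T = (%f. if f \<in> MS S then (b ^^ n) (T f) else 0)" for n
 proof (induction n)
  case 0
  show ?case using homK_out[OF T] by (intro ext) simp
 next
  case (Suc n)
  have "(L ^^ Suc n) T = L ((L ^^ n) T)" by simp
  then show ?case unfolding Suc.IH L_def by (intro ext) simp
 qed
 have Rn: "f \<in> MS S ==> (R ^^ n) T f = T ((a ^^ n) f)" for n f
 proof (induction n arbitrary: f)
  case (Suc n)
  have "(R ^^ Suc n) T f = R ((R ^^ n) T) f" by simp
  also have "\<dots> = (R ^^ n) T (a f)" using Suc.prems by (simp only: R_def if_True)
  also have "\<dots> = T ((a ^^ n) (a f))" by (rule Suc.IH[OF kop_in[OF a Suc.prems]])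
  finally show ?case by (simp only: funpow_Suc_right o_def)
 qed simp
 have H0: "A (var_H ^ N') T = 0"
 proof -
  have "(A var_H ^^ n) T = (L ^^ n) T" for n
   by (induction n) (auto simp: AH clin_in[OF clin_funpow[OF L] T])
  then show ?thesis using bN homK_in[OF T] by (simp only: ract_funpow[OF rA T]) (auto simp: Ln fun_eq_iff)
 qed
 have C0: "A (var_C ^ N) T = 0"
 proof -
  have "(A var_C ^^ n) T = (R ^^ n) T" for n
   by (induction n) (simp_all only: funpow.simps o_def id_def AC clin_in[OF clin_funpow[OF R] T])
  moreover have "(R ^^ N) T f = 0" for f
  proof (cases "f \<in> MS S")
   case True
   then show ?thesis using aN clin_0[OF homK_clin[OF T] subspace_MS[OF S]] by (simp add: Rn)
  next
   case False
   then show ?thesis using homK_out[OF clin_in[OF clin_funpow[OF R] T]] by simp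
  qed
  ultimately show ?thesis by (simp only: ract_funpow[OF rA T]) (simp add: fun_eq_iff)
 qed
 have z: "A (p * q) T = 0" if "A q T = 0" for p q
  using that T by (simp only: ract_mult[OF rA] clin_0[OF ract_clin[OF rA] M])
 have "A ((var_H - var_C) ^ (N + N')) T = A (\<Sum>k\<le>N + N'. of_nat (N + N' choose k) * var_H ^ k * (- var_C) ^ (N + N' - k)) T"
  by (simp only: diff_conv_add_uminus binomial_ring)
 also have "\<dots> = (\<Sum>k\<le>N + N'. A (of_nat (N + N' choose k) * var_H ^ k * (- var_C) ^ (N + N' - k)) T)"
  by (rule ract_sum[OF rA T])
 also have "\<dots> = 0"
 proof (rule sum.neutral, rule ballI)
  fix k assume "k \<in> {..N + N'}"
  let ?b = "of_nat (N + N' choose k) :: complex poly poly" and ?j = "N + N' - k"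
  show "A (?b * var_H ^ k * (- var_C) ^ ?j) T = 0"
  proof (cases "N' \<le> k")
   case True
   have "?b * var_H ^ k * (- var_C) ^ ?j = (?b * (- var_C) ^ ?j * var_H ^ (k - N')) * var_H ^ N'"
    using True by (simp only: mult.assoc power_add[symmetric]) (simp only: mult_ac le_add_diff_inverse2)
   then show ?thesis using z[OF H0] by metis
  next
   case False
   have "(- var_C) ^ ?j = (- var_C) ^ (?j - N) * (- var_C) ^ N"
    using False by (simp only: power_add[symmetric]) (simp add: add.commute)
   also have "(- var_C) ^ N = (-1) ^ N * var_C ^ N" by (rule power_minus)
   finally have "?b * var_H ^ k * (- var_C) ^ ?j = (?b * var_H ^ k * (- var_C) ^ (?j - N) * (-1) ^ N) * var_C ^ N"
    by (simp only: mult.assoc)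
   then show ?thesis using z[OF C0] by metis
  qed
 qed
 finally show ?thesis unfolding opn .
qed

end

lemma hom_op_apply: "f \<in> MS S ==> hom_op S a b T f = b (T f) - T (a f)"
 by (simp add: hom_op_def)

lemma hom_module:
 assumes "sl2_deformed S e f h" "sl2_deformed S' e' f' h'"
 shows "sl2_module (homK S S') (hom_op S e e') (hom_op S f f') (hom_op S h h')"
proof -
 interpret d: sl2_deformed S e f h by fact
 interpret d': sl2_deformed S' e' f' h' by fact
 note [simp] = kop_in[OF d.ke] kop_in[OF d.kf] kop_in[OF d.kh] hom_op_apply homK_in
 note SS = d.S0 d'.S0
 note E = hom_op_clin[OF SS d.ke d'.ke] and F = hom_op_clin[OF SS d.kf d'.kf] and H = hom_op_clin[OF SS d.kh d'.kh]
 note sub = subspace_homK[OF SS]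
 show ?thesis
 proof
  fix T assume T: "T \<in> homK S S'"
  note i = clin_in[OF E] clin_in[OF F] clin_in[OF H] T homK_in[OF T] cv.subspace_add[OF sub] cv.subspace_diff[OF sub] cv.subspace_scale[OF sub]
  note c = homK_clin[OF T]
  note l = clin_add[OF c] clin_diff[OF c d.S] clin_csc[OF c] 
  show "hom_op S h h' (hom_op S e e' T) = hom_op S e e' (hom_op S h h' T) + 2 \<cdot> hom_op S e e' T"
   by (rule homK_eqI[of _ S S']) (simp_all add: i l d.he d'.he d'.L_simps cv.scale_right_diff_distrib algebra_simps)
  show "hom_op S h h' (hom_op S f f' T) = hom_op S f f' (hom_op S h h' T) - 2 \<cdot> hom_op S f f' T"
   by (rule homK_eqI[of _ S S']) (simp_all add: i l d.hf d'.hf d'.L_simps cv.scale_right_diff_distrib algebra_simps)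
  have "hom_op S e e' (hom_op S f f' T) x - hom_op S f f' (hom_op S e e' T) x = hom_op S h h' T x" if x: "x \<in> MS S" for x
  proof -
   have "T (e (f x)) - T (f (e x)) = T (h x)" using x by (simp add: d.ef[symmetric] l)
   moreover have "e' (f' (T x)) - f' (e' (T x)) = h' (T x)" using x T by (simp add: d'.ef)
   ultimately show ?thesis using x T by (simp add: i d'.L_simps algebra_simps)
  qed
  then show "hom_op S e e' (hom_op S f f' T) - hom_op S f f' (hom_op S e e' T) = hom_op S h h' T"
   by (intro homK_eqI[of _ S S']) (simp_all add: i)
 qed (use sub E F H in auto)
qed

text \<open>The maps between two modules form an \<open>sl\<^sub>2\<close>-module again, and e, f
are nilpotent on it. Its projector onto the joint eigenvalue (0,1) of (H,C), the
invariants, is applied to the constant extension of \<open>\<theta>\<close>. The result is an intertwiner, and its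
limit is still \<open>\<theta>\<close> because \<open>\<theta>\<close> is invariant modulo (h,h').\<close>

lemma rigidity:
 assumes "sl2_deformed S e f h" "sl2_deformed S' e' f' h'" and \<theta>: "clin S S' \<theta>"
  and \<theta>e: "!!v. v \<in> S ==> \<theta> (lim0 e v) = lim0 e' (\<theta> v)" and \<theta>f: "!!v. v \<in> S ==> \<theta> (lim0 f v) = lim0 f' (\<theta> v)"
  and \<theta>h: "!!v. v \<in> S ==> \<theta> (lim0 h v) = lim0 h' (\<theta> v)"
 shows "\<exists>\<phi>. kop S S' \<phi> & (\<forall>x\<in>MS S. \<phi> (e x) = e' (\<phi> x) & \<phi> (f x) = f' (\<phi> x) & \<phi> (h x) = h' (\<phi> x)) & (\<forall>v\<in>S. lim0 \<phi> v = \<theta> v)"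
proof -
 interpret d: sl2_deformed S e f h by fact
 interpret d': sl2_deformed S' e' f' h' by fact
 note SS = d.S0 d'.S0
 obtain N where N: "sl2_nil (MS S) e f h N" using d.nilpotent_deformed by blast
 obtain N' where N': "sl2_nil (MS S') e' f' h' N'" using d'.nilpotent_deformed by blast
 interpret n: sl2_nil "MS S" e f h N by fact
 interpret n': sl2_nil "MS S'" e' f' h' N' by fact
 let ?E = "hom_op S e e'" and ?F = "hom_op S f f'" and ?H = "hom_op S h h'"
 interpret M: sl2_module "homK S S'" ?E ?F ?H by (rule hom_module[OF assms(1,2)])
 interpret M: sl2_nil "homK S S'" ?E ?F ?H "N + N'"
 proof
  show "(?E ^^ (N + N')) T = 0" if "T \<in> homK S S'" for T
   by (rule hom_op_nilpotent[OF SS d.ke d'.ke n.eN n'.eN that])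
  show "(?F ^^ (N + N')) T = 0" if "T \<in> homK S S'" for T
   by (rule hom_op_nilpotent[OF SS d.kf d'.kf n.fN n'.fN that])
  show "0 < N + N'" using n.N0 by simp
 qed
 have kT: "kop S S' (%f k l. \<theta> (f k l))"
  unfolding kop_def clin_def using clin_0[OF \<theta> SS(1)]
  by (auto simp: MS_def fun_eq_iff hsh_def vsh_def clin_add[OF \<theta>] clin_csc[OF \<theta>] clin_in[OF \<theta>] split: nat.splits)
 define T0 where "T0 = (%f. if f \<in> MS S then (%k l. \<theta> (f k l)) else 0)"
 have T0: "T0 \<in> homK S S'" unfolding T0_def by (rule homK_I[OF SS(1) kT])
 define U where "U = {T \<in> homK S S'. ALL f. T f 0 0 = 0}"
 have U: "cv.subspace U" unfolding U_def
  by (rule cv.subspaceI) (auto simp: cv.subspace_0[OF M.S])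
 have op0: "hom_op S a b T f 0 0 = lim0 b (T f 0 0) - T (a f) 0 0"
  if "f \<in> MS S" "kop S S a" "kop S' S' b" "T \<in> homK S S'" for a b T f
  using that kop_00[OF SS(2) that(3) homK_in[OF that(4,1)]] by (simp add: hom_op_apply)
 have Uop: "hom_op S a b T \<in> U" if "T \<in> U" "kop S S a" "kop S' S' b" for a b T
 proof -
  have T: "T \<in> homK S S'" "!!f. T f 0 0 = 0" using that(1) by (auto simp: U_def)
  have "hom_op S a b T f 0 0 = 0" for f
  proof (cases "f \<in> MS S")
   case True
   then show ?thesis using op0[OF True that(2,3) T(1)] T(2) clin_0[OF lim0_clin[OF SS(2) that(3)] SS(2)] by simp
  qed (simp add: hom_op_def)
  then show ?thesis using clin_in[OF hom_op_clin[OF SS that(2,3)] T(1)] by (simp add: U_def)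
 qed
 have UT: "hom_op S a b T0 \<in> U"
  if a: "kop S S a" and b: "kop S' S' b" and ab: "!!v. v \<in> S ==> \<theta> (lim0 a v) = lim0 b (\<theta> v)" for a b
 proof -
  have "hom_op S a b T0 f 0 0 = 0" for f
  proof (cases "f \<in> MS S")
   case True
   then show ?thesis using op0[OF True a b T0] ab[OF MS_D[OF True]] kop_00[OF SS(1) a True] kop_in[OF a True] by (simp add: T0_def)
  qed (simp add: hom_op_def)
  then show ?thesis using clin_in[OF hom_op_clin[OF SS a b] T0] by (simp add: U_def)
 qed
 note UE = UT[OF d.ke d'.ke \<theta>e] and UF = UT[OF d.kf d'.kf \<theta>f] and UH = UT[OF d.kh d'.kh \<theta>h]
 note Ucl = cv.subspace_add[OF U] cv.subspace_diff[OF U] cv.subspace_scale[OF U]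
 have Ucas: "M.cas T - T \<in> U" if "?F T \<in> U" "?H T \<in> U" for T
 proof -
  have "M.cas T - T = 4 \<cdot> ?E (?F T) + ?H (?H T) - 2 \<cdot> ?H T" by (simp add: M.cas_def)
  then show ?thesis using that Uop d.ke d'.ke d.kh d'.kh Ucl by simp
 qed
 define \<phi> where "\<phi> = M.act (M.proj (0, 0)) T0"
 have p0: "(0, 0) \<in> M.pts" using M.N0 by (auto simp: M.pts_def)
 have pt0: "ptH (0,0) = 0" "ptC (0,0) = 1" by (auto simp: ptH_def ptC_def)
 have "\<phi> - evalHC 0 1 (M.proj (0, 0)) \<cdot> T0 \<in> U" unfolding \<phi>_def
 proof (rule M.act_eigen_mod[OF U])
  show "U \<subseteq> homK S S'" by (auto simp: U_def)
  show "?H u \<in> U" if "u \<in> U" for u by (rule Uop[OF that d.kh d'.kh])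
  show "M.cas u \<in> U" if "u \<in> U" for u
  proof -
   have "M.cas u - u \<in> U" by (rule Ucas) (rule Uop[OF that d.kf d'.kf], rule Uop[OF that d.kh d'.kh])
   from Ucl(1)[OF this that] show ?thesis by simp
  qed
  show "?H T0 - 0 \<cdot> T0 \<in> U" using UH by simp
  show "M.cas T0 - 1 \<cdot> T0 \<in> U" using Ucas[OF UF UH] by simp
 qed (rule T0)
 then have \<phi>T: "\<phi> - T0 \<in> U" using M.eval_proj[OF p0 p0] by (simp add: pt0)
 have \<phi>: "\<phi> \<in> homK S S'" unfolding \<phi>_def by (rule M.act_in[OF T0])
 have "?H \<phi> = 0" "M.cas \<phi> = \<phi>" using M.proj_eigen[OF p0 T0] by (simp_all add: \<phi>_def pt0)
 then have inv: "?E \<phi> = 0" "?F \<phi> = 0" "?H \<phi> = 0" using M.invariant[OF \<phi>] by auto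
 have op: "\<phi> (a x) = b (\<phi> x)" if "hom_op S a b \<phi> = 0" "x \<in> MS S" for a b x
  using fun_cong[OF that(1), of x] that(2) by (simp add: hom_op_apply)
 have "lim0 \<phi> v = \<theta> v" if v: "v \<in> S" for v
 proof -
  have "(\<phi> - T0) (mconst v) 0 0 = 0" using \<phi>T by (simp add: U_def)
  then show ?thesis using MS_mconst[OF SS(1) v] by (simp add: lim0_def T0_def)
 qed
 then show ?thesis using homK_kop[OF \<phi>] op[OF inv(1)] op[OF inv(2)] op[OF inv(3)] by blast
qed

context sl2_module
begin

lemma evalA: "evalHC (of_nat m) (of_nat (Suc m) * of_nat (Suc m)) (rtA i) = 4 * (of_nat i + 1) * (of_nat m - of_nat i)"
 unfolding rtA_def by (simp only: evalHC_simps) (simp add: algebra_simps)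

lemma evalB: "evalHC (ptH (j, k)) (ptC (j, k)) (rtB i) = 4 * (of_nat k - of_nat i) * (of_nat j + of_nat i + 1)"
 unfolding rtB_def ptH_def ptC_def by (simp only: evalHC_simps) (simp add: algebra_simps)

lemma e_funpow_in [simp]: "v \<in> S ==> (e ^^ n) v \<in> S" and f_funpow_in [simp]: "v \<in> S ==> (f ^^ n) v \<in> S"
 using clin_in[OF clin_funpow[OF e]] clin_in[OF clin_funpow[OF f]] by auto

lemma eigen_e_funpow:
 assumes v: "v \<in> S" "h v = x \<cdot> v" "cas v = y \<cdot> v"
 shows "h ((e ^^ n) v) = (x + of_nat (2 * n)) \<cdot> (e ^^ n) v" "cas ((e ^^ n) v) = y \<cdot> (e ^^ n) v"
proof -
 show "h ((e ^^ n) v) = (x + of_nat (2 * n)) \<cdot> (e ^^ n) v"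
  unfolding h_funpow(1)[OF v(1)] v(2) clin_csc[OF clin_funpow[OF e] v(1)] csc_add_left ..
 show "cas ((e ^^ n) v) = y \<cdot> (e ^^ n) v"
  by (induction n) (simp_all add: v e_cas[symmetric] clin_csc[OF e])
qed

lemma eigen_f_funpow:
 assumes v: "v \<in> S" "h v = x \<cdot> v" "cas v = y \<cdot> v"
 shows "h ((f ^^ n) v) = (x - of_nat (2 * n)) \<cdot> (f ^^ n) v" "cas ((f ^^ n) v) = y \<cdot> (f ^^ n) v"
proof -
 show "h ((f ^^ n) v) = (x - of_nat (2 * n)) \<cdot> (f ^^ n) v"
  unfolding h_funpow(2)[OF v(1)] v(2) clin_csc[OF clin_funpow[OF f] v(1)] diff_conv_add_uminus csc_add_left ..
 show "cas ((f ^^ n) v) = y \<cdot> (f ^^ n) v"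
  by (induction n) (simp_all add: v f_cas[symmetric] clin_csc[OF f])
qed

lemma cas_hw:
 assumes "v \<in> S" "e v = 0" "h v = of_nat m \<cdot> v"
 shows "cas v = (of_nat (Suc m) * of_nat (Suc m)) \<cdot> v"
 using assms by (simp add: cas_alt clin_0[OF f S] L_simps csc_csc csc_add_left csc_2 algebra_simps)

lemma e_string:
 assumes v: "v \<in> S" "e v = 0" "h v = of_nat m \<cdot> v"
 shows "e ((f ^^ Suc j) v) = (of_nat (Suc j) * (of_nat m - of_nat j)) \<cdot> (f ^^ j) v"
proof (induction j)
 case 0
 then show ?case using ef[OF v(1)] v clin_0[OF f S] by simp
next
 case (Suc j)
 let ?w = "(f ^^ Suc j) v"
 have "e (f ?w) = f (e ?w) + h ?w" using ef[of ?w] v(1) by (simp add: algebra_simps)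
 also have "f (e ?w) = (of_nat (Suc j) * (of_nat m - of_nat j)) \<cdot> ?w"
  unfolding Suc.IH using v(1) by (simp add: clin_csc[OF f])
 also have "h ?w = (of_nat m - of_nat (2 * Suc j)) \<cdot> ?w"
  by (rule eigen_f_funpow(1)[OF v(1,3) cas_hw[OF v]])
 finally have "e (f ?w) = (of_nat (Suc j) * (of_nat m - of_nat j) + (of_nat m - of_nat (2 * Suc j))) \<cdot> ?w"
  by (simp only: csc_add_left)
 also have "(of_nat (Suc j) * (of_nat m - of_nat j) + (of_nat m - of_nat (2 * Suc j)) :: complex) = of_nat (Suc (Suc j)) * (of_nat m - of_nat (Suc j))"
  by (simp add: algebra_simps)
 finally show ?case by simp
qed

lemma ef_hw:
 assumes v: "v \<in> S" "e v = 0" "h v = of_nat m \<cdot> v" and "j \<le> m"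
 shows "EX k. k ~= 0 & (\<forall>w\<in>S. e w = 0 --> h w = of_nat m \<cdot> w --> (e ^^ j) ((f ^^ j) w) = k \<cdot> w)"
proof -
 define k where "k = (\<Prod>i<j. 4 * (of_nat i + 1) * (of_nat m - of_nat i) :: complex) / 4 ^ j"
 have nz: "(of_nat i + 1 :: complex) ~= 0" for i by (metis of_nat_Suc of_nat_eq_0_iff add.commute nat.distinct(1))
 have "4 * (of_nat i + 1) * (of_nat m - of_nat i) ~= (0::complex)" if "i < j" for i
  using nz[of i] that assms(4) unfolding mult_eq_0_iff by auto
 then have "(\<Prod>i<j. 4 * (of_nat i + 1) * (of_nat m - of_nat i) :: complex) ~= 0"
  unfolding prod_zero_iff[OF finite_lessThan] by blast
 then have "k ~= 0" unfolding k_def by simp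
 moreover have "(e ^^ j) ((f ^^ j) w) = k \<cdot> w" if w: "w \<in> S" "e w = 0" "h w = of_nat m \<cdot> w" for w
 proof -
  have "4 ^ j \<cdot> (e ^^ j) ((f ^^ j) w) = (\<Prod>i<j. 4 * (of_nat i + 1) * (of_nat m - of_nat i)) \<cdot> w"
   using act_eigen[OF w(1,3) cas_hw[OF w], of "\<Prod>i<j. rtA i"] unfolding ef_funpow[OF w(1)] evalHC_simps evalA .
  then have "(1 / 4 ^ j) \<cdot> 4 ^ j \<cdot> (e ^^ j) ((f ^^ j) w) = (1 / 4 ^ j) \<cdot> (\<Prod>i<j. 4 * (of_nat i + 1) * (of_nat m - of_nat i)) \<cdot> w"
   by simp
  then show ?thesis by (simp add: csc_csc k_def)
 qed
 ultimately show ?thesis by blast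
qed

end

context sl2_nil
begin

lemma f_top:
 assumes v: "v \<in> S" "e v = 0" "h v = of_nat m \<cdot> v"
 shows "(f ^^ Suc m) v = 0"
proof (rule eigen_zero[OF _ eigen_f_funpow[OF v(1,3) cas_hw[OF v]]])
 fix p show "(ptH p, ptC p) ~= (of_nat m - of_nat (2 * Suc m), of_nat (Suc m) * of_nat (Suc m))"
 proof
  assume "(ptH p, ptC p) = (of_nat m - of_nat (2 * Suc m), of_nat (Suc m) * of_nat (Suc m))"
  then have "ptH p = of_int (int m - int (2 * Suc m))" "ptC p = of_nat (Suc m) * of_nat (Suc m)" by auto
  from pt_cases[OF this] show False by auto
 qed
qed (use v in simp)

lemma descent:
 assumes v: "v \<in> S" "h v = ptH (j, k) \<cdot> v" "cas v = ptC (j, k) \<cdot> v"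
 shows "\<exists>w\<in>S. e w = 0 & h w = of_nat (j + k) \<cdot> w & v = (f ^^ k) w"
proof -
 define w where "w = (e ^^ k) v"
 have w: "w \<in> S" "h w = of_nat (j + k) \<cdot> w" "cas w = ptC (j, k) \<cdot> w"
  using eigen_e_funpow[OF v, of k] v(1) by (simp_all add: w_def ptH_def)
 have "e w = 0"
 proof (rule eigen_zero)
  show "e w \<in> S" using w by simp
  show "h (e w) = (of_nat (j + k) + of_nat (2 * 1)) \<cdot> e w" "cas (e w) = ptC (j, k) \<cdot> e w"
   using eigen_e_funpow[OF w, of 1] by simp_all
  fix p show "(ptH p, ptC p) ~= (of_nat (j + k) + of_nat (2 * 1), ptC (j, k))"
  proof
   assume "(ptH p, ptC p) = (of_nat (j + k) + of_nat (2 * 1), ptC (j, k))"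
   then have "ptH p = of_int (int (j + k) + 2)" "ptC p = of_nat (Suc (j + k)) * of_nat (Suc (j + k))"
    by (auto simp: ptC_def)
   from pt_cases[OF this] show False by auto
  qed
 qed
 define c where "c = (\<Prod>i<k. 4 * (of_nat k - of_nat i) * (of_nat j + of_nat i + 1) :: complex)"
 have nz: "(of_nat j + of_nat i + 1 :: complex) ~= 0" for i by (metis of_nat_Suc of_nat_add of_nat_eq_0_iff add.commute nat.distinct(1))
 have "4 * (of_nat k - of_nat i) * (of_nat j + of_nat i + 1) ~= (0::complex)" if "i < k" for i
  using nz[of i] that unfolding mult_eq_0_iff by auto
 then have c: "c ~= 0" unfolding c_def prod_zero_iff[OF finite_lessThan] by blast
 have "4 ^ k \<cdot> (f ^^ k) w = c \<cdot> v"
  using act_eigen[OF v, of "\<Prod>i<k. rtB i"] unfolding fe_funpow[OF v(1)] evalHC_simps evalB c_def w_def .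
 then have "(1 / c) \<cdot> 4 ^ k \<cdot> (f ^^ k) w = (1 / c) \<cdot> c \<cdot> v" by simp
 then have "v = (f ^^ k) ((4 ^ k / c) \<cdot> w)" using c w(1) by (simp add: csc_csc clin_csc[OF clin_funpow[OF f]])
 moreover have "(4 ^ k / c) \<cdot> w \<in> S" "e ((4 ^ k / c) \<cdot> w) = 0" "h ((4 ^ k / c) \<cdot> w) = of_nat (j + k) \<cdot> (4 ^ k / c) \<cdot> w"
  using w \<open>e w = 0\<close> by (simp_all add: L_simps csc_csc mult.commute)
 ultimately show ?thesis by blast
qed

end

text \<open>Joint eigenvectors of H and C span, and each of them is \<open>f\<^sup>k w\<close> for a
highest weight vector w; bases of the spaces of highest weight vectors then generate all strings.
Independence is checked by applying \<open>e\<^sup>j\<close> within one joint eigenspace.\<close>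

lemma (in sl2_module) frame:
 assumes fd: "fd S"
 obtains L :: "(nat \<times> 'm) list" where
  "!!p. p \<in> set L ==> snd p \<in> S & e (snd p) = 0 & h (snd p) = of_nat (fst p) \<cdot> snd p & (f ^^ Suc (fst p)) (snd p) = 0"
  "!!u. u \<in> S ==> EX c. u = (\<Sum>i<length L. \<Sum>j\<le>fst (L ! i). c i j \<cdot> (f ^^ j) (snd (L ! i)))"
  "!!c i j. (\<Sum>i<length L. \<Sum>j\<le>fst (L ! i). c i j \<cdot> (f ^^ j) (snd (L ! i))) = 0 ==> i < length L ==> j \<le> fst (L ! i) ==> c i j = 0"
proof -
 obtain N where "sl2_nil S e f h N" using nilpotent_fd[OF fd] by blast
 then interpret n: sl2_nil S e f h N .
 define HW where "HW m = {u\<in>S. e u = 0 & h u = of_nat m \<cdot> u}" for m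
 have "EX B. B \<subseteq> HW m & cv.independent B & HW m \<subseteq> cv.span B" for m
  using cv.basis_exists[of "HW m"] by metis
 then obtain B where B: "!!m. B m \<subseteq> HW m" "!!m. cv.independent (B m)" "!!m. HW m \<subseteq> cv.span (B m)" by metis
 have BS: "b \<in> S" "e b = 0" "h b = of_nat m \<cdot> b" if "b \<in> B m" for b m using B(1) that by (auto simp: HW_def)
 have fin: "finite (B m)" for m
  using cv.independent_span_bound[OF _ B(2)] fd BS(1) unfolding fd_def by blast
 define P where "P = (SIGMA m:{..<2*N}. B m)"
 have finP: "finite P" unfolding P_def using fin by auto
 obtain L where L: "set L = P" "distinct L" using finite_distinct_list[OF finP] by blast
 have bij: "bij_betw ((!) L) {..<length L} P" using bij_betw_nth[OF L(2) refl L(1)[symmetric]] .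
 have conv: "(\<Sum>i<length L. G (L ! i)) = (\<Sum>p\<in>P. G p)" for G :: "nat \<times> 'm => 'm"
  by (rule sum.reindex_bij_betw[OF bij])
 define \<sigma> where "\<sigma> c = (\<Sum>p\<in>P. \<Sum>j\<le>fst p. c p j \<cdot> (f ^^ j) (snd p))" for c
 have Sp: "cv.subspace (range \<sigma>)"
 proof (rule cv.subspaceI)
  have "\<sigma> (%_ _. 0) = 0" by (simp add: \<sigma>_def)
  then show "0 \<in> range \<sigma>" by (metis rangeI)
 next
  fix x y assume "x \<in> range \<sigma>" "y \<in> range \<sigma>"
  then obtain c d where "x = \<sigma> c" "y = \<sigma> d" by auto
  then have "x + y = \<sigma> (%p j. c p j + d p j)" by (simp add: \<sigma>_def csc_add_left sum.distrib)
  then show "x + y \<in> range \<sigma>" by blast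
 next
  fix a x assume "x \<in> range \<sigma>"
  then obtain c where "x = \<sigma> c" by auto
  then have "a \<cdot> x = \<sigma> (%p j. a * c p j)" by (simp add: \<sigma>_def cv.scale_sum_right)
  then show "a \<cdot> x \<in> range \<sigma>" by blast
 qed
 have gen: "(f ^^ j0) (snd q) \<in> range \<sigma>" if "q \<in> P" "j0 \<le> fst q" for q j0
 proof -
  have "(\<Sum>j\<le>fst p. (if p = q then if j = j0 then 1 else 0 else 0) \<cdot> (f ^^ j) (snd p)) = (if p = q then (f ^^ j0) (snd q) else 0)" for p
  proof (cases "p = q")
   case True
   have "(\<Sum>j\<le>fst q. (if j = j0 then 1 else 0) \<cdot> (f ^^ j) (snd q)) = (\<Sum>j\<in>{j0}. (if j = j0 then 1 else 0) \<cdot> (f ^^ j) (snd q))"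
    using that by (intro sum.mono_neutral_right) auto
   then show ?thesis using True by simp
  qed simp
  then have "\<sigma> (%p j. if p = q then if j = j0 then 1 else 0 else 0) = (f ^^ j0) (snd q)"
   using that finP by (simp add: \<sigma>_def)
  then show ?thesis by (metis rangeI)
 qed
 show thesis
 proof (rule that[of L])
  show "snd p \<in> S & e (snd p) = 0 & h (snd p) = of_nat (fst p) \<cdot> snd p & (f ^^ Suc (fst p)) (snd p) = 0" if "p \<in> set L" for p
  proof -
   have b: "snd p \<in> B (fst p)" using that L(1) by (auto simp: P_def)
   show ?thesis using BS[OF b] n.f_top[OF BS[OF b]] by blast
  qed
 next
  fix u assume u: "u \<in> S"
  have "act (n.proj p) u \<in> range \<sigma>" if p: "p \<in> n.pts" for p
  proof -
   obtain j k where jk: "p = (j, k)" by (cases p)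
   obtain w where w: "w \<in> S" "e w = 0" "h w = of_nat (j + k) \<cdot> w" "act (n.proj p) u = (f ^^ k) w"
    using n.descent[OF act_in[OF u] n.proj_eigen[OF p u, unfolded jk]] unfolding jk by blast
   have "w \<in> HW (j + k)" unfolding HW_def using w by blast
   then have "w \<in> cv.span (B (j + k))" using B(3) by blast
   then obtain a where a: "w = (\<Sum>b\<in>B (j + k). a b \<cdot> b)" using cv.span_finite[OF fin] by auto
   have "(f ^^ k) w = (\<Sum>b\<in>B (j + k). a b \<cdot> (f ^^ k) b)" unfolding a
    using BS(1) by (subst clin_sum[OF clin_funpow[OF f] S]) (auto simp: clin_csc[OF clin_funpow[OF f]])
   moreover have "(f ^^ k) b \<in> range \<sigma>" if "b \<in> B (j + k)" for b
    using gen[of "(j + k, b)" k] that p jk by (auto simp: P_def n.pts_def)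
   ultimately show ?thesis unfolding w(4) using cv.subspace_scale[OF Sp] by (auto intro!: cv.subspace_sum[OF Sp])
  qed
  then have "u \<in> range \<sigma>" using n.decomp[OF u] cv.subspace_sum[OF Sp, of n.pts "%p. act (n.proj p) u"] by simp
  then obtain c where "u = \<sigma> c" by blast
  then show "EX c. u = (\<Sum>i<length L. \<Sum>j\<le>fst (L ! i). c i j \<cdot> (f ^^ j) (snd (L ! i)))"
   unfolding \<sigma>_def conv[symmetric] by (intro exI[of _ "%i. c (L ! i)"])
 next
  fix c i j assume 0: "(\<Sum>i<length L. \<Sum>j\<le>fst (L ! i). c i j \<cdot> (f ^^ j) (snd (L ! i))) = 0" and ij: "i < length L" "j \<le> fst (L ! i)"
  define d where "d p = c (the_inv_into {..<length L} ((!) L) p)" for p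
  have d: "d (L ! i) = c i" if "i < length L" for i
   unfolding d_def using bij that by (simp add: bij_betw_def the_inv_into_f_f)
  have "(\<Sum>i<length L. \<Sum>j\<le>fst (L ! i). c i j \<cdot> (f ^^ j) (snd (L ! i))) = \<sigma> d"
   unfolding \<sigma>_def conv[symmetric] by (intro sum.cong refl) (simp add: d)
  then have s0: "\<sigma> d = 0" using 0 by simp
  define y where "y q = (\<Sum>b\<in>B (fst q). d (fst q, b) (snd q) \<cdot> (f ^^ snd q) b)" for q
  let ?Q = "SIGMA m:{..<2*N}. {..m}"
  have "\<sigma> d = (\<Sum>m<2*N. \<Sum>b\<in>B m. \<Sum>j\<le>m. d (m, b) j \<cdot> (f ^^ j) b)"
   unfolding \<sigma>_def P_def using fin by (subst sum.Sigma) (auto simp: case_prod_beta)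
  also have "\<dots> = (\<Sum>m<2*N. \<Sum>j\<le>m. y (m, j))"
   unfolding y_def by (intro sum.cong refl) (subst sum.swap, simp)
  also have "\<dots> = (\<Sum>q\<in>?Q. y q)" by (subst sum.Sigma) (auto simp: case_prod_beta)
  finally have y0: "(\<Sum>q\<in>?Q. y q) = 0" using s0 by simp
  define Zop where "Zop v = h v + \<i> \<cdot> cas v" for v
  have Z: "clin S S Zop" unfolding Zop_def by (intro clin_plus clin_scale S h cas_clin)
  have yS: "y q \<in> S" for q unfolding y_def using BS by (intro cv.subspace_sum[OF S]) auto
  have yeig: "y q \<in> S & Zop (y q) = ptZ (fst q - snd q, snd q) \<cdot> y q" if qQ: "q \<in> ?Q" for q
  proof -
   obtain m j where q: "q = (m, j)" "j \<le> m" using qQ by auto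
   have "Zop ((f ^^ j) b) = ptZ (m - j, j) \<cdot> (f ^^ j) b" if b: "b \<in> B m" for b
   proof -
    have x: "ptH (m - j, j) = of_nat m - of_nat (2 * j)" "ptC (m - j, j) = of_nat (Suc m) * of_nat (Suc m)"
     using q(2) by (simp_all add: ptH_def ptC_def of_nat_diff)
    show ?thesis unfolding Zop_def ptZ_def x csc_add_left csc_csc[symmetric]
     eigen_f_funpow[OF BS(1,3)[OF b] cas_hw[OF BS[OF b]]] ..
   qed
   then have "Zop (y q) = ptZ (m - j, j) \<cdot> y q" unfolding y_def q using BS(1)
    by (subst clin_sum[OF Z S]) (auto simp: clin_csc[OF Z] cv.scale_sum_right csc_csc mult.commute intro!: sum.cong)
   then show ?thesis using yS q by simp
  qed
  have inj: "inj_on (%q. ptZ (fst q - snd q, snd q)) ?Q"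
   by (rule inj_onI) (auto simp: inj_eq[OF ptZ_inj])
  have yz: "y q = 0" if "q \<in> ?Q" for q
   by (rule eigen_indep[OF S Z _ yeig inj y0 that]) auto
  have LiP: "L ! i \<in> P" using bij ij by (auto simp: bij_betw_def)
  then obtain m b where mb: "L ! i = (m, b)" "m < 2 * N" "b \<in> B m" by (auto simp: P_def)
  then have "y (m, j) = 0" using ij by (intro yz) auto
  obtain k where k: "k ~= 0" "!!w. w \<in> S ==> e w = 0 ==> h w = of_nat m \<cdot> w ==> (e ^^ j) ((f ^^ j) w) = k \<cdot> w"
   using ef_hw[OF BS[OF mb(3)], of j] ij mb(1) by auto
  have "(e ^^ j) (y (m, j)) = (\<Sum>b\<in>B m. d (m, b) j \<cdot> (e ^^ j) ((f ^^ j) b))" unfolding y_def fst_conv snd_conv using BS(1)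
   by (subst clin_sum[OF clin_funpow[OF e] S]) (auto simp: clin_csc[OF clin_funpow[OF e]])
  also have "\<dots> = k \<cdot> (\<Sum>b\<in>B m. d (m, b) j \<cdot> b)"
   unfolding cv.scale_sum_right using BS k(2) by (intro sum.cong refl) (simp add: csc_csc mult.commute)
  finally have "(\<Sum>b\<in>B m. d (m, b) j \<cdot> b) = 0"
   using \<open>y (m, j) = 0\<close> k(1) clin_0[OF clin_funpow[OF e] S] by simp
  then have "d (m, b) j = 0" by (rule cv.independentD[OF B(2) fin subset_refl _ mb(3), where u = "%b. d (m, b) j"])
  then show "c i j = 0" using d[OF ij(1)] mb(1) by simp
 qed
qed

section \<open>The series \<open>[a]\<close>\<close>

definition rhom :: "('a::comm_ring_1 => 'b::comm_ring_1) => bool" where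
 "rhom \<theta> \<longleftrightarrow> \<theta> 1 = 1 & (ALL a b. \<theta> (a + b) = \<theta> a + \<theta> b) & (ALL a b. \<theta> (a * b) = \<theta> a * \<theta> b)"

lemma rhomD: "rhom \<theta> ==> \<theta> 1 = 1" "rhom \<theta> ==> \<theta> (a + b) = \<theta> a + \<theta> b" "rhom \<theta> ==> \<theta> (a * b) = \<theta> a * \<theta> b"
 by (auto simp: rhom_def)

lemma rhom_0: "rhom \<theta> ==> \<theta> 0 = 0"
 using rhomD(2)[of \<theta> 0 0] by simp

lemma rhom_uminus: "rhom \<theta> ==> \<theta> (- a) = - \<theta> a"
 using rhomD(2)[of \<theta> a "- a"] rhom_0[of \<theta>] by (simp add: eq_neg_iff_add_eq_0 add.commute)

lemma rhom_diff: "rhom \<theta> ==> \<theta> (a - b) = \<theta> a - \<theta> b"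
 using rhomD(2)[of \<theta> a "- b"] by (simp add: rhom_uminus)

lemma rhom_sum: "rhom \<theta> ==> \<theta> (sum f A) = (\<Sum>a\<in>A. \<theta> (f a))"
 by (induction A rule: infinite_finite_induct) (auto simp: rhom_0 rhomD)

lemma rhom_prod: "rhom \<theta> ==> \<theta> (prod f A) = (\<Prod>a\<in>A. \<theta> (f a))"
 by (induction A rule: infinite_finite_induct) (auto simp: rhomD)

lemma rhom_power: "rhom \<theta> ==> \<theta> (a ^ n) = \<theta> a ^ n"
 by (induction n) (auto simp: rhomD)

lemmas rhom_simps = rhomD rhom_0 rhom_uminus rhom_diff rhom_sum rhom_prod rhom_power

lemma rhom_cA: "rhom cA"
 by (simp add: rhom_def cA_simps)

lemma rhom_id: "rhom (%c. c)"
 by (simp add: rhom_def)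

definition hmapc :: "('a => 'b) => 'a fps fps => 'b fps fps" where
 "hmapc \<theta> x = hseries (%k l. \<theta> (hcoeff x k l))"

lemma hcoeff_hmapc [simp]: "hcoeff (hmapc \<theta> x) k l = \<theta> (hcoeff x k l)"
 by (simp add: hmapc_def)

lemma hcoeff_var_h: "hcoeff var_h k l = (if k = 1 & l = 0 then 1 else 0)"
 by (auto simp: hcoeff_def var_h_def)

lemma hcoeff_var_h': "hcoeff var_h' k l = (if k = 0 & l = 1 then 1 else 0)"
 by (auto simp: hcoeff_def var_h'_def)

lemma rhom_hmapc: assumes "rhom \<theta>" shows "rhom (hmapc \<theta>)"
 unfolding rhom_def
proof (intro conjI allI)
 show "hmapc \<theta> 1 = 1" by (rule hcoeff_eqI) (simp add: hcoeff_1 rhom_simps[OF assms])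
 show "hmapc \<theta> (a + b) = hmapc \<theta> a + hmapc \<theta> b" for a b by (rule hcoeff_eqI) (simp add: rhom_simps[OF assms])
 show "hmapc \<theta> (a * b) = hmapc \<theta> a * hmapc \<theta> b" for a b by (rule hcoeff_eqI) (simp add: hcoeff_mult rhom_simps[OF assms])
qed

lemma hmapc_hconst: "rhom \<theta> ==> hmapc \<theta> (hconst a) = hconst (\<theta> a)"
 by (rule hcoeff_eqI) (simp add: hcoeff_hconst rhom_0)

lemma hmapc_var: "rhom \<theta> ==> hmapc \<theta> var_h = var_h" "rhom \<theta> ==> hmapc \<theta> var_h' = var_h'"
 by (rule hcoeff_eqI; simp add: hcoeff_var_h hcoeff_var_h' rhom_0 rhomD)+

text \<open>vo n x bounds the order of vanishing of x; it controls the exponential series and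
justifies the division by log_base.\<close>

definition vo :: "nat => 'a::zero fps fps => bool" where
 "vo n x \<longleftrightarrow> (ALL k l. k + l < n --> hcoeff x k l = 0)"

lemma vo_mult: fixes x y :: "'a::comm_ring_1 fps fps"
 assumes "vo a x" "vo b y" shows "vo (a + b) (x * y)"
 unfolding vo_def
proof (intro allI impI)
 fix k l assume kl: "k + l < a + b"
 have "hcoeff x i j * hcoeff y (k - i) (l - j) = 0" if "i \<le> k" "j \<le> l" for i j
 proof (cases "i + j < a")
  case False
  then have "(k - i) + (l - j) < b" using that kl by linarith
  then show ?thesis using assms(2) by (simp add: vo_def)
 qed (use assms(1) in \<open>simp add: vo_def\<close>)
 then show "hcoeff (x * y) k l = 0" by (simp add: hcoeff_mult)
qed

lemma vo_0 [simp]: "vo 0 x" by (simp add: vo_def)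
lemma vo_1: "vo 1 x \<longleftrightarrow> hcoeff x 0 0 = 0" "vo (Suc 0) x \<longleftrightarrow> hcoeff x 0 0 = 0" by (simp_all add: vo_def)

lemma vo_power: "vo 1 (y :: 'a::comm_ring_1 fps fps) ==> vo n (y ^ n)"
proof (induction n)
 case (Suc n)
 then show ?case using vo_mult[of 1 y n "y ^ n"] by simp
qed simp

definition hser :: "(nat => complex) => (complex => 'a::idom) => 'a fps fps => 'a fps fps" where
 "hser c \<iota> y = hseries (%k l. \<Sum>n\<le>k+l. hcoeff (hconst (\<iota> (c n)) * y ^ n) k l)"

lemma hexp_hser: "hexp \<iota> y = hser (%n. 1 / fact n) \<iota> y"
 by (simp add: hexp_def hser_def)

lemma hser_trunc:
 assumes y: "vo 1 y" and "k + l \<le> N"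
 shows "hcoeff (hser c \<iota> y) k l = (\<Sum>n\<le>N. \<iota> (c n) * hcoeff (y ^ n) k l)"
proof -
 have "hcoeff (y ^ n) k l = 0" if "n > k + l" for n using vo_power[OF y, of n] that by (simp add: vo_def)
 then have "(\<Sum>n\<le>N. \<iota> (c n) * hcoeff (y ^ n) k l) = (\<Sum>n\<le>k+l. \<iota> (c n) * hcoeff (y ^ n) k l)"
  using assms(2) by (intro sum.mono_neutral_right) auto
 then show ?thesis by (simp add: hser_def)
qed

lemma hser_0 [simp]: "hcoeff (hser c \<iota> y) 0 0 = \<iota> (c 0)"
 by (simp add: hser_def hcoeff_1)

lemma hser_step:
 assumes y: "vo 1 y"
 shows "hser c \<iota> y = hconst (\<iota> (c 0)) + y * hser (%n. c (Suc n)) \<iota> y"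
proof (rule hcoeff_eqI)
 fix k l :: nat
 let ?N = "k + l" and ?d = "%n. c (Suc n)"
 define R where "R = hser ?d \<iota> y - (\<Sum>n\<le>?N. hconst (\<iota> (?d n)) * y ^ n)"
 have "vo (Suc ?N) R" unfolding vo_def R_def by (auto simp: hser_trunc[OF y, of _ _ ?N] hcoeff_sum)
 from vo_mult[OF y this] have R: "hcoeff (y * R) k l = 0" by (simp add: vo_def)
 have "hser ?d \<iota> y = R + (\<Sum>n\<le>?N. hconst (\<iota> (?d n)) * y ^ n)" by (simp add: R_def)
 then have "hcoeff (y * hser ?d \<iota> y) k l = hcoeff (y * R) k l + (\<Sum>n\<le>?N. hcoeff (hconst (\<iota> (?d n)) * y ^ Suc n) k l)"
  by (simp add: distrib_left sum_distrib_left hcoeff_sum mult_ac)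
 then have "hcoeff (hconst (\<iota> (c 0)) + y * hser ?d \<iota> y) k l = (\<Sum>n\<le>Suc ?N. \<iota> (c n) * hcoeff (y ^ n) k l)"
  by (subst sum.atMost_Suc_shift) (simp add: R hcoeff_hconst hcoeff_1)
 then show "hcoeff (hser c \<iota> y) k l = hcoeff (hconst (\<iota> (c 0)) + y * hser ?d \<iota> y) k l"
  using hser_trunc[OF y, of k l "Suc ?N"] by simp
qed

lemma hser_diff: "rhom \<iota> ==> hser (%n. c n - d n) \<iota> y = hser c \<iota> y - hser d \<iota> y"
 by (rule hcoeff_eqI) (simp add: hser_def rhom_diff left_diff_distrib sum_subtractf)

lemma hser_uminus: assumes "rhom \<iota>" shows "hser c \<iota> (- y) = hser (%n. (-1) ^ n * c n) \<iota> y"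
proof (rule hcoeff_eqI)
 have "hconst (\<iota> (c n)) * (- y) ^ n = hconst (\<iota> ((-1) ^ n * c n)) * y ^ n" for n
  by (cases "even n") (simp_all add: rhom_uminus[OF assms] hconst_uminus)
 then show "hcoeff (hser c \<iota> (- y)) k l = hcoeff (hser (%n. (-1) ^ n * c n) \<iota> y) k l" for k l
  unfolding hser_def hcoeff_hseries by simp
qed

lemma hmapc_hser:
 assumes "rhom \<theta>" shows "hmapc \<theta> (hser c \<iota> y) = hser c (%x. \<theta> (\<iota> x)) (hmapc \<theta> y)"
 by (rule hcoeff_eqI) (simp add: hser_def rhom_simps[OF assms] rhom_power[OF rhom_hmapc[OF assms], symmetric])

definition shs :: "(complex => 'a::idom) => 'a fps fps => 'a fps fps" where
 "shs \<iota> = hser (%n. (1 + (-1) ^ n) / fact (Suc n)) \<iota>"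

lemma exp_diff:
 assumes "rhom \<iota>" "vo 1 y" shows "hexp \<iota> y - hexp \<iota> (- y) = y * shs \<iota> y"
proof -
 have "hexp \<iota> y - hexp \<iota> (- y) = hser (%n. 1 / fact n - (-1) ^ n * (1 / fact n)) \<iota> y"
  unfolding hexp_hser hser_uminus[OF assms(1)] hser_diff[OF assms(1)] ..
 also have "\<dots> = y * hser (%n. 1 / fact (Suc n) - (-1) ^ Suc n * (1 / fact (Suc n))) \<iota> y"
  by (subst hser_step[OF assms(2)]) (simp add: rhom_0[OF assms(1)])
 also have "(%n. 1 / fact (Suc n) - (-1) ^ Suc n * (1 / fact (Suc n)) :: complex) = (%n. (1 + (-1) ^ n) / fact (Suc n))"
  by (simp add: add_divide_distrib fun_eq_iff)
 finally show ?thesis by (simp add: shs_def)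
qed

lemma shs_even: assumes "rhom \<iota>" shows "shs \<iota> (- y) = shs \<iota> y"
proof -
 have "(%n. (-1) ^ n * ((1 + (-1) ^ n) / fact (Suc n)) :: complex) = (%n. (1 + (-1) ^ n) / fact (Suc n))"
 proof
  fix n show "(-1) ^ n * ((1 + (-1) ^ n) / fact (Suc n)) = ((1 + (-1) ^ n) / fact (Suc n) :: complex)"
   by (cases "even n") auto
 qed
 then show ?thesis by (simp add: shs_def hser_uminus[OF assms])
qed

definition hinv :: "(complex => 'a::idom) => 'a fps fps => 'a fps fps" where
 "hinv \<iota> x = hser (%_. 1) \<iota> (1 - x)"

lemma hinv: assumes "rhom \<iota>" "hcoeff x 0 0 = 1" shows "x * hinv \<iota> x = 1"
proof -
 have "vo 1 (1 - x)" using assms by (simp add: vo_1 hcoeff_1)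
 from hser_step[OF this, of "%_. 1" \<iota>] have "hinv \<iota> x = 1 + (1 - x) * hinv \<iota> x"
  by (simp add: hinv_def rhomD[OF assms(1)])
 then show ?thesis by (simp add: algebra_simps)
qed

lemma hinv_0: "rhom \<iota> ==> hcoeff (hinv \<iota> x) 0 0 = 1"
 by (simp add: hinv_def rhomD)

text \<open>[a] is a times this series, which has constant coefficient 1 and is even in
a: both quotients in the definition of [a] are values of the even series
sinh(x)/x.\<close>

definition qunit :: "(complex => 'a::idom) => nat => 'a => 'a fps fps" where
 "qunit \<iota> g a = (let z = log_base \<iota> g a; t = hconst (\<iota> (1/2)) in t * shs \<iota> (hconst a * z) * hinv \<iota> (t * shs \<iota> z))"

lemma log_base_vo: "vo 1 (log_base \<iota> g a)"
 by (simp add: vo_1 log_base_def hcoeff_var_h hcoeff_var_h')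

lemma log_base_nz: "log_base \<iota> g a ~= 0"
proof
 assume "log_base \<iota> g a = 0"
 then have "hcoeff (log_base \<iota> g a) 1 0 = 0" by simp
 then show False by (simp add: log_base_def hcoeff_var_h hcoeff_var_h'_mult)
qed

lemma exact_div_eq: "b ~= 0 ==> exact_div (b * c) b = (c :: 'a::idom)"
 unfolding exact_div_def by (rule the_equality) auto

lemma half_shs_0: assumes "rhom \<iota>" "vo 1 y" shows "hcoeff (hconst (\<iota> (1/2)) * shs \<iota> y) 0 0 = 1"
proof -
 have "hcoeff (hconst (\<iota> (1/2)) * shs \<iota> y) 0 0 = \<iota> (1/2) * \<iota> 2" by (simp add: shs_def hcoeff_hconst)
 also have "\<dots> = 1" using rhomD(3)[OF assms(1), of "1/2" 2] rhomD(1)[OF assms(1)] by simp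
 finally show ?thesis .
qed

lemma qbracket_qunit:
 assumes \<iota>: "rhom \<iota>"
 shows "qbracket \<iota> g a = hconst a * qunit \<iota> g a"
proof -
 define z where "z = log_base \<iota> g a"
 have z: "vo 1 z" "z ~= 0" unfolding z_def by (rule log_base_vo log_base_nz)+
 have az: "vo 1 (hconst a * z)" using z by (simp add: vo_1)
 define t where "t = hconst (\<iota> (1/2))"
 have inv: "t * shs \<iota> z * hinv \<iota> (t * shs \<iota> z) = 1" unfolding t_def by (rule hinv[OF \<iota> half_shs_0[OF \<iota> z(1)]])
 then have nz: "shs \<iota> z ~= 0" by auto
 have 1: "hexp \<iota> (hconst a * z) - hexp \<iota> (- (hconst a * z)) = z * (hconst a * shs \<iota> (hconst a * z))"
  using exp_diff[OF \<iota> az] by (simp add: mult_ac)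
 have "hconst a * shs \<iota> (hconst a * z) = hconst a * shs \<iota> (hconst a * z) * (t * shs \<iota> z * hinv \<iota> (t * shs \<iota> z))"
  by (simp add: inv)
 also have "\<dots> = shs \<iota> z * (hconst a * qunit \<iota> g a)"
  unfolding qunit_def Let_def z_def[symmetric] t_def[symmetric] by (simp only: mult_ac)
 finally have 2: "hconst a * shs \<iota> (hconst a * z) = shs \<iota> z * (hconst a * qunit \<iota> g a)" .
 show ?thesis
  unfolding qbracket_def Let_def z_def[symmetric] 1 exp_diff[OF \<iota> z(1)] exact_div_eq[OF z(2)]
  unfolding 2 exact_div_eq[OF nz] ..
qed

lemma qunit_0: assumes "rhom \<iota>" shows "hcoeff (qunit \<iota> g a) 0 0 = 1"
proof -
 have "vo 1 (hconst a * log_base \<iota> g a)" using log_base_vo[of \<iota> g a] by (simp add: vo_1)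
 from half_shs_0[OF assms this] show ?thesis unfolding qunit_def Let_def
  by (simp only: hcoeff_mult_00[of "_ * _"] hinv_0[OF assms] mult_1_left)
qed

lemma hmapc_Plaurent:
 assumes "rhom \<theta>" shows "hmapc \<theta> (Plaurent \<iota> g u u') = Plaurent (%x. \<theta> (\<iota> x)) g (hmapc \<theta> u) (hmapc \<theta> u')"
 by (simp add: Plaurent_def rhom_simps[OF rhom_hmapc[OF assms]] hmapc_hconst[OF assms])

lemma hmapc_log_base:
 assumes "rhom \<theta>" shows "hmapc \<theta> (log_base \<iota> g a) = log_base (%x. \<theta> (\<iota> x)) g (\<theta> a)"
 by (simp add: log_base_def curly_def hexp_hser hmapc_Plaurent[OF assms] rhom_simps[OF rhom_hmapc[OF assms]]
   hmapc_hconst[OF assms] hmapc_var[OF assms] hmapc_hser[OF assms])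

lemma hmapc_qunit:
 assumes "rhom \<theta>" shows "hmapc \<theta> (qunit \<iota> g a) = qunit (%x. \<theta> (\<iota> x)) g (\<theta> a)"
 by (simp add: qunit_def Let_def shs_def hinv_def rhom_simps[OF rhom_hmapc[OF assms]]
   hmapc_hconst[OF assms] hmapc_hser[OF assms] hmapc_log_base[OF assms])

lemma eps_power: assumes "g \<ge> 1" shows "eps g ^ g = -1"
proof -
 have "eps g ^ g = exp (of_nat g * (\<i> * of_real pi / of_nat g))" unfolding eps_def by (rule exp_of_nat_mult[symmetric])
 also have "of_nat g * (\<i> * of_real pi / of_nat g) = \<i> * of_real pi" using assms by simp
 finally show ?thesis by simp
qed

lemma Plaurent_swap:
 assumes "rhom \<iota>" "g \<ge> 1" shows "Plaurent \<iota> g u u' = Plaurent \<iota> g u' u"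
proof -
 define t where "t k u u' = (hconst (\<iota> (eps g ^ k)) * u - hconst (\<iota> (inverse (eps g ^ k))) * u') *
    hconst (\<iota> (1 / (eps g ^ k - inverse (eps g ^ k))))" for k u u'
 have "t (g - k) u' u = t k u u'" if "k \<in> {1..g-1}" for k
 proof -
  have "k \<le> g" using that by auto
  then have "eps g ^ (g - k) * eps g ^ k = -1" using eps_power[OF assms(2)] by (simp add: power_add[symmetric])
  moreover have nz: "eps g ^ k ~= 0" by (simp add: eps_def)
  ultimately have 1: "eps g ^ (g - k) = - inverse (eps g ^ k)" by (simp add: field_simps)
  have 2: "inverse (- inverse (eps g ^ k)) = - (eps g ^ k)" by simp
  show ?thesis unfolding t_def 1 2 by (simp add: rhom_uminus[OF assms(1)] hconst_uminus)
 qed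
 then have "(\<Prod>k=1..g-1. t k u u') = (\<Prod>k=1..g-1. t (g - k) u' u)" by simp
 also have "\<dots> = (\<Prod>k=1..g-1. t k u' u)"
  by (rule prod.reindex_bij_witness[of _ "%k. g - k" "%k. g - k"]) auto
 finally have "(\<Prod>k=1..g-1. t k u u') = (\<Prod>k=1..g-1. t k u' u)" .
 then show ?thesis unfolding Plaurent_def t_def by (simp only: add.commute)
qed

lemma qunit_even: assumes "rhom \<iota>" "g \<ge> 1" shows "qunit \<iota> g (- a) = qunit \<iota> g a"
proof -
 have "curly \<iota> g (- a) = curly \<iota> g a" unfolding curly_def
  by (subst Plaurent_swap[OF assms]) (simp add: hconst_uminus)
 then have "log_base \<iota> g (- a) = log_base \<iota> g a" by (simp add: log_base_def)
 then show ?thesis by (simp add: qunit_def hconst_uminus shs_even[OF assms(1)])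
qed

section \<open>Series even in the square root of the Casimir element\<close>

lemma rhom_map_poly: assumes "rhom \<theta>" shows "rhom (map_poly \<theta>)"
 unfolding rhom_def
 by (auto intro!: poly_eqI simp: coeff_map_poly rhom_simps[OF assms] coeff_mult map_poly_1')

lemma rhom_pcompose: "rhom (%q. pcompose q r)"
 by (auto simp: rhom_def pcompose_mult pcompose_add) (metis one_pCons pcompose_const)

lemma rhom_hshift: "rhom (hshift s)"
 by (simp add: rhom_def hshift_mult hshift_add)

lemma rhom_evalHC: "rhom (evalHC x y)"
 by (simp add: rhom_def)

definition sqsub :: "complex poly poly => complex poly poly" where
 "sqsub = map_poly (%q. pcompose q [:0, 0, 1:])"

definition sqneg :: "complex poly poly => complex poly poly" where
 "sqneg = map_poly (%q. pcompose q [:0, -1:])"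

definition halfp :: "complex poly => complex poly" where
 "halfp q = (\<Sum>n\<le>Polynomial.degree q. Polynomial.monom (Polynomial.coeff q (2 * n)) n)"

definition evenpart :: "complex poly poly => complex poly poly" where
 "evenpart = map_poly halfp"

lemma rhom_sqsub: "rhom sqsub" and rhom_sqneg: "rhom sqneg"
 unfolding sqsub_def sqneg_def by (rule rhom_map_poly rhom_pcompose)+

lemma coeff_halfp: "Polynomial.coeff (halfp q) n = Polynomial.coeff q (2 * n)"
 by (auto simp: halfp_def coeff_sum coeff_eq_0)

lemma halfp_0 [simp]: "halfp 0 = 0" by (simp add: halfp_def)

lemma poly_bound: "Polynomial.degree p \<le> N ==> poly p x = (\<Sum>i\<le>N. Polynomial.coeff p i * (x :: complex) ^ i)"
 unfolding poly_altdef by (intro sum.mono_neutral_left) (auto simp: coeff_eq_0)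

lemma halfp_square: assumes "pcompose q [:0, -1:] = q" shows "pcompose (halfp q) [:0, 0, 1:] = q"
proof -
 have "poly (pcompose (halfp q) [:0, 0, 1:]) x = poly q x" for x
 proof -
  let ?d = "Polynomial.degree q" and ?c = "Polynomial.coeff q"
  have split: "(\<Sum>i\<le>Suc (2 * d). f i) = (\<Sum>n\<le>d. f (2 * n) + f (Suc (2 * n)))" for f :: "nat => complex" and d
   by (induction d) (auto simp: algebra_simps)
  have "Polynomial.degree (halfp q) \<le> ?d"
   by (rule degree_le) (auto simp: coeff_halfp coeff_eq_0)
  then have h: "poly (halfp q) (x * x) = (\<Sum>n\<le>?d. ?c (2 * n) * x ^ (2 * n))"
   by (simp add: poly_bound coeff_halfp power_mult power2_eq_square)
  have q: "poly q y = (\<Sum>n\<le>?d. ?c (2 * n) * y ^ (2 * n) + ?c (Suc (2 * n)) * y ^ Suc (2 * n))" for y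
   by (subst poly_bound[of q "Suc (2 * ?d)"]) (auto simp: split simp del: sum.atMost_Suc)
  have "poly q (- x) = poly q x" using arg_cong[OF assms, of "%p. poly p x"] by (simp add: poly_pcompose)
  then have "2 * poly q x = poly q x + poly q (- x)" by simp
  also have "\<dots> = 2 * (\<Sum>n\<le>?d. ?c (2 * n) * x ^ (2 * n))"
   unfolding q sum.distrib[symmetric] sum_distrib_left by (intro sum.cong refl) simp
  finally show ?thesis by (simp add: poly_pcompose h)
 qed
 then show ?thesis by (simp add: poly_eq_poly_eq_iff[symmetric] fun_eq_iff)
qed

lemma evenpart_square: assumes "sqneg f = f" shows "sqsub (evenpart f) = f"
proof (rule poly_eqI)
 fix n
 have "pcompose (Polynomial.coeff f n) [:0, -1:] = Polynomial.coeff f n"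
  using arg_cong[OF assms, of "%f. Polynomial.coeff f n"] by (simp add: sqneg_def coeff_map_poly)
 from halfp_square[OF this] show "Polynomial.coeff (sqsub (evenpart f)) n = Polynomial.coeff f n"
  by (simp add: sqsub_def evenpart_def coeff_map_poly)
qed

lemma sqsub_inj: assumes "sqsub f = sqsub f'" shows "f = f'"
proof (rule poly_eqI)
 fix n
 have *: "pcompose (Polynomial.coeff f n) [:0, 0, 1:] = pcompose (Polynomial.coeff f' n) [:0, 0, 1:]"
  using arg_cong[OF assms, of "%f. Polynomial.coeff f n"] by (simp add: sqsub_def coeff_map_poly)
 have "poly (Polynomial.coeff f n) x = poly (Polynomial.coeff f' n) x" for x
  using arg_cong[OF *, of "%q. poly q (csqrt x)"] by (simp add: poly_pcompose power2_eq_square[symmetric])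
 then show "Polynomial.coeff f n = Polynomial.coeff f' n" by (simp add: poly_eq_poly_eq_iff[symmetric] fun_eq_iff)
qed

lemma hmapc_sqsub_inj: "hmapc sqsub x = hmapc sqsub y ==> x = y"
 by (metis hcoeff_hmapc hcoeff_eqI sqsub_inj)

lemma sqsub_hshift: "sqsub (hshift s f) = hshift s (sqsub f)"
proof (induction f)
 case 0
 then show ?case by (simp add: rhom_0[OF rhom_sqsub])
next
 case (pCons a f)
 have p: "sqsub (pCons a f) = pCons (pcompose a [:0, 0, 1:]) (sqsub f)" for a f
  by (simp add: sqsub_def map_poly_pCons)
 have h: "hshift s (pCons a f) = [:a:] + [:[:s:], 1:] * hshift s f" for a f
  by (simp add: hshift_def pcompose_pCons)
 have 0: "sqsub 0 = 0" by (rule rhom_0[OF rhom_sqsub])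
 have 1: "sqsub [:a:] = [:pcompose a [:0, 0, 1:]:]" for a by (simp add: p 0)
 have 2: "sqsub [:[:s:], 1:] = [:[:s:], 1:]" by (simp add: p 0) (metis one_pCons pcompose_const)
 have "sqsub (hshift s (pCons a f)) = sqsub [:a:] + sqsub [:[:s:], 1:] * sqsub (hshift s f)"
  unfolding h[of a f] rhomD[OF rhom_sqsub] ..
 also have "\<dots> = [:pcompose a [:0, 0, 1:]:] + [:[:s:], 1:] * hshift s (sqsub f)"
  unfolding 1 2 pCons.IH ..
 also have "\<dots> = hshift s (sqsub (pCons a f))" unfolding p[of a f] h ..
 finally show ?case .
qed

lemma evalHC_sqsub: "evalHC x s (sqsub f) = evalHC x (s * s) f"
proof (induction f)
 case 0
 then show ?case by (simp add: rhom_0[OF rhom_sqsub])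
next
 case (pCons a f)
 have p: "sqsub (pCons a f) = pCons (pcompose a [:0, 0, 1:]) (sqsub f)" by (simp add: sqsub_def map_poly_pCons)
 show ?case using pCons.IH unfolding p by (simp add: evalHC_def poly_pcompose)
qed

text \<open>The sign change of \<open>\<surd>C\<close> exchanges the factors e = 1 and e = -1 up to
two signs, so rel_series is even in \<open>\<surd>C\<close>. relG is the same series
written in C, and relY below is its unit factor.\<close>

definition relG :: "nat => complex => complex poly poly fps fps" where
 "relG g \<sigma> = hmapc evenpart (rel_series g \<sigma>)"

lemma H_shift_neg: "sqneg (H_shift \<sigma> 1) = - H_shift \<sigma> (-1)" "sqneg (H_shift \<sigma> (-1)) = - H_shift \<sigma> 1"
proof -
 have 0: "sqneg (cA a) = cA a" for a by (simp add: sqneg_def cA_def map_poly_pCons)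
 have 1: "sqneg var_H = var_H" by (simp add: sqneg_def var_H_def map_poly_pCons) (metis one_pCons pcompose_const)
 have 2: "sqneg sqrt_C = - sqrt_C" by (simp add: sqneg_def sqrt_C_def map_poly_pCons pcompose_pCons)
 show "sqneg (H_shift \<sigma> 1) = - H_shift \<sigma> (-1)" "sqneg (H_shift \<sigma> (-1)) = - H_shift \<sigma> 1"
  unfolding H_shift_def rhom_simps[OF rhom_sqneg] 0 1 2 by (simp_all add: cA_simps algebra_simps)
qed

lemma H_shift_shift: "H_shift (-1) e = hshift 2 (H_shift 1 e)"
proof -
 have 0: "hshift 2 (cA a) = cA a" for a by (simp add: hshift_def cA_def)
 have 1: "hshift 2 var_H = var_H + cA 2" by (simp add: hshift_def var_H_def cA_def pcompose_pCons)
 have 2: "hshift 2 sqrt_C = sqrt_C" by (simp add: hshift_def sqrt_C_def)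
 show ?thesis
  unfolding H_shift_def rhom_simps[OF rhom_hshift] 0 1 2 by (simp add: cA_simps cA_numeral algebra_simps)
qed

definition pairunit :: "nat => complex => complex poly poly fps fps" where
 "pairunit g \<sigma> = qunit cA g (H_shift \<sigma> 1) * qunit cA g (H_shift \<sigma> (-1))"

lemma rel_series_factor: "rel_series g \<sigma> = hconst (H_shift \<sigma> 1 * H_shift \<sigma> (-1)) * pairunit g \<sigma>"
proof -
 have "rel_series g \<sigma> = qbracket cA g (H_shift \<sigma> 1) * qbracket cA g (H_shift \<sigma> (-1))"
  unfolding rel_series_def by (subst prod.insert) auto
 then show ?thesis by (simp add: qbracket_qunit[OF rhom_cA] pairunit_def hconst_mult mult_ac)
qed

lemma pairunit_even: "g \<ge> 1 ==> hmapc sqneg (pairunit g \<sigma>) = pairunit g \<sigma>"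
proof -
 assume g: "g \<ge> 1"
 have c: "(%x. sqneg (cA x)) = cA" by (simp add: sqneg_def cA_def map_poly_pCons fun_eq_iff)
 show ?thesis
  unfolding pairunit_def rhomD[OF rhom_hmapc[OF rhom_sqneg]] hmapc_qunit[OF rhom_sqneg] c H_shift_neg
  by (simp add: qunit_even[OF rhom_cA g] mult.commute)
qed

lemma rel_series_even: "g \<ge> 1 ==> hmapc sqneg (rel_series g \<sigma>) = rel_series g \<sigma>"
 unfolding rel_series_factor rhomD[OF rhom_hmapc[OF rhom_sqneg]] hmapc_hconst[OF rhom_sqneg]
 by (simp add: pairunit_even rhomD[OF rhom_sqneg] H_shift_neg mult.commute)

lemma evenpart_series: "hmapc sqneg x = x ==> hmapc sqsub (hmapc evenpart x) = x"
 by (rule hcoeff_eqI) (metis hcoeff_hmapc evenpart_square)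

lemma relG_square: "g \<ge> 1 ==> hmapc sqsub (relG g \<sigma>) = rel_series g \<sigma>"
 unfolding relG_def by (rule evenpart_series[OF rel_series_even])

definition relY :: "nat => complex poly poly fps fps" where
 "relY g = hmapc evenpart (pairunit g 1)"

lemma relY_square: "g \<ge> 1 ==> hmapc sqsub (relY g) = pairunit g 1"
 unfolding relY_def by (rule evenpart_series[OF pairunit_even])

lemma sqsub_basic: "sqsub (cA a) = cA a" "sqsub var_H = var_H" "sqsub var_C = sqrt_C * sqrt_C"
 by (auto simp: sqsub_def cA_def var_H_def sqrt_C_def map_poly_pCons pcompose_pCons)
   (metis one_pCons pcompose_const)

lemma relG_1: assumes "g \<ge> 1"
 shows "relG g 1 = hconst (cA (1/4) * (var_C - (var_H - 1) * (var_H - 1))) * relY g"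
proof (rule hmapc_sqsub_inj)
 have 4: "cA (1/2) * cA (1/2) = cA (1/4)" by (simp add: cA_simps[symmetric])
 have "H_shift 1 1 * H_shift 1 (-1) = (cA (1/2) * cA (1/2)) * (sqrt_C * sqrt_C - (var_H - 1) * (var_H - 1))"
  unfolding H_shift_def by (simp add: cA_simps algebra_simps)
 then have "H_shift 1 1 * H_shift 1 (-1) = sqsub (cA (1/4) * (var_C - (var_H - 1) * (var_H - 1)))"
  unfolding rhom_simps[OF rhom_sqsub] sqsub_basic 4 .
 then show "hmapc sqsub (relG g 1) = hmapc sqsub (hconst (cA (1/4) * (var_C - (var_H - 1) * (var_H - 1))) * relY g)"
  unfolding relG_square[OF assms] rel_series_factor rhomD[OF rhom_hmapc[OF rhom_sqsub]] hmapc_hconst[OF rhom_sqsub] relY_square[OF assms]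
  by simp
qed

lemma relG_shift: assumes "g \<ge> 1" shows "relG g (-1) = hmapc (hshift 2) (relG g 1)"
proof (rule hmapc_sqsub_inj)
 have c: "(%x. hshift 2 (cA x)) = cA" by (simp add: hshift_def cA_def fun_eq_iff)
 have "rel_series g (-1) = hmapc (hshift 2) (rel_series g 1)"
  unfolding rel_series_factor pairunit_def rhomD[OF rhom_hmapc[OF rhom_hshift]] hmapc_hconst[OF rhom_hshift]
   hmapc_qunit[OF rhom_hshift] c H_shift_shift rhomD[OF rhom_hshift] ..
 then have "hmapc sqsub (relG g (-1)) = hmapc (hshift 2) (hmapc sqsub (relG g 1))"
  by (simp add: relG_square[OF assms])
 also have "\<dots> = hmapc sqsub (hmapc (hshift 2) (relG g 1))"
  by (rule hcoeff_eqI) (simp add: sqsub_hshift)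
 finally show "hmapc sqsub (relG g (-1)) = hmapc sqsub (hmapc (hshift 2) (relG g 1))" .
qed

lemma relY_0: assumes "g \<ge> 1" shows "hcoeff (relY g) 0 0 = 1"
proof (rule sqsub_inj)
 have "sqsub (hcoeff (relY g) 0 0) = hcoeff (hmapc sqsub (relY g)) 0 0" by simp
 also have "\<dots> = 1" unfolding relY_square[OF assms] by (simp add: pairunit_def qunit_0[OF rhom_cA])
 finally show "sqsub (hcoeff (relY g) 0 0) = sqsub 1" by (simp add: rhomD[OF rhom_sqsub])
qed

lemma relG_eval: assumes "g \<ge> 1"
 shows "hmapc (evalHC x (s * s)) (relG g 1) = qbracket (%c. c) g ((s + x - 1) / 2) * qbracket (%c. c) g ((s - x + 1) / 2)"
proof -
 have "hmapc (evalHC x (s * s)) (relG g 1) = hmapc (evalHC x s) (rel_series g 1)"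
  unfolding relG_square[OF assms, symmetric] by (rule hcoeff_eqI) (simp add: evalHC_sqsub)
 also have "\<dots> = qbracket (%c. c) g (evalHC x s (H_shift 1 1)) * qbracket (%c. c) g (evalHC x s (H_shift 1 (-1)))"
  unfolding rel_series_factor pairunit_def rhomD[OF rhom_hmapc[OF rhom_evalHC]] hmapc_hconst[OF rhom_evalHC]
   hmapc_qunit[OF rhom_evalHC] qbracket_qunit[OF rhom_id] evalHC_simps hconst_mult by (simp only: mult_ac)
 also have "evalHC x s (H_shift 1 1) = (s + x - 1) / 2"
  unfolding H_shift_def evalHC_simps by (simp add: evalHC_def sqrt_C_def)
 also have "evalHC x s (H_shift 1 (-1)) = (s - x + 1) / 2"
  unfolding H_shift_def evalHC_simps by (simp add: evalHC_def sqrt_C_def)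
 finally show ?thesis .
qed

section \<open>Actions of double series rings\<close>

definition slin :: "('b::ring_1 fps fps => nat => nat => 'a::cvec) => bool" where
 "slin F \<longleftrightarrow> (ALL x y. F (x + y) = F x + F y) & (ALL x. F (var_h * x) = hsh (F x)) & (ALL x. F (var_h' * x) = vsh (F x))"

lemma slin_eq:
 assumes "slin F" "slin G" "!!b. F (hconst b) = G (hconst b)" shows "F x = G x"
 using series_map_zero[of "%x. F x - G x" x] assms by (simp add: slin_def hsh_diff vsh_diff)

lemma slin_add: "slin F ==> slin G ==> slin (%x. F x + G x)"
 and slin_scale: "slin F ==> slin (%x. a \<cdot> F x)"
 and slin_hsh: "slin F ==> slin (%x. hsh (F x))"
 and slin_vsh: "slin F ==> slin (%x. vsh (F x))"
 by (auto simp: slin_def hsh_add vsh_add hsh_csc vsh_csc csc_add_right hsh_vsh)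

lemma slin_kop:
 assumes F: "slin F" and T: "kop S S' T" and I: "!!x. F x \<in> MS S"
 shows "slin (%x. T (F x))"
 using F by (simp add: slin_def kop_hsh[OF T I] kop_vsh[OF T I] clin_add[OF kop_clin[OF T] I I])

lemma slin_mult_right: "slin F ==> slin (%x. F (x * y))"
 by (auto simp: slin_def distrib_right mult.assoc)

lemma slin_mult_left: "slin F ==> slin (%x. F (y * x))"
 unfolding slin_def by (auto simp: distrib_left) (metis mult_var_h mult.assoc, metis mult_var_h' mult.assoc)

lemma slin_hmapc: "rhom \<theta> ==> slin F ==> slin (%x. F (hmapc \<theta> x))"
 by (auto simp: slin_def rhomD[OF rhom_hmapc] hmapc_var)

definition Phi :: "('b::ring_1 => (nat => nat => 'a::cvec) => 'a dser) => 'b fps fps => ('a dser) => 'a dser" where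
 "Phi \<phi> x f = (%k l. \<Sum>i\<le>k. \<Sum>j\<le>l. \<phi> (hcoeff x i j) f (k - i) (l - j))"

lemma sum_at0: "(!!i. i ~= 0 ==> F i = 0) ==> (\<Sum>i\<le>k::nat. F i) = (F 0 :: 'a::comm_monoid_add)"
 by (subst sum.mono_neutral_right[of _ "{0}"]) auto

lemma Phi_cong: "(!!i j. \<phi> (hcoeff x i j) f = \<phi>' (hcoeff y i j) f) ==> Phi \<phi> x f = Phi \<phi>' y f"
 by (simp add: Phi_def)

locale kract =
 fixes S :: "'a::cvec set" and \<phi> :: "'b::ring_1 => ('a dser) => 'a dser"
 assumes sub: "cv.subspace S" and ra: "ract (MS S) \<phi>" and ka: "!!b. kop S S (\<phi> b)"
begin

lemma Phi_const: assumes "f \<in> MS S" shows "Phi \<phi> (hconst b) f = \<phi> b f"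
proof (intro ext)
 fix k l
 have z: "\<phi> 0 f i j = 0" for i j using ract_zero[OF ra assms] by simp
 have "Phi \<phi> (hconst b) f k l = (\<Sum>j\<le>l. \<phi> (hcoeff (hconst b) 0 j) f (k - 0) (l - j))"
  unfolding Phi_def by (rule sum_at0) (simp add: hcoeff_hconst z)
 also have "\<dots> = \<phi> (hcoeff (hconst b) 0 0) f (k - 0) (l - 0)"
  by (rule sum_at0) (simp add: hcoeff_hconst z)
 finally show "Phi \<phi> (hconst b) f k l = \<phi> b f k l" by (simp add: hcoeff_hconst)
qed

lemma Phi_slin: assumes "f \<in> MS S" shows "slin (%x. Phi \<phi> x f)"
 unfolding slin_def
proof (intro conjI allI)
 show "Phi \<phi> (x + y) f = Phi \<phi> x f + Phi \<phi> y f" for x y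
  by (auto simp: Phi_def fun_eq_iff ract_add[OF ra assms] sum.distrib)
 have z: "\<phi> 0 f i j = 0" for i j using ract_zero[OF ra assms] by simp
 show "Phi \<phi> (var_h * x) f = hsh (Phi \<phi> x f)" for x
 proof (intro ext)
  fix k l show "Phi \<phi> (var_h * x) f k l = hsh (Phi \<phi> x f) k l"
   by (cases k) (simp_all add: Phi_def hcoeff_var_h_mult z sum.atMost_Suc_shift del: sum.atMost_Suc)
 qed
 show "Phi \<phi> (var_h' * x) f = vsh (Phi \<phi> x f)" for x
 proof (intro ext)
  fix k l show "Phi \<phi> (var_h' * x) f k l = vsh (Phi \<phi> x f) k l"
   by (cases l) (simp_all add: Phi_def hcoeff_var_h'_mult z sum.atMost_Suc_shift del: sum.atMost_Suc)
 qed
qed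

lemma Phi_in: assumes "f \<in> MS S" shows "Phi \<phi> x f \<in> MS S"
 unfolding Phi_def using ract_in[OF ra assms]
 by (intro MS_I cv.subspace_sum[OF sub]) (auto simp: MS_D)

lemma Phi_kop: "kop S S (Phi \<phi> x)"
 unfolding kop_def
proof (intro conjI ballI clinI)
 fix f assume f: "f \<in> MS S"
 note c = clin_csc[OF subspace_MS[OF sub, THEN clin_csc_id]]
 note in' = f MS_hsh[OF sub f] MS_vsh[OF sub f] cv.subspace_scale[OF subspace_MS[OF sub] f] cv.subspace_add[OF subspace_MS[OF sub] f]
 show "Phi \<phi> x f \<in> MS S" by (rule Phi_in[OF f])
 show "Phi \<phi> x (f + g) = Phi \<phi> x f + Phi \<phi> x g" if g: "g \<in> MS S" for g
  by (rule slin_eq[OF Phi_slin[OF in'(5)[OF g]] slin_add[OF Phi_slin[OF f] Phi_slin[OF g]]])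
   (simp only: Phi_const[OF in'(5)[OF g]] Phi_const[OF f] Phi_const[OF g] clin_add[OF kop_clin[OF ka] f g])
 show "Phi \<phi> x (a \<cdot> f) = a \<cdot> Phi \<phi> x f" for a
  by (rule slin_eq[OF Phi_slin[OF in'(4)] slin_scale[OF Phi_slin[OF f]]])
   (simp only: Phi_const[OF in'(4)] Phi_const[OF f] clin_csc[OF kop_clin[OF ka] f])
 show "Phi \<phi> x (hsh f) = hsh (Phi \<phi> x f)"
  by (rule slin_eq) (auto intro!: slin_hsh Phi_slin in' simp: Phi_const in' kop_hsh[OF ka])
 show "Phi \<phi> x (vsh f) = vsh (Phi \<phi> x f)"
  by (rule slin_eq) (auto intro!: slin_vsh Phi_slin in' simp: Phi_const in' kop_vsh[OF ka])
qed

lemma Phi_mult: assumes f: "f \<in> MS S" shows "Phi \<phi> (x * y) f = Phi \<phi> x (Phi \<phi> y f)"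
proof (rule slin_eq[of "%x. Phi \<phi> (x * y) f"])
 fix b show "Phi \<phi> (hconst b * y) f = Phi \<phi> (hconst b) (Phi \<phi> y f)"
  unfolding Phi_const[OF Phi_in[OF f]]
 proof (rule slin_eq[of "%y. Phi \<phi> (hconst b * y) f"])
  show "slin (%x. \<phi> b (Phi \<phi> x f))" by (rule slin_kop[OF Phi_slin[OF f] ka Phi_in[OF f]])
  show "Phi \<phi> (hconst b * hconst c) f = \<phi> b (Phi \<phi> (hconst c) f)" for c
   by (simp add: hconst_mult[symmetric] Phi_const f ract_mult[OF ra f])
 qed (rule slin_mult_left[OF Phi_slin[OF f]])
qed (rule slin_mult_right[OF Phi_slin[OF f]], rule Phi_slin[OF Phi_in[OF f]])

lemma ract_Phi: "ract (MS S) (Phi \<phi>)"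
 unfolding ract_def
 using kop_clin[OF Phi_kop] Phi_slin Phi_mult Phi_const[of _ 1] ract_one[OF ra] by (auto simp: slin_def)

lemma Phi_unique:
 assumes "f \<in> MS S" "slin (%x. R x f)" "!!b. R (hconst b) f = \<phi> b f" shows "R x f = Phi \<phi> x f"
 by (rule slin_eq) (simp_all add: assms Phi_slin Phi_const)

lemma Phi_00: assumes "f \<in> MS S" shows "Phi \<phi> x f 0 0 = \<phi> (hcoeff x 0 0) f 0 0"
 by (simp add: Phi_def)

end

lemma kract_csc: "cv.subspace S ==> kract S (csc :: complex => (nat => nat => 'a::cvec) => _)"
 by unfold_locales (auto simp: ract_csc subspace_MS kop_def clin_csc_id hsh_csc vsh_csc)

text \<open>Both sides are additive in the series and compatible with multiplication by h and h',
hence determined by constant series.\<close>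

lemma Phi_intertwine:
 assumes "kract S \<phi>" "kract S' \<phi>'" "kop S S' T" "!!b f. f \<in> MS S ==> T (\<phi> b f) = \<phi>' b (T f)" and f: "f \<in> MS S"
 shows "T (Phi \<phi> x f) = Phi \<phi>' x (T f)"
proof (rule slin_eq[of "%x. T (Phi \<phi> x f)"])
 interpret a: kract S \<phi> by fact
 interpret b: kract S' \<phi>' by fact
 show "slin (%x. T (Phi \<phi> x f))" by (rule slin_kop[OF a.Phi_slin[OF f] assms(3) a.Phi_in[OF f]])
 show "slin (%x. Phi \<phi>' x (T f))" by (rule b.Phi_slin[OF kop_in[OF assms(3) f]])
 show "T (Phi \<phi> (hconst b) f) = Phi \<phi>' (hconst b) (T f)" for b
  by (simp add: a.Phi_const b.Phi_const assms f kop_in[OF assms(3)])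
qed

lemma kop_iff_linear:
 assumes S: "cv.subspace S" and S': "cv.subspace S'"
 shows "kop S S' T \<longleftrightarrow> (\<forall>f\<in>MS S. T f \<in> MS S') & (\<forall>f\<in>MS S. \<forall>g\<in>MS S. T (f + g) = T f + T g) &
  (ALL c. \<forall>f\<in>MS S. T (Phi csc c f) = Phi csc c (T f))" (is "_ \<longleftrightarrow> ?R")
proof
 assume T: "kop S S' T"
 have "T (Phi csc c f) = Phi csc c (T f)" if "f \<in> MS S" for c f
  by (rule Phi_intertwine[OF kract_csc[OF S] kract_csc[OF S'] T _ that]) (rule clin_csc[OF kop_clin[OF T]])
 then show ?R using kop_in[OF T] clin_add[OF kop_clin[OF T]] by blast
next
 assume R: ?R
 interpret a: kract S csc by (rule kract_csc[OF S])
 interpret b: kract S' csc by (rule kract_csc[OF S'])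
 have "T (a \<cdot> f) = a \<cdot> T f" "T (hsh f) = hsh (T f)" "T (vsh f) = vsh (T f)" if f: "f \<in> MS S" for f a
 proof -
  have Tf: "T f \<in> MS S'" using R f by blast
  have h: "Phi csc var_h f = hsh f" "Phi csc var_h' f = vsh f" if "f \<in> MS S" for f :: "'a dser"
   using a.Phi_slin[OF that] a.Phi_const[OF that, of 1] unfolding slin_def by (metis hconst_1 mult.right_neutral csc_one)+
  have h': "Phi csc var_h f = hsh f" "Phi csc var_h' f = vsh f" if "f \<in> MS S'" for f :: "'b dser"
   using b.Phi_slin[OF that] b.Phi_const[OF that, of 1] unfolding slin_def by (metis hconst_1 mult.right_neutral csc_one)+
  show "T (a \<cdot> f) = a \<cdot> T f" using R f a.Phi_const[OF f, of a] b.Phi_const[OF Tf, of a] by metis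
  show "T (hsh f) = hsh (T f)" "T (vsh f) = vsh (T f)" using R f h[OF f] h'[OF Tf] by metis+
 qed
 then show "kop S S' T" using R by (auto simp: kop_def clin_def)
qed

section \<open>Actions of the free algebra\<close>

lemma poly_mapping_sum_single: "(\<Sum>w\<in>Poly_Mapping.keys p. Poly_Mapping.single w (Poly_Mapping.lookup p w)) = p"
proof (rule poly_mapping_eqI)
 fix k
 have "Poly_Mapping.lookup (\<Sum>w\<in>Poly_Mapping.keys p. Poly_Mapping.single w (Poly_Mapping.lookup p w)) k
   = (\<Sum>w\<in>Poly_Mapping.keys p. if w = k then Poly_Mapping.lookup p w else 0)"
  by (simp add: Poly_Mapping.lookup_sum lookup_single when_def)
 then show "Poly_Mapping.lookup (\<Sum>w\<in>Poly_Mapping.keys p. Poly_Mapping.single w (Poly_Mapping.lookup p w)) k = Poly_Mapping.lookup p k"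
  by (simp add: in_keys_iff)
qed

lemma poly_mapping_additive_eq:
 fixes F G :: "('w \<Rightarrow>\<^sub>0 'c::comm_monoid_add) => 'm::ab_group_add"
 assumes F: "!!p q. F (p + q) = F p + F q" and G: "!!p q. G (p + q) = G p + G q"
  and s: "!!w c. F (Poly_Mapping.single w c) = G (Poly_Mapping.single w c)"
 shows "F p = G p"
proof -
 have 0: "F 0 = 0" "G 0 = 0" using F[of 0 0] G[of 0 0] by auto
 have "F (sum P A) = (\<Sum>a\<in>A. F (P a)) & G (sum P A) = (\<Sum>a\<in>A. G (P a))" for P and A :: "'w set"
  by (induction A rule: infinite_finite_induct) (auto simp: F G 0)
 then have "F (\<Sum>w\<in>Poly_Mapping.keys p. Poly_Mapping.single w (Poly_Mapping.lookup p w)) = G (\<Sum>w\<in>Poly_Mapping.keys p. Poly_Mapping.single w (Poly_Mapping.lookup p w))"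
  by (simp add: s)
 then show ?thesis by (simp add: poly_mapping_sum_single)
qed

definition wact :: "(gen => 'm => 'm) => gword => 'm => 'm" where
 "wact T w = (case w of Word xs => foldr T xs)"

definition fact_act :: "(gen => 'm::cvec => 'm) => free_alg => 'm => 'm" where
 "fact_act T p f = (\<Sum>w\<in>Poly_Mapping.keys p. Poly_Mapping.lookup p w \<cdot> wact T w f)"

lemma wact_simps [simp]: "wact T (Word []) f = f" "wact T (Word (x # xs)) f = T x (wact T (Word xs) f)"
 by (simp_all add: wact_def)

lemma wact_plus: "wact T (w + w') f = wact T w (wact T w' f)"
 by (cases w; cases w') (simp add: wact_def)

lemma fact_bound: "finite A ==> Poly_Mapping.keys p \<subseteq> A ==> fact_act T p f = (\<Sum>w\<in>A. Poly_Mapping.lookup p w \<cdot> wact T w f)"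
 unfolding fact_act_def by (rule sum.mono_neutral_left) (auto simp: in_keys_iff)

lemma fact_add: "fact_act T (p + q) f = fact_act T p f + fact_act T q f"
 using Poly_Mapping.keys_add[of p q]
 by (simp add: fact_bound[of "Poly_Mapping.keys p \<union> Poly_Mapping.keys q"] lookup_add csc_add_left sum.distrib)

lemma fact_single: "fact_act T (Poly_Mapping.single w c) f = c \<cdot> wact T w f"
 by (subst fact_bound[of "{w}"]) auto

lemma fact_sum: "fact_act T (sum P A) f = (\<Sum>a\<in>A. fact_act T (P a) f)"
 by (induction A rule: infinite_finite_induct) (simp_all add: fact_add fact_act_def[of T 0])

lemma kop_sum: "cv.subspace S' ==> (!!a. a \<in> A ==> kop S S' (F a)) ==> kop S S' (%f. \<Sum>a\<in>A. F a f)"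
 by (induction A rule: infinite_finite_induct) (auto intro: kop_zero kop_add)

lemma kop_id: "kop S S (%f. f)"
 by (simp add: kop_def clin_def)

locale gens =
 fixes S :: "'a::cvec set" and T :: "gen => ('a dser) => 'a dser"
 assumes sub: "cv.subspace S" and kT: "!!x. kop S S (T x)"
begin

lemma kop_wact: "kop S S (wact T w)"
proof (cases w)
 case (Word xs)
 have "kop S S (wact T (Word xs))"
 proof (induction xs)
  case Nil
  show ?case using kop_id by (simp add: wact_def id_def)
 next
  case (Cons x xs)
  then show ?case using kop_comp[OF Cons.IH kT[of x]] by (simp add: wact_def comp_def)
 qed
 then show ?thesis using Word by simp
qed

sublocale free: kract S "fact_act T"
proof
 show k: "kop S S (fact_act T p)" for p
  unfolding fact_act_def[abs_def] by (intro kop_sum kop_scale kop_wact sub)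
 show "ract (MS S) (fact_act T)"
  unfolding ract_def
 proof (intro conjI allI ballI)
  fix f assume f: "f \<in> MS S"
  note c = clin_add[OF kop_clin[OF k]]
  show "fact_act T (p * q) f = fact_act T p (fact_act T q f)" for p q
  proof (rule poly_mapping_additive_eq[of "%p. fact_act T (p * q) f"])
   fix w a show "fact_act T (Poly_Mapping.single w a * q) f = fact_act T (Poly_Mapping.single w a) (fact_act T q f)"
   proof (rule poly_mapping_additive_eq[of "%q. fact_act T (Poly_Mapping.single w a * q) f"])
    show "fact_act T (Poly_Mapping.single w a) (fact_act T (p + q) f) =
      fact_act T (Poly_Mapping.single w a) (fact_act T p f) + fact_act T (Poly_Mapping.single w a) (fact_act T q f)" for p q
     using kop_in[OF k f] by (simp add: fact_add c)
    show "fact_act T (Poly_Mapping.single w a * Poly_Mapping.single w' b) f =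
      fact_act T (Poly_Mapping.single w a) (fact_act T (Poly_Mapping.single w' b) f)" for w' b
     using kop_in[OF kop_wact f] by (simp add: mult_single fact_single wact_plus clin_csc[OF kop_clin[OF kop_wact]] csc_csc)
   qed (simp only: distrib_left fact_add)
  qed (simp only: distrib_right fact_add, rule fact_add)
  have one: "(1 :: free_alg) = Poly_Mapping.single (Word []) 1" by (metis single_one zero_gword_def)
  show "fact_act T 1 f = f" by (subst one) (simp only: fact_single wact_simps csc_one)
 qed (simp_all add: kop_clin[OF k] fact_add)
qed (rule sub)

lemma Phi_gen: "f \<in> MS S ==> Phi (fact_act T) (gen_el x) f = T x f"
 by (simp add: gen_el_def free.Phi_const fact_single)

end

definition HCact :: "(gen => 'm::cvec => 'm) => complex poly poly => 'm => 'm" where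
 "HCact T = pact (pact csc (T Gen_C)) (T Gen_H)"

text \<open>Operators for the four generators subject to the defining relations. With \<open>X\<^sup>+X\<^sup>- = (C -
(H-1)\<^sup>2)/4\<close> times the unit relY, the operator Xe introduced below, which is
\<open>X\<^sup>+\<close> divided by a unit, completes \<open>X\<^sup>-\<close> and H to an
\<open>sl\<^sub>2\<close>-triple whose Casimir operator is C.\<close>

locale hops = gens S T for S :: "'a::cvec set" and T + fixes g :: nat
 assumes fdS: "fd S" and g1: "g \<ge> 1"
  and CXp: "!!f. f \<in> MS S ==> T Gen_C (T Gen_Xp f) = T Gen_Xp (T Gen_C f)"
  and CXm: "!!f. f \<in> MS S ==> T Gen_C (T Gen_Xm f) = T Gen_Xm (T Gen_C f)"
  and CH: "!!f. f \<in> MS S ==> T Gen_C (T Gen_H f) = T Gen_H (T Gen_C f)"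
  and HXp: "!!f. f \<in> MS S ==> T Gen_H (T Gen_Xp f) = T Gen_Xp (T Gen_H f) + 2 \<cdot> T Gen_Xp f"
  and HXm: "!!f. f \<in> MS S ==> T Gen_H (T Gen_Xm f) = T Gen_Xm (T Gen_H f) - 2 \<cdot> T Gen_Xm f"
  and XpXm: "!!f. f \<in> MS S ==> T Gen_Xp (T Gen_Xm f) = Phi (HCact T) (relG g 1) f"
  and XmXp: "!!f. f \<in> MS S ==> T Gen_Xm (T Gen_Xp f) = Phi (HCact T) (relG g (-1)) f"

lemma kop_pact: assumes S: "cv.subspace S" and a: "!!b. kop S S (\<alpha> b)" and T: "kop S S T" shows "kop S S (pact \<alpha> T p)"
proof -
 have "kop S S (%v. \<alpha> (Polynomial.coeff p i) ((T ^^ i) v))" for i by (rule kop_comp[OF kop_funpow[OF T] a])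
 then show ?thesis unfolding pact_def[abs_def] by (intro kop_sum S)
qed

lemma kop_csc: "cv.subspace S ==> kop S S (csc a)"
 using kract.ka[OF kract_csc] by blast

locale kpair = HCpair "MS S" c h for S :: "'a::cvec set" and c h +
 assumes S0: "cv.subspace S" and kc: "kop S S c" and kh: "kop S S h"
begin

sublocale ser: kract S act
proof
 show "kop S S (act b)" for b unfolding act_def by (intro kop_pact kop_csc kc kh S0)
qed (rule S0 ract_act)+

lemma ser_shift:
 assumes T: "kop S S T" and Tc: "!!v. v \<in> MS S ==> T (c v) = c (T v)"
  and hT: "!!v. v \<in> MS S ==> h (T v) = T (h v) + s \<cdot> T v" and v: "v \<in> MS S"
 shows "Phi act x (T v) = T (Phi act (hmapc (hshift s) x) v)"
proof (rule slin_eq[of "%x. Phi act x (T v)"])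
 show "slin (%x. T (Phi act (hmapc (hshift s) x) v))"
  by (rule slin_kop[OF slin_hmapc[OF rhom_hshift ser.Phi_slin[OF v]] T ser.Phi_in[OF v]])
 show "Phi act (hconst b) (T v) = T (Phi act (hmapc (hshift s) (hconst b)) v)" for b
  using act_shift[OF kop_clin[OF T] Tc hT v, of b] by (simp add: hmapc_hconst[OF rhom_hshift] ser.Phi_const v kop_in[OF T])
qed (rule ser.Phi_slin[OF kop_in[OF T v]])

lemma ser_commute:
 assumes T: "kop S S T" and Tc: "!!v. v \<in> MS S ==> T (c v) = c (T v)"
  and hT: "!!v. v \<in> MS S ==> h (T v) = T (h v)" and v: "v \<in> MS S"
 shows "Phi act x (T v) = T (Phi act x v)"
proof -
 have "hshift 0 p = p" for p by (simp add: hshift_def pcompose_idR)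
 then have "hmapc (hshift 0) x = x" by (intro hcoeff_eqI) simp
 then show ?thesis using ser_shift[OF T Tc _ v, of 0 x] hT by simp
qed

end

text \<open>The shift by 2 comes from moving the unit past \<open>X\<^sup>+\<close>, which raises H by 2.\<close>

definition Ucas :: "nat => complex poly poly fps fps" where "Ucas g = hmapc (hshift 2) (relY g)"

lemma hshift_hshift: "hshift s (hshift t p) = hshift (s + t) p"
proof -
 have "pcompose [:[:t:], 1:] [:[:s:], 1:] = [:[:s + t:], 1:]" by (simp add: pcompose_pCons algebra_simps)
 then show ?thesis unfolding hshift_def by (metis pcompose_assoc)
qed

lemma hshift_m2_2: "hmapc (hshift (-2)) (hmapc (hshift 2) x) = x"
proof (rule hcoeff_eqI)
 have "hshift 0 p = p" for p by (simp add: hshift_def pcompose_idR)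
 then show "hcoeff (hmapc (hshift (-2)) (hmapc (hshift 2) x)) k l = hcoeff x k l" for k l
  by (simp add: hshift_hshift)
qed

lemma Ucas_0: "g \<ge> 1 ==> hcoeff (Ucas g) 0 0 = 1"
 by (simp add: Ucas_def relY_0)

lemma Ucas_inv: "g \<ge> 1 ==> Ucas g * hinv cA (Ucas g) = 1"
 by (rule hinv[OF rhom_cA Ucas_0])

lemma relG_m1: assumes "g \<ge> 1"
 shows "relG g (-1) = hconst (cA (1/4) * (var_C - (var_H + 1) * (var_H + 1))) * Ucas g"
proof -
 have "hshift 2 (cA (1/4) * (var_C - (var_H - 1) * (var_H - 1))) = cA (1/4) * (var_C - (var_H + 1) * (var_H + 1))"
  unfolding rhom_simps[OF rhom_hshift] hshift_basic by (simp add: cA_numeral algebra_simps)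
 then show ?thesis unfolding relG_shift[OF assms] relG_1[OF assms] rhomD[OF rhom_hmapc[OF rhom_hshift]] hmapc_hconst[OF rhom_hshift] Ucas_def
  by simp
qed

context hops
begin

lemma sl2_HC: "kpair S (T Gen_C) (T Gen_H)"
 by unfold_locales (auto simp: subspace_MS sub kop_clin kT CH)

end

sublocale hops \<subseteq> hc: kpair S "T Gen_C" "T Gen_H"
 rewrites "HCpair.act (T Gen_C) (T Gen_H) = HCact T"
proof -
 show "kpair S (T Gen_C) (T Gen_H)" by (rule sl2_HC)
 then interpret kpair S "T Gen_C" "T Gen_H" .
 show "HCpair.act (T Gen_C) (T Gen_H) = HCact T" by (simp add: act_def HCact_def)
qed

context hops
begin

definition Xe where "Xe f = T Gen_Xp (Phi (HCact T) (hinv cA (Ucas g)) f)"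

lemma kXe: "kop S S Xe"
 unfolding Xe_def[abs_def] by (rule kop_comp[OF hc.ser.Phi_kop kT])

lemma Xp_Xe: "f \<in> MS S ==> T Gen_Xp f = Xe (Phi (HCact T) (Ucas g) f)"
 unfolding Xe_def
 by (subst hc.ser.Phi_mult[symmetric]) (simp_all add: mult.commute[of "hinv cA (Ucas g)"] Ucas_inv[OF g1] ract_one[OF hc.ser.ract_Phi])

lemma H_ser: "f \<in> MS S ==> T Gen_H (Phi (HCact T) x f) = Phi (HCact T) x (T Gen_H f)"
 by (rule hc.ser_commute[OF kT, symmetric]) (simp_all add: CH)

lemma act_quarter:
 assumes "f \<in> MS S"
 shows "HCact T (cA (1/4) * (var_C - (var_H - 1) * (var_H - 1))) f = (1/4) \<cdot> (T Gen_C f - (T Gen_H (T Gen_H f - f) - (T Gen_H f - f)))"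
  "HCact T (cA (1/4) * (var_C - (var_H + 1) * (var_H + 1))) f = (1/4) \<cdot> (T Gen_C f - (T Gen_H (T Gen_H f + f) + (T Gen_H f + f)))"
 using assms by (simp_all only: hc.act_mult hc.act_diff hc.act_add hc.act_C hc.act_H hc.act_one hc.act_cA hc.act_in hc.HC_simps)

lemma XeXm: assumes f: "f \<in> MS S"
 shows "Xe (T Gen_Xm f) = (1/4) \<cdot> (T Gen_C f - (T Gen_H (T Gen_H f - f) - (T Gen_H f - f)))"
proof -
 let ?V = "hmapc (hshift (-2)) (hinv cA (Ucas g))"
 have "Xe (T Gen_Xm f) = T Gen_Xp (T Gen_Xm (Phi (HCact T) ?V f))"
  unfolding Xe_def by (subst hc.ser_shift[OF kT _ _ f, where s = "-2"]) (simp_all add: CXm HXm)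
 also have "\<dots> = Phi (HCact T) (relG g 1 * ?V) f"
  by (simp add: XpXm hc.ser.Phi_in f hc.ser.Phi_mult)
 also have "relG g 1 * ?V = hconst (cA (1/4) * (var_C - (var_H - 1) * (var_H - 1)))"
 proof -
  have "relY g * ?V = hmapc (hshift (-2)) (Ucas g * hinv cA (Ucas g))"
   unfolding rhomD[OF rhom_hmapc[OF rhom_hshift]] by (simp add: Ucas_def hshift_m2_2)
  also have "\<dots> = 1" unfolding Ucas_inv[OF g1] by (rule rhomD(1)[OF rhom_hmapc[OF rhom_hshift]])
  finally show ?thesis unfolding relG_1[OF g1] mult.assoc by simp
 qed
 finally show ?thesis using act_quarter(1)[OF f] by (simp only: hc.ser.Phi_const[OF f])
qed

lemma XmXe: assumes f: "f \<in> MS S"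
 shows "T Gen_Xm (Xe f) = (1/4) \<cdot> (T Gen_C f - (T Gen_H (T Gen_H f + f) + (T Gen_H f + f)))"
proof -
 have "T Gen_Xm (Xe f) = Phi (HCact T) (relG g (-1) * hinv cA (Ucas g)) f"
  unfolding Xe_def by (simp add: XmXp hc.ser.Phi_in f hc.ser.Phi_mult)
 also have "relG g (-1) * hinv cA (Ucas g) = hconst (cA (1/4) * (var_C - (var_H + 1) * (var_H + 1)))"
  unfolding relG_m1[OF g1] mult.assoc Ucas_inv[OF g1] by simp
 finally show ?thesis using act_quarter(2)[OF f] by (simp only: hc.ser.Phi_const[OF f])
qed

lemma quarter_4: "(1/4) \<cdot> (a + a + a + a) = (a :: 'm::cvec)"
 by (simp add: csc_4[symmetric] csc_csc)

lemma triple: "sl2_deformed S Xe (T Gen_Xm) (T Gen_H)"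
proof -
 note [simp] = kop_in[OF kT] kop_in[OF kXe] hc.HC_simps hc.ser.Phi_in
 have "sl2_module (MS S) Xe (T Gen_Xm) (T Gen_H)"
 proof
  fix f assume f: "f \<in> MS S"
  show "T Gen_H (Xe f) = Xe (T Gen_H f) + 2 \<cdot> Xe f"
   unfolding Xe_def using f by (simp add: HXp H_ser)
  show "T Gen_H (T Gen_Xm f) = T Gen_Xm (T Gen_H f) - 2 \<cdot> T Gen_Xm f" by (rule HXm[OF f])
  have "Xe (T Gen_Xm f) - T Gen_Xm (Xe f) = (1/4) \<cdot> (T Gen_H f + T Gen_H f + T Gen_H f + T Gen_H f)"
   unfolding XeXm[OF f] XmXe[OF f] cv.scale_right_diff_distrib[symmetric]
   using f by (simp add: hc.h_simps algebra_simps)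
  then show "Xe (T Gen_Xm f) - T Gen_Xm (Xe f) = T Gen_H f" unfolding quarter_4 .
 qed (auto simp: subspace_MS sub kop_clin kT kXe)
 then show ?thesis
  by (intro sl2_deformed.intro sl2_deformed_axioms.intro fdS kXe kT)
qed

lemma cas_C: assumes f: "f \<in> MS S" shows "sl2_module.cas Xe (T Gen_Xm) (T Gen_H) f = T Gen_C f"
proof -
 interpret t: sl2_deformed S Xe "T Gen_Xm" "T Gen_H" by (rule triple)
 show ?thesis unfolding t.cas_def XeXm[OF f] using f by (simp add: csc_csc csc_2 hc.h_simps)
qed

lemma lim0_Xe: assumes "v \<in> S" shows "lim0 Xe v = lim0 (T Gen_Xp) v"
proof -
 note mv = MS_mconst[OF sub assms]
 have "Phi (HCact T) (hinv cA (Ucas g)) (mconst v) 0 0 = v"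
  by (simp add: hc.ser.Phi_00[OF mv] hinv_0[OF rhom_cA] hc.act_one[OF mv])
 then have "lim0 Xe v = lim0 (T Gen_Xp) v"
  unfolding lim0_def[of Xe] Xe_def using kop_00[OF sub kT hc.ser.Phi_in[OF mv]] by simp
 then show ?thesis .
qed

end

text \<open>C is the Casimir operator of the triple and \<open>X\<^sup>+\<close> is Xe times a
series in H and C.\<close>

lemma hops_intertwine:
 assumes "hops S T g" "hops S' T' g" and \<phi>: "kop S S' \<phi>"
  and E: "!!x. x \<in> MS S ==> \<phi> (hops.Xe T g x) = hops.Xe T' g (\<phi> x)"
  and F: "!!x. x \<in> MS S ==> \<phi> (T Gen_Xm x) = T' Gen_Xm (\<phi> x)" and H: "!!x. x \<in> MS S ==> \<phi> (T Gen_H x) = T' Gen_H (\<phi> x)"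
  and x: "x \<in> MS S"
 shows "\<phi> (T a x) = T' a (\<phi> x)"
proof -
 interpret A: hops S T g by fact
 interpret B: hops S' T' g by fact
 interpret a: sl2_deformed S A.Xe "T Gen_Xm" "T Gen_H" by (rule A.triple)
 interpret b: sl2_deformed S' B.Xe "T' Gen_Xm" "T' Gen_H" by (rule B.triple)
 note c = kop_clin[OF \<phi>]
 have C: "\<phi> (T Gen_C x) = T' Gen_C (\<phi> x)" if x: "x \<in> MS S" for x
  unfolding A.cas_C[OF x, symmetric] B.cas_C[OF kop_in[OF \<phi> x], symmetric] a.cas_def b.cas_def
  using x by (simp add: clin_add[OF c] clin_diff[OF c a.S] clin_csc[OF c] E F H)
 have C': "\<phi> (pact csc (T Gen_C) p y) = pact csc (T' Gen_C) p (\<phi> y)" if "y \<in> MS S" for p y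
  by (rule pact_commute[OF A.hc.S ract_csc[OF A.hc.S] A.hc.c _ c _ _ that])
   (rule clin_csc[OF A.hc.c], assumption, rule clin_csc[OF c], assumption, rule C, assumption)
 have hc: "\<phi> (HCact T p y) = HCact T' p (\<phi> y)" if "y \<in> MS S" for p y
  unfolding HCact_def
  by (rule pact_commute[OF A.hc.S A.hc.ract_C A.hc.h _ c _ _ that, where \<alpha>' = "pact csc (T' Gen_C)"])
   (rule A.hc.h_C, assumption, rule C', assumption, rule H, assumption)
 have ser: "\<phi> (Phi (HCact T) p y) = Phi (HCact T') p (\<phi> y)" if "y \<in> MS S" for p y
  by (rule Phi_intertwine[OF A.hc.ser.kract_axioms B.hc.ser.kract_axioms \<phi> _ that]) (rule hc)
 have "\<phi> (T Gen_Xp x) = T' Gen_Xp (\<phi> x)"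
  using x by (simp add: A.Xp_Xe B.Xp_Xe kop_in[OF \<phi>] E A.hc.ser.Phi_in ser)
 then show ?thesis using C F H x by (cases a) auto
qed

lemma hops_lift:
 assumes A: "hops S T g" and B: "hops S' T' g" and \<theta>: "clin S S' \<theta>"
  and lim: "!!v a. v \<in> S ==> a ~= Gen_C ==> \<theta> (lim0 (T a) v) = lim0 (T' a) (\<theta> v)"
 shows "\<exists>\<phi>. kop S S' \<phi> & (ALL a. \<forall>x\<in>MS S. \<phi> (T a x) = T' a (\<phi> x)) & (\<forall>v\<in>S. lim0 \<phi> v = \<theta> v)"
proof -
 interpret A: hops S T g by fact
 interpret B: hops S' T' g by fact
 obtain \<phi> where \<phi>: "kop S S' \<phi>" "!!x. x \<in> MS S ==> \<phi> (A.Xe x) = B.Xe (\<phi> x) & \<phi> (T Gen_Xm x) = T' Gen_Xm (\<phi> x) & \<phi> (T Gen_H x) = T' Gen_H (\<phi> x)"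
  "!!v. v \<in> S ==> lim0 \<phi> v = \<theta> v"
  using rigidity[OF A.triple B.triple \<theta>] lim A.lim0_Xe B.lim0_Xe clin_in[OF \<theta>] by (metis gen.distinct)
 have "\<phi> (T a x) = T' a (\<phi> x)" if "x \<in> MS S" for a x
  by (rule hops_intertwine[OF A B \<phi>(1) _ _ _ that]) (auto simp: \<phi>(2))
 then show ?thesis using \<phi> by blast
qed

definition ext0 :: "('a => 'b) => ('a dser) => 'b dser" where
 "ext0 \<theta> = (%f k l. \<theta> (f k l))"

lemma ext0_kop: assumes "cv.subspace S" "clin S S' \<theta>" shows "kop S S' (ext0 \<theta>)"
 unfolding kop_def clin_def ext0_def using clin_0[OF assms(2,1)]
 by (auto simp: MS_def fun_eq_iff hsh_def vsh_def clin_add[OF assms(2)] clin_csc[OF assms(2)] clin_in[OF assms(2)] split: nat.splits)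

text \<open>The deformation keeps H, C, \<open>X\<^sup>-\<close> constant in h and
h' and multiplies \<open>X\<^sup>+\<close> by the unit.\<close>

definition deform_ops :: "nat => ('a::cvec => 'a) => ('a => 'a) => ('a => 'a) => gen => ('a dser) => 'a dser" where
 "deform_ops g e f h x = (case x of Gen_Xm => ext0 f | Gen_H => ext0 h | Gen_C => ext0 (sl2_module.cas e f h)
   | Gen_Xp => (%v. ext0 e (Phi (pact (pact csc (ext0 (sl2_module.cas e f h))) (ext0 h)) (Ucas g) v)))"

lemma deform_hops:
 assumes m: "sl2_module S e f h" and fd: "fd S" and g: "g \<ge> 1"
 shows "hops S (deform_ops g e f h) g" "!!v. v \<in> S ==> lim0 (deform_ops g e f h Gen_Xp) v = e v"
proof -
 interpret m: sl2_module S e f h by fact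
 note k = ext0_kop[OF m.S m.e] ext0_kop[OF m.S m.f] ext0_kop[OF m.S m.h] ext0_kop[OF m.S m.cas_clin]
 have M: "sl2_module (MS S) (ext0 e) (ext0 f) (ext0 h)"
  by unfold_locales (auto simp: subspace_MS m.S kop_clin k, auto simp: ext0_def fun_eq_iff MS_D m.he m.hf m.ef)
 interpret M: sl2_module "MS S" "ext0 e" "ext0 f" "ext0 h" by (rule M)
 have casM: "ext0 m.cas = M.cas"
  by (intro ext, subst M.cas_def) (simp add: ext0_def m.cas_def)
 interpret P: kpair S "ext0 m.cas" "ext0 h"
  rewrites "HCpair.act (ext0 m.cas) (ext0 h) = M.act" and "HCpair (MS S) (ext0 m.cas) (ext0 h) = True"
 proof -
  show "kpair S (ext0 m.cas) (ext0 h)"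
   by (intro kpair.intro kpair_axioms.intro k m.S) (unfold casM, rule M.HCpair_axioms)
 qed (simp_all add: casM M.HCpair_axioms)
 let ?T = "deform_ops g e f h"
 have act: "pact (pact csc (ext0 m.cas)) (ext0 h) = M.act" by (simp add: M.act_def casM)
 have T: "?T Gen_Xm = ext0 f" "?T Gen_H = ext0 h" "?T Gen_C = M.cas" "?T Gen_Xp = (%v. ext0 e (Phi M.act (Ucas g) v))"
  by (simp_all only: deform_ops_def gen.case casM M.act_def)
 have hca: "HCact ?T = M.act" by (simp add: HCact_def T M.act_def)
 have com: "ext0 h (Phi M.act x v) = Phi M.act x (ext0 h v)" "M.cas (Phi M.act x v) = Phi M.act x (M.cas v)" if "v \<in> MS S" for x v
  using P.ser_commute[OF k(3) _ _ that, of x] P.ser_commute[OF k(4) _ _ that, of x] unfolding casM by (simp_all add: M.h_cas that)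
 show "hops S ?T g"
 proof (intro hops.intro gens.intro hops_axioms.intro)
  show "cv.subspace S" "fd S" "g \<ge> 1" by (fact m.S fd g)+
  show "kop S S (?T x)" for x
   using k kop_comp[OF P.ser.Phi_kop k(1)] by (cases x) (simp_all add: T casM)
  fix v assume v: "v \<in> MS S"
  note [simp] = P.ser.Phi_in[OF v] P.ser.Phi_in
  show "?T Gen_C (?T Gen_Xp v) = ?T Gen_Xp (?T Gen_C v)" using v by (simp add: T M.e_cas[symmetric] com)
  show "?T Gen_C (?T Gen_Xm v) = ?T Gen_Xm (?T Gen_C v)" using v by (simp add: T M.f_cas)
  show "?T Gen_C (?T Gen_H v) = ?T Gen_H (?T Gen_C v)" using v by (simp add: T M.h_cas)
  show "?T Gen_H (?T Gen_Xp v) = ?T Gen_Xp (?T Gen_H v) + 2 \<cdot> ?T Gen_Xp v" using v by (simp add: T M.he com)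
  show "?T Gen_H (?T Gen_Xm v) = ?T Gen_Xm (?T Gen_H v) - 2 \<cdot> ?T Gen_Xm v" using v by (simp add: T M.hf)
  have q: "ext0 e (ext0 f w) = M.act (cA (1/4) * (var_C - (var_H - 1) * (var_H - 1))) w"
   "ext0 f (ext0 e w) = M.act (cA (1/4) * (var_C - (var_H + 1) * (var_H + 1))) w" if w: "w \<in> MS S" for w
  proof -
   have r: "var_C - (var_H - 1) * (var_H - 1) = M.rtA 0" "var_C - (var_H + 1) * (var_H + 1) = M.rtB 0"
    by (simp_all add: M.rtA_def M.rtB_def cA_simps)
   show "ext0 e (ext0 f w) = M.act (cA (1/4) * (var_C - (var_H - 1) * (var_H - 1))) w"
    "ext0 f (ext0 e w) = M.act (cA (1/4) * (var_C - (var_H + 1) * (var_H + 1))) w"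
    unfolding r M.act_mult[OF w] M.act_rtA0[OF w] M.act_rtB0[OF w] using w by (simp_all add: M.act_cA csc_csc)
  qed
  have "?T Gen_Xp (?T Gen_Xm v) = ext0 e (ext0 f (Phi M.act (relY g) v))"
   unfolding T by (subst P.ser_shift[OF k(2) _ _ v, where s = "-2"])
    (simp_all add: casM M.f_cas M.hf Ucas_def hshift_m2_2 csc_2)
  also have "\<dots> = Phi M.act (relG g 1) v"
   unfolding relG_1[OF g] using v by (simp add: q P.ser.Phi_mult P.ser.Phi_const)
  finally show "?T Gen_Xp (?T Gen_Xm v) = Phi (HCact ?T) (relG g 1) v" unfolding hca .
  have "?T Gen_Xm (?T Gen_Xp v) = Phi M.act (relG g (-1)) v"
   unfolding relG_m1[OF g] T using v by (simp add: q P.ser.Phi_mult P.ser.Phi_const)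
  then show "?T Gen_Xm (?T Gen_Xp v) = Phi (HCact ?T) (relG g (-1)) v" unfolding hca .
 qed
 fix v assume v: "v \<in> S"
 note mv = MS_mconst[OF m.S v]
 have "Phi M.act (Ucas g) (mconst v) 0 0 = v"
  by (simp add: P.ser.Phi_00[OF mv] Ucas_0[OF g] M.act_one[OF mv])
 then show "lim0 (?T Gen_Xp) v = e v" by (simp add: lim0_def T ext0_def)
qed

section \<open>The algebra \<open>U\<close> and its modules\<close>

lemma free_ring_simps [simp]:
 "carrier free_ring = UNIV" "x \<otimes>\<^bsub>free_ring\<^esub> y = x * y" "x \<oplus>\<^bsub>free_ring\<^esub> y = x + y"
 "\<one>\<^bsub>free_ring\<^esub> = 1" "\<zero>\<^bsub>free_ring\<^esub> = 0"
 by (simp_all add: free_ring_def ring_of_type_algebra_def)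

lemma ring_free_ring: "ring free_ring"
proof -
 have "EX y. x + y = 0" for x :: "free_alg fps fps" using add.right_inverse by blast
 then show ?thesis
  unfolding free_ring_def ring_of_type_algebra_def using add.right_inverse
  by unfold_locales (auto simp: algebra_simps Units_def)
qed

interpretation FR: ring free_ring by (rule ring_free_ring)

lemma free_ring_uminus [simp]: "\<ominus>\<^bsub>free_ring\<^esub> x = - x"
 by (rule FR.minus_equality) simp_all

lemma free_ring_minus [simp]: "x \<ominus>\<^bsub>free_ring\<^esub> y = x - y"
 by (simp add: a_minus_def)

lemma ideal_free_ringI:
 assumes "0 \<in> I" "!!x y. x \<in> I ==> y \<in> I ==> x + y \<in> I" "!!a x. x \<in> I ==> a * x \<in> I" "!!a x. x \<in> I ==> x * a \<in> I"
 shows "ideal I free_ring"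
proof (rule idealI[OF ring_free_ring])
 have neg: "- x \<in> I" if "x \<in> I" for x using assms(3)[OF that, of "-1"] by simp
 have inv: "inv\<^bsub>add_monoid free_ring\<^esub> x = - x" for x using free_ring_uminus[of x, unfolded a_inv_def] .
 show "subgroup I (add_monoid free_ring)"
 proof (rule subgroup.intro)
  show "inv\<^bsub>add_monoid free_ring\<^esub> x \<in> I" if "x \<in> I" for x unfolding inv by (rule neg[OF that])
 qed (use assms in auto)
qed (use assms in auto)

lemma ideal_free_ringD:
 assumes "ideal I free_ring"
 shows "0 \<in> I" "x \<in> I ==> y \<in> I ==> x + y \<in> I" "x \<in> I ==> a * x \<in> I" "x \<in> I ==> x * a \<in> I"
 using additive_subgroup.zero_closed[OF ideal.axioms(1)[OF assms]] additive_subgroup.a_closed[OF ideal.axioms(1)[OF assms]]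
  ideal.I_l_closed[OF assms] ideal.I_r_closed[OF assms] by simp_all

lemma adic_closureD: "x \<in> adic_closure I ==> \<exists>y\<in>I. ALL k l. k + l < n --> hcoeff x k l = hcoeff y k l"
 by (simp add: adic_closure_def)

lemma adic_closure_ideal: assumes "ideal I free_ring" shows "ideal (adic_closure I) free_ring"
proof (rule ideal_free_ringI)
 note J = ideal_free_ringD[OF assms]
 show "0 \<in> adic_closure I" unfolding adic_closure_def using J(1) by blast
 fix x y a assume x: "x \<in> adic_closure I"
 show "x + y \<in> adic_closure I" if yy: "y \<in> adic_closure I"
  unfolding adic_closure_def
 proof (rule CollectI, rule allI)
  fix n
  obtain x' where "x' \<in> I" "ALL k l. k + l < n --> hcoeff x k l = hcoeff x' k l"
   using adic_closureD[OF x] by blast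
  moreover obtain y' where "y' \<in> I" "ALL k l. k + l < n --> hcoeff y k l = hcoeff y' k l"
   using adic_closureD[OF yy] by blast
  ultimately show "\<exists>z\<in>I. ALL k l. k + l < n --> hcoeff (x + y) k l = hcoeff z k l"
   using J(2) by (intro bexI[of _ "x' + y'"]) auto
 qed
 have "a * x \<in> adic_closure I & x * a \<in> adic_closure I"
  unfolding adic_closure_def
 proof (rule conjI; rule CollectI; rule allI)
  fix n
  obtain x' where x': "x' \<in> I" "!!k l. k + l < n ==> hcoeff x k l = hcoeff x' k l"
   using adic_closureD[OF x] by blast
  have "hcoeff (a * x) k l = hcoeff (a * x') k l" "hcoeff (x * a) k l = hcoeff (x' * a) k l" if "k + l < n" for k l
   unfolding hcoeff_mult using that by (auto intro!: sum.cong simp: x'(2))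
  then show "\<exists>z\<in>I. ALL k l. k + l < n --> hcoeff (a * x) k l = hcoeff z k l"
   "\<exists>z\<in>I. ALL k l. k + l < n --> hcoeff (x * a) k l = hcoeff z k l" using J(3,4)[OF x'(1)] by blast+
 qed
 then show "a * x \<in> adic_closure I" "x * a \<in> adic_closure I" by auto
qed

lemma ideal_rel_ideal: "ideal (rel_ideal g) free_ring"
 unfolding rel_ideal_def by (rule adic_closure_ideal, rule FR.genideal_ideal) simp

lemma relators_rel_ideal: "x \<in> relators g ==> x \<in> rel_ideal g"
 using FR.genideal_self[of "relators g"] unfolding rel_ideal_def adic_closure_def by auto

lemma ucls_in [simp]: "ucls g x \<in> carrier (Uhh g)"
 and ucls_mult: "ucls g x \<otimes>\<^bsub>Uhh g\<^esub> ucls g y = ucls g (x * y)"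
 and ucls_add: "ucls g x \<oplus>\<^bsub>Uhh g\<^esub> ucls g y = ucls g (x + y)"
 and ucls_one: "\<one>\<^bsub>Uhh g\<^esub> = ucls g 1"
 using ring_hom_closed[OF ideal.rcos_ring_hom[OF ideal_rel_ideal], of x g]
  ring_hom_mult[OF ideal.rcos_ring_hom[OF ideal_rel_ideal], of x y g]
  ring_hom_add[OF ideal.rcos_ring_hom[OF ideal_rel_ideal], of x y g]
  ring_hom_one[OF ideal.rcos_ring_hom[OF ideal_rel_ideal], of g]
 by (simp_all add: ucls_def Uhh_def)

lemma ucls_surj: "u \<in> carrier (Uhh g) ==> EX x. u = ucls g x"
 unfolding Uhh_def ucls_def by (auto simp: FactRing_def A_RCOSETS_def RCOSETS_def a_r_coset_def)

lemma ucls_eq: "ucls g x = ucls g y \<longleftrightarrow> x - y \<in> rel_ideal g"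
 using FR.quotient_eq_iff_same_a_r_cos[OF ideal_rel_ideal, of x y g] by (simp add: ucls_def)

lemma hrepD:
 assumes W: "hrep_obj g W" and f: "f \<in> psc (hspace W)"
 shows "hact W (ucls g x) \<in> lin_maps KR (ps_mod (hspace W)) (ps_mod (hspace W))"
  "hact W (ucls g (x + y)) f = hact W (ucls g x) f \<oplus>\<^bsub>ps_mod (hspace W)\<^esub> hact W (ucls g y) f"
  "hact W (ucls g (x * y)) f = hact W (ucls g x) (hact W (ucls g y) f)"
  "hact W (ucls g 1) f = f"
  "hact W (uscalar g c) f = c \<odot>\<^bsub>ps_mod (hspace W)\<^esub> f"
proof -
 let ?E = "End_ring KR (ps_mod (hspace W))"
 have h: "hact W \<in> ring_hom (Uhh g) ?E" and s: "hact W (uscalar g c) = (\<lambda>f\<in>psc (hspace W). c \<odot>\<^bsub>ps_mod (hspace W)\<^esub> f)"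
  using W by (auto simp: hrep_obj_def)
 show "hact W (ucls g x) \<in> lin_maps KR (ps_mod (hspace W)) (ps_mod (hspace W))"
  using ring_hom_closed[OF h, of "ucls g x"] by (simp add: End_ring_def)
 show "hact W (ucls g (x + y)) f = hact W (ucls g x) f \<oplus>\<^bsub>ps_mod (hspace W)\<^esub> hact W (ucls g y) f"
  using ring_hom_add[OF h, of "ucls g x" "ucls g y"] f by (simp add: End_ring_def ucls_add)
 show "hact W (ucls g (x * y)) f = hact W (ucls g x) (hact W (ucls g y) f)"
  using ring_hom_mult[OF h, of "ucls g x" "ucls g y"] f by (simp add: End_ring_def ucls_mult compose_def)
 show "hact W (ucls g 1) f = f" using ring_hom_one[OF h] f by (simp add: End_ring_def ucls_one)
 show "hact W (uscalar g c) f = c \<odot>\<^bsub>ps_mod (hspace W)\<^esub> f" using s f by simp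
qed

definition emod :: "'a::cvec set => (complex, 'a) module" where
 "emod S = \<lparr>carrier = S, mult = undefined, one = undefined, ring.zero = 0, ring.add = (+), module.smult = csc\<rparr>"

lemma emod_simps [simp]: "carrier (emod S) = S" "\<zero>\<^bsub>emod S\<^esub> = 0" "x \<oplus>\<^bsub>emod S\<^esub> y = x + y" "c \<odot>\<^bsub>emod S\<^esub> x = c \<cdot> x"
 by (simp_all add: emod_def)

lemma CR_simps [simp]: "carrier CR = UNIV" "x \<otimes>\<^bsub>CR\<^esub> y = x * y" "x \<oplus>\<^bsub>CR\<^esub> y = x + y" "\<one>\<^bsub>CR\<^esub> = 1" "\<zero>\<^bsub>CR\<^esub> = 0"
 by (simp_all add: CR_def ring_of_type_algebra_def)

lemma KR_simps [simp]: "carrier KR = UNIV"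
 by (simp add: KR_def ring_of_type_algebra_def)

lemma cring_CR: "cring CR" unfolding CR_def by (rule cring_from_type_algebra)

lemma abelian_group_emod: assumes "cv.subspace S" shows "abelian_group (emod S)"
proof (rule abelian_groupI)
 show "\<exists>y\<in>carrier (emod S). y \<oplus>\<^bsub>emod S\<^esub> x = \<zero>\<^bsub>emod S\<^esub>" if "x \<in> carrier (emod S)" for x
  using that cv.subspace_neg[OF assms] by (auto intro!: bexI[of _ "- x"])
qed (use assms cv.subspace_add cv.subspace_0 in \<open>auto simp: add.assoc add.commute\<close>)

lemma module_emod: "cv.subspace S ==> Module.module CR (emod S)"
 by (rule moduleI[OF cring_CR abelian_group_emod])
   (auto simp: cv.subspace_scale csc_add_left csc_add_right csc_csc)

lemma finsum_emod: assumes "cv.subspace S" "!!i. i \<in> I ==> F i \<in> S" shows "finsum (emod S) F I = sum F I"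
proof -
 interpret abelian_group "emod S" by (rule abelian_group_emod[OF assms(1)])
 show ?thesis using assms(2)
 proof (induction I rule: infinite_finite_induct)
  case (infinite A)
  then show ?case by (simp add: finsum_infinite)
 next
  case (insert x A)
  then show ?case by (subst finsum_insert) auto
 qed simp
qed

lemma ps_mod_emod [simp]:
 "psc (emod S) = MS S" "\<zero>\<^bsub>ps_mod (emod S)\<^esub> = 0" "f \<oplus>\<^bsub>ps_mod (emod S)\<^esub> f' = f + f'"
 by (auto simp: ps_mod_def MS_def fun_eq_iff)

lemma ps_smult: assumes "cv.subspace S" "f \<in> MS S" shows "c \<odot>\<^bsub>ps_mod (emod S)\<^esub> f = Phi csc c f"
proof (intro ext)
 fix k l
 have 1: "(\<Oplus>\<^bsub>emod S\<^esub>j\<in>{..l}. hcoeff c i j \<odot>\<^bsub>emod S\<^esub> f (k - i) (l - j)) = (\<Sum>j\<le>l. hcoeff c i j \<cdot> f (k - i) (l - j))" for i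
  using assms by (subst finsum_emod) (auto simp: cv.subspace_scale MS_D)
 have "(c \<odot>\<^bsub>ps_mod (emod S)\<^esub> f) k l = (\<Oplus>\<^bsub>emod S\<^esub>i\<in>{..k}. (\<Sum>j\<le>l. hcoeff c i j \<cdot> f (k - i) (l - j)))"
  unfolding 1[symmetric] by (simp add: ps_mod_def)
 also have "\<dots> = (\<Sum>i\<le>k. \<Sum>j\<le>l. hcoeff c i j \<cdot> f (k - i) (l - j))"
  using assms by (intro finsum_emod) (auto intro!: cv.subspace_sum simp: cv.subspace_scale MS_D)
 finally show "(c \<odot>\<^bsub>ps_mod (emod S)\<^esub> f) k l = Phi csc c f k l" by (simp add: Phi_def)
qed

lemma ps_const_emod [simp]: "ps_const (emod S) v = mconst v"
 by (intro ext) (simp add: ps_const_def mconst_def)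

lemma lin_maps_emod:
 assumes "cv.subspace S" "cv.subspace S'"
 shows "T \<in> lin_maps KR (ps_mod (emod S)) (ps_mod (emod S')) \<longleftrightarrow> T \<in> extensional (MS S) & kop S S' T"
 unfolding kop_iff_linear[OF assms] lin_maps_def
 by (auto simp: PiE_iff ps_smult[OF assms(1)] ps_smult[OF assms(2)] intro!: funcsetI)

lemma fin_dim_emod: assumes "fd S" shows "fin_dim (emod S)"
proof -
 note S = fd_subspace[OF assms]
 obtain B where B: "B \<subseteq> S" "cv.independent B" "S \<subseteq> cv.span B" using cv.basis_exists[of S] by metis
 have fin: "finite B"
  using cv.independent_span_bound[OF _ B(2)] assms B(1) by (auto simp: fd_def)
 show ?thesis unfolding fin_dim_def
 proof (intro exI[of _ B] conjI ballI)
  fix v assume "v \<in> carrier (emod S)"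
  then obtain u where "v = (\<Sum>b\<in>B. u b \<cdot> b)" using B cv.span_finite[OF fin] by auto
  then show "EX c. v = (\<Oplus>\<^bsub>emod S\<^esub>b\<in>B. c b \<odot>\<^bsub>emod S\<^esub> b)"
   using B cv.subspace_scale[OF S] by (intro exI[of _ u]) (subst finsum_emod[OF S], auto)
 qed (use fin B in auto)
qed

lemma fd_fin_dim: assumes "fin_dim (emod S)" and S: "cv.subspace S" shows "fd S"
proof -
 obtain B where B: "finite B" "B \<subseteq> S" "!!v. v \<in> S ==> EX c. v = (\<Oplus>\<^bsub>emod S\<^esub>b\<in>B. c b \<odot>\<^bsub>emod S\<^esub> b)"
  using assms(1) by (auto simp: fin_dim_def)
 have "v \<in> cv.span B" if vS: "v \<in> S" for v
 proof -
  obtain c where "v = (\<Oplus>\<^bsub>emod S\<^esub>b\<in>B. c b \<odot>\<^bsub>emod S\<^esub> b)" using B(3)[OF vS] by blast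
  also have "\<dots> = (\<Sum>b\<in>B. c b \<cdot> b)" using B cv.subspace_scale[OF S] by (subst finsum_emod[OF S]) auto
  finally show ?thesis by (simp add: cv.span_sum cv.span_scale cv.span_base)
 qed
 then show ?thesis unfolding fd_def using S B(1) by blast
qed

definition hgen :: "nat => 'v hrep => gen => ('v dser) => 'v dser" where
 "hgen g W x = hact W (ucls g (gen_el x))"

lemma uscalar_var: "uscalar g var_h = ucls g var_h" "uscalar g var_h' = ucls g var_h'" "uscalar g (hconst c) = ucls g (hconst (Poly_Mapping.single 0 c))"
proof -
 have "hseries (%k l. Poly_Mapping.single 0 (hcoeff var_h k l)) = (var_h :: free_alg fps fps)"
  by (rule hcoeff_eqI) (simp add: hcoeff_var_h)
 then show "uscalar g var_h = ucls g var_h" by (simp add: uscalar_def)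
 have "hseries (%k l. Poly_Mapping.single 0 (hcoeff var_h' k l)) = (var_h' :: free_alg fps fps)"
  by (rule hcoeff_eqI) (simp add: hcoeff_var_h')
 then show "uscalar g var_h' = ucls g var_h'" by (simp add: uscalar_def)
 have "hseries (%k l. Poly_Mapping.single 0 (hcoeff (hconst c) k l)) = (hconst (Poly_Mapping.single 0 c) :: free_alg fps fps)"
  by (rule hcoeff_eqI) (simp add: hcoeff_hconst)
 then show "uscalar g (hconst c) = ucls g (hconst (Poly_Mapping.single 0 c))" by (simp add: uscalar_def)
qed

lemma Phi_csc_var:
 assumes "cv.subspace S" "f \<in> MS S"
 shows "Phi csc var_h f = hsh f" "Phi csc var_h' f = vsh f" "Phi csc (hconst a) f = a \<cdot> f"
proof -
 interpret k: kract S csc by (rule kract_csc[OF assms(1)])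
 show "Phi csc var_h f = hsh f" "Phi csc var_h' f = vsh f"
  using k.Phi_slin[OF assms(2)] k.Phi_const[OF assms(2), of 1] unfolding slin_def by (metis hconst_1 mult.right_neutral csc_one)+
 show "Phi csc (hconst a) f = a \<cdot> f" by (rule k.Phi_const[OF assms(2)])
qed

text \<open>Linearity over the double series forces the action to be continuous: an element of the free algebra acts by the series
of its coefficients, each of which acts through words in the four operators.\<close>

lemma hrep_gens:
 assumes W: "hrep_obj g W" and V: "hspace W = emod S" and S: "cv.subspace S"
 shows "gens S (hgen g W)" "f \<in> MS S ==> hact W (ucls g x) f = Phi (fact_act (hgen g W)) x f"
proof -
 note D = hrepD[OF W, unfolded V ps_mod_emod]
 have k: "kop S S (hact W (ucls g x))" for x
  using D(1)[of 0 x] cv.subspace_0[OF subspace_MS[OF S]] lin_maps_emod[OF S S] by blast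
 show G: "gens S (hgen g W)" unfolding hgen_def by unfold_locales (auto simp: S k)
 interpret gens S "hgen g W" by (rule G)
 fix f assume f: "f \<in> MS S"
 have "hact W (ucls g (hconst p)) f = fact_act (hgen g W) p f" for p
 proof (rule poly_mapping_additive_eq[of "%p. hact W (ucls g (hconst p)) f" "%p. fact_act (hgen g W) p f"])
  fix w c
  obtain xs where w: "w = Word xs" by (cases w)
  have "hact W (ucls g (hconst (Poly_Mapping.single (Word xs) c))) f = c \<cdot> wact (hgen g W) (Word xs) f"
  proof (induction xs)
   case Nil
   have "hact W (ucls g (hconst (Poly_Mapping.single (Word []) c))) f = hact W (uscalar g (hconst c)) f"
    by (simp add: uscalar_var zero_gword_def)
   then show ?case using f by (simp add: D(5) ps_smult[OF S] Phi_csc_var[OF S])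
  next
   case (Cons x xs)
   have e: "hconst (Poly_Mapping.single (Word (x # xs)) c) = gen_el x * hconst (Poly_Mapping.single (Word xs) c)"
    by (simp add: gen_el_def hconst_mult[symmetric] mult_single)
   have "hact W (ucls g (hconst (Poly_Mapping.single (Word (x # xs)) c))) f = hgen g W x (c \<cdot> wact (hgen g W) (Word xs) f)"
    unfolding e D(3)[OF f] Cons.IH by (simp only: hgen_def[of g W x])
   then show ?case using clin_csc[OF kop_clin[OF kT] kop_in[OF kop_wact f]] by simp
  qed
  then show "hact W (ucls g (hconst (Poly_Mapping.single w c))) f = fact_act (hgen g W) (Poly_Mapping.single w c) f"
   by (simp add: w fact_single)
 qed (simp_all add: hconst_add D(2)[OF f] fact_add)
 moreover have "slin (%x. hact W (ucls g x) f)"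
  unfolding slin_def using kop_in[OF k f]
  by (auto simp: D(2)[OF f] D(3)[OF f] uscalar_var[symmetric] D(5) ps_smult[OF S] Phi_csc_var[OF S])
 ultimately show "hact W (ucls g x) f = Phi (fact_act (hgen g W)) x f"
  by (intro free.Phi_unique[where R = "%x. hact W (ucls g x)"] f)
qed

context gens
begin

lemma fact_even:
 assumes CH: "!!f. f \<in> MS S ==> T Gen_C (T Gen_H f) = T Gen_H (T Gen_C f)" and f: "f \<in> MS S"
 shows "fact_act T (even_subst p) f = HCact T (evenpart p) f"
proof -
 interpret HCpair "MS S" "T Gen_C" "T Gen_H"
  by unfold_locales (auto simp: subspace_MS sub kop_clin kT CH)
 have w: "wact T (Word (replicate i Gen_H @ replicate j Gen_C)) f = (T Gen_H ^^ i) ((T Gen_C ^^ j) f)" for i j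
  by (simp add: wact_def foldr_replicate)
 have cm: "(T Gen_H ^^ i) ((T Gen_C ^^ j) f) = (T Gen_C ^^ j) ((T Gen_H ^^ i) f)" for i j
 proof -
  have inC: "(T Gen_C ^^ j) f \<in> MS S" for j using kop_in[OF kop_funpow[OF kT] f] .
  have inH: "(T Gen_H ^^ i) f' \<in> MS S" if "f' \<in> MS S" for i f' using kop_in[OF kop_funpow[OF kT] that] .
  have 1: "(T Gen_H ^^ i) (T Gen_C f') = T Gen_C ((T Gen_H ^^ i) f')" if "f' \<in> MS S" for i f'
   by (induction i) (simp_all add: CH[symmetric] inH that)
  show ?thesis by (induction j) (simp_all add: 1 inC)
 qed
 have "HCact T (evenpart p) f = (\<Sum>i\<le>Polynomial.degree p. pact csc (T Gen_C) (Polynomial.coeff (evenpart p) i) ((T Gen_H ^^ i) f))"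
  unfolding HCact_def evenpart_def
  by (rule pact_bound[OF S ract_C h _ f])
   (rule h_C, assumption, rule degree_le, simp add: coeff_map_poly coeff_eq_0)
 also have "\<dots> = (\<Sum>i\<le>Polynomial.degree p. \<Sum>j\<le>Polynomial.degree (Polynomial.coeff p i).
   Polynomial.coeff (Polynomial.coeff p i) (2 * j) \<cdot> (T Gen_C ^^ j) ((T Gen_H ^^ i) f))"
 proof (intro sum.cong refl)
  fix i
  have d: "Polynomial.degree (halfp q) \<le> Polynomial.degree q" for q
   by (rule degree_le) (auto simp: coeff_halfp coeff_eq_0)
  have Hi: "(T Gen_H ^^ i) f \<in> MS S" using kop_in[OF kop_funpow[OF kT] f] .
  show "pact csc (T Gen_C) (Polynomial.coeff (evenpart p) i) ((T Gen_H ^^ i) f) = (\<Sum>j\<le>Polynomial.degree (Polynomial.coeff p i).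
   Polynomial.coeff (Polynomial.coeff p i) (2 * j) \<cdot> (T Gen_C ^^ j) ((T Gen_H ^^ i) f))"
   unfolding evenpart_def coeff_map_poly[of halfp, OF halfp_0]
   using pact_bound[OF S ract_csc[OF S] c _ Hi d, of "Polynomial.coeff p i"] clin_csc[OF c] by (simp add: coeff_halfp)
 qed
 also have "\<dots> = fact_act T (even_subst p) f"
  unfolding even_subst_def fact_sum fact_single w cm ..
 finally show ?thesis ..
qed

lemma Phi_rel_rhs:
 assumes CH: "!!f. f \<in> MS S ==> T Gen_C (T Gen_H f) = T Gen_H (T Gen_C f)" and f: "f \<in> MS S"
 shows "Phi (fact_act T) (rel_rhs g \<sigma>) f = Phi (HCact T) (relG g \<sigma>) f"
 by (rule Phi_cong) (simp add: rel_rhs_def relG_def fact_even[OF CH f])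

lemma Phi_gen2: "f \<in> MS S ==> Phi (fact_act T) (gen_el x * gen_el y) f = T x (T y f)"
 by (simp add: free.Phi_mult Phi_gen kop_in[OF kT])

lemma Phi_rel_simps:
 assumes "f \<in> MS S"
 shows "Phi (fact_act T) (x - y) f = Phi (fact_act T) x f - Phi (fact_act T) y f"
  "Phi (fact_act T) (x + y) f = Phi (fact_act T) x f + Phi (fact_act T) y f"
  "Phi (fact_act T) (2 * x) f = 2 \<cdot> Phi (fact_act T) x f"
 using ract_diff[OF free.ract_Phi assms] ract_add[OF free.ract_Phi assms] by (auto simp: csc_2 mult_2)

end

lemma hrep_hops:
 assumes W: "hrep_obj g W" and V: "hspace W = emod S" and S: "cv.subspace S" and g: "g \<ge> 1"
 shows "hops S (hgen g W) g"
proof -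
 interpret gens S "hgen g W" by (rule hrep_gens[OF W V S])
 have fd: "fd S" using W V S by (intro fd_fin_dim) (auto simp: hrep_obj_def)
 have z: "Phi (fact_act (hgen g W)) x f = 0" if "x \<in> relators g" "f \<in> MS S" for x f
 proof -
  have "ucls g x = ucls g 0" using relators_rel_ideal[OF that(1)] by (simp add: ucls_eq)
  then have "Phi (fact_act (hgen g W)) x f = Phi (fact_act (hgen g W)) 0 f"
   using hrep_gens(2)[OF W V S that(2)] by metis
  then show ?thesis using ract_zero[OF free.ract_Phi that(2)] by simp
 qed
 have CH: "hgen g W Gen_C (hgen g W Gen_H f) = hgen g W Gen_H (hgen g W Gen_C f)" if "f \<in> MS S" for f
  using z[of "gen_el Gen_C * gen_el Gen_H - gen_el Gen_H * gen_el Gen_C" f] that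
  by (simp add: relators_def Let_def Phi_rel_simps Phi_gen2)
 show ?thesis
 proof (unfold_locales)
  fix f assume f: "f \<in> MS S"
  show "hgen g W Gen_C (hgen g W Gen_Xp f) = hgen g W Gen_Xp (hgen g W Gen_C f)"
   using z[of "gen_el Gen_C * gen_el Gen_Xp - gen_el Gen_Xp * gen_el Gen_C" f] f
   by (simp add: relators_def Let_def Phi_rel_simps Phi_gen2)
  show "hgen g W Gen_C (hgen g W Gen_Xm f) = hgen g W Gen_Xm (hgen g W Gen_C f)"
   using z[of "gen_el Gen_C * gen_el Gen_Xm - gen_el Gen_Xm * gen_el Gen_C" f] f
   by (simp add: relators_def Let_def Phi_rel_simps Phi_gen2)
  show "hgen g W Gen_H (hgen g W Gen_Xp f) = hgen g W Gen_Xp (hgen g W Gen_H f) + 2 \<cdot> hgen g W Gen_Xp f"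
   using z[of "(gen_el Gen_H * gen_el Gen_Xp - gen_el Gen_Xp * gen_el Gen_H) - 2 * gen_el Gen_Xp" f] f
   by (simp add: relators_def Let_def Phi_rel_simps Phi_gen2 Phi_gen algebra_simps)
  show "hgen g W Gen_H (hgen g W Gen_Xm f) = hgen g W Gen_Xm (hgen g W Gen_H f) - 2 \<cdot> hgen g W Gen_Xm f"
   using z[of "(gen_el Gen_H * gen_el Gen_Xm - gen_el Gen_Xm * gen_el Gen_H) + 2 * gen_el Gen_Xm" f] f
   by (simp add: relators_def Let_def Phi_rel_simps Phi_gen2 Phi_gen eq_diff_eq algebra_simps)
  show "hgen g W Gen_Xp (hgen g W Gen_Xm f) = Phi (HCact (hgen g W)) (relG g 1) f"
   using z[of "gen_el Gen_Xp * gen_el Gen_Xm - rel_rhs g 1" f] f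
   by (simp add: relators_def Let_def Phi_rel_simps Phi_gen2 Phi_rel_rhs[OF CH])
  show "hgen g W Gen_Xm (hgen g W Gen_Xp f) = Phi (HCact (hgen g W)) (relG g (-1)) f"
   using z[of "gen_el Gen_Xm * gen_el Gen_Xp - rel_rhs g (-1)" f] f
   by (simp add: relators_def Let_def Phi_rel_simps Phi_gen2 Phi_rel_rhs[OF CH])
 qed (use fd g CH in auto)
qed

text \<open>The choice of a representative x is immaterial because the operators satisfy the relations and the
action is continuous, so that the closure of the ideal acts by zero.\<close>

definition mk_hrep :: "nat => 'a::cvec set => (gen => ('a dser) => 'a dser) => 'a hrep" where
 "mk_hrep g S T = \<lparr>hspace = emod S, hact = (\<lambda>u\<in>carrier (Uhh g). \<lambda>f\<in>MS S. Phi (fact_act T) (SOME x. u = ucls g x) f)\<rparr>"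

lemma (in hops) kills_ideal:
 assumes x: "x \<in> rel_ideal g" and f: "f \<in> MS S" shows "Phi (fact_act T) x f = 0"
proof -
 define A where "A = {x. \<forall>f\<in>MS S. Phi (fact_act T) x f = 0}"
 have "ideal A free_ring"
  by (rule ideal_free_ringI)
   (auto simp: A_def ract_zero[OF free.ract_Phi] Phi_rel_simps free.Phi_mult free.Phi_in clin_0[OF kop_clin[OF free.Phi_kop] subspace_MS[OF sub]])
 moreover have "relators g \<subseteq> A"
  unfolding relators_def Let_def A_def
  by (auto simp: Phi_rel_simps Phi_gen2 Phi_gen Phi_rel_rhs[OF CH] CXp CXm CH HXp HXm XpXm XmXp)
 ultimately have gen: "genideal free_ring (relators g) \<subseteq> A" by (rule FR.genideal_minimal)
 show ?thesis
 proof (intro ext)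
  fix k l
  obtain y where y: "y \<in> genideal free_ring (relators g)" "!!i j. i + j < Suc (k + l) ==> hcoeff x i j = hcoeff y i j"
   using adic_closureD[OF x[unfolded rel_ideal_def]] by blast
  have "Phi (fact_act T) x f k l = Phi (fact_act T) y f k l"
   unfolding Phi_def by (intro sum.cong refl) (simp add: y(2))
  also have "\<dots> = 0" using gen y(1) f by (auto simp: A_def)
  finally show "Phi (fact_act T) x f k l = 0 k l" by simp
 qed
qed

lemma (in hops) mk_hrep:
 shows "hact (mk_hrep g S T) (ucls g x) = (\<lambda>f\<in>MS S. Phi (fact_act T) x f)" "hrep_obj g (mk_hrep g S T)"
  "hspace (mk_hrep g S T) = emod S"
proof -
 show sp: "hspace (mk_hrep g S T) = emod S" by (simp add: mk_hrep_def)
 show act: "hact (mk_hrep g S T) (ucls g x) = (\<lambda>f\<in>MS S. Phi (fact_act T) x f)" for x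
 proof -
  define y where "y = (SOME y. ucls g x = ucls g y)"
  have "ucls g x = ucls g y" unfolding y_def by (rule someI) (rule refl)
  then have "Phi (fact_act T) (x - y) f = 0" if "f \<in> MS S" for f
   using that kills_ideal by (simp add: ucls_eq)
  then have "Phi (fact_act T) x f = Phi (fact_act T) y f" if "f \<in> MS S" for f using that by (simp add: Phi_rel_simps)
  then show ?thesis by (auto simp: mk_hrep_def y_def fun_eq_iff restrict_def)
 qed
 show "hrep_obj g (mk_hrep g S T)"
  unfolding hrep_obj_def sp
 proof (intro conjI allI)
  show "Module.module CR (emod S)" by (rule module_emod[OF sub])
  show "fin_dim (emod S)" by (rule fin_dim_emod[OF fdS])
  show "hact (mk_hrep g S T) \<in> extensional (carrier (Uhh g))" by (simp add: mk_hrep_def)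
  show "hact (mk_hrep g S T) \<in> ring_hom (Uhh g) (End_ring KR (ps_mod (emod S)))"
  proof (rule ring_hom_memI)
   fix u v assume u: "u \<in> carrier (Uhh g)"
   then obtain x where x: "u = ucls g x" using ucls_surj by blast
   have "kop S S (\<lambda>f\<in>MS S. Phi (fact_act T) x f)"
    by (rule kop_cong[OF sub free.Phi_kop]) simp
   then have "(\<lambda>f\<in>MS S. Phi (fact_act T) x f) \<in> lin_maps KR (ps_mod (emod S)) (ps_mod (emod S))"
    unfolding lin_maps_emod[OF sub sub] by simp
   then show "hact (mk_hrep g S T) u \<in> carrier (End_ring KR (ps_mod (emod S)))"
    by (simp add: x act End_ring_def)
   assume "v \<in> carrier (Uhh g)"
   then obtain y where y: "v = ucls g y" using ucls_surj by blast
   show "hact (mk_hrep g S T) (u \<otimes>\<^bsub>Uhh g\<^esub> v) = hact (mk_hrep g S T) u \<otimes>\<^bsub>End_ring KR (ps_mod (emod S))\<^esub> hact (mk_hrep g S T) v"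
    by (auto simp: x y ucls_mult act End_ring_def compose_def free.Phi_mult free.Phi_in fun_eq_iff restrict_def)
   show "hact (mk_hrep g S T) (u \<oplus>\<^bsub>Uhh g\<^esub> v) = hact (mk_hrep g S T) u \<oplus>\<^bsub>End_ring KR (ps_mod (emod S))\<^esub> hact (mk_hrep g S T) v"
    by (auto simp: x y ucls_add act End_ring_def Phi_rel_simps fun_eq_iff restrict_def)
  next
   show "hact (mk_hrep g S T) \<one>\<^bsub>Uhh g\<^esub> = \<one>\<^bsub>End_ring KR (ps_mod (emod S))\<^esub>"
    by (auto simp: ucls_one act End_ring_def ract_one[OF free.ract_Phi] fun_eq_iff restrict_def)
  qed
  fix c
  show "hact (mk_hrep g S T) (uscalar g c) = (\<lambda>f\<in>psc (emod S). c \<odot>\<^bsub>ps_mod (emod S)\<^esub> f)"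
  proof -
   have "Phi (fact_act T) (hseries (%k l. Poly_Mapping.single 0 (hcoeff c k l))) f = Phi csc c f" for f
    by (rule Phi_cong) (simp add: fact_single zero_gword_def)
   then show ?thesis unfolding uscalar_def act by (auto simp: ps_smult[OF sub] fun_eq_iff restrict_def)
  qed
 qed
qed

lemma (in hops) mk_hrep_gen: "f \<in> MS S ==> hgen g (mk_hrep g S T) x f = T x f"
 by (simp add: hgen_def mk_hrep(1) Phi_gen)

lemma hrep_hom_emod:
 assumes V: "hrep_obj g V" "hspace V = emod S" "cv.subspace S" and W: "hrep_obj g W" "hspace W = emod S'" "cv.subspace S'"
 shows "\<phi> \<in> hrep_hom g V W \<longleftrightarrow> \<phi> \<in> extensional (MS S) & kop S S' \<phi> & (ALL x. \<forall>f\<in>MS S. \<phi> (hgen g V x f) = hgen g W x (\<phi> f))"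
proof
 assume "\<phi> \<in> hrep_hom g V W"
 then show "\<phi> \<in> extensional (MS S) & kop S S' \<phi> & (ALL x. \<forall>f\<in>MS S. \<phi> (hgen g V x f) = hgen g W x (\<phi> f))"
  by (auto simp: hrep_hom_def V W lin_maps_emod hgen_def)
next
 assume \<phi>: "\<phi> \<in> extensional (MS S) & kop S S' \<phi> & (ALL x. \<forall>f\<in>MS S. \<phi> (hgen g V x f) = hgen g W x (\<phi> f))"
 then have k: "kop S S' \<phi>" and gn: "!!x f. f \<in> MS S ==> \<phi> (hgen g V x f) = hgen g W x (\<phi> f)" by auto
 interpret v: gens S "hgen g V" by (rule hrep_gens[OF V])
 interpret w: gens S' "hgen g W" by (rule hrep_gens[OF W])
 have c: "\<phi> (fact_act (hgen g V) p f) = fact_act (hgen g W) p (\<phi> f)" if f: "f \<in> MS S" for p f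
 proof (rule poly_mapping_additive_eq[of "%p. \<phi> (fact_act (hgen g V) p f)"])
  show "\<phi> (fact_act (hgen g V) (p + q) f) = \<phi> (fact_act (hgen g V) p f) + \<phi> (fact_act (hgen g V) q f)" for p q
   by (simp only: fact_add clin_add[OF kop_clin[OF k] kop_in[OF v.free.ka f] kop_in[OF v.free.ka f]])
  show "fact_act (hgen g W) (p + q) (\<phi> f) = fact_act (hgen g W) p (\<phi> f) + fact_act (hgen g W) q (\<phi> f)" for p q
   by (rule fact_add)
  show "\<phi> (fact_act (hgen g V) (Poly_Mapping.single w a) f) = fact_act (hgen g W) (Poly_Mapping.single w a) (\<phi> f)" for w a
  proof (cases w)
   case (Word xs)
   have "\<phi> (wact (hgen g V) (Word xs) f) = wact (hgen g W) (Word xs) (\<phi> f)"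
    by (induction xs) (simp_all add: gn kop_in[OF v.kop_wact f])
   then show ?thesis using Word by (simp add: fact_single clin_csc[OF kop_clin[OF k] kop_in[OF v.kop_wact f]])
  qed
 qed
 have "\<phi> (hact V u f) = hact W u (\<phi> f)" if u: "u \<in> carrier (Uhh g)" and f: "f \<in> MS S" for u f
 proof -
  obtain x where "u = ucls g x" using ucls_surj[OF u] by blast
  moreover have "\<phi> (Phi (fact_act (hgen g V)) x f) = Phi (fact_act (hgen g W)) x (\<phi> f)"
   by (rule Phi_intertwine[OF v.free.kract_axioms w.free.kract_axioms k _ f]) (rule c)
  ultimately show ?thesis
   by (simp add: hrep_gens(2)[OF V f] hrep_gens(2)[OF W kop_in[OF k f]])
 qed
 then show "\<phi> \<in> hrep_hom g V W" using \<phi> by (auto simp: hrep_hom_def V W lin_maps_emod)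
qed

section \<open>\<open>sl\<^sub>2\<close>-triples and representations of \<open>sl\<^sub>2\<close>\<close>

definition slact :: "'a::cvec set => ('a => 'a) => ('a => 'a) => ('a => 'a) => complex^2^2 => 'a => 'a" where
 "slact S e f h = (\<lambda>A\<in>sl2. \<lambda>v\<in>S. A $ 1 $ 1 \<cdot> h v + A $ 1 $ 2 \<cdot> e v + A $ 2 $ 1 \<cdot> f v)"

lemma trace2: "trace (A :: complex^2^2) = A $ 1 $ 1 + A $ 2 $ 2"
 by (simp add: trace_def UNIV_2)

lemma matmul2: "((A :: complex^2^2) ** B) $ i $ j = A $ i $ 1 * B $ 1 $ j + A $ i $ 2 * B $ 2 $ j"
 by (simp add: matrix_matrix_mult_def sum_2)

lemma sl2_22: "A \<in> sl2 ==> A $ 2 $ 2 = - A $ 1 $ 1"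
 by (simp add: sl2_def trace2 eq_neg_iff_add_eq_0 add.commute)

lemma sl2_closed: "A \<in> sl2 ==> B \<in> sl2 ==> A + B \<in> sl2" "A \<in> sl2 ==> (\<chi> i j. c * A $ i $ j) \<in> sl2" "A ** B - B ** A \<in> sl2"
 by (auto simp: sl2_def trace2 matmul2 algebra_simps distrib_left[symmetric])

lemma sl2_obj_triple:
 assumes "sl2_module S e f h" "fd S"
 shows "sl2_obj \<lparr>sspace = emod S, sact = slact S e f h\<rparr>"
proof -
 interpret sl2_module S e f h by fact
 have cl: "clin S S (%v. a \<cdot> h v + b \<cdot> e v + c \<cdot> f v)" for a b c
  by (intro clin_plus clin_scale S e f h)
 have min: "x \<ominus>\<^bsub>emod S\<^esub> y = x - y" if "x \<in> S" "y \<in> S" for x y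
 proof -
  interpret abelian_group "emod S" by (rule abelian_group_emod[OF S])
  have "\<ominus>\<^bsub>emod S\<^esub> y = - y" using that by (intro minus_equality) auto
  then show ?thesis by (simp add: a_minus_def)
 qed
 show ?thesis
  unfolding sl2_obj_def
 proof (simp only: sl2_rep.simps emod_simps, intro conjI ballI allI)
  show "Module.module CR (emod S)" "fin_dim (emod S)" by (rule module_emod[OF S] fin_dim_emod[OF assms(2)])+
  show "slact S e f h \<in> sl2 \<rightarrow>\<^sub>E lin_maps CR (emod S) (emod S)"
   using cl by (auto simp: slact_def lin_maps_def clin_def)
  fix A B c v assume A: "A \<in> sl2" and B: "B \<in> sl2" and v: "v \<in> S"
  note [simp] = sl2_closed A B v
  show "slact S e f h (A + B) v = slact S e f h A v + slact S e f h B v"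
   by (simp add: slact_def csc_add_left)
  show "slact S e f h (\<chi> i j. c * A $ i $ j) v = c \<cdot> slact S e f h A v"
   by (simp add: slact_def csc_add_right csc_csc)
  have efv: "e (f v) = f (e v) + h v" using ef[OF v] by (simp add: algebra_simps)
  have "slact S e f h (A ** B - B ** A) v = slact S e f h A (slact S e f h B v) - slact S e f h B (slact S e f h A v)"
   by (simp add: slact_def matmul2 sl2_22[OF A] sl2_22[OF B] L_simps he hf efv csc_add_right csc_add_left csc_csc
     cv.scale_left_diff_distrib cv.scale_right_diff_distrib algebra_simps)
  then show "slact S e f h (A ** B - B ** A) v = slact S e f h A (slact S e f h B v) \<ominus>\<^bsub>emod S\<^esub> slact S e f h B (slact S e f h A v)"
   by (subst min) (simp_all add: slact_def)
 qed
qed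

definition matE :: "complex^2^2" where "matE = (\<chi> i j. if i = 1 & j = 2 then 1 else 0)"
definition matF :: "complex^2^2" where "matF = (\<chi> i j. if i = 2 & j = 1 then 1 else 0)"
definition matH :: "complex^2^2" where "matH = (\<chi> i j. if i = 1 & j = 1 then 1 else if i = 2 & j = 2 then -1 else 0)"

lemma mat_sl2 [simp]: "matE \<in> sl2" "matF \<in> sl2" "matH \<in> sl2"
 by (auto simp: sl2_def trace2 matE_def matF_def matH_def)

lemma slact_mat: "v \<in> S ==> slact S e f h matE v = e v" "v \<in> S ==> slact S e f h matF v = f v" "v \<in> S ==> slact S e f h matH v = h v"
 by (simp_all add: slact_def) (simp_all add: matE_def matF_def matH_def)

lemma triple_sl2_obj:
 assumes V: "sl2_obj V" and sp: "sspace V = emod S" and S: "cv.subspace S"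
 shows "sl2_module S (sact V matE) (sact V matF) (sact V matH)" "fd S"
  "sact V = slact S (sact V matE) (sact V matF) (sact V matH)"
proof -
 show "fd S" using V sp S by (intro fd_fin_dim) (auto simp: sl2_obj_def)
 have L: "sact V \<in> sl2 \<rightarrow>\<^sub>E lin_maps CR (emod S) (emod S)"
  and add: "!!A B v. A \<in> sl2 ==> B \<in> sl2 ==> v \<in> S ==> sact V (A + B) v = sact V A v + sact V B v"
  and sc: "!!A c v. A \<in> sl2 ==> v \<in> S ==> sact V (\<chi> i j. c * A $ i $ j) v = c \<cdot> sact V A v"
  and br': "!!A B v. A \<in> sl2 ==> B \<in> sl2 ==> v \<in> S ==> sact V (A ** B - B ** A) v = sact V A (sact V B v) \<ominus>\<^bsub>emod S\<^esub> sact V B (sact V A v)"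
  using V unfolding sl2_obj_def sp by (auto simp: mat_sl2)
 have c: "clin S S (sact V A)" if "A \<in> sl2" for A
  using PiE_mem[OF L that] by (auto simp: lin_maps_def clin_def)
 have ext: "sact V A \<in> extensional S" if "A \<in> sl2" for A
  using PiE_mem[OF L that] by (auto simp: lin_maps_def PiE_def)
 have min: "x \<ominus>\<^bsub>emod S\<^esub> y = x - y" if "x \<in> S" "y \<in> S" for x y
 proof -
  interpret abelian_group "emod S" by (rule abelian_group_emod[OF S])
  have "\<ominus>\<^bsub>emod S\<^esub> y = - y" using that cv.subspace_neg[OF S] by (intro minus_equality) auto
  then show ?thesis by (simp add: a_minus_def)
 qed
 have br: "sact V (A ** B - B ** A) v = sact V A (sact V B v) - sact V B (sact V A v)" if "A \<in> sl2" "B \<in> sl2" "v \<in> S" for A B v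
  using br'[OF that] min clin_in[OF c] that by simp
 have HE: "matH ** matE - matE ** matH = (\<chi> i j. 2 * matE $ i $ j)"
  and HF: "matH ** matF - matF ** matH = (\<chi> i j. (-2) * matF $ i $ j)"
  and EF: "matE ** matF - matF ** matE = matH"
  by (simp_all add: vec_eq_iff forall_2 matmul2, simp_all add: matE_def matF_def matH_def)
 show "sl2_module S (sact V matE) (sact V matF) (sact V matH)"
 proof
  fix v assume v: "v \<in> S"
  show "sact V matH (sact V matE v) = sact V matE (sact V matH v) + 2 \<cdot> sact V matE v"
   using br[of matH matE v] sc[of matE v 2] v unfolding HE by (simp add: algebra_simps)
  show "sact V matH (sact V matF v) = sact V matF (sact V matH v) - 2 \<cdot> sact V matF v"
   using br[of matH matF v] sc[of matF v "-2"] v unfolding HF by (simp add: algebra_simps)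
  show "sact V matE (sact V matF v) - sact V matF (sact V matE v) = sact V matH v"
   using br[of matE matF v] v unfolding EF by simp
 qed (use S c in auto)
 show "sact V = slact S (sact V matE) (sact V matF) (sact V matH)"
 proof (rule extensionalityI[of _ sl2])
  fix A :: "complex^2^2" assume A: "A \<in> sl2"
  have dec: "A = ((\<chi> i j. (A $ 1 $ 1) * matH $ i $ j) + (\<chi> i j. (A $ 1 $ 2) * matE $ i $ j)) + (\<chi> i j. (A $ 2 $ 1) * matF $ i $ j)"
   using sl2_22[OF A] by (simp add: vec_eq_iff forall_2 matE_def matF_def matH_def)
  have "sact V A v = slact S (sact V matE) (sact V matF) (sact V matH) A v" if v: "v \<in> S" for v
   using A v by (subst dec) (simp add: add sc sl2_closed slact_def)
  then show "sact V A = slact S (sact V matE) (sact V matF) (sact V matH) A"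
   using ext[OF A] A by (intro extensionalityI[of _ S]) (auto simp: slact_def)
 qed (use L in \<open>auto simp: slact_def PiE_def\<close>)
qed

lemma class_lim_emod:
 assumes "hspace W = emod S"
 shows "class_lim g W = \<lparr>sspace = emod S, sact = slact S (lim0 (hgen g W Gen_Xp)) (lim0 (hgen g W Gen_Xm)) (lim0 (hgen g W Gen_H))\<rparr>"
 by (simp add: class_lim_def slact_def hact_mod_def lim0_def hgen_def assms)

lemma (in hops) limit_triple: "sl2_module S (lim0 (T Gen_Xp)) (lim0 (T Gen_Xm)) (lim0 (T Gen_H))"
proof -
 interpret t: sl2_deformed S Xe "T Gen_Xm" "T Gen_H" by (rule triple)
 interpret l: sl2_module S "lim0 Xe" "lim0 (T Gen_Xm)" "lim0 (T Gen_H)" by (rule t.limit_module)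
 show ?thesis
 proof
  show "clin S S (lim0 (T Gen_Xp))" by (rule lim0_clin[OF sub kT])
  fix v assume v: "v \<in> S"
  show "lim0 (T Gen_H) (lim0 (T Gen_Xp) v) = lim0 (T Gen_Xp) (lim0 (T Gen_H) v) + 2 \<cdot> lim0 (T Gen_Xp) v"
   using l.he[OF v] lim0_Xe[OF v] lim0_Xe[OF clin_in[OF l.h v]] by simp
  show "lim0 (T Gen_Xp) (lim0 (T Gen_Xm) v) - lim0 (T Gen_Xm) (lim0 (T Gen_Xp) v) = lim0 (T Gen_H) v"
   using l.ef[OF v] lim0_Xe[OF v] lim0_Xe[OF clin_in[OF l.f v]] by simp
  show "lim0 (T Gen_H) (lim0 (T Gen_Xm) v) = lim0 (T Gen_Xm) (lim0 (T Gen_H) v) - 2 \<cdot> lim0 (T Gen_Xm) v"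
   by (rule l.hf[OF v])
 qed (use l.S l.f l.h in auto)
qed

section \<open>Transport of structure\<close>

lemma finsum_hom:
 assumes G: "abelian_monoid G" and H: "abelian_monoid H" and t: "!!x. x \<in> carrier G ==> t x \<in> carrier H"
  and add: "!!x y. x \<in> carrier G ==> y \<in> carrier G ==> t (x \<oplus>\<^bsub>G\<^esub> y) = t x \<oplus>\<^bsub>H\<^esub> t y" and zero: "t \<zero>\<^bsub>G\<^esub> = \<zero>\<^bsub>H\<^esub>"
  and F: "!!a. a \<in> A ==> F a \<in> carrier G"
 shows "t (finsum G F A) = finsum H (%a. t (F a)) A"
proof -
 interpret G: abelian_monoid G by fact
 interpret H: abelian_monoid H by fact
 show ?thesis using F
 proof (induction A rule: infinite_finite_induct)
  case (infinite A)
  then show ?case by (simp add: G.finsum_infinite H.finsum_infinite zero)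
 next
  case empty
  then show ?case by (simp add: zero)
 next
  case (insert x A)
  then have "F \<in> A \<rightarrow> carrier G" "(%a. t (F a)) \<in> A \<rightarrow> carrier H" "F x \<in> carrier G" "t (F x) \<in> carrier H" using t by auto
  then show ?case using insert by (simp add: G.finsum_insert H.finsum_insert add)
 qed
qed

abbreviation vmod :: "(complex, 'v) module => bool" where "vmod V \<equiv> Module.module CR V"

lemma vmod_group: "vmod V ==> abelian_group V"
 by (simp add: Module.module_def)

lemma vmod_monoid: "vmod V ==> abelian_monoid V"
 by (simp add: vmod_group abelian_group.axioms(1))

lemma vmod_add: "vmod V ==> x \<in> carrier V ==> y \<in> carrier V ==> x \<oplus>\<^bsub>V\<^esub> y \<in> carrier V"
 using abelian_monoid.a_closed[OF vmod_monoid] .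

lemma vmod_zero: "vmod V ==> \<zero>\<^bsub>V\<^esub> \<in> carrier V"
 using abelian_monoid.zero_closed[OF vmod_monoid] .

lemma vmod_smult: "vmod V ==> x \<in> carrier V ==> c \<odot>\<^bsub>V\<^esub> x \<in> carrier V"
 using module.smult_closed[of CR V c x] by simp

lemma vmod_smult_0: "vmod V ==> x \<in> carrier V ==> 0 \<odot>\<^bsub>V\<^esub> x = \<zero>\<^bsub>V\<^esub>"
 using module.smult_l_null[of CR V x] by simp

lemma ps_carrier: "f \<in> psc V \<longleftrightarrow> (ALL k l. f k l \<in> carrier V)"
 by (simp add: ps_mod_def)

lemma ps_add: "f \<oplus>\<^bsub>ps_mod V\<^esub> f' = (%k l. f k l \<oplus>\<^bsub>V\<^esub> f' k l)"
 by (simp add: ps_mod_def)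

lemma ps_zero: "\<zero>\<^bsub>ps_mod V\<^esub> = (%k l. \<zero>\<^bsub>V\<^esub>)"
 by (simp add: ps_mod_def)

lemma ps_smult_def: "c \<odot>\<^bsub>ps_mod V\<^esub> f = (%k l. \<Oplus>\<^bsub>V\<^esub>i\<in>{..k}. \<Oplus>\<^bsub>V\<^esub>j\<in>{..l}. hcoeff c i j \<odot>\<^bsub>V\<^esub> f (k - i) (l - j))"
 by (simp add: ps_mod_def)

lemma ps_add_closed: "vmod V ==> f \<in> psc V ==> f' \<in> psc V ==> f \<oplus>\<^bsub>ps_mod V\<^esub> f' \<in> psc V"
 by (simp add: ps_carrier ps_add vmod_add)

lemma ps_smult_inner: "vmod V ==> f \<in> psc V ==>
  (\<Oplus>\<^bsub>V\<^esub>j\<in>{..l}. hcoeff c i j \<odot>\<^bsub>V\<^esub> f k (l - j)) \<in> carrier V"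
 by (intro abelian_monoid.finsum_closed[OF vmod_monoid]) (auto simp: ps_carrier vmod_smult)

lemma ps_smult_closed: "vmod V ==> f \<in> psc V ==> c \<odot>\<^bsub>ps_mod V\<^esub> f \<in> psc V"
 by (auto simp: ps_smult_def ps_carrier intro!: abelian_monoid.finsum_closed[OF vmod_monoid] vmod_smult)

lemma ps_const_in: "vmod V ==> v \<in> carrier V ==> ps_const V v \<in> psc V"
 by (simp add: ps_carrier ps_const_def vmod_zero)

lemma ps_smult_hom:
 assumes V: "vmod V" and V': "vmod V'" and t: "!!x. x \<in> carrier V ==> t x \<in> carrier V'"
  and add: "!!x y. x \<in> carrier V ==> y \<in> carrier V ==> t (x \<oplus>\<^bsub>V\<^esub> y) = t x \<oplus>\<^bsub>V'\<^esub> t y"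
  and sm: "!!c x. x \<in> carrier V ==> t (c \<odot>\<^bsub>V\<^esub> x) = c \<odot>\<^bsub>V'\<^esub> t x" and f: "f \<in> psc V"
 shows "ext0 t (c \<odot>\<^bsub>ps_mod V\<^esub> f) = c \<odot>\<^bsub>ps_mod V'\<^esub> ext0 t f"
proof (intro ext)
 fix k l
 have zero: "t \<zero>\<^bsub>V\<^esub> = \<zero>\<^bsub>V'\<^esub>"
  using sm[OF vmod_zero[OF V], of 0] vmod_smult_0[OF V vmod_zero[OF V]] vmod_smult_0[OF V' t[OF vmod_zero[OF V]]] by simp
 note hom = finsum_hom[OF vmod_monoid[OF V] vmod_monoid[OF V'], of t, OF t add zero]
 have fin: "hcoeff c i j \<odot>\<^bsub>V\<^esub> f k l \<in> carrier V" for i j k l using f V by (simp add: ps_carrier vmod_smult)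
 have "ext0 t (c \<odot>\<^bsub>ps_mod V\<^esub> f) k l = (\<Oplus>\<^bsub>V'\<^esub>i\<in>{..k}. t (\<Oplus>\<^bsub>V\<^esub>j\<in>{..l}. hcoeff c i j \<odot>\<^bsub>V\<^esub> f (k - i) (l - j)))"
  unfolding ext0_def ps_smult_def by (rule hom) (auto intro: ps_smult_inner[OF V f])
 also have "(%i. t (\<Oplus>\<^bsub>V\<^esub>j\<in>{..l}. hcoeff c i j \<odot>\<^bsub>V\<^esub> f (k - i) (l - j))) = (%i. \<Oplus>\<^bsub>V'\<^esub>j\<in>{..l}. t (hcoeff c i j \<odot>\<^bsub>V\<^esub> f (k - i) (l - j)))"
  by (rule ext, rule hom) (auto intro: fin)
 also have "\<dots> = (%i. \<Oplus>\<^bsub>V'\<^esub>j\<in>{..l}. hcoeff c i j \<odot>\<^bsub>V'\<^esub> t (f (k - i) (l - j)))"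
  using f by (simp add: sm ps_carrier)
 finally show "ext0 t (c \<odot>\<^bsub>ps_mod V\<^esub> f) k l = (c \<odot>\<^bsub>ps_mod V'\<^esub> ext0 t f) k l"
  by (simp add: ps_smult_def ext0_def)
qed

definition miso :: "(complex, 'v) module => (complex, 'w) module => ('v => 'w) => bool" where
 "miso V V' \<theta> \<longleftrightarrow> bij_betw \<theta> (carrier V) (carrier V') &
   (\<forall>x\<in>carrier V. \<forall>y\<in>carrier V. \<theta> (x \<oplus>\<^bsub>V\<^esub> y) = \<theta> x \<oplus>\<^bsub>V'\<^esub> \<theta> y) & (ALL c. \<forall>x\<in>carrier V. \<theta> (c \<odot>\<^bsub>V\<^esub> x) = c \<odot>\<^bsub>V'\<^esub> \<theta> x)"

lemma miso_inv:
 assumes "vmod V" "miso V V' \<theta>" shows "miso V' V (inv_into (carrier V) \<theta>)"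
proof -
 let ?i = "inv_into (carrier V) \<theta>"
 have bij: "bij_betw \<theta> (carrier V) (carrier V')" using assms by (simp add: miso_def)
 have i: "?i x \<in> carrier V" "\<theta> (?i x) = x" if "x \<in> carrier V'" for x
  using bij that by (auto simp: bij_betw_def inv_into_into f_inv_into_f)
 have l: "?i (\<theta> x) = x" if "x \<in> carrier V" for x using bij that by (simp add: bij_betw_inv_into_left)
 have "?i (x \<oplus>\<^bsub>V'\<^esub> y) = ?i x \<oplus>\<^bsub>V\<^esub> ?i y" if "x \<in> carrier V'" "y \<in> carrier V'" for x y
  using l[of "?i x \<oplus>\<^bsub>V\<^esub> ?i y"] i that assms by (simp add: miso_def vmod_add)
 moreover have "?i (c \<odot>\<^bsub>V'\<^esub> x) = c \<odot>\<^bsub>V\<^esub> ?i x" if "x \<in> carrier V'" for c x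
  using l[of "c \<odot>\<^bsub>V\<^esub> ?i x"] i that assms by (simp add: miso_def vmod_smult)
 ultimately show ?thesis using bij_betw_inv_into[OF bij] by (simp add: miso_def)
qed

text \<open>Transport of a representation along a linear isomorphism \<open>\<theta>\<close> from its space to V'.
Actions have to be undefined outside their domain for the transport to be invertible up to equality.\<close>

definition htr :: "nat => ('v => 'w) => 'v hrep => (complex, 'w) module => 'w hrep" where
 "htr g \<theta> W V' = \<lparr>hspace = V', hact = (\<lambda>u\<in>carrier (Uhh g). \<lambda>f\<in>psc V'.
   ext0 \<theta> (hact W u (ext0 (inv_into (carrier (hspace W)) \<theta>) f)))\<rparr>"

definition str :: "('v => 'w) => 'v sl2_rep => (complex, 'w) module => 'w sl2_rep" where
 "str \<theta> Y V' = \<lparr>sspace = V', sact = (\<lambda>A\<in>sl2. \<lambda>v\<in>carrier V'. \<theta> (sact Y A (inv_into (carrier (sspace Y)) \<theta> v)))\<rparr>"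

lemma htr_simps [simp]: "hspace (htr g \<theta> W V') = V'"
 by (simp add: htr_def)

lemma str_simps [simp]: "sspace (str \<theta> Y V') = V'"
 by (simp add: str_def)

locale mtrans =
 fixes V :: "(complex, 'v) module" and V' :: "(complex, 'w) module" and \<theta> :: "'v => 'w"
 assumes V: "vmod V" and V': "vmod V'" and iso: "miso V V' \<theta>"
begin

abbreviation "\<theta>i \<equiv> inv_into (carrier V) \<theta>"

lemma th: "x \<in> carrier V ==> \<theta> x \<in> carrier V'" and ths: "w \<in> carrier V' ==> \<theta>i w \<in> carrier V"
 and li: "x \<in> carrier V ==> \<theta>i (\<theta> x) = x" and ri: "w \<in> carrier V' ==> \<theta> (\<theta>i w) = w"
 and th_add: "x \<in> carrier V ==> y \<in> carrier V ==> \<theta> (x \<oplus>\<^bsub>V\<^esub> y) = \<theta> x \<oplus>\<^bsub>V'\<^esub> \<theta> y"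
 and th_smult: "x \<in> carrier V ==> \<theta> (c \<odot>\<^bsub>V\<^esub> x) = c \<odot>\<^bsub>V'\<^esub> \<theta> x"
 using iso by (auto simp: miso_def bij_betw_def inv_into_into f_inv_into_f)

lemma ti_add: "x \<in> carrier V' ==> y \<in> carrier V' ==> \<theta>i (x \<oplus>\<^bsub>V'\<^esub> y) = \<theta>i x \<oplus>\<^bsub>V\<^esub> \<theta>i y"
 and ti_smult: "x \<in> carrier V' ==> \<theta>i (c \<odot>\<^bsub>V'\<^esub> x) = c \<odot>\<^bsub>V\<^esub> \<theta>i x"
 using miso_inv[OF V iso] by (auto simp: miso_def)

lemma th_zero: "\<theta> \<zero>\<^bsub>V\<^esub> = \<zero>\<^bsub>V'\<^esub>"
 using th_smult[OF vmod_zero[OF V], of 0] vmod_smult_0[OF V vmod_zero[OF V]] vmod_smult_0[OF V' th[OF vmod_zero[OF V]]] by simp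

lemma ti_zero: "\<theta>i \<zero>\<^bsub>V'\<^esub> = \<zero>\<^bsub>V\<^esub>"
 using li[OF vmod_zero[OF V]] by (simp add: th_zero)

lemma e_in: "f \<in> psc V ==> ext0 \<theta> f \<in> psc V'"
 and ei_in: "f' \<in> psc V' ==> ext0 \<theta>i f' \<in> psc V"
 and e_li: "f \<in> psc V ==> ext0 \<theta>i (ext0 \<theta> f) = f"
 and e_ri: "f' \<in> psc V' ==> ext0 \<theta> (ext0 \<theta>i f') = f'"
 by (auto simp: ps_carrier ext0_def th ths li ri)

lemma e_add: "f \<in> psc V ==> f' \<in> psc V ==> ext0 \<theta> (f \<oplus>\<^bsub>ps_mod V\<^esub> f') = ext0 \<theta> f \<oplus>\<^bsub>ps_mod V'\<^esub> ext0 \<theta> f'"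
 and ei_add: "g1 \<in> psc V' ==> g2 \<in> psc V' ==> ext0 \<theta>i (g1 \<oplus>\<^bsub>ps_mod V'\<^esub> g2) = ext0 \<theta>i g1 \<oplus>\<^bsub>ps_mod V\<^esub> ext0 \<theta>i g2"
 by (auto simp: ps_carrier ext0_def ps_add th_add ti_add)

lemma e_smult: "f \<in> psc V ==> ext0 \<theta> (c \<odot>\<^bsub>ps_mod V\<^esub> f) = c \<odot>\<^bsub>ps_mod V'\<^esub> ext0 \<theta> f"
 by (rule ps_smult_hom[OF V V' th th_add th_smult])

lemma ei_smult: "f \<in> psc V' ==> ext0 \<theta>i (c \<odot>\<^bsub>ps_mod V'\<^esub> f) = c \<odot>\<^bsub>ps_mod V\<^esub> ext0 \<theta>i f"
 by (rule ps_smult_hom[OF V' V ths ti_add ti_smult])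

lemma e_const: "ext0 \<theta> (ps_const V v) = ps_const V' (\<theta> v)" and ei_const: "ext0 \<theta>i (ps_const V' w) = ps_const V (\<theta>i w)"
 by (auto simp: ext0_def ps_const_def fun_eq_iff th_zero ti_zero)

lemma e_bij: "bij_betw (ext0 \<theta>) (psc V) (psc V')"
 by (rule bij_betw_byWitness[where f' = "ext0 \<theta>i"]) (auto simp: e_in ei_in e_li e_ri)

lemma fin_dim_trans: assumes "fin_dim V" shows "fin_dim V'"
proof -
 obtain B where B: "finite B" "B \<subseteq> carrier V" "!!v. v \<in> carrier V ==> EX c. v = (\<Oplus>\<^bsub>V\<^esub>b\<in>B. c b \<odot>\<^bsub>V\<^esub> b)"
  using assms by (auto simp: fin_dim_def)
 have inj: "inj_on \<theta> B" using B(2) li by (metis inj_on_def subsetD)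
 have "EX c. w = (\<Oplus>\<^bsub>V'\<^esub>b\<in>\<theta> ` B. c b \<odot>\<^bsub>V'\<^esub> b)" if w: "w \<in> carrier V'" for w
 proof -
  obtain c where c: "\<theta>i w = (\<Oplus>\<^bsub>V\<^esub>b\<in>B. c b \<odot>\<^bsub>V\<^esub> b)" using B(3)[OF ths[OF w]] by blast
  have "w = \<theta> (\<Oplus>\<^bsub>V\<^esub>b\<in>B. c b \<odot>\<^bsub>V\<^esub> b)" unfolding c[symmetric] by (simp add: ri w)
  also have "\<dots> = (\<Oplus>\<^bsub>V'\<^esub>b\<in>B. \<theta> (c b \<odot>\<^bsub>V\<^esub> b))"
   by (rule finsum_hom[OF vmod_monoid[OF V] vmod_monoid[OF V'] th th_add th_zero]) (use B(2) in \<open>auto simp: vmod_smult[OF V]\<close>)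
  also have "\<dots> = (\<Oplus>\<^bsub>V'\<^esub>b\<in>B. c (\<theta>i (\<theta> b)) \<odot>\<^bsub>V'\<^esub> \<theta> b)"
   using B(2) by (intro abelian_monoid.finsum_cong'[OF vmod_monoid[OF V']]) (auto simp: th_smult li vmod_smult[OF V'] th subset_iff)
  also have "\<dots> = (\<Oplus>\<^bsub>V'\<^esub>b\<in>\<theta> ` B. c (\<theta>i b) \<odot>\<^bsub>V'\<^esub> b)"
   using B(2) by (intro abelian_monoid.finsum_reindex[OF vmod_monoid[OF V'], symmetric] inj) (auto simp: vmod_smult[OF V'] th subset_iff)
  finally show ?thesis by (rule exI[of _ "%b. c (\<theta>i b)"])
 qed
 then show ?thesis unfolding fin_dim_def using B th by (intro exI[of _ "\<theta> ` B"]) auto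
qed

lemma htr_act: "f \<in> psc V' ==> u \<in> carrier (Uhh g) ==> hspace W = V ==> hact (htr g \<theta> W V') u f = ext0 \<theta> (hact W u (ext0 \<theta>i f))"
 by (simp add: htr_def)

lemma htr_obj:
 assumes W: "hrep_obj g W" and sp: "hspace W = V"
 shows "hrep_obj g (htr g \<theta> W V')"
proof -
 let ?W = "htr g \<theta> W V'"
 have h: "hact W \<in> ring_hom (Uhh g) (End_ring KR (ps_mod V))" and s: "hact W (uscalar g c) = (\<lambda>f\<in>psc V. c \<odot>\<^bsub>ps_mod V\<^esub> f)" for c
  using W by (auto simp: hrep_obj_def sp)
 have lm: "hact W u \<in> lin_maps KR (ps_mod V) (ps_mod V)" if "u \<in> carrier (Uhh g)" for u
  using ring_hom_closed[OF h that] by (simp add: End_ring_def)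
 have cl: "hact W u f \<in> psc V" if "u \<in> carrier (Uhh g)" "f \<in> psc V" for u f
  using lm[OF that(1)] that(2) by (auto simp: lin_maps_def)
 show ?thesis unfolding hrep_obj_def htr_simps
 proof (intro conjI allI)
  show "vmod V'" by (rule V')
  show "fin_dim V'" using W sp by (intro fin_dim_trans) (simp add: hrep_obj_def)
  show "hact ?W \<in> extensional (carrier (Uhh g))" by (simp add: htr_def)
  show "hact ?W \<in> ring_hom (Uhh g) (End_ring KR (ps_mod V'))"
  proof (rule ring_hom_memI)
   fix u v assume u: "u \<in> carrier (Uhh g)"
   have "hact ?W u (x \<oplus>\<^bsub>ps_mod V'\<^esub> y) = hact ?W u x \<oplus>\<^bsub>ps_mod V'\<^esub> hact ?W u y" if xy: "x \<in> psc V'" "y \<in> psc V'" for x y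
    using lm[OF u] xy u ps_add_closed[OF V' xy] by (auto simp: htr_act sp ei_add ei_in cl e_add lin_maps_def)
   moreover have "hact ?W u (c \<odot>\<^bsub>ps_mod V'\<^esub> x) = c \<odot>\<^bsub>ps_mod V'\<^esub> hact ?W u x" if x: "x \<in> psc V'" for x c
    using lm[OF u] x u ps_smult_closed[OF V' x] by (auto simp: htr_act sp ei_smult ei_in cl e_smult lin_maps_def)
   moreover have "hact ?W u \<in> psc V' \<rightarrow>\<^sub>E psc V'"
    using u by (auto simp: htr_def sp intro!: e_in cl ei_in)
   ultimately show "hact ?W u \<in> carrier (End_ring KR (ps_mod V'))"
    by (simp add: End_ring_def lin_maps_def)
   assume v: "v \<in> carrier (Uhh g)"
   have uv: "u \<otimes>\<^bsub>Uhh g\<^esub> v \<in> carrier (Uhh g)" "u \<oplus>\<^bsub>Uhh g\<^esub> v \<in> carrier (Uhh g)"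
    using ucls_surj[OF u] ucls_surj[OF v] by (auto simp: ucls_mult ucls_add)
   have m: "hact W (u \<otimes>\<^bsub>Uhh g\<^esub> v) f = hact W u (hact W v f)" "hact W (u \<oplus>\<^bsub>Uhh g\<^esub> v) f = hact W u f \<oplus>\<^bsub>ps_mod V\<^esub> hact W v f"
    if "f \<in> psc V" for f
    using ring_hom_mult[OF h u v] ring_hom_add[OF h u v] that by (simp_all add: End_ring_def compose_def)
   show "hact ?W (u \<otimes>\<^bsub>Uhh g\<^esub> v) = hact ?W u \<otimes>\<^bsub>End_ring KR (ps_mod V')\<^esub> hact ?W v"
    using u v uv by (auto simp: htr_def End_ring_def compose_def fun_eq_iff restrict_def sp m ei_in e_in cl e_li)
   show "hact ?W (u \<oplus>\<^bsub>Uhh g\<^esub> v) = hact ?W u \<oplus>\<^bsub>End_ring KR (ps_mod V')\<^esub> hact ?W v"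
    using u v uv by (auto simp: htr_def End_ring_def fun_eq_iff restrict_def sp m(2) ei_in cl e_add)
  next
   have "hact W \<one>\<^bsub>Uhh g\<^esub> f = f" if "f \<in> psc V" for f using ring_hom_one[OF h] that by (simp add: End_ring_def)
   then have "ext0 \<theta> (hact W (ucls g 1) (ext0 \<theta>i x)) = x" if "x \<in> psc V'" for x
    using that by (simp only: ucls_one ei_in e_ri)
   then show "hact ?W \<one>\<^bsub>Uhh g\<^esub> = \<one>\<^bsub>End_ring KR (ps_mod V')\<^esub>"
    unfolding htr_def End_ring_def hrep.simps monoid.simps ucls_one sp
    by (simp only: restrict_apply' ucls_in) (rule restrict_ext)
  qed
  show "hact ?W (uscalar g c) = (\<lambda>f\<in>psc V'. c \<odot>\<^bsub>ps_mod V'\<^esub> f)" for c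
  proof -
   have "ext0 \<theta> (c \<odot>\<^bsub>ps_mod V\<^esub> ext0 \<theta>i f) = c \<odot>\<^bsub>ps_mod V'\<^esub> f" if "f \<in> psc V'" for f
    using that by (simp add: e_smult ei_in e_ri)
   then have "ext0 \<theta> (hact W (uscalar g c) (ext0 \<theta>i f)) = c \<odot>\<^bsub>ps_mod V'\<^esub> f" if "f \<in> psc V'" for f
    using that by (simp only: s ei_in restrict_apply')
   moreover have "uscalar g c \<in> carrier (Uhh g)" by (simp add: uscalar_def)
   ultimately show ?thesis
    unfolding htr_def hrep.simps sp by (simp only: restrict_apply') (rule restrict_ext)
  qed
 qed
qed

lemma htr_iso:
 assumes W: "hrep_obj g W" and sp: "hspace W = V"
 shows "hrep_iso g W (htr g \<theta> W V')"
proof -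
 have h: "hact W \<in> ring_hom (Uhh g) (End_ring KR (ps_mod V))" using W by (auto simp: hrep_obj_def sp)
 have cl: "hact W u f \<in> psc V" if "u \<in> carrier (Uhh g)" "f \<in> psc V" for u f
  using ring_hom_closed[OF h that(1)] that(2) by (auto simp: End_ring_def lin_maps_def)
 let ?\<phi> = "\<lambda>f\<in>psc V. ext0 \<theta> f"
 have "?\<phi> \<in> hrep_hom g W (htr g \<theta> W V')"
  unfolding hrep_hom_def lin_maps_def htr_simps sp
  by (auto simp: e_in e_add e_smult ps_add_closed[OF V] ps_smult_closed[OF V] htr_act[OF _ _ sp] cl e_li)
 moreover have "bij_betw ?\<phi> (psc V) (psc V') = bij_betw (ext0 \<theta>) (psc V) (psc V')"
  by (rule bij_betw_cong) simp
 then have "bij_betw ?\<phi> (psc V) (psc V')" using e_bij by simp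
 ultimately show ?thesis unfolding hrep_iso_def htr_simps sp by blast
qed

lemma htr_class_lim:
 assumes W: "hrep_obj g W" and sp: "hspace W = V"
 shows "class_lim g (htr g \<theta> W V') = str \<theta> (class_lim g W) V'"
proof -
 have h: "hact W \<in> ring_hom (Uhh g) (End_ring KR (ps_mod V))" using W by (auto simp: hrep_obj_def sp)
 have cl: "hact W u f k l \<in> carrier V" if "u \<in> carrier (Uhh g)" "f \<in> psc V" for u f k l
 proof -
  have "hact W u f \<in> psc V"
   using ring_hom_closed[OF h that(1)] that(2) by (auto simp: End_ring_def lin_maps_def)
  then show ?thesis by (simp add: ps_carrier)
 qed
 have m: "hact_mod g (htr g \<theta> W V') x v = \<theta> (hact_mod g W x (\<theta>i v))" if "v \<in> carrier V'" for x v
  using that by (simp add: hact_mod_def htr_act[OF ps_const_in[OF V']] sp ei_const) (simp add: ext0_def)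
 have hm: "hact_mod g W x v \<in> carrier V" if "v \<in> carrier V" for x v
  unfolding hact_mod_def sp by (rule cl) (simp_all add: ps_const_in[OF V that])
 have "A $ 1 $ 1 \<odot>\<^bsub>V'\<^esub> hact_mod g (htr g \<theta> W V') Gen_H v \<oplus>\<^bsub>V'\<^esub> A $ 1 $ 2 \<odot>\<^bsub>V'\<^esub> hact_mod g (htr g \<theta> W V') Gen_Xp v \<oplus>\<^bsub>V'\<^esub>
   A $ 2 $ 1 \<odot>\<^bsub>V'\<^esub> hact_mod g (htr g \<theta> W V') Gen_Xm v
  = \<theta> (A $ 1 $ 1 \<odot>\<^bsub>V\<^esub> hact_mod g W Gen_H (\<theta>i v) \<oplus>\<^bsub>V\<^esub> A $ 1 $ 2 \<odot>\<^bsub>V\<^esub> hact_mod g W Gen_Xp (\<theta>i v) \<oplus>\<^bsub>V\<^esub>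
   A $ 2 $ 1 \<odot>\<^bsub>V\<^esub> hact_mod g W Gen_Xm (\<theta>i v))" if "v \<in> carrier V'" for A v
  using that by (simp add: m hm ths vmod_add[OF V] vmod_smult[OF V] th_add th_smult)
 then show ?thesis
  unfolding class_lim_def str_def htr_simps by (auto simp: fun_eq_iff restrict_def sp ths)
qed

lemma htr_htr:
 assumes W: "hrep_obj g W" and sp: "hspace W = V'"
 shows "htr g \<theta> (htr g \<theta>i W V) V' = W"
proof -
 have h: "hact W \<in> ring_hom (Uhh g) (End_ring KR (ps_mod V'))" and e: "hact W \<in> extensional (carrier (Uhh g))"
  using W by (auto simp: hrep_obj_def sp)
 have lm: "hact W u \<in> lin_maps KR (ps_mod V') (ps_mod V')" if "u \<in> carrier (Uhh g)" for u
  using ring_hom_closed[OF h that] by (simp add: End_ring_def)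
 have cl: "hact W u f \<in> psc V'" if "u \<in> carrier (Uhh g)" "f \<in> psc V'" for u f
  using lm[OF that(1)] that(2) by (auto simp: lin_maps_def)
 have ii: "inv_into (carrier V') \<theta>i x = \<theta> x" if "x \<in> carrier V" for x
  using inv_into_f_f[of \<theta>i "carrier V'" "\<theta> x"] li th ri that by (metis inj_on_def)
 have eii: "ext0 (inv_into (carrier V') \<theta>i) f = ext0 \<theta> f" if "f \<in> psc V" for f
  using that by (simp add: ext0_def ps_carrier ii)
 have "hact (htr g \<theta> (htr g \<theta>i W V) V') u f = hact W u f" if "u \<in> carrier (Uhh g)" "f \<in> psc V'" for u f
  using that by (simp add: htr_def sp ei_in eii e_ri cl)
 moreover have "hact W u f = undefined" if "u \<in> carrier (Uhh g)" "f \<notin> psc V'" for u f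
  using lm[OF that(1)] that(2) by (auto simp: lin_maps_def)
 moreover have "hact W u = undefined" if "u \<notin> carrier (Uhh g)" for u
  using e that by (auto simp: extensional_def)
 ultimately have eq: "hact (htr g \<theta> (htr g \<theta>i W V) V') u f = hact W u f" for u f
  by (cases "u \<in> carrier (Uhh g)"; cases "f \<in> psc V'") (auto simp: htr_def)
 have "hact (htr g \<theta> (htr g \<theta>i W V) V') = hact W" by (rule ext, rule ext, rule eq)
 then show ?thesis by (intro hrep.equality) (simp_all add: sp)
qed

lemma str_obj:
 assumes Y: "sl2_obj Y" and sp: "sspace Y = V"
 shows "sl2_obj (str \<theta> Y V')"
proof -
 have L: "sact Y A \<in> lin_maps CR V V" if "A \<in> sl2" for A using Y that by (auto simp: sl2_obj_def sp)
 have cl: "sact Y A v \<in> carrier V" if "A \<in> sl2" "v \<in> carrier V" for A v using L[OF that(1)] that(2) by (auto simp: lin_maps_def)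
 have rel: "sact Y (A + B) v = sact Y A v \<oplus>\<^bsub>V\<^esub> sact Y B v" "sact Y (\<chi> i j. c * A $ i $ j) v = c \<odot>\<^bsub>V\<^esub> sact Y A v"
  "sact Y (A ** B - B ** A) v = sact Y A (sact Y B v) \<ominus>\<^bsub>V\<^esub> sact Y B (sact Y A v)"
  if "A \<in> sl2" "B \<in> sl2" "v \<in> carrier V" for A B c v using Y that by (auto simp: sl2_obj_def sp)
 have th_minus: "\<theta> (x \<ominus>\<^bsub>V\<^esub> y) = \<theta> x \<ominus>\<^bsub>V'\<^esub> \<theta> y" if "x \<in> carrier V" "y \<in> carrier V" for x y
 proof -
  interpret A: abelian_group V by (rule vmod_group[OF V])
  interpret B: abelian_group V' by (rule vmod_group[OF V'])
  have "\<theta> (\<ominus>\<^bsub>V\<^esub> y) \<oplus>\<^bsub>V'\<^esub> \<theta> y = \<zero>\<^bsub>V'\<^esub>" using that by (simp add: th_add[symmetric] th_zero A.l_neg)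
  then have "\<ominus>\<^bsub>V'\<^esub> \<theta> y = \<theta> (\<ominus>\<^bsub>V\<^esub> y)" using that by (intro B.minus_equality) (auto simp: th)
  then show ?thesis using that by (simp add: a_minus_def th_add)
 qed
 have ac: "sact (str \<theta> Y V') A v = \<theta> (sact Y A (\<theta>i v))" if "A \<in> sl2" "v \<in> carrier V'" for A v
  using that by (simp add: str_def sp)
 show ?thesis unfolding sl2_obj_def str_simps
 proof (intro conjI ballI allI)
  show "vmod V'" by (rule V')
  show "fin_dim V'" using Y sp by (intro fin_dim_trans) (simp add: sl2_obj_def)
  show "sact (str \<theta> Y V') \<in> sl2 \<rightarrow>\<^sub>E lin_maps CR V' V'"
  proof (rule PiE_I)
   fix A assume A: "A \<in> sl2"
   have "sact (str \<theta> Y V') A \<in> carrier V' \<rightarrow>\<^sub>E carrier V'" using A by (auto simp: str_def sp intro!: th cl ths)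
   moreover have "sact (str \<theta> Y V') A (x \<oplus>\<^bsub>V'\<^esub> y) = sact (str \<theta> Y V') A x \<oplus>\<^bsub>V'\<^esub> sact (str \<theta> Y V') A y"
    if "x \<in> carrier V'" "y \<in> carrier V'" for x y
    using that L[OF A] by (simp add: ac A vmod_add[OF V'] ti_add lin_maps_def ths th_add[OF cl cl])
   moreover have "sact (str \<theta> Y V') A (c \<odot>\<^bsub>V'\<^esub> x) = c \<odot>\<^bsub>V'\<^esub> sact (str \<theta> Y V') A x" if "x \<in> carrier V'" for x c
    using that L[OF A] by (simp add: ac A vmod_smult[OF V'] ti_smult lin_maps_def ths th_smult[OF cl])
   ultimately show "sact (str \<theta> Y V') A \<in> lin_maps CR V' V'" by (simp add: lin_maps_def)
  qed (simp add: str_def)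
  fix A B c v assume A: "A \<in> sl2" "B \<in> sl2" and v: "v \<in> carrier V'"
  note [simp] = sl2_closed ac A v rel[OF A ths[OF v]] cl ths th li th_add th_smult th_minus
  show "sact (str \<theta> Y V') (A + B) v = sact (str \<theta> Y V') A v \<oplus>\<^bsub>V'\<^esub> sact (str \<theta> Y V') B v" by simp
  show "sact (str \<theta> Y V') (\<chi> i j. c * A $ i $ j) v = c \<odot>\<^bsub>V'\<^esub> sact (str \<theta> Y V') A v" by simp
  show "sact (str \<theta> Y V') (A ** B - B ** A) v = sact (str \<theta> Y V') A (sact (str \<theta> Y V') B v) \<ominus>\<^bsub>V'\<^esub> sact (str \<theta> Y V') B (sact (str \<theta> Y V') A v)"
   by simp
 qed
qed

lemma str_iso:
 assumes Y: "sl2_obj Y" and sp: "sspace Y = V"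
 shows "sl2_iso Y (str \<theta> Y V')"
proof -
 have L: "sact Y A \<in> lin_maps CR V V" if "A \<in> sl2" for A using Y that by (auto simp: sl2_obj_def sp)
 have cl: "sact Y A v \<in> carrier V" if "A \<in> sl2" "v \<in> carrier V" for A v using L[OF that(1)] that(2) by (auto simp: lin_maps_def)
 let ?\<phi> = "\<lambda>v\<in>carrier V. \<theta> v"
 have "?\<phi> \<in> sl2_hom Y (str \<theta> Y V')"
  by (auto simp: sl2_hom_def lin_maps_def sp th th_add th_smult vmod_add[OF V] vmod_smult[OF V] cl str_def li)
 moreover have "bij_betw ?\<phi> (carrier V) (carrier V') = bij_betw \<theta> (carrier V) (carrier V')"
  by (rule bij_betw_cong) simp
 then have "bij_betw ?\<phi> (carrier V) (carrier V')" using iso by (simp add: miso_def)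
 ultimately show ?thesis unfolding sl2_iso_def str_simps sp by blast
qed

lemma str_str:
 assumes Y: "sl2_obj Y" and sp: "sspace Y = V'"
 shows "str \<theta> (str \<theta>i Y V) V' = Y"
proof -
 have L: "sact Y A \<in> lin_maps CR V' V'" if "A \<in> sl2" for A using Y that by (auto simp: sl2_obj_def sp)
 have e: "sact Y \<in> extensional sl2" using Y by (auto simp: sl2_obj_def sp PiE_def)
 have cl: "sact Y A v \<in> carrier V'" if "A \<in> sl2" "v \<in> carrier V'" for A v using L[OF that(1)] that(2) by (auto simp: lin_maps_def)
 have ii: "inv_into (carrier V') \<theta>i x = \<theta> x" if "x \<in> carrier V" for x
  using inv_into_f_f[of \<theta>i "carrier V'" "\<theta> x"] li th ri that by (metis inj_on_def)
 have "sact (str \<theta> (str \<theta>i Y V) V') A v = sact Y A v" if "A \<in> sl2" "v \<in> carrier V'" for A v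
  using that by (simp add: str_def sp ths ii ri cl)
 moreover have "sact Y A v = undefined" if "A \<in> sl2" "v \<notin> carrier V'" for A v
  using L[OF that(1)] that(2) by (auto simp: lin_maps_def)
 moreover have "sact Y A = undefined" if "A \<notin> sl2" for A
  using e that by (auto simp: extensional_def)
 ultimately have eq: "sact (str \<theta> (str \<theta>i Y V) V') A v = sact Y A v" for A v
  by (cases "A \<in> sl2"; cases "v \<in> carrier V'") (auto simp: str_def)
 have "sact (str \<theta> (str \<theta>i Y V) V') = sact Y" by (rule ext, rule ext, rule eq)
 then show ?thesis by (intro sl2_rep.equality) (simp_all add: sp)
qed

end

lemma vmod_transfer:
 assumes S: "cv.subspace S" and iso: "miso (emod S) V \<theta>" and z: "\<zero>\<^bsub>V\<^esub> = \<theta> 0"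
 shows "vmod V"
proof -
 have im: "carrier V = \<theta> ` S" using iso by (auto simp: miso_def bij_betw_def)
 have a: "\<theta> x \<oplus>\<^bsub>V\<^esub> \<theta> y = \<theta> (x + y)" if "x \<in> S" "y \<in> S" for x y using iso that by (simp add: miso_def)
 have s: "c \<odot>\<^bsub>V\<^esub> \<theta> x = \<theta> (c \<cdot> x)" if "x \<in> S" for c x using iso that by (simp add: miso_def)
 note [simp] = im z a s cv.subspace_add[OF S] cv.subspace_scale[OF S] cv.subspace_0[OF S] cv.subspace_neg[OF S]
 show ?thesis
 proof (rule moduleI[OF cring_CR])
  show "abelian_group V"
  proof (rule abelian_groupI)
   fix x assume "x \<in> carrier V"
   then obtain y where "y \<in> S" "x = \<theta> y" by auto
   then show "\<exists>y\<in>carrier V. y \<oplus>\<^bsub>V\<^esub> x = \<zero>\<^bsub>V\<^esub>" by (auto intro!: bexI[of _ "- y"])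
  qed (auto simp: add_ac)
 qed (auto simp: csc_add_left csc_add_right csc_csc)
qed

lemma fin_dim_transfer: "fd S ==> miso (emod S) V \<theta> ==> \<zero>\<^bsub>V\<^esub> = \<theta> 0 ==> fin_dim V"
 using mtrans.fin_dim_trans[OF mtrans.intro[OF module_emod vmod_transfer] fin_dim_emod] fd_subspace by blast

lemma complement:
 fixes K E :: "'a::cvec set"
 assumes K: "cv.subspace K" and E: "cv.subspace E" and KE: "K \<subseteq> E"
 shows "EX S. cv.subspace S & S \<subseteq> E & K \<inter> S = {0} & (\<forall>x\<in>E. \<exists>k\<in>K. \<exists>s\<in>S. x = k + s)"
proof -
 obtain B where B: "B \<subseteq> K" "cv.independent B" "K \<subseteq> cv.span B" using cv.basis_exists[of K] by metis
 obtain C where C: "B \<subseteq> C" "C \<subseteq> E" "cv.independent C" "E \<subseteq> cv.span C"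
  using cv.maximal_independent_subset_extend[of B E] B KE by (metis subset_trans)
 let ?S = "cv.span (C - B)"
 have "?S \<subseteq> E" using C(2) E by (meson Diff_subset cv.span_minimal subset_trans)
 moreover have "x = 0" if x: "x \<in> K" "x \<in> ?S" for x
 proof -
  have 1: "cv.representation C x = cv.representation B x"
   by (rule cv.representation_extend[OF C(3) _ C(1)]) (use x B in auto)
  have 2: "cv.representation C x = cv.representation (C - B) x"
   by (rule cv.representation_extend[OF C(3) x(2)]) auto
  have "cv.representation C x b = 0" for b
  proof (cases "b \<in> B")
   case True
   then show ?thesis unfolding 2 using cv.representation_ne_zero[of "C - B" x b] by auto
  next
   case False
   then show ?thesis unfolding 1 using cv.representation_ne_zero[of B x b] by auto
  qed
  moreover have "x \<in> cv.span C" using x B C by (meson cv.span_mono subset_iff)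
  ultimately show ?thesis using cv.sum_nonzero_representation_eq[OF C(3), of x] by simp
 qed
 moreover have "\<exists>k\<in>K. \<exists>s\<in>?S. x = k + s" if "x \<in> E" for x
 proof -
  have "x \<in> cv.span (B \<union> (C - B))" using that C by (simp add: Un_absorb1 subset_iff)
  then obtain k s where "k \<in> cv.span B" "s \<in> ?S" "x = k + s" unfolding cv.span_Un by auto
  moreover have "cv.span B \<subseteq> K" by (rule cv.span_minimal[OF B(1) K])
  ultimately show ?thesis by blast
 qed
 ultimately show ?thesis using K cv.subspace_span cv.subspace_0 cv.span_zero by (intro exI[of _ ?S]) blast
qed

definition Cr :: "nat => (nat => complex) set" where "Cr r = {x. \<forall>j\<ge>r. x j = 0}"

lemma subspace_Cr: "cv.subspace (Cr r)"
 by (auto simp: cv.subspace_def Cr_def csc_complex_def)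

lemma fd_Cr: "fd (Cr r)"
 unfolding fd_def
proof (intro conjI exI[of _ "(%i j. if j = i then 1 else 0) ` {..<r}"])
 show "Cr r \<subseteq> cv.span ((%i j. if j = i then 1 else (0::complex)) ` {..<r})"
 proof
  fix x assume x: "x \<in> Cr r"
  have "x = (\<Sum>i<r. x i \<cdot> (%j. if j = i then 1 else (0::complex)))"
  proof
   fix j
   have "(\<Sum>i<r. x i \<cdot> (%j. if j = i then 1 else (0::complex))) j = (\<Sum>i<r. if j = i then x i else 0)"
    by (induction r) (auto simp: csc_complex_def)
   also have "\<dots> = x j" using x by (auto simp: Cr_def)
   finally show "x j = (\<Sum>i<r. x i \<cdot> (%j. if j = i then 1 else (0::complex))) j" ..
  qed
  then show "x \<in> cv.span ((%i j. if j = i then 1 else 0) ` {..<r})"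
   by (metis (no_types, lifting) cv.span_sum cv.span_scale cv.span_base imageI)
 qed
qed (auto simp: subspace_Cr)

lemma fd_subset: "fd S ==> cv.subspace S' ==> S' \<subseteq> S ==> fd S'"
 unfolding fd_def by blast

text \<open>\<open>\<complex>\<^sup>r\<close> maps onto V, and a complement of the kernel is mapped isomorphically.\<close>

lemma coordinates:
 assumes V: "vmod V" and fin: "fin_dim V"
 shows "\<exists>(S :: (nat => complex) set) \<theta>. fd S & miso (emod S) V \<theta>"
proof -
 interpret A: abelian_group V by (rule vmod_group[OF V])
 interpret M: module CR V by (rule V)
 obtain B where B: "finite B" "B \<subseteq> carrier V" "!!v. v \<in> carrier V ==> EX c. v = (\<Oplus>\<^bsub>V\<^esub>b\<in>B. c b \<odot>\<^bsub>V\<^esub> b)"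
  using fin by (auto simp: fin_dim_def)
 obtain r and b :: "nat => 'a" where b: "bij_betw b {..<r} B" using ex_bij_betw_nat_finite[OF B(1)] by (auto simp: atLeast0LessThan)
 have bV: "b i \<in> carrier V" if "i < r" for i using b B(2) that by (auto simp: bij_betw_def)
 define \<sigma> where "\<sigma> x = (\<Oplus>\<^bsub>V\<^esub>i\<in>{..<r}. x i \<odot>\<^bsub>V\<^esub> b i)" for x :: "nat => complex"
 have bc: "(%i. x i \<odot>\<^bsub>V\<^esub> b i) \<in> {..<r} \<rightarrow> carrier V" for x :: "nat => complex" using bV vmod_smult[OF V] by auto
 have sin: "\<sigma> x \<in> carrier V" for x unfolding \<sigma>_def by (rule A.finsum_closed[OF bc])
 have sadd: "\<sigma> (x + y) = \<sigma> x \<oplus>\<^bsub>V\<^esub> \<sigma> y" for x y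
 proof -
  have "\<sigma> (x + y) = (\<Oplus>\<^bsub>V\<^esub>i\<in>{..<r}. x i \<odot>\<^bsub>V\<^esub> b i \<oplus>\<^bsub>V\<^esub> y i \<odot>\<^bsub>V\<^esub> b i)"
   unfolding \<sigma>_def using bV M.smult_l_distr vmod_smult[OF V] by (intro A.finsum_cong') (auto simp: vmod_add[OF V])
  also have "\<dots> = \<sigma> x \<oplus>\<^bsub>V\<^esub> \<sigma> y" unfolding \<sigma>_def by (rule A.finsum_addf[OF bc bc])
  finally show ?thesis .
 qed
 have ssm: "\<sigma> (c \<cdot> x) = c \<odot>\<^bsub>V\<^esub> \<sigma> x" for c x
 proof -
  have "c \<odot>\<^bsub>V\<^esub> \<sigma> x = (\<Oplus>\<^bsub>V\<^esub>i\<in>{..<r}. c \<odot>\<^bsub>V\<^esub> (x i \<odot>\<^bsub>V\<^esub> b i))"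
   unfolding \<sigma>_def
  proof (rule finsum_hom[OF vmod_monoid[OF V] vmod_monoid[OF V]])
   show "c \<odot>\<^bsub>V\<^esub> \<zero>\<^bsub>V\<^esub> = \<zero>\<^bsub>V\<^esub>" using M.smult_r_null by simp
   show "c \<odot>\<^bsub>V\<^esub> (x \<oplus>\<^bsub>V\<^esub> y) = c \<odot>\<^bsub>V\<^esub> x \<oplus>\<^bsub>V\<^esub> c \<odot>\<^bsub>V\<^esub> y" if "x \<in> carrier V" "y \<in> carrier V" for x y
    using M.smult_r_distr[of c x y] that by simp
  qed (use bV vmod_smult[OF V] in auto)
  also have "\<dots> = \<sigma> (c \<cdot> x)" unfolding \<sigma>_def
   using bV M.smult_assoc1[symmetric] vmod_smult[OF V] by (intro A.finsum_cong') (auto simp: csc_complex_def)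
  finally show ?thesis ..
 qed
 have s0: "\<sigma> 0 = \<zero>\<^bsub>V\<^esub>" using ssm[of 0 0] vmod_smult_0[OF V sin] by simp
 define K where "K = {x \<in> Cr r. \<sigma> x = \<zero>\<^bsub>V\<^esub>}"
 have "cv.subspace K" unfolding K_def
  using cv.subspace_add[OF subspace_Cr] cv.subspace_scale[OF subspace_Cr] cv.subspace_0[OF subspace_Cr] M.smult_r_null
  by (intro cv.subspaceI) (auto simp: s0 sadd ssm)
 then obtain S where S: "cv.subspace S" "S \<subseteq> Cr r" "K \<inter> S = {0}" "!!x. x \<in> Cr r ==> \<exists>k\<in>K. \<exists>s\<in>S. x = k + s"
  using complement[of K "Cr r"] subspace_Cr[of r] unfolding K_def by auto
 have "inj_on \<sigma> S"
 proof (rule inj_onI)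
  fix x y assume xy: "x \<in> S" "y \<in> S" "\<sigma> x = \<sigma> y"
  have "\<sigma> (x - y) \<oplus>\<^bsub>V\<^esub> \<sigma> y = \<sigma> y" using sadd[of "x - y" y] xy by simp
  then have "\<sigma> (x - y) = \<zero>\<^bsub>V\<^esub>" using A.add.r_cancel_one'[OF sin sin] by metis
  then have "x - y \<in> K \<inter> S" using cv.subspace_diff[OF S(1) xy(1,2)] S(2) by (auto simp: K_def)
  then show "x = y" using S(3) by auto
 qed
 moreover have "v \<in> \<sigma> ` S" if vV: "v \<in> carrier V" for v
 proof -
  obtain c where c: "v = (\<Oplus>\<^bsub>V\<^esub>b\<in>B. c b \<odot>\<^bsub>V\<^esub> b)" using B(3)[OF vV] by blast
  let ?x = "%i. if i < r then c (b i) else 0"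
  have "\<sigma> ?x = (\<Oplus>\<^bsub>V\<^esub>i\<in>{..<r}. c (b i) \<odot>\<^bsub>V\<^esub> b i)" unfolding \<sigma>_def
   using bV vmod_smult[OF V] by (intro A.finsum_cong') auto
  also have "\<dots> = (\<Oplus>\<^bsub>V\<^esub>b\<in>b ` {..<r}. c b \<odot>\<^bsub>V\<^esub> b)"
   using b bV vmod_smult[OF V] by (intro A.finsum_reindex[symmetric]) (auto simp: bij_betw_def)
  finally have "\<sigma> ?x = v" using b c by (simp add: bij_betw_def)
  moreover have "?x \<in> Cr r" by (auto simp: Cr_def)
  then obtain k s where "k \<in> K" "s \<in> S" "?x = k + s" using S(4) by blast
  ultimately have "v = \<sigma> s" using sadd[of k s] sin[of s] by (simp add: K_def)
  then show ?thesis using \<open>s \<in> S\<close> by blast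
 qed
 ultimately have "bij_betw \<sigma> S (carrier V)" using sin by (auto simp: bij_betw_def)
 then have "miso (emod S) V \<sigma>" by (auto simp: miso_def sadd ssm)
 then show ?thesis using fd_subset[OF fd_Cr S(1,2)] by blast
qed

section \<open>The classical limit functor\<close>

lemma rep_coord:
 assumes W: "hrep_obj g W"
 obtains S :: "(nat => complex) set" and \<theta> W1
 where "fd S" "mtrans (emod S) (hspace W) \<theta>" "hrep_obj g W1" "hspace W1 = emod S" "W = htr g \<theta> W1 (hspace W)"
proof -
 have V: "vmod (hspace W)" "fin_dim (hspace W)" using W by (simp_all add: hrep_obj_def)
 obtain S :: "(nat => complex) set" and \<theta> where S: "fd S" and iso: "miso (emod S) (hspace W) \<theta>" using coordinates[OF V] by blast
 interpret m: mtrans "emod S" "hspace W" \<theta> by (rule mtrans.intro[OF module_emod[OF fd_subspace[OF S]] V(1) iso])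
 interpret i: mtrans "hspace W" "emod S" m.\<theta>i by (rule mtrans.intro[OF V(1) m.V miso_inv[OF m.V iso]])
 show ?thesis
  by (rule that[OF S m.mtrans_axioms i.htr_obj[OF W refl] htr_simps m.htr_htr[OF W refl, symmetric]])
qed

lemma sl2_coord:
 assumes Y: "sl2_obj Y"
 obtains S :: "(nat => complex) set" and \<theta> Y1
 where "fd S" "mtrans (emod S) (sspace Y) \<theta>" "sl2_obj Y1" "sspace Y1 = emod S" "Y = str \<theta> Y1 (sspace Y)"
proof -
 have V: "vmod (sspace Y)" "fin_dim (sspace Y)" using Y by (simp_all add: sl2_obj_def)
 obtain S :: "(nat => complex) set" and \<theta> where S: "fd S" and iso: "miso (emod S) (sspace Y) \<theta>" using coordinates[OF V] by blast
 interpret m: mtrans "emod S" "sspace Y" \<theta> by (rule mtrans.intro[OF module_emod[OF fd_subspace[OF S]] V(1) iso])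
 interpret i: mtrans "sspace Y" "emod S" m.\<theta>i by (rule mtrans.intro[OF V(1) m.V miso_inv[OF m.V iso]])
 show ?thesis
  by (rule that[OF S m.mtrans_axioms i.str_obj[OF Y refl] str_simps m.str_str[OF Y refl, symmetric]])
qed

lemma class_lim_obj_emod:
 assumes W: "hrep_obj g W" and sp: "hspace W = emod S" and S: "fd S" and g: "g \<ge> 1"
 shows "sl2_obj (class_lim g W)"
proof -
 interpret hops S "hgen g W" g by (rule hrep_hops[OF W sp fd_subspace[OF S] g])
 show ?thesis unfolding class_lim_emod[OF sp] by (rule sl2_obj_triple[OF limit_triple S])
qed

lemma class_lim_obj:
 assumes W: "hrep_obj g W" and g: "g \<ge> 1"
 shows "sl2_obj (class_lim g W)"
proof -
 obtain S :: "(nat => complex) set" and \<theta> W1 where S: "fd S" and m: "mtrans (emod S) (hspace W) \<theta>"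
  and W1: "hrep_obj g W1" "hspace W1 = emod S" and eq: "W = htr g \<theta> W1 (hspace W)" by (rule rep_coord[OF W])
 interpret mtrans "emod S" "hspace W" \<theta> by (rule m)
 have "sl2_obj (str \<theta> (class_lim g W1) (hspace W))"
  by (rule str_obj[OF class_lim_obj_emod[OF W1 S g]]) (simp add: class_lim_def W1)
 then show ?thesis by (subst eq) (simp only: htr_class_lim[OF W1])
qed

lemma lin_maps_comp:
 assumes \<phi>: "\<phi> \<in> lin_maps R M N" and \<psi>: "\<psi> \<in> lin_maps R N P"
  and "!!x y. x \<in> carrier M ==> y \<in> carrier M ==> x \<oplus>\<^bsub>M\<^esub> y \<in> carrier M" "!!c x. c \<in> carrier R ==> x \<in> carrier M ==> c \<odot>\<^bsub>M\<^esub> x \<in> carrier M"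
 shows "compose (carrier M) \<psi> \<phi> \<in> lin_maps R M P"
proof -
 have "\<phi> x \<in> carrier N" if "x \<in> carrier M" for x using \<phi> that by (auto simp: lin_maps_def)
 then show ?thesis using assms by (auto simp: lin_maps_def compose_def)
qed

lemma lin_maps_inv:
 assumes \<phi>: "\<phi> \<in> lin_maps R M N" and bij: "bij_betw \<phi> (carrier M) (carrier N)"
  and cl: "!!x y. x \<in> carrier M ==> y \<in> carrier M ==> x \<oplus>\<^bsub>M\<^esub> y \<in> carrier M" "!!c x. c \<in> carrier R ==> x \<in> carrier M ==> c \<odot>\<^bsub>M\<^esub> x \<in> carrier M"
 obtains \<psi> where "\<psi> \<in> lin_maps R N M" "!!x. x \<in> carrier M ==> \<psi> (\<phi> x) = x" "!!y. y \<in> carrier N ==> \<phi> (\<psi> y) = y & \<psi> y \<in> carrier M"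
  "bij_betw \<psi> (carrier N) (carrier M)"
proof -
 let ?i = "inv_into (carrier M) \<phi>"
 have i: "?i y \<in> carrier M" "\<phi> (?i y) = y" if "y \<in> carrier N" for y
  using bij that by (auto simp: bij_betw_def inv_into_into f_inv_into_f)
 have l: "?i (\<phi> x) = x" if "x \<in> carrier M" for x using bij that by (simp add: bij_betw_inv_into_left)
 have f: "\<phi> x \<in> carrier N" if "x \<in> carrier M" for x using \<phi> that by (auto simp: lin_maps_def)
 have a: "\<phi> (x \<oplus>\<^bsub>M\<^esub> y) = \<phi> x \<oplus>\<^bsub>N\<^esub> \<phi> y" if "x \<in> carrier M" "y \<in> carrier M" for x y using \<phi> that by (simp add: lin_maps_def)
 have s: "\<phi> (c \<odot>\<^bsub>M\<^esub> x) = c \<odot>\<^bsub>N\<^esub> \<phi> x" if "c \<in> carrier R" "x \<in> carrier M" for c x using \<phi> that by (simp add: lin_maps_def)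
 have A: "?i (x \<oplus>\<^bsub>N\<^esub> y) = ?i x \<oplus>\<^bsub>M\<^esub> ?i y" "x \<oplus>\<^bsub>N\<^esub> y \<in> carrier N" if "x \<in> carrier N" "y \<in> carrier N" for x y
  using l[OF cl(1)[OF i(1)[OF that(1)] i(1)[OF that(2)]]] f[OF cl(1)[OF i(1)[OF that(1)] i(1)[OF that(2)]]]
   a[OF i(1)[OF that(1)] i(1)[OF that(2)]] i(2)[OF that(1)] i(2)[OF that(2)] by simp_all
 have B: "?i (c \<odot>\<^bsub>N\<^esub> x) = c \<odot>\<^bsub>M\<^esub> ?i x" "c \<odot>\<^bsub>N\<^esub> x \<in> carrier N" if "c \<in> carrier R" "x \<in> carrier N" for c x
  using l[OF cl(2)[OF that(1) i(1)[OF that(2)]]] f[OF cl(2)[OF that(1) i(1)[OF that(2)]]]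
   s[OF that(1) i(1)[OF that(2)]] i(2)[OF that(2)] by simp_all
 show thesis
 proof (rule that[of "\<lambda>y\<in>carrier N. ?i y"])
  show "(\<lambda>y\<in>carrier N. ?i y) \<in> lin_maps R N M"
   unfolding lin_maps_def by (auto simp: i A B)
  have "bij_betw (\<lambda>y\<in>carrier N. ?i y) (carrier N) (carrier M) = bij_betw ?i (carrier N) (carrier M)"
   by (rule bij_betw_cong) simp
  then show "bij_betw (\<lambda>y\<in>carrier N. ?i y) (carrier N) (carrier M)" using bij_betw_inv_into[OF bij] by simp
 qed (use i l f in auto)
qed

lemma hrep_space: "hrep_obj g W ==> vmod (hspace W)" "hrep_obj g W ==> fin_dim (hspace W)"
 by (simp_all add: hrep_obj_def)

lemma sl2_space: "sl2_obj Y ==> vmod (sspace Y)" "sl2_obj Y ==> fin_dim (sspace Y)"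
 by (simp_all add: sl2_obj_def)

lemma hact_lin: "hrep_obj g W ==> u \<in> carrier (Uhh g) ==> hact W u \<in> lin_maps KR (ps_mod (hspace W)) (ps_mod (hspace W))"
 using ring_hom_closed[of "hact W" "Uhh g" "End_ring KR (ps_mod (hspace W))" u] by (simp add: hrep_obj_def End_ring_def)

lemma lin_maps_in: "\<phi> \<in> lin_maps R M N ==> x \<in> carrier M ==> \<phi> x \<in> carrier N"
 by (auto simp: lin_maps_def)

lemma hact_in: "hrep_obj g W ==> u \<in> carrier (Uhh g) ==> f \<in> psc (hspace W) ==> hact W u f \<in> psc (hspace W)"
 by (rule lin_maps_in[OF hact_lin])

lemma sact_lin: "sl2_obj Y ==> A \<in> sl2 ==> sact Y A \<in> lin_maps CR (sspace Y) (sspace Y)"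
 by (auto simp: sl2_obj_def)

lemma sact_in: "sl2_obj Y ==> A \<in> sl2 ==> v \<in> carrier (sspace Y) ==> sact Y A v \<in> carrier (sspace Y)"
 by (rule lin_maps_in[OF sact_lin])

lemma hrep_hom_comp:
 assumes V: "hrep_obj g V" and \<phi>: "\<phi> \<in> hrep_hom g V W" and \<psi>: "\<psi> \<in> hrep_hom g W Z"
 shows "compose (psc (hspace V)) \<psi> \<phi> \<in> hrep_hom g V Z"
proof -
 note h = hrep_space(1)[OF V]
 have L: "compose (psc (hspace V)) \<psi> \<phi> \<in> lin_maps KR (ps_mod (hspace V)) (ps_mod (hspace Z))"
  by (rule lin_maps_comp[of \<phi> _ _ "ps_mod (hspace W)"]) (use \<phi> \<psi> h ps_add_closed ps_smult_closed in \<open>auto simp: hrep_hom_def\<close>)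
 have "\<phi> f \<in> psc (hspace W)" if "f \<in> psc (hspace V)" for f
  using \<phi> that by (auto simp: hrep_hom_def lin_maps_def)
 then show ?thesis using L \<phi> \<psi> hact_in[OF V] by (simp add: hrep_hom_def compose_def)
qed

lemma sl2_hom_comp:
 assumes V: "sl2_obj V" and \<phi>: "\<phi> \<in> sl2_hom V W" and \<psi>: "\<psi> \<in> sl2_hom W Z"
 shows "compose (carrier (sspace V)) \<psi> \<phi> \<in> sl2_hom V Z"
proof -
 note h = sl2_space(1)[OF V]
 have L: "compose (carrier (sspace V)) \<psi> \<phi> \<in> lin_maps CR (sspace V) (sspace Z)"
  by (rule lin_maps_comp[of \<phi> _ _ "sspace W"]) (use \<phi> \<psi> h vmod_add vmod_smult in \<open>auto simp: sl2_hom_def\<close>)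
 have "\<phi> f \<in> carrier (sspace W)" if "f \<in> carrier (sspace V)" for f
  using \<phi> that by (auto simp: sl2_hom_def lin_maps_def)
 then show ?thesis using L \<phi> \<psi> sact_in[OF V] by (simp add: sl2_hom_def compose_def)
qed

lemma bij_betw_compose: "bij_betw \<phi> A B ==> bij_betw \<psi> B C ==> bij_betw (compose A \<psi> \<phi>) A C"
 using bij_betw_trans[of \<phi> A B \<psi> C] bij_betw_cong[of A "compose A \<psi> \<phi>" "\<psi> \<circ> \<phi>" C] by (simp add: compose_def)

lemma hrep_iso_trans: "hrep_obj g V ==> hrep_iso g V W ==> hrep_iso g W Z ==> hrep_iso g V Z"
 unfolding hrep_iso_def using hrep_hom_comp bij_betw_compose by blast

lemma sl2_iso_trans: "sl2_obj V ==> sl2_iso V W ==> sl2_iso W Z ==> sl2_iso V Z"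
 unfolding sl2_iso_def using sl2_hom_comp bij_betw_compose by blast

lemma hrep_iso_inv:
 assumes V: "hrep_obj g V" and W: "hrep_obj g W" and \<phi>: "\<phi> \<in> hrep_hom g V W" and bij: "bij_betw \<phi> (psc (hspace V)) (psc (hspace W))"
 obtains \<psi> where "\<psi> \<in> hrep_hom g W V" "!!x. x \<in> psc (hspace V) ==> \<psi> (\<phi> x) = x" "!!y. y \<in> psc (hspace W) ==> \<phi> (\<psi> y) = y"
  "bij_betw \<psi> (psc (hspace W)) (psc (hspace V))"
proof -
 note h = hrep_space(1)[OF V]
 have "\<phi> \<in> lin_maps KR (ps_mod (hspace V)) (ps_mod (hspace W))" using \<phi> by (simp add: hrep_hom_def)
 from lin_maps_inv[OF this bij ps_add_closed[OF h] ps_smult_closed[OF h]]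
 obtain \<psi> where \<psi>: "\<psi> \<in> lin_maps KR (ps_mod (hspace W)) (ps_mod (hspace V))" "!!x. x \<in> psc (hspace V) ==> \<psi> (\<phi> x) = x"
  "!!y. y \<in> psc (hspace W) ==> \<phi> (\<psi> y) = y & \<psi> y \<in> psc (hspace V)"
  "bij_betw \<psi> (psc (hspace W)) (psc (hspace V))" by blast
 have "\<psi> (hact W u y) = hact V u (\<psi> y)" if u: "u \<in> carrier (Uhh g)" and y: "y \<in> psc (hspace W)" for u y
 proof -
  have "\<phi> (hact V u (\<psi> y)) = hact W u y" using \<phi> \<psi>(3)[OF y] u by (simp add: hrep_hom_def)
  then show ?thesis using \<psi>(2)[of "hact V u (\<psi> y)"] hact_in[OF V u] \<psi>(3)[OF y] by metis
 qed
 then show thesis using \<psi> by (intro that[of \<psi>]) (auto simp: hrep_hom_def)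
qed

lemma hrep_iso_sym: "hrep_obj g V ==> hrep_obj g W ==> hrep_iso g V W ==> hrep_iso g W V"
 unfolding hrep_iso_def by (metis hrep_iso_inv)

lemma sl2_iso_sym:
 assumes V: "sl2_obj V" and W: "sl2_obj W" and iso: "sl2_iso V W"
 shows "sl2_iso W V"
proof -
 note h = sl2_space(1)[OF V]
 obtain \<phi> where \<phi>: "\<phi> \<in> sl2_hom V W" and bij: "bij_betw \<phi> (carrier (sspace V)) (carrier (sspace W))" using iso by (auto simp: sl2_iso_def)
 have "\<phi> \<in> lin_maps CR (sspace V) (sspace W)" using \<phi> by (simp add: sl2_hom_def)
 from lin_maps_inv[OF this bij vmod_add[OF h] vmod_smult[OF h]]
 obtain \<psi> where \<psi>: "\<psi> \<in> lin_maps CR (sspace W) (sspace V)" "!!x. x \<in> carrier (sspace V) ==> \<psi> (\<phi> x) = x"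
  "!!y. y \<in> carrier (sspace W) ==> \<phi> (\<psi> y) = y & \<psi> y \<in> carrier (sspace V)"
  "bij_betw \<psi> (carrier (sspace W)) (carrier (sspace V))" by blast
 have "\<psi> (sact W u y) = sact V u (\<psi> y)" if u: "u \<in> sl2" and y: "y \<in> carrier (sspace W)" for u y
 proof -
  have "\<phi> (sact V u (\<psi> y)) = sact W u y" using \<phi> \<psi>(3)[OF y] u by (simp add: sl2_hom_def)
  then show ?thesis using \<psi>(2)[of "sact V u (\<psi> y)"] sact_in[OF V u] \<psi>(3)[OF y] by metis
 qed
 then have "\<psi> \<in> sl2_hom W V" using \<psi> by (auto simp: sl2_hom_def)
 then show ?thesis using \<psi>(4) by (auto simp: sl2_iso_def)
qed

lemma hrep_id_hom: "hrep_obj g V ==> (\<lambda>f\<in>psc (hspace V). f) \<in> hrep_hom g V V"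
 using ps_add_closed[of "hspace V"] ps_smult_closed[of "hspace V"] hrep_space(1)[of g V] hact_in[of g V]
 by (auto simp: hrep_hom_def lin_maps_def)

lemma sl2_id_hom: "sl2_obj V ==> (\<lambda>f\<in>carrier (sspace V). f) \<in> sl2_hom V V"
 using vmod_add[of "sspace V"] vmod_smult[of "sspace V"] sl2_space(1)[of V] sact_in[of V]
 by (auto simp: sl2_hom_def lin_maps_def)

lemma bij_betw_restrict_id: "bij_betw (\<lambda>x\<in>A. x) A A"
 by (auto simp: bij_betw_def inj_on_def)

lemma hrep_iso_refl: "hrep_obj g V ==> hrep_iso g V V"
 unfolding hrep_iso_def using hrep_id_hom bij_betw_restrict_id by blast

lemma sl2_iso_refl: "sl2_obj V ==> sl2_iso V V"
 unfolding sl2_iso_def using sl2_id_hom bij_betw_restrict_id by blast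

text \<open>f - f(0,0) is a combination of h and h' over V[[h,h']],
and \<open>\<phi>\<close> respects such combinations. Hence the limit of morphisms is a functor.\<close>

lemma lin_00:
 assumes V: "vmod V" "fin_dim V" and W: "vmod W" "fin_dim W" and \<phi>: "\<phi> \<in> lin_maps KR (ps_mod V) (ps_mod W)"
  and f: "f \<in> psc V"
 shows "\<phi> f 0 0 = \<phi> (ps_const V (f 0 0)) 0 0"
proof -
 obtain S :: "(nat => complex) set" and \<theta> where S: "fd S" and iso: "miso (emod S) V \<theta>" using coordinates[OF V] by blast
 obtain S' :: "(nat => complex) set" and \<theta>' where S': "fd S'" and iso': "miso (emod S') W \<theta>'" using coordinates[OF W] by blast
 note sub = fd_subspace[OF S] fd_subspace[OF S']
 interpret m: mtrans "emod S" V \<theta> by (rule mtrans.intro[OF module_emod[OF sub(1)] V(1) iso])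
 interpret m': mtrans "emod S'" W \<theta>' by (rule mtrans.intro[OF module_emod[OF sub(2)] W(1) iso'])
 have p: "\<phi> (x \<oplus>\<^bsub>ps_mod V\<^esub> y) = \<phi> x \<oplus>\<^bsub>ps_mod W\<^esub> \<phi> y" "\<phi> (c \<odot>\<^bsub>ps_mod V\<^esub> x) = c \<odot>\<^bsub>ps_mod W\<^esub> \<phi> x"
  if "x \<in> psc V" "y \<in> psc V" for x y c
  using \<phi> that by (auto simp: lin_maps_def)
 note pin = lin_maps_in[OF \<phi>]
 define T where "T = (\<lambda>x\<in>psc (emod S). ext0 m'.\<theta>i (\<phi> (ext0 \<theta> x)))"
 have "T \<in> lin_maps KR (ps_mod (emod S)) (ps_mod (emod S'))"
  unfolding lin_maps_def
 proof (intro CollectI conjI ballI)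
  show "T \<in> psc (emod S) \<rightarrow>\<^sub>E psc (emod S')"
   unfolding T_def by (rule PiE_I) (simp_all only: m'.ei_in pin m.e_in restrict_apply if_True if_False)
  fix x y c assume x: "x \<in> psc (emod S)"
  show "T (c \<odot>\<^bsub>ps_mod (emod S)\<^esub> x) = c \<odot>\<^bsub>ps_mod (emod S')\<^esub> T x"
   unfolding T_def by (simp only: restrict_apply' x ps_smult_closed[OF m.V x] m.e_smult[OF x] p(2)[OF m.e_in[OF x] m.e_in[OF x]] m'.ei_smult pin m.e_in[OF x])
  assume y: "y \<in> psc (emod S)"
  show "T (x \<oplus>\<^bsub>ps_mod (emod S)\<^esub> y) = T x \<oplus>\<^bsub>ps_mod (emod S')\<^esub> T y"
   unfolding T_def by (simp only: restrict_apply' x y ps_add_closed[OF m.V x y] m.e_add[OF x y] p(1)[OF m.e_in[OF x] m.e_in[OF y]] m'.ei_add pin m.e_in[OF x] m.e_in[OF y])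
 qed
 then have T: "kop S S' T" by (simp add: lin_maps_emod[OF sub])
 let ?x = "ext0 m.\<theta>i f"
 have fx: "f = ext0 \<theta> ?x" "?x \<in> psc (emod S)" using m.e_ri[OF f] m.ei_in[OF f] by simp_all
 then have xM: "?x \<in> MS S" by simp
 have TT: "\<theta>' (T x k l) = \<phi> (ext0 \<theta> x) k l" if "x \<in> MS S" for x k l
 proof -
  have x: "x \<in> psc (emod S)" using that by simp
  have "ext0 \<theta>' (T x) = \<phi> (ext0 \<theta> x)" unfolding T_def by (simp only: restrict_apply' x m'.e_ri pin m.e_in[OF x])
  then show ?thesis by (metis ext0_def)
 qed
 have "f 0 0 = \<theta> (?x 0 0)" by (subst fx(1)) (simp add: ext0_def)
 then have c: "ps_const V (f 0 0) = ext0 \<theta> (mconst (?x 0 0))" by (simp add: m.e_const[symmetric])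
 have "\<phi> f 0 0 = \<theta>' (T ?x 0 0)" using TT[OF xM] fx(1) by simp
 also have "T ?x 0 0 = T (mconst (?x 0 0)) 0 0" using kop_00[OF sub(1) T xM] by (simp add: lim0_def)
 also have "\<theta>' \<dots> = \<phi> (ps_const V (f 0 0)) 0 0" unfolding c by (rule TT) (rule peel_in(1)[OF sub(1) xM])
 finally show ?thesis .
qed

lemma ps_smult_00: assumes "vmod V" "f \<in> psc V" shows "(c \<odot>\<^bsub>ps_mod V\<^esub> f) 0 0 = hcoeff c 0 0 \<odot>\<^bsub>V\<^esub> f 0 0"
proof -
 interpret abelian_monoid V by (rule vmod_monoid[OF assms(1)])
 have "hcoeff c 0 0 \<odot>\<^bsub>V\<^esub> f 0 0 \<in> carrier V" using assms by (simp add: ps_carrier vmod_smult)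
 then show ?thesis by (simp add: ps_smult_def finsum_insert[of "{}" _ "%_. hcoeff c 0 0 \<odot>\<^bsub>V\<^esub> f 0 0", simplified])
qed

lemma hact_mod_in:
 assumes W: "hrep_obj g W" and v: "v \<in> carrier (hspace W)"
 shows "hact_mod g W x v \<in> carrier (hspace W)"
 using hact_in[OF W ucls_in[of g "gen_el x"] ps_const_in[OF hrep_space(1)[OF W] v]] by (simp add: hact_mod_def ps_carrier)

lemma class_lim_mor_hom:
 assumes V: "hrep_obj g V" and W: "hrep_obj g W" and \<phi>: "\<phi> \<in> hrep_hom g V W"
 shows "class_lim_mor V \<phi> \<in> sl2_hom (class_lim g V) (class_lim g W)"
proof -
 note v = hrep_space[OF V] and w = hrep_space[OF W]
 have L: "\<phi> \<in> lin_maps KR (ps_mod (hspace V)) (ps_mod (hspace W))"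
  and eq: "!!u f. u \<in> carrier (Uhh g) ==> f \<in> psc (hspace V) ==> \<phi> (hact V u f) = hact W u (\<phi> f)"
  using \<phi> by (auto simp: hrep_hom_def)
 note z = lin_00[OF v w L] and zV = lin_00[OF v v hact_lin[OF V ucls_in]] and zW = lin_00[OF w w hact_lin[OF W ucls_in]]
 have c: "\<phi> f \<in> psc (hspace W)" if "f \<in> psc (hspace V)" for f using lin_maps_in[OF L that] .
 define m where "m = class_lim_mor V \<phi>"
 have m: "m x = \<phi> (ps_const (hspace V) x) 0 0" if "x \<in> carrier (hspace V)" for x using that by (simp add: m_def class_lim_mor_def)
 have pc: "ps_const (hspace V) x \<in> psc (hspace V)" if "x \<in> carrier (hspace V)" for x using ps_const_in[OF v(1) that] .
 have m0: "m (f 0 0) = \<phi> f 0 0" if "f \<in> psc (hspace V)" for f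
  using z[OF that] that by (simp add: m ps_carrier)
 have cm: "m x \<in> carrier (hspace W)" if "x \<in> carrier (hspace V)" for x using c[OF pc[OF that]] that by (simp add: m ps_carrier)
 have pc0: "ps_const (hspace V) x 0 0 = x" for x by (simp add: ps_const_def)
 have add: "m (x \<oplus>\<^bsub>hspace V\<^esub> y) = m x \<oplus>\<^bsub>hspace W\<^esub> m y" if "x \<in> carrier (hspace V)" "y \<in> carrier (hspace V)" for x y
  using m0[OF ps_add_closed[OF v(1) pc[OF that(1)] pc[OF that(2)]]] L pc[OF that(1)] pc[OF that(2)] that
  by (simp add: ps_add pc0 lin_maps_def m)
 have sm: "m (a \<odot>\<^bsub>hspace V\<^esub> x) = a \<odot>\<^bsub>hspace W\<^esub> m x" if "x \<in> carrier (hspace V)" for x a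
 proof -
  have "m (a \<odot>\<^bsub>hspace V\<^esub> x) = m ((hconst a \<odot>\<^bsub>ps_mod (hspace V)\<^esub> ps_const (hspace V) x) 0 0)"
   by (simp only: ps_smult_00[OF v(1) pc[OF that]] pc0) (simp add: hcoeff_def hconst_def)
  also have "\<dots> = \<phi> (hconst a \<odot>\<^bsub>ps_mod (hspace V)\<^esub> ps_const (hspace V) x) 0 0"
   by (rule m0[OF ps_smult_closed[OF v(1) pc[OF that]]])
  also have "\<phi> (hconst a \<odot>\<^bsub>ps_mod (hspace V)\<^esub> ps_const (hspace V) x) = hconst a \<odot>\<^bsub>ps_mod (hspace W)\<^esub> \<phi> (ps_const (hspace V) x)"
   using L pc[OF that] by (simp add: lin_maps_def)
  also have "\<dots> 0 0 = a \<odot>\<^bsub>hspace W\<^esub> m x" by (simp add: ps_smult_00[OF w(1) c[OF pc[OF that]]] m that) (simp add: hcoeff_def hconst_def)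
  finally show ?thesis .
 qed
 have act: "m (hact_mod g V x v) = hact_mod g W x (m v)" if v: "v \<in> carrier (hspace V)" for x v
 proof -
  have "m (hact_mod g V x v) = \<phi> (hact V (ucls g (gen_el x)) (ps_const (hspace V) v)) 0 0"
   unfolding hact_mod_def by (rule m0[OF hact_in[OF V ucls_in pc[OF v]]])
  also have "\<dots> = hact_mod g W x (m v)"
   unfolding eq[OF ucls_in pc[OF v]] hact_mod_def by (subst zW[OF c[OF pc[OF v]]]) (simp add: m v)
  finally show ?thesis .
 qed
 have "m \<in> extensional (carrier (hspace V))" by (simp add: m_def class_lim_mor_def)
 then have "m \<in> lin_maps CR (hspace V) (hspace W)" unfolding lin_maps_def by (auto simp: add sm cm PiE_iff)
 moreover have "m (sact (class_lim g V) A x) = sact (class_lim g W) A (m x)" if "A \<in> sl2" "x \<in> carrier (hspace V)" for A x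
  using that by (simp add: class_lim_def cm act add sm hact_mod_in[OF V] vmod_add[OF v(1)] vmod_smult[OF v(1)])
 ultimately show ?thesis unfolding m_def[symmetric] by (simp add: sl2_hom_def class_lim_def)
qed

lemma class_lim_mor_comp:
 assumes V: "hrep_obj g V" and W: "hrep_obj g W" and Z: "hrep_obj g Z" and \<phi>: "\<phi> \<in> hrep_hom g V W" and \<psi>: "\<psi> \<in> hrep_hom g W Z"
 shows "class_lim_mor V (compose (psc (hspace V)) \<psi> \<phi>) =
      compose (carrier (sspace (class_lim g V))) (class_lim_mor W \<psi>) (class_lim_mor V \<phi>)"
proof -
 have L: "\<phi> \<in> lin_maps KR (ps_mod (hspace V)) (ps_mod (hspace W))" "\<psi> \<in> lin_maps KR (ps_mod (hspace W)) (ps_mod (hspace Z))"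
  using \<phi> \<psi> by (auto simp: hrep_hom_def)
 have "\<psi> (\<phi> (ps_const (hspace V) v)) 0 0 = \<psi> (ps_const (hspace W) (\<phi> (ps_const (hspace V) v) 0 0)) 0 0"
  and "\<phi> (ps_const (hspace V) v) 0 0 \<in> carrier (hspace W)" if "v \<in> carrier (hspace V)" for v
 proof -
  have c: "\<phi> (ps_const (hspace V) v) \<in> psc (hspace W)" by (rule lin_maps_in[OF L(1) ps_const_in[OF hrep_space(1)[OF V] that]])
  show "\<psi> (\<phi> (ps_const (hspace V) v)) 0 0 = \<psi> (ps_const (hspace W) (\<phi> (ps_const (hspace V) v) 0 0)) 0 0"
   by (rule lin_00[OF hrep_space[OF W] hrep_space[OF Z] L(2) c])
  show "\<phi> (ps_const (hspace V) v) 0 0 \<in> carrier (hspace W)" using c by (simp add: ps_carrier)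
 qed
 then show ?thesis
  by (auto simp: class_lim_mor_def class_lim_def compose_def fun_eq_iff restrict_def ps_const_in[OF hrep_space(1)[OF V]])
qed

lemma class_lim_mor_id:
 assumes V: "hrep_obj g V"
 shows "class_lim_mor V (\<lambda>f\<in>psc (hspace V). f) = (\<lambda>v\<in>carrier (sspace (class_lim g V)). v)"
 by (auto simp: class_lim_mor_def class_lim_def fun_eq_iff restrict_def ps_const_in[OF hrep_space(1)[OF V]]) (simp_all add: ps_const_def)

lemma class_lim_iso:
 assumes V: "hrep_obj g V" and W: "hrep_obj g W" and iso: "hrep_iso g V W"
 shows "sl2_iso (class_lim g V) (class_lim g W)"
proof -
 obtain \<phi> where \<phi>: "\<phi> \<in> hrep_hom g V W" and bij: "bij_betw \<phi> (psc (hspace V)) (psc (hspace W))"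
  using iso by (auto simp: hrep_iso_def)
 obtain \<psi> where \<psi>: "\<psi> \<in> hrep_hom g W V" "!!x. x \<in> psc (hspace V) ==> \<psi> (\<phi> x) = x" "!!y. y \<in> psc (hspace W) ==> \<phi> (\<psi> y) = y"
  using hrep_iso_inv[OF V W \<phi> bij] by blast
 let ?m = "class_lim_mor V \<phi>" and ?n = "class_lim_mor W \<psi>"
 note hm = class_lim_mor_hom[OF V W \<phi>] and hn = class_lim_mor_hom[OF W V \<psi>(1)]
 have c: "carrier (sspace (class_lim g V)) = carrier (hspace V)" "carrier (sspace (class_lim g W)) = carrier (hspace W)"
  by (simp_all add: class_lim_def)
 have i1: "compose (psc (hspace V)) \<psi> \<phi> = (\<lambda>f\<in>psc (hspace V). f)"
  unfolding compose_def by (rule restrict_ext) (rule \<psi>(2))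
 have i2: "compose (psc (hspace W)) \<phi> \<psi> = (\<lambda>f\<in>psc (hspace W). f)"
  unfolding compose_def by (rule restrict_ext) (rule \<psi>(3))
 have nm: "?n (?m x) = x" if "x \<in> carrier (hspace V)" for x
  using class_lim_mor_comp[OF V W V \<phi> \<psi>(1)] that unfolding i1 class_lim_mor_id[OF V] by (metis c compose_eq restrict_apply')
 have mn: "?m (?n x) = x" if "x \<in> carrier (hspace W)" for x
  using class_lim_mor_comp[OF W V W \<psi>(1) \<phi>] that unfolding i2 class_lim_mor_id[OF W] by (metis c compose_eq restrict_apply')
 have "?m x \<in> carrier (hspace W)" if "x \<in> carrier (hspace V)" for x
  using hm that by (auto simp: sl2_hom_def lin_maps_def class_lim_def)
 moreover have "?n x \<in> carrier (hspace V)" if "x \<in> carrier (hspace W)" for x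
  using hn that by (auto simp: sl2_hom_def lin_maps_def class_lim_def)
 ultimately have "bij_betw ?m (carrier (hspace V)) (carrier (hspace W))"
  by (intro bij_betw_byWitness[where f' = ?n]) (auto simp: nm mn)
 then show ?thesis unfolding sl2_iso_def c using hm by blast
qed

lemma sl2_iso_triple:
 assumes V: "sspace V = emod S" "sact V = slact S e f h" and W: "sspace W = emod S'" "sact W = slact S' e' f' h'"
  and cl: "clin S S e" "clin S S f" "clin S S h" and S: "cv.subspace S"
 shows "sl2_iso V W \<longleftrightarrow> (\<exists>\<theta>. clin S S' \<theta> & bij_betw \<theta> S S' & (\<forall>v\<in>S. \<theta> (e v) = e' (\<theta> v) & \<theta> (f v) = f' (\<theta> v) & \<theta> (h v) = h' (\<theta> v)))"
proof
 assume "sl2_iso V W"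
 then obtain \<phi> where \<phi>: "\<phi> \<in> sl2_hom V W" "bij_betw \<phi> S S'" by (auto simp: sl2_iso_def V W)
 have L: "clin S S' \<phi>" using \<phi>(1) by (auto simp: sl2_hom_def lin_maps_def V W clin_def)
 have eq: "\<phi> (slact S e f h A v) = slact S' e' f' h' A (\<phi> v)" if "A \<in> sl2" "v \<in> S" for A v
  using \<phi>(1) that by (simp add: sl2_hom_def V W)
 have "\<phi> (e v) = e' (\<phi> v) & \<phi> (f v) = f' (\<phi> v) & \<phi> (h v) = h' (\<phi> v)" if "v \<in> S" for v
  using eq[OF mat_sl2(1) that] eq[OF mat_sl2(2) that] eq[OF mat_sl2(3) that] that clin_in[OF L that] by (simp add: slact_mat)
 then show "\<exists>\<theta>. clin S S' \<theta> & bij_betw \<theta> S S' & (\<forall>v\<in>S. \<theta> (e v) = e' (\<theta> v) & \<theta> (f v) = f' (\<theta> v) & \<theta> (h v) = h' (\<theta> v))"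
  using L \<phi>(2) by blast
next
 assume "\<exists>\<theta>. clin S S' \<theta> & bij_betw \<theta> S S' & (\<forall>v\<in>S. \<theta> (e v) = e' (\<theta> v) & \<theta> (f v) = f' (\<theta> v) & \<theta> (h v) = h' (\<theta> v))"
 then obtain \<theta> where \<theta>: "clin S S' \<theta>" "bij_betw \<theta> S S'" and eq: "!!v. v \<in> S ==> \<theta> (e v) = e' (\<theta> v) & \<theta> (f v) = f' (\<theta> v) & \<theta> (h v) = h' (\<theta> v)" by blast
 note [simp] = clin_in[OF \<theta>(1)] clin_add[OF \<theta>(1)] clin_csc[OF \<theta>(1)] clin_in[OF cl(1)] clin_in[OF cl(2)] clin_in[OF cl(3)]
  cv.subspace_add[OF S] cv.subspace_scale[OF S]
 have "(\<lambda>v\<in>S. \<theta> v) \<in> sl2_hom V W"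
  by (auto simp: sl2_hom_def lin_maps_def V W slact_def eq)
 moreover have "bij_betw (\<lambda>v\<in>S. \<theta> v) S S' = bij_betw \<theta> S S'" by (rule bij_betw_cong) simp
 ultimately show "sl2_iso V W" unfolding sl2_iso_def V W emod_simps using \<theta>(2) by blast
qed

lemma lift_iso_emod:
 assumes V: "hrep_obj g V" "hspace V = emod S" "fd S" and W: "hrep_obj g W" "hspace W = emod S'" "fd S'" and g: "g \<ge> 1"
  and iso: "sl2_iso (class_lim g V) (class_lim g W)"
 shows "hrep_iso g V W"
proof -
 note sub = fd_subspace[OF V(3)] fd_subspace[OF W(3)]
 note hV = hrep_hops[OF V(1,2) sub(1) g] and hW = hrep_hops[OF W(1,2) sub(2) g]
 interpret l: sl2_module S "lim0 (hgen g V Gen_Xp)" "lim0 (hgen g V Gen_Xm)" "lim0 (hgen g V Gen_H)" by (rule hops.limit_triple[OF hV])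
 have "\<exists>\<theta>. clin S S' \<theta> & bij_betw \<theta> S S' & (\<forall>v\<in>S. \<theta> (lim0 (hgen g V Gen_Xp) v) = lim0 (hgen g W Gen_Xp) (\<theta> v) &
   \<theta> (lim0 (hgen g V Gen_Xm) v) = lim0 (hgen g W Gen_Xm) (\<theta> v) & \<theta> (lim0 (hgen g V Gen_H) v) = lim0 (hgen g W Gen_H) (\<theta> v))"
  using iso by (subst sl2_iso_triple[of "class_lim g V" S _ _ _ "class_lim g W", symmetric])
   (simp_all add: class_lim_emod[OF V(2)] class_lim_emod[OF W(2)] l.e l.f l.h sub)
 then obtain \<theta> where \<theta>: "clin S S' \<theta>" "bij_betw \<theta> S S'" and eq: "!!v. v \<in> S ==> \<theta> (lim0 (hgen g V Gen_Xp) v) = lim0 (hgen g W Gen_Xp) (\<theta> v) &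
   \<theta> (lim0 (hgen g V Gen_Xm) v) = lim0 (hgen g W Gen_Xm) (\<theta> v) & \<theta> (lim0 (hgen g V Gen_H) v) = lim0 (hgen g W Gen_H) (\<theta> v)" by blast
 have "\<exists>\<phi>. kop S S' \<phi> & (ALL a. \<forall>x\<in>MS S. \<phi> (hgen g V a x) = hgen g W a (\<phi> x)) & (\<forall>v\<in>S. lim0 \<phi> v = \<theta> v)"
 proof (rule hops_lift[OF hV hW \<theta>(1)])
  fix v a assume "v \<in> S" "a ~= Gen_C"
  then show "\<theta> (lim0 (hgen g V a) v) = lim0 (hgen g W a) (\<theta> v)" using eq by (cases a) auto
 qed
 then obtain \<phi> where \<phi>: "kop S S' \<phi>" "!!a x. x \<in> MS S ==> \<phi> (hgen g V a x) = hgen g W a (\<phi> x)" "!!v. v \<in> S ==> lim0 \<phi> v = \<theta> v" by blast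
 have "bij_betw (lim0 \<phi>) S S' = bij_betw \<theta> S S'" by (rule bij_betw_cong) (rule \<phi>(3))
 then have b: "bij_betw \<phi> (MS S) (MS S')" using kop_bij[OF sub \<phi>(1)] \<theta>(2) by simp
 have "bij_betw (\<lambda>f\<in>MS S. \<phi> f) (MS S) (MS S') = bij_betw \<phi> (MS S) (MS S')" by (rule bij_betw_cong) simp
 moreover have "(\<lambda>f\<in>MS S. \<phi> f) \<in> hrep_hom g V W"
 proof (subst hrep_hom_emod[OF V(1,2) sub(1) W(1,2) sub(2)], intro conjI allI ballI)
  show "kop S S' (\<lambda>f\<in>MS S. \<phi> f)" by (rule kop_cong[OF sub(1) \<phi>(1)]) simp
  fix a f assume f: "f \<in> MS S"
  have "hgen g V a f \<in> MS S" using kop_in[OF gens.kT[OF hrep_gens(1)[OF V(1,2) sub(1)]] f] .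
  then show "(\<lambda>f\<in>MS S. \<phi> f) (hgen g V a f) = hgen g W a ((\<lambda>f\<in>MS S. \<phi> f) f)" by (simp only: restrict_apply' f \<phi>(2))
 qed simp
 ultimately show ?thesis using b unfolding hrep_iso_def by (intro bexI[of _ "\<lambda>f\<in>MS S. \<phi> f"]) (simp_all add: V W)
qed

text \<open>In coordinates an isomorphism of the limits lifts to an intertwiner by rigidity, and a map with bijective limit is
bijective.\<close>

lemma lift_iso:
 assumes V: "hrep_obj g V" and W: "hrep_obj g W" and g: "g \<ge> 1" and iso: "sl2_iso (class_lim g V) (class_lim g W)"
 shows "hrep_iso g V W"
proof -
 obtain S :: "(nat => complex) set" and \<theta> V1 where S: "fd S" and m: "mtrans (emod S) (hspace V) \<theta>"
  and V1: "hrep_obj g V1" "hspace V1 = emod S" and eq: "V = htr g \<theta> V1 (hspace V)" by (rule rep_coord[OF V])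
 obtain S' :: "(nat => complex) set" and \<theta>' W1 where S': "fd S'" and m': "mtrans (emod S') (hspace W) \<theta>'"
  and W1: "hrep_obj g W1" "hspace W1 = emod S'" and eq': "W = htr g \<theta>' W1 (hspace W)" by (rule rep_coord[OF W])
 have i: "hrep_iso g V1 V" using mtrans.htr_iso[OF m V1] eq by simp
 have i': "hrep_iso g W1 W" using mtrans.htr_iso[OF m' W1] eq' by simp
 note ob = class_lim_obj[OF V g] class_lim_obj[OF W g] class_lim_obj[OF V1(1) g] class_lim_obj[OF W1(1) g]
 have "sl2_iso (class_lim g V1) (class_lim g W1)"
  by (rule sl2_iso_trans[OF ob(3) class_lim_iso[OF V1(1) V i] sl2_iso_trans[OF ob(1) iso sl2_iso_sym[OF ob(4,2) class_lim_iso[OF W1(1) W i']]]])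
 then have "hrep_iso g V1 W1" by (rule lift_iso_emod[OF V1 S W1 S' g])
 then show ?thesis using hrep_iso_trans[OF V hrep_iso_sym[OF V1(1) V i] hrep_iso_trans[OF V1(1) _ i']] by blast
qed

lemma hrep_iso_iff:
 "hrep_obj g V ==> hrep_obj g W ==> g \<ge> 1 ==> hrep_iso g V W \<longleftrightarrow> sl2_iso (class_lim g V) (class_lim g W)"
 using lift_iso class_lim_iso by blast

lemma deformation_exists:
 fixes Y :: "'v sl2_rep"
 assumes Y: "sl2_obj Y" and g: "g \<ge> 1"
 shows "\<exists>W :: 'v hrep. hrep_obj g W & class_lim g W = Y"
proof -
 obtain S :: "(nat => complex) set" and \<theta> Y1 where S: "fd S" and m: "mtrans (emod S) (sspace Y) \<theta>"
  and Y1: "sl2_obj Y1" "sspace Y1 = emod S" and eq: "Y = str \<theta> Y1 (sspace Y)" by (rule sl2_coord[OF Y])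
 interpret mtrans "emod S" "sspace Y" \<theta> by (rule m)
 note t = triple_sl2_obj[OF Y1 fd_subspace[OF S]]
 let ?T = "deform_ops g (sact Y1 matE) (sact Y1 matF) (sact Y1 matH)"
 interpret hops S ?T g by (rule deform_hops(1)[OF t(1) S g])
 let ?W = "mk_hrep g S ?T"
 have lim: "lim0 (hgen g ?W x) v = lim0 (?T x) v" if "v \<in> S" for x v
  unfolding lim0_def by (simp add: mk_hrep_gen MS_mconst sub that)
 have "lim0 (?T Gen_Xp) v = sact Y1 matE v" "lim0 (?T Gen_Xm) v = sact Y1 matF v" "lim0 (?T Gen_H) v = sact Y1 matH v" if "v \<in> S" for v
  using deform_hops(2)[OF t(1) S g that] by (auto simp: deform_ops_def lim0_def ext0_def)
 then have "slact S (lim0 (hgen g ?W Gen_Xp)) (lim0 (hgen g ?W Gen_Xm)) (lim0 (hgen g ?W Gen_H)) = slact S (sact Y1 matE) (sact Y1 matF) (sact Y1 matH)"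
  unfolding slact_def by (intro restrict_ext) (simp only: lim)
 then have "slact S (lim0 (hgen g ?W Gen_Xp)) (lim0 (hgen g ?W Gen_Xm)) (lim0 (hgen g ?W Gen_H)) = sact Y1"
  by (simp only: t(3)[symmetric])
 then have "class_lim g ?W = Y1" unfolding class_lim_emod[OF mk_hrep(3)] by (intro sl2_rep.equality) (simp_all add: Y1(2))
 then have "class_lim g (htr g \<theta> ?W (sspace Y)) = Y" using htr_class_lim[OF mk_hrep(2,3)] eq by simp
 moreover have "hrep_obj g (htr g \<theta> ?W (sspace Y))" by (rule htr_obj[OF mk_hrep(2,3)])
 ultimately show ?thesis by blast
qed

section \<open>Direct sums\<close>

lemma ds_carrier: "x \<in> carrier (mod_dsum Vs) \<longleftrightarrow> x \<in> extensional {..<length Vs} & (\<forall>i<length Vs. x i \<in> carrier (Vs ! i))"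
 by (auto simp: mod_dsum_def PiE_iff)

lemma ds_add: "i < length Vs ==> (x \<oplus>\<^bsub>mod_dsum Vs\<^esub> y) i = x i \<oplus>\<^bsub>Vs ! i\<^esub> y i"
 and ds_smult: "i < length Vs ==> (c \<odot>\<^bsub>mod_dsum Vs\<^esub> x) i = c \<odot>\<^bsub>Vs ! i\<^esub> x i"
 and ds_zero: "i < length Vs ==> \<zero>\<^bsub>mod_dsum Vs\<^esub> i = \<zero>\<^bsub>Vs ! i\<^esub>"
 by (simp_all add: mod_dsum_def)

lemma ds_ext: "x \<oplus>\<^bsub>mod_dsum Vs\<^esub> y \<in> extensional {..<length Vs}" "c \<odot>\<^bsub>mod_dsum Vs\<^esub> x \<in> extensional {..<length Vs}"
 "\<zero>\<^bsub>mod_dsum Vs\<^esub> \<in> extensional {..<length Vs}"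
 by (simp_all add: mod_dsum_def)

lemma ds_eqI: "x \<in> extensional {..<n} ==> y \<in> extensional {..<n} ==> (!!i. i < n ==> x i = y i) ==> x = y"
 by (rule extensionalityI[of _ "{..<n}"]) auto

definition dS :: "nat => (nat => 'a::cvec set) => (nat => 'a) set" where
 "dS n S = {x. (\<forall>i<n. x i \<in> S i) & (\<forall>i\<ge>n. x i = 0)}"

definition atv :: "nat => 'a::cvec => nat => 'a" where "atv i v = (%k. if k = i then v else 0)"

lemma atv_simps: "atv i 0 = 0" "atv i (c \<cdot> v) = c \<cdot> atv i v" "atv i (v + w) = atv i v + atv i w"
 by (auto simp: atv_def fun_eq_iff csc_fun_def)

lemma atv_span: "v \<in> cv.span B ==> atv i v \<in> cv.span (atv i ` B)"
proof (induction rule: cv.span_induct_alt)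
 case base
 then show ?case by (simp only: atv_simps cv.span_zero)
next
 case (step c x y)
 show ?case unfolding atv_simps by (rule cv.span_add[OF cv.span_scale[OF cv.span_base[OF imageI[OF step(1)]]] step(2)])
qed

lemma dS_sum: "x \<in> dS n S ==> x = (\<Sum>i<n. atv i (x i))"
proof
 fix k assume x: "x \<in> dS n S"
 have "(\<Sum>i<n. atv i (x i)) k = (\<Sum>i<n. if k = i then x i else 0)" by (induction n) (auto simp: atv_def)
 also have "\<dots> = x k" using x by (auto simp: dS_def)
 finally show "x k = (\<Sum>i<n. atv i (x i)) k" ..
qed

lemma fd_dS: assumes "!!i. i < n ==> fd (S i)" shows "fd (dS n S)"
proof -
 have "ALL i. EX B. i < n --> finite B & S i \<subseteq> cv.span B" using assms by (auto simp: fd_def)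
 then obtain B where B: "!!i. i < n ==> finite (B i) & S i \<subseteq> cv.span (B i)" by metis
 have sub: "cv.subspace (dS n S)"
  using cv.subspace_add[OF fd_subspace[OF assms]] cv.subspace_scale[OF fd_subspace[OF assms]] cv.subspace_0[OF fd_subspace[OF assms]]
  by (intro cv.subspaceI) (auto simp: dS_def)
 have "x \<in> cv.span (\<Union>i<n. atv i ` B i)" if x: "x \<in> dS n S" for x
 proof (subst dS_sum[OF x], rule cv.span_sum)
  fix i assume i: "i \<in> {..<n}"
  then have "x i \<in> cv.span (B i)" using B[of i] x by (auto simp: dS_def)
  moreover have "atv i ` B i \<subseteq> (\<Union>i<n. atv i ` B i)" using i by blast
  ultimately show "atv i (x i) \<in> cv.span (\<Union>i<n. atv i ` B i)" using atv_span cv.span_mono by blast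
 qed
 then show ?thesis unfolding fd_def using sub B by (intro conjI exI[of _ "\<Union>i<n. atv i ` B i"]) auto
qed

lemma dsum_space:
 assumes "\<forall>V\<in>set Vs. vmod V & fin_dim V"
 shows "vmod (mod_dsum Vs)" "fin_dim (mod_dsum Vs)"
proof -
 let ?n = "length Vs"
 have "ALL i. \<exists>S \<theta>. i < ?n --> fd S & miso (emod (S :: (nat => complex) set)) (Vs ! i) \<theta>"
  using coordinates assms nth_mem by blast
 then obtain S \<theta> where S: "!!i. i < ?n ==> fd (S i :: (nat => complex) set)" and iso: "!!i. i < ?n ==> miso (emod (S i)) (Vs ! i) (\<theta> i)" by metis
 define \<Theta> where "\<Theta> x = (\<lambda>i\<in>{..<?n}. \<theta> i (x i))" for x
 define \<Theta>i where "\<Theta>i y = (%i. if i < ?n then inv_into (S i) (\<theta> i) (y i) else 0)" for y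
 have mt: "mtrans (emod (S i)) (Vs ! i) (\<theta> i)" if "i < ?n" for i
  using that assms nth_mem[OF that] by (intro mtrans.intro iso module_emod fd_subspace S) auto
 have b: "inv_into (S i) (\<theta> i) y \<in> S i" "\<theta> i (inv_into (S i) (\<theta> i) y) = y" if "i < ?n" "y \<in> carrier (Vs ! i)" for i y
  using mtrans.ths[OF mt[OF that(1)] that(2)] mtrans.ri[OF mt[OF that(1)] that(2)] by simp_all
 have a: "\<theta> i x \<in> carrier (Vs ! i)" "inv_into (S i) (\<theta> i) (\<theta> i x) = x" if "i < ?n" "x \<in> S i" for i x
  using mtrans.th[OF mt[OF that(1)], of x] mtrans.li[OF mt[OF that(1)], of x] that(2) by simp_all
 have tl: "\<theta> i (x + y) = \<theta> i x \<oplus>\<^bsub>Vs ! i\<^esub> \<theta> i y" "\<theta> i (c \<cdot> x) = c \<odot>\<^bsub>Vs ! i\<^esub> \<theta> i x" if "i < ?n" "x \<in> S i" "y \<in> S i" for i x y c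
  using mtrans.th_add[OF mt[OF that(1)], of x y] mtrans.th_smult[OF mt[OF that(1)], of x c] that(2,3) by simp_all
 have "bij_betw \<Theta> (dS ?n S) (carrier (mod_dsum Vs))"
 proof (rule bij_betw_byWitness[where f' = \<Theta>i])
  show "\<forall>x\<in>dS ?n S. \<Theta>i (\<Theta> x) = x" by (auto simp: \<Theta>_def \<Theta>i_def dS_def a)
  show "\<forall>y\<in>carrier (mod_dsum Vs). \<Theta> (\<Theta>i y) = y"
   by (auto simp: \<Theta>_def \<Theta>i_def ds_carrier b intro!: ds_eqI[of _ ?n])
  show "\<Theta> ` dS ?n S \<subseteq> carrier (mod_dsum Vs)" by (auto simp: \<Theta>_def dS_def ds_carrier a)
  show "\<Theta>i ` carrier (mod_dsum Vs) \<subseteq> dS ?n S" by (auto simp: \<Theta>i_def dS_def ds_carrier b)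
 qed
 moreover have "\<Theta> (x + y) = \<Theta> x \<oplus>\<^bsub>mod_dsum Vs\<^esub> \<Theta> y" if "x \<in> dS ?n S" "y \<in> dS ?n S" for x y
  using that by (intro ds_eqI[of _ ?n]) (auto simp: ds_ext ds_add \<Theta>_def dS_def tl)
 moreover have "\<Theta> (c \<cdot> x) = c \<odot>\<^bsub>mod_dsum Vs\<^esub> \<Theta> x" if "x \<in> dS ?n S" for c x
  using that by (intro ds_eqI[of _ ?n]) (auto simp: ds_ext ds_smult \<Theta>_def dS_def tl)
 ultimately have I: "miso (emod (dS ?n S)) (mod_dsum Vs) \<Theta>" by (auto simp: miso_def)
 have z: "\<zero>\<^bsub>mod_dsum Vs\<^esub> = \<Theta> 0"
 proof (rule ds_eqI[of _ ?n])
  fix i assume i: "i < ?n"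
  then show "\<zero>\<^bsub>mod_dsum Vs\<^esub> i = \<Theta> 0 i" using mtrans.th_zero[OF mt[OF i]] by (simp add: ds_zero \<Theta>_def)
 qed (auto simp: ds_ext \<Theta>_def)
 have fd: "fd (dS ?n S)" by (rule fd_dS) (rule S)
 show "vmod (mod_dsum Vs)" by (rule vmod_transfer, rule fd_subspace[OF fd], rule I, rule z)
 show "fin_dim (mod_dsum Vs)" by (rule fin_dim_transfer, rule fd, rule I, rule z)
qed

text \<open>A series with coefficients in a direct sum is a family of series. cmp takes a component and
asm reassembles a family.\<close>

definition cmp :: "nat => (nat => 'v dser) => 'v dser" where "cmp i = ext0 (%x. x i)"

definition asm :: "nat => (nat => 'v dser) => nat => 'v dser" where "asm n F = (%k l. \<lambda>i\<in>{..<n}. F i k l)"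

lemma cmp_asm: "i < n ==> cmp i (asm n F) = F i"
 by (simp add: cmp_def asm_def ext0_def)

lemma cmp_in: "f \<in> psc (mod_dsum Vs) ==> i < length Vs ==> cmp i f \<in> psc (Vs ! i)"
 by (simp add: cmp_def ext0_def ps_carrier ds_carrier)

lemma asm_in: "(!!i. i < length Vs ==> F i \<in> psc (Vs ! i)) ==> asm (length Vs) F \<in> psc (mod_dsum Vs)"
 by (simp add: asm_def ps_carrier ds_carrier)

lemma cmp_eqI:
 assumes "f \<in> psc (mod_dsum Vs)" "f' \<in> psc (mod_dsum Vs)" "!!i. i < length Vs ==> cmp i f = cmp i f'"
 shows "f = f'"
proof (rule ext, rule ext, rule ds_eqI)
 fix k l
 show "f k l \<in> extensional {..<length Vs}" "f' k l \<in> extensional {..<length Vs}" using assms(1,2) by (simp_all add: ps_carrier ds_carrier)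
 fix i assume "i < length Vs"
 from assms(3)[OF this] show "f k l i = f' k l i" by (simp add: cmp_def ext0_def fun_eq_iff)
qed

lemma cmp_add: "i < length Vs ==> cmp i (f \<oplus>\<^bsub>ps_mod (mod_dsum Vs)\<^esub> f') = cmp i f \<oplus>\<^bsub>ps_mod (Vs ! i)\<^esub> cmp i f'"
 by (simp add: cmp_def ext0_def ps_add ds_add)

lemma cmp_smult:
 assumes "\<forall>V\<in>set Vs. vmod V & fin_dim V" and i: "i < length Vs" and f: "f \<in> psc (mod_dsum Vs)"
 shows "cmp i (c \<odot>\<^bsub>ps_mod (mod_dsum Vs)\<^esub> f) = c \<odot>\<^bsub>ps_mod (Vs ! i)\<^esub> cmp i f"
 unfolding cmp_def by (rule ps_smult_hom) (use assms dsum_space(1)[OF assms(1)] in \<open>auto simp: ds_add ds_smult ds_carrier\<close>)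

lemma hrep_dsum_space [simp]: "hspace (hrep_dsum g Ws) = mod_dsum (map hspace Ws)"
 by (simp add: hrep_dsum_def)

lemma hrep_dsum_obj:
 assumes W: "\<forall>W\<in>set Ws. hrep_obj g W"
 shows "hrep_obj g (hrep_dsum g Ws)"
  and "u \<in> carrier (Uhh g) ==> f \<in> psc (mod_dsum (map hspace Ws)) ==> hact (hrep_dsum g Ws) u f = asm (length Ws) (%i. hact (Ws ! i) u (cmp i f))"
proof -
 let ?n = "length Ws" and ?D = "mod_dsum (map hspace Ws)" and ?W = "hrep_dsum g Ws"
 have Wi: "hrep_obj g (Ws ! i)" if "i < ?n" for i using W that by simp
 have sp: "\<forall>V\<in>set (map hspace Ws). vmod V & fin_dim V" using W by (auto simp: hrep_obj_def)
 note D = dsum_space[OF sp]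
 show act: "hact ?W u f = asm ?n (%i. hact (Ws ! i) u (cmp i f))" if "u \<in> carrier (Uhh g)" "f \<in> psc ?D" for u f
  using that by (simp add: hrep_dsum_def asm_def cmp_def ext0_def)
 have cin: "cmp i f \<in> psc (hspace (Ws ! i))" if "f \<in> psc ?D" "i < ?n" for i f
  using cmp_in[OF that(1), of i] that(2) by simp
 have hin: "hact (Ws ! i) u (cmp i f) \<in> psc (hspace (Ws ! i))" if "u \<in> carrier (Uhh g)" "f \<in> psc ?D" "i < ?n" for u f i
  by (rule hact_in[OF Wi[OF that(3)] that(1) cin[OF that(2,3)]])
 have ain: "hact ?W u f \<in> psc ?D" if "u \<in> carrier (Uhh g)" "f \<in> psc ?D" for u f
  unfolding act[OF that] using asm_in[of "map hspace Ws" "%i. hact (Ws ! i) u (cmp i f)"] hin[OF that] by simp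
 have cact: "cmp i (hact ?W u f) = hact (Ws ! i) u (cmp i f)" if "u \<in> carrier (Uhh g)" "f \<in> psc ?D" "i < ?n" for u f i
  unfolding act[OF that(1,2)] by (rule cmp_asm[OF that(3)])
 have eqI: "f = f'" if "f \<in> psc ?D" "f' \<in> psc ?D" "!!i. i < ?n ==> cmp i f = cmp i f'" for f f'
  by (rule cmp_eqI[OF that(1,2)]) (simp add: that(3))
 have cadd: "cmp i (f \<oplus>\<^bsub>ps_mod ?D\<^esub> f') = cmp i f \<oplus>\<^bsub>ps_mod (hspace (Ws ! i))\<^esub> cmp i f'" if "i < ?n" for i f f'
  using cmp_add[of i "map hspace Ws"] that by simp
 have csm: "cmp i (c \<odot>\<^bsub>ps_mod ?D\<^esub> f) = c \<odot>\<^bsub>ps_mod (hspace (Ws ! i))\<^esub> cmp i f" if "i < ?n" "f \<in> psc ?D" for i f c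
  using cmp_smult[OF sp _ that(2), of i c] that by simp
 note padd = ps_add_closed[OF D(1)] and psm = ps_smult_closed[OF D(1)]
 have h: "hact (Ws ! i) \<in> ring_hom (Uhh g) (End_ring KR (ps_mod (hspace (Ws ! i))))" if "i < ?n" for i
  using Wi[OF that] by (simp add: hrep_obj_def)
 have L: "hact (Ws ! i) u (x \<oplus>\<^bsub>ps_mod (hspace (Ws ! i))\<^esub> y) = hact (Ws ! i) u x \<oplus>\<^bsub>ps_mod (hspace (Ws ! i))\<^esub> hact (Ws ! i) u y"
  "hact (Ws ! i) u (c \<odot>\<^bsub>ps_mod (hspace (Ws ! i))\<^esub> x) = c \<odot>\<^bsub>ps_mod (hspace (Ws ! i))\<^esub> hact (Ws ! i) u x"
  if "i < ?n" "u \<in> carrier (Uhh g)" "x \<in> psc (hspace (Ws ! i))" "y \<in> psc (hspace (Ws ! i))" for i u x y c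
  using hact_lin[OF Wi[OF that(1)] that(2)] that(3,4) by (simp_all add: lin_maps_def)
 have ext: "hact ?W u \<in> extensional (psc ?D)" if "u \<in> carrier (Uhh g)" for u using that by (simp add: hrep_dsum_def)
 show "hrep_obj g ?W"
  unfolding hrep_obj_def hrep_dsum_space
 proof (intro conjI allI D)
  show "hact ?W \<in> extensional (carrier (Uhh g))" by (simp add: hrep_dsum_def)
  show "hact ?W \<in> ring_hom (Uhh g) (End_ring KR (ps_mod ?D))"
  proof (rule ring_hom_memI)
   fix u assume u: "u \<in> carrier (Uhh g)"
   have "hact ?W u (x \<oplus>\<^bsub>ps_mod ?D\<^esub> y) = hact ?W u x \<oplus>\<^bsub>ps_mod ?D\<^esub> hact ?W u y" if xy: "x \<in> psc ?D" "y \<in> psc ?D" for x y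
    by (rule eqI[OF ain[OF u padd[OF xy]] padd[OF ain[OF u xy(1)] ain[OF u xy(2)]]])
     (simp add: cact u xy padd cadd L(1) cin)
   moreover have "hact ?W u (c \<odot>\<^bsub>ps_mod ?D\<^esub> x) = c \<odot>\<^bsub>ps_mod ?D\<^esub> hact ?W u x" if x: "x \<in> psc ?D" for x c
    by (rule eqI[OF ain[OF u psm[OF x]] psm[OF ain[OF u x]]]) (simp add: cact u x psm csm ain L(2)[OF _ u cin[OF x] cin[OF x]])
   ultimately show "hact ?W u \<in> carrier (End_ring KR (ps_mod ?D))"
    using ext[OF u] ain[OF u] by (simp add: End_ring_def lin_maps_def PiE_iff)
   fix v assume v: "v \<in> carrier (Uhh g)"
   have uv: "u \<otimes>\<^bsub>Uhh g\<^esub> v \<in> carrier (Uhh g)" "u \<oplus>\<^bsub>Uhh g\<^esub> v \<in> carrier (Uhh g)"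
    using ucls_surj[OF u] ucls_surj[OF v] by (auto simp: ucls_mult ucls_add)
   have m: "hact (Ws ! i) (u \<otimes>\<^bsub>Uhh g\<^esub> v) f = hact (Ws ! i) u (hact (Ws ! i) v f)"
    "hact (Ws ! i) (u \<oplus>\<^bsub>Uhh g\<^esub> v) f = hact (Ws ! i) u f \<oplus>\<^bsub>ps_mod (hspace (Ws ! i))\<^esub> hact (Ws ! i) v f"
    if "i < ?n" "f \<in> psc (hspace (Ws ! i))" for i f
    using ring_hom_mult[OF h[OF that(1)] u v] ring_hom_add[OF h[OF that(1)] u v] that(2) by (simp_all add: End_ring_def compose_def)
   show "hact ?W (u \<otimes>\<^bsub>Uhh g\<^esub> v) = hact ?W u \<otimes>\<^bsub>End_ring KR (ps_mod ?D)\<^esub> hact ?W v"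
   proof (rule extensionalityI[OF ext[OF uv(1)]])
    fix f assume f: "f \<in> psc ?D"
    have "hact ?W (u \<otimes>\<^bsub>Uhh g\<^esub> v) f = hact ?W u (hact ?W v f)"
     by (rule eqI[OF ain[OF uv(1) f] ain[OF u ain[OF v f]]]) (simp add: cact uv u v f ain m(1) cin)
    then show "hact ?W (u \<otimes>\<^bsub>Uhh g\<^esub> v) f = (hact ?W u \<otimes>\<^bsub>End_ring KR (ps_mod ?D)\<^esub> hact ?W v) f"
     using f by (simp add: End_ring_def compose_def)
   qed (simp add: End_ring_def)
   show "hact ?W (u \<oplus>\<^bsub>Uhh g\<^esub> v) = hact ?W u \<oplus>\<^bsub>End_ring KR (ps_mod ?D)\<^esub> hact ?W v"
   proof (rule extensionalityI[OF ext[OF uv(2)]])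
    fix f assume f: "f \<in> psc ?D"
    have "hact ?W (u \<oplus>\<^bsub>Uhh g\<^esub> v) f = hact ?W u f \<oplus>\<^bsub>ps_mod ?D\<^esub> hact ?W v f"
     by (rule eqI[OF ain[OF uv(2) f] padd[OF ain[OF u f] ain[OF v f]]]) (simp add: cact uv u v f cadd m(2) cin)
    then show "hact ?W (u \<oplus>\<^bsub>Uhh g\<^esub> v) f = (hact ?W u \<oplus>\<^bsub>End_ring KR (ps_mod ?D)\<^esub> hact ?W v) f"
     using f by (simp add: End_ring_def)
   qed (simp add: End_ring_def)
  next
   have one: "\<one>\<^bsub>Uhh g\<^esub> \<in> carrier (Uhh g)" by (simp add: ucls_one)
   have m: "hact (Ws ! i) \<one>\<^bsub>Uhh g\<^esub> f = f" if "i < ?n" "f \<in> psc (hspace (Ws ! i))" for i f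
    using ring_hom_one[OF h[OF that(1)]] that(2) by (simp add: End_ring_def)
   show "hact ?W \<one>\<^bsub>Uhh g\<^esub> = \<one>\<^bsub>End_ring KR (ps_mod ?D)\<^esub>"
   proof (rule extensionalityI[OF ext[OF one]])
    fix f assume f: "f \<in> psc ?D"
    have "hact ?W \<one>\<^bsub>Uhh g\<^esub> f = f" by (rule eqI[OF ain[OF one f] f]) (simp only: cact[OF one f] m cin[OF f])
    then show "hact ?W \<one>\<^bsub>Uhh g\<^esub> f = \<one>\<^bsub>End_ring KR (ps_mod ?D)\<^esub> f"
     using f by (simp add: End_ring_def)
   qed (simp add: End_ring_def)
  qed
  fix c
  have us: "uscalar g c \<in> carrier (Uhh g)" by (simp add: uscalar_def)
  show "hact ?W (uscalar g c) = (\<lambda>f\<in>psc ?D. c \<odot>\<^bsub>ps_mod ?D\<^esub> f)"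
  proof (rule extensionalityI[OF ext[OF us]])
   fix f assume f: "f \<in> psc ?D"
   have "hact (Ws ! i) (uscalar g c) (cmp i f) = c \<odot>\<^bsub>ps_mod (hspace (Ws ! i))\<^esub> cmp i f" if "i < ?n" for i
    using Wi[OF that] cin[OF f that] by (simp add: hrep_obj_def)
   then have "hact ?W (uscalar g c) f = c \<odot>\<^bsub>ps_mod ?D\<^esub> f"
    by (intro eqI[OF ain[OF us f] psm[OF f]]) (simp only: cact[OF us f] csm f)
   then show "hact ?W (uscalar g c) f = (\<lambda>f\<in>psc ?D. c \<odot>\<^bsub>ps_mod ?D\<^esub> f) f" using f by simp
  qed simp
 qed
qed

lemma class_lim_dsum:
 assumes W: "\<forall>W\<in>set Ws. hrep_obj g W"
 shows "class_lim g (hrep_dsum g Ws) = sl2_dsum (map (class_lim g) Ws)"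
proof -
 let ?n = "length Ws" and ?D = "mod_dsum (map hspace Ws)"
 have sp: "\<forall>V\<in>set (map hspace Ws). vmod V & fin_dim V" using W by (auto simp: hrep_obj_def)
 have hm: "hact_mod g (hrep_dsum g Ws) x v = (\<lambda>i\<in>{..<?n}. hact_mod g (Ws ! i) x (v i))" if v: "v \<in> carrier ?D" for x v
 proof -
  have "cmp i (ps_const ?D v) = ps_const (hspace (Ws ! i)) (v i)" if "i < ?n" for i
   using that by (intro ext) (simp add: cmp_def ext0_def ps_const_def ds_zero)
  then show ?thesis unfolding hact_mod_def hrep_dsum_space hrep_dsum_obj(2)[OF W ucls_in ps_const_in[OF dsum_space(1)[OF sp] v]] asm_def
   by (intro restrict_ext) simp
 qed
 have s: "map sspace (map (class_lim g) Ws) = map hspace Ws" by (simp add: class_lim_def)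
 have vi: "v i \<in> carrier (hspace (Ws ! i))" if "v \<in> carrier ?D" "i < ?n" for v i using that by (simp add: ds_carrier)
 have "(A $ 1 $ 1 \<odot>\<^bsub>?D\<^esub> hact_mod g (hrep_dsum g Ws) Gen_H v \<oplus>\<^bsub>?D\<^esub> A $ 1 $ 2 \<odot>\<^bsub>?D\<^esub> hact_mod g (hrep_dsum g Ws) Gen_Xp v \<oplus>\<^bsub>?D\<^esub>
   A $ 2 $ 1 \<odot>\<^bsub>?D\<^esub> hact_mod g (hrep_dsum g Ws) Gen_Xm v) = (\<lambda>i\<in>{..<?n}. sact (map (class_lim g) Ws ! i) A (v i))"
  if A: "A \<in> sl2" and v: "v \<in> carrier ?D" for A v
 proof (rule ds_eqI[of _ ?n])
  fix i assume i: "i < ?n"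
  then show "(A $ 1 $ 1 \<odot>\<^bsub>?D\<^esub> hact_mod g (hrep_dsum g Ws) Gen_H v \<oplus>\<^bsub>?D\<^esub> A $ 1 $ 2 \<odot>\<^bsub>?D\<^esub> hact_mod g (hrep_dsum g Ws) Gen_Xp v \<oplus>\<^bsub>?D\<^esub>
   A $ 2 $ 1 \<odot>\<^bsub>?D\<^esub> hact_mod g (hrep_dsum g Ws) Gen_Xm v) i = (\<lambda>i\<in>{..<?n}. sact (map (class_lim g) Ws ! i) A (v i)) i"
   using vi[OF v i] A by (simp add: ds_add ds_smult hm[OF v] class_lim_def)
 qed (use ds_ext[where Vs = "map hspace Ws"] in simp_all)
 then show ?thesis
  unfolding sl2_dsum_def s length_map by (intro sl2_rep.equality) (simp_all add: class_lim_def cong: restrict_cong)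
qed

text \<open>The classical summands are limits of deformations, and the limit of the direct sum of these is the direct sum in
question.\<close>

lemma sl2_dsum_obj:
 fixes Vs :: "'v sl2_rep list"
 assumes V: "\<forall>V\<in>set Vs. sl2_obj V"
 shows "sl2_obj (sl2_dsum Vs)"
proof -
 have "ALL V. \<exists>W :: 'v hrep. V \<in> set Vs --> hrep_obj 1 W & class_lim 1 W = V" using deformation_exists[of _ 1] V by force
 then obtain d :: "'v sl2_rep => 'v hrep" where d: "!!V. V \<in> set Vs ==> hrep_obj 1 (d V) & class_lim 1 (d V) = V" by metis
 have eq: "map (class_lim 1) (map d Vs) = Vs" using d by (simp add: map_idI)
 have ob: "\<forall>W\<in>set (map d Vs). hrep_obj 1 W" using d by auto
 show ?thesis using class_lim_obj[OF hrep_dsum_obj(1)[OF ob]] class_lim_dsum[OF ob] unfolding eq by simp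
qed

section \<open>Weight decompositions\<close>

definition wdec :: "nat => 'v hrep => ('v dser) => (int => 'v dser) => bool" where
 "wdec g W f w \<longleftrightarrow> (ALL n. w n \<in> weight_space g W n) &
       finite {n. w n ~= \<zero>\<^bsub>ps_mod (hspace W)\<^esub>} &
       f = (\<Oplus>\<^bsub>ps_mod (hspace W)\<^esub>n\<in>{n. w n ~= \<zero>\<^bsub>ps_mod (hspace W)\<^esub>}. w n)"

lemma ps_abelian: "vmod V ==> abelian_monoid (ps_mod V)"
 by (rule abelian_monoidI)
  (auto simp: ps_carrier ps_add ps_zero vmod_add vmod_zero fun_eq_iff abelian_monoid.a_assoc[OF vmod_monoid]
   abelian_monoid.l_zero[OF vmod_monoid] intro: abelian_monoid.a_comm[OF vmod_monoid])

lemma (in mtrans) wdec_trans: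
 assumes W: "hrep_obj g W" and sp: "hspace W = V" and w: "wdec g W f w"
 shows "wdec g (htr g \<theta> W V') (ext0 \<theta> f) (%n. ext0 \<theta> (w n))"
proof -
 have wV: "w n \<in> psc V" "hact W (ucls g (gen_el Gen_H)) (w n) = of_int n \<odot>\<^bsub>ps_mod V\<^esub> w n" for n
  using w by (auto simp: wdec_def weight_space_def sp)
 have z: "ext0 \<theta> \<zero>\<^bsub>ps_mod V\<^esub> = \<zero>\<^bsub>ps_mod V'\<^esub>" by (simp add: ps_zero ext0_def th_zero)
 have zi: "ext0 \<theta>i \<zero>\<^bsub>ps_mod V'\<^esub> = \<zero>\<^bsub>ps_mod V\<^esub>" by (simp add: ps_zero ext0_def ti_zero)
 have nz: "ext0 \<theta> (w n) ~= \<zero>\<^bsub>ps_mod V'\<^esub> \<longleftrightarrow> w n ~= \<zero>\<^bsub>ps_mod V\<^esub>" for n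
  using e_li[OF wV(1)[of n]] z zi by metis
 have f: "f = (\<Oplus>\<^bsub>ps_mod V\<^esub>n\<in>{n. w n ~= \<zero>\<^bsub>ps_mod V\<^esub>}. w n)" using w by (simp add: wdec_def sp)
 have "ext0 \<theta> f = (\<Oplus>\<^bsub>ps_mod V'\<^esub>n\<in>{n. w n ~= \<zero>\<^bsub>ps_mod V\<^esub>}. ext0 \<theta> (w n))"
  unfolding f by (rule finsum_hom[OF ps_abelian[OF V] ps_abelian[OF V'] e_in e_add z wV(1)])
 moreover have "ext0 \<theta> (w n) \<in> weight_space g (htr g \<theta> W V') n" for n
  by (simp add: weight_space_def e_in[OF wV(1)] htr_act[OF _ _ sp] e_li[OF wV(1)] wV(2) e_smult[OF wV(1)])
 ultimately show ?thesis using w by (simp add: wdec_def sp nz)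
qed

lemma of_int_hconst: "(of_int n :: complex fps fps) = hconst (of_int n)"
proof -
 have "(of_nat k :: complex fps fps) = hconst (of_nat k)" for k
  by (simp add: hconst_def fps_of_nat)
 then show ?thesis by (cases n rule: int_cases2) (simp_all add: hconst_def)
qed

lemma (in sl2_nil) weight_split:
 assumes v: "v \<in> S"
 shows "EX w. (ALL n. w n \<in> S & h (w n) = of_int n \<cdot> w n) & finite {n. w n ~= 0} & v = (\<Sum>n | w n ~= 0. w n)"
proof -
 define P where "P n = {p\<in>pts. int (fst p) - int (snd p) = n}" for n
 define w where "w n = (\<Sum>p\<in>P n. act (proj p) v)" for n
 have a: "act q v \<in> S" for q by (rule act_in[OF v])
 have "w n \<in> S" for n unfolding w_def by (intro cv.subspace_sum[OF S] a)
 moreover have "h (w n) = of_int n \<cdot> w n" for n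
 proof -
  have "h (w n) = (\<Sum>p\<in>P n. h (act (proj p) v))" unfolding w_def by (rule clin_sum[OF h S]) (rule a)
  also have "\<dots> = (\<Sum>p\<in>P n. of_int n \<cdot> act (proj p) v)"
   by (rule sum.cong[OF refl]) (auto simp: P_def proj_eigen(1)[OF _ v] ptH_def)
  also have "\<dots> = of_int n \<cdot> w n" unfolding w_def by (simp add: cv.scale_sum_right)
  finally show ?thesis .
 qed
 moreover have sub: "{n. w n ~= 0} \<subseteq> (%p. int (fst p) - int (snd p)) ` pts"
 proof
  fix n assume "n \<in> {n. w n ~= 0}"
  then have "P n ~= {}" by (auto simp: w_def)
  then obtain p where "p \<in> pts" "n = int (fst p) - int (snd p)" unfolding P_def by blast
  then show "n \<in> (%p. int (fst p) - int (snd p)) ` pts" by (rule image_eqI[rotated])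
 qed
 moreover have "v = (\<Sum>n | w n ~= 0. w n)"
 proof -
  have "v = (\<Sum>p\<in>pts. act (proj p) v)" by (rule decomp[OF v, symmetric])
  also have "\<dots> = (\<Sum>n\<in>(%p. int (fst p) - int (snd p)) ` pts. w n)"
   unfolding w_def P_def by (rule sum.image_gen) simp
  also have "\<dots> = (\<Sum>n | w n ~= 0. w n)" by (rule sum.mono_neutral_right) (use sub in auto)
  finally show ?thesis .
 qed
 ultimately show ?thesis using finite_subset[OF sub] by (intro exI[of _ w]) auto
qed

lemma weight_rep_emod:
 assumes W: "hrep_obj g W" and sp: "hspace W = emod S" and S: "cv.subspace S" and g: "g \<ge> 1"
 shows "f \<in> MS S ==> EX w. wdec g W f w" "wdec g W f w ==> wdec g W f w' ==> w = w'"
proof -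
 let ?h = "hgen g W Gen_H"
 interpret hops S "hgen g W" g by (rule hrep_hops[OF W sp S g])
 note MSs = subspace_MS[OF S]
 have sm: "of_int n \<odot>\<^bsub>ps_mod (emod S)\<^esub> f = of_int n \<cdot> f" if "f \<in> MS S" for n f
  unfolding ps_smult[OF S that] of_int_hconst by (rule kract.Phi_const[OF kract_csc[OF S] that])
 have ws: "f \<in> weight_space g W n \<longleftrightarrow> f \<in> MS S & ?h f = of_int n \<cdot> f" for f n
  unfolding weight_space_def sp hgen_def by (auto simp: sm)
 have fs: "(\<Oplus>\<^bsub>ps_mod (emod S)\<^esub>n\<in>F. w n) = (\<Sum>n\<in>F. w n)" if "!!n. w n \<in> MS S" for w and F :: "int set"
  using finsum_hom[OF ps_abelian[OF module_emod[OF S]] vmod_monoid[OF module_emod[OF MSs]], of "%x. x" F w] finsum_emod[OF MSs, of F w] that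
  by (simp add: ps_add ps_zero zero_fun_def plus_fun_def)
 have wd: "wdec g W f w \<longleftrightarrow> (ALL n. w n \<in> MS S & ?h (w n) = of_int n \<cdot> w n) & finite {n. w n ~= 0} & f = (\<Sum>n | w n ~= 0. w n)" for f w
  unfolding wdec_def ws sp using fs[of w] by auto
 show "EX w. wdec g W f w" if f: "f \<in> MS S"
 proof -
  interpret t: sl2_deformed S Xe "hgen g W Gen_Xm" ?h by (rule triple)
  obtain N where "sl2_nil (MS S) Xe (hgen g W Gen_Xm) ?h N" using t.nilpotent_deformed by blast
  then show ?thesis unfolding wd using sl2_nil.weight_split[OF _ f] by blast
 qed
 show "w = w'" if "wdec g W f w" "wdec g W f w'"
 proof
  fix n
  note A = that(1)[unfolded wd] and B = that(2)[unfolded wd]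
  let ?F = "insert n ({n. w n ~= 0} \<union> {n. w' n ~= 0})"
  have F: "finite ?F" using A B by simp
  have "(\<Sum>n | w n ~= 0. w n) = sum w ?F" by (rule sum.mono_neutral_left) (use F in auto)
  moreover have "(\<Sum>n | w' n ~= 0. w' n) = sum w' ?F" by (rule sum.mono_neutral_left) (use F in auto)
  ultimately have "(\<Sum>n\<in>?F. w n - w' n) = 0" using A B by (simp only: sum_subtractf) (metis diff_self)
  moreover have "w k - w' k \<in> MS S & ?h (w k - w' k) = of_int k \<cdot> (w k - w' k)" for k
   using A B cv.subspace_diff[OF MSs] clin_diff[OF kop_clin[OF kT[of Gen_H]] MSs] by (simp add: cv.scale_right_diff_distrib)
  ultimately have "w n - w' n = 0"
   by (intro eigen_indep[OF MSs kop_clin[OF kT[of Gen_H]] F, where w = "%n. w n - w' n" and c = of_int]) (auto simp: inj_on_def)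
  then show "w n = w' n" by simp
 qed
qed

lemma all_weight_rep:
 assumes W: "hrep_obj g W" and g: "g \<ge> 1"
 shows "weight_rep g W"
proof -
 obtain S :: "(nat => complex) set" and \<theta> where S: "fd S" and iso: "miso (emod S) (hspace W) \<theta>"
  using coordinates[OF hrep_space[OF W]] by blast
 interpret m: mtrans "emod S" "hspace W" \<theta> by (rule mtrans.intro[OF module_emod[OF fd_subspace[OF S]] hrep_space(1)[OF W] iso])
 interpret i: mtrans "hspace W" "emod S" m.\<theta>i by (rule mtrans.intro[OF m.V' m.V miso_inv[OF m.V m.iso]])
 define W1 where "W1 = htr g m.\<theta>i W (emod S)"
 have W1: "hrep_obj g W1" "hspace W1 = emod S" and eq: "htr g \<theta> W1 (hspace W) = W"
  unfolding W1_def by (rule i.htr_obj[OF W refl], simp, rule m.htr_htr[OF W refl])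
 note eq1 = W1_def[symmetric]
 note E = weight_rep_emod[OF W1 fd_subspace[OF S] g]
 have "\<exists>!w. wdec g W f w" if f: "f \<in> psc (hspace W)" for f
 proof -
  have "ext0 m.\<theta>i f \<in> MS S" using m.ei_in[OF f] by simp
  from E(1)[OF this] obtain w1 where "wdec g W1 (ext0 m.\<theta>i f) w1" by blast
  from m.wdec_trans[OF W1 this] have ex: "wdec g W f (%n. ext0 \<theta> (w1 n))" using eq m.e_ri[OF f] by simp
  moreover have "w = w'" if "wdec g W f w" "wdec g W f w'" for w w'
  proof
   fix n
   have "(%n. ext0 m.\<theta>i (w n)) = (%n. ext0 m.\<theta>i (w' n))"
    using i.wdec_trans[OF W refl that(1)] i.wdec_trans[OF W refl that(2)] unfolding eq1 by (rule E(2))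
   then have "ext0 m.\<theta>i (w n) = ext0 m.\<theta>i (w' n)" by (rule fun_cong)
   moreover have "w n \<in> psc (hspace W)" "w' n \<in> psc (hspace W)"
    using that by (auto simp: wdec_def weight_space_def)
   ultimately show "w n = w' n" using m.e_ri by metis
  qed
  ultimately show ?thesis by blast
 qed
 then show ?thesis unfolding weight_rep_def wdec_def[symmetric] by blast
qed

section \<open>The Grothendieck groups\<close>

lemma iso_class_eq:
 assumes "!!V. Ob V ==> eqv V V" "!!V W. Ob V ==> Ob W ==> eqv V W ==> eqv W V"
  "!!V W Z. Ob V ==> Ob W ==> Ob Z ==> eqv V W ==> eqv W Z ==> eqv V Z" and "Ob V" "Ob W"
 shows "iso_class Ob eqv V = iso_class Ob eqv W \<longleftrightarrow> eqv V W"
 unfolding iso_class_def using assms by blast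

text \<open>Formal: L maps isomorphism classes bijectively onto isomorphism classes, and the induced isomorphism of
free abelian groups carries the relators of one group onto those of the other.\<close>

lemma groth_iso:
 assumes e: "!!V. Ob V ==> eqv V V" "!!V W. Ob V ==> Ob W ==> eqv V W ==> eqv W V"
  "!!V W Z. Ob V ==> Ob W ==> Ob Z ==> eqv V W ==> eqv W Z ==> eqv V Z"
  and e': "!!V. Ob' V ==> eqv' V V" "!!V W. Ob' V ==> Ob' W ==> eqv' V W ==> eqv' W V"
  "!!V W Z. Ob' V ==> Ob' W ==> Ob' Z ==> eqv' V W ==> eqv' W Z ==> eqv' V Z"
  and L: "!!V. Ob V ==> Ob' (L V)" "!!Y. Ob' Y ==> EX V. Ob V & L V = Y" "!!V W. Ob V ==> Ob W ==> eqv V W \<longleftrightarrow> eqv' (L V) (L W)"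
  and sm: "!!D A B. Ob D ==> Ob A ==> Ob B ==> is_sum D A B \<longleftrightarrow> is_sum' (L D) (L A) (L B)"
 shows "\<exists>\<Phi>\<in>iso (groth_group Ob eqv is_sum) (groth_group Ob' eqv' is_sum'). ALL V. Ob V --> \<Phi> (groth_class Ob eqv is_sum V) = groth_class Ob' eqv' is_sum' (L V)"
proof -
 define C where "C = {iso_class Ob eqv V | V. Ob V}"
 define C' where "C' = {iso_class Ob' eqv' V | V. Ob' V}"
 let ?F = "free_Abelian_group C" and ?F' = "free_Abelian_group C'"
 define R where "R = {frag_of (iso_class Ob eqv D) - frag_of (iso_class Ob eqv A) - frag_of (iso_class Ob eqv B) | D A B. Ob D & Ob A & Ob B & is_sum D A B}"
 define R' where "R' = {frag_of (iso_class Ob' eqv' D) - frag_of (iso_class Ob' eqv' A) - frag_of (iso_class Ob' eqv' B) | D A B. Ob' D & Ob' A & Ob' B & is_sum' D A B}"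
 let ?N = "generate ?F R" and ?N' = "generate ?F' R'"
 interpret F: comm_group ?F by (rule abelian_free_Abelian_group)
 interpret F': comm_group ?F' by (rule abelian_free_Abelian_group)
 have img: "L ` iso_class Ob eqv V = iso_class Ob' eqv' (L V)" if "Ob V" for V
  using L that unfolding iso_class_def by (auto simp: image_iff) metis
 have inC: "Ob V ==> iso_class Ob eqv V \<in> C" and inC': "Ob' Y ==> iso_class Ob' eqv' Y \<in> C'" for V Y by (auto simp: C_def C'_def)
 have bij: "bij_betw ((`) L) C C'"
 proof (rule bij_betwI')
  fix c d assume "c \<in> C" "d \<in> C"
  then obtain V W where c: "c = iso_class Ob eqv V" "Ob V" "d = iso_class Ob eqv W" "Ob W" by (auto simp: C_def)
  have "(L ` c = L ` d) = eqv' (L V) (L W)" unfolding c img[OF c(2)] img[OF c(4)] by (rule iso_class_eq[where Ob = Ob' and eqv = eqv', OF e' L(1)[OF c(2)] L(1)[OF c(4)]])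
  also have "\<dots> = (c = d)" unfolding c L(3)[OF c(2,4), symmetric] by (rule iso_class_eq[where Ob = Ob and eqv = eqv, OF e c(2,4), symmetric])
  finally show "(L ` c = L ` d) = (c = d)" .
 next
  fix c assume "c \<in> C" then show "L ` c \<in> C'" unfolding C_def using img inC' L(1) by auto
 next
  fix c' assume "c' \<in> C'"
  then obtain Y where Y: "Ob' Y" "c' = iso_class Ob' eqv' Y" by (auto simp: C'_def)
  obtain V where "Ob V" "L V = Y" using L(2)[OF Y(1)] by blast
  then show "\<exists>c\<in>C. c' = L ` c" using img[of V] inC[of V] Y by auto
 qed
 let ?\<gamma> = "inv_into C ((`) L)"
 have \<gamma>: "?\<gamma> c' \<in> C" if "c' \<in> C'" for c' using bij that by (auto simp: bij_betw_def inv_into_into)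
 have Lg: "L ` ?\<gamma> c' = c'" if "c' \<in> C'" for c' using bij that by (simp add: bij_betw_inv_into_right)
 have gL: "?\<gamma> (L ` c) = c" if "c \<in> C" for c using bij that by (simp add: bij_betw_inv_into_left)
 have bC: "L ` c \<in> C'" if "c \<in> C" for c using bij that by (auto simp: bij_betw_def)
 obtain h where h: "h \<in> hom ?F ?F'" "!!c. c \<in> C ==> h (frag_of c) = frag_of (L ` c)"
  using F'.free_Abelian_group_universal[of "%c. frag_of (L ` c)" C] bC by (auto simp: image_subset_iff)
 obtain k where k: "k \<in> hom ?F' ?F" "!!c. c \<in> C' ==> k (frag_of c) = frag_of (?\<gamma> c)"
  using F.free_Abelian_group_universal[of "%c. frag_of (?\<gamma> c)" C'] \<gamma> by (auto simp: image_subset_iff)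
 interpret h: group_hom ?F ?F' h by unfold_locales (rule h(1))
 interpret k: group_hom ?F' ?F k by unfold_locales (rule k(1))
 have car: "x \<in> carrier ?F \<longleftrightarrow> Poly_Mapping.keys x \<subseteq> C" for x by simp
 have diff: "h (x - y) = h x - h y" if "Poly_Mapping.keys x \<subseteq> C" "Poly_Mapping.keys y \<subseteq> C" for x y
  by (rule hom_frag_diff[OF h(1) that])
 have kdiff: "k (x - y) = k x - k y" if "Poly_Mapping.keys x \<subseteq> C'" "Poly_Mapping.keys y \<subseteq> C'" for x y
  by (rule hom_frag_diff[OF k(1) that])
 have hC: "Poly_Mapping.keys (h x) \<subseteq> C'" if "Poly_Mapping.keys x \<subseteq> C" for x using h.hom_closed[of x] that by simp
 have kC: "Poly_Mapping.keys (k x) \<subseteq> C" if "Poly_Mapping.keys x \<subseteq> C'" for x using k.hom_closed[of x] that by simp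
 have kd: "Poly_Mapping.keys (x - y) \<subseteq> C" if "Poly_Mapping.keys x \<subseteq> C" "Poly_Mapping.keys y \<subseteq> C" for x y
  using that keys_diff[of x y] by blast
 have kd': "Poly_Mapping.keys (x - y) \<subseteq> C'" if "Poly_Mapping.keys x \<subseteq> C'" "Poly_Mapping.keys y \<subseteq> C'" for x y
  using that keys_diff[of x y] by blast
 have kh: "k (h x) = x" if "Poly_Mapping.keys x \<subseteq> C" for x
 proof -
  have "Poly_Mapping.keys x \<subseteq> C & k (h x) = x"
   using that
  proof (rule free_Abelian_group_induct)
   show "Poly_Mapping.keys (0 :: 'a set \<Rightarrow>\<^sub>0 int) \<subseteq> C & k (h 0) = 0" using h.hom_one k.hom_one by simp
   fix x y assume "Poly_Mapping.keys x \<subseteq> C & k (h x) = x" "Poly_Mapping.keys y \<subseteq> C & k (h y) = y"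
   then show "Poly_Mapping.keys (x - y) \<subseteq> C & k (h (x - y)) = x - y" by (simp add: kd diff kdiff hC)
  next
   fix c assume "c \<in> C" then show "Poly_Mapping.keys (frag_of c) \<subseteq> C & k (h (frag_of c)) = frag_of c" by (simp add: h k bC gL)
  qed
  then show ?thesis ..
 qed
 have hk: "h (k x) = x" if "Poly_Mapping.keys x \<subseteq> C'" for x
 proof -
  have "Poly_Mapping.keys x \<subseteq> C' & h (k x) = x"
   using that
  proof (rule free_Abelian_group_induct)
   show "Poly_Mapping.keys (0 :: 'b set \<Rightarrow>\<^sub>0 int) \<subseteq> C' & h (k 0) = 0" using h.hom_one k.hom_one by simp
   fix x y assume "Poly_Mapping.keys x \<subseteq> C' & h (k x) = x" "Poly_Mapping.keys y \<subseteq> C' & h (k y) = y"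
   then show "Poly_Mapping.keys (x - y) \<subseteq> C' & h (k (x - y)) = x - y" by (simp add: kd' diff kdiff kC)
  next
   fix c assume "c \<in> C'" then show "Poly_Mapping.keys (frag_of c) \<subseteq> C' & h (k (frag_of c)) = frag_of c" by (simp add: h k \<gamma> Lg)
  qed
  then show ?thesis ..
 qed
 have "Poly_Mapping.keys (frag_of c - frag_of a - frag_of b) \<subseteq> C" if "c \<in> C" "a \<in> C" "b \<in> C" for a b c
  by (intro kd) (use that in simp_all)
 then have RC: "R \<subseteq> carrier ?F" unfolding R_def car subset_iff using inC by blast
 have "Poly_Mapping.keys (frag_of c - frag_of a - frag_of b) \<subseteq> C'" if "c \<in> C'" "a \<in> C'" "b \<in> C'" for a b c
  by (intro kd') (use that in simp_all)
 then have RC': "R' \<subseteq> carrier ?F'" unfolding R'_def carrier_free_Abelian_group_iff subset_iff using inC' by blast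
 have hr: "h (frag_of (iso_class Ob eqv D) - frag_of (iso_class Ob eqv A) - frag_of (iso_class Ob eqv B)) =
   frag_of (iso_class Ob' eqv' (L D)) - frag_of (iso_class Ob' eqv' (L A)) - frag_of (iso_class Ob' eqv' (L B))" if "Ob D" "Ob A" "Ob B" for D A B
  using that by (simp add: diff kd inC h(2) img)
 have "h ` R = R'"
 proof
  show "h ` R \<subseteq> R'"
  proof
   fix y assume "y \<in> h ` R"
   then obtain D A B where "Ob D" "Ob A" "Ob B" "is_sum D A B" "y = h (frag_of (iso_class Ob eqv D) - frag_of (iso_class Ob eqv A) - frag_of (iso_class Ob eqv B))"
    unfolding R_def by blast
   then show "y \<in> R'" unfolding R'_def using hr sm L(1) by blast
  qed
  show "R' \<subseteq> h ` R"
  proof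
   fix y assume "y \<in> R'"
   then obtain D' A' B' where y: "Ob' D'" "Ob' A'" "Ob' B'" "is_sum' D' A' B'" "y = frag_of (iso_class Ob' eqv' D') - frag_of (iso_class Ob' eqv' A') - frag_of (iso_class Ob' eqv' B')"
    unfolding R'_def by blast
   obtain D A B where "Ob D" "Ob A" "Ob B" "L D = D'" "L A = A'" "L B = B'" using L(2) y by metis
   then have "y = h (frag_of (iso_class Ob eqv D) - frag_of (iso_class Ob eqv A) - frag_of (iso_class Ob eqv B))"
    "frag_of (iso_class Ob eqv D) - frag_of (iso_class Ob eqv A) - frag_of (iso_class Ob eqv B) \<in> R"
    using hr[of D A B] y sm[of D A B] unfolding R_def by auto
   then show "y \<in> h ` R" by blast
  qed
 qed
 then have N: "h ` ?N = ?N'" using h.generate_img[OF RC] by simp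
 have sN: "subgroup ?N ?F" by (rule F.generate_is_subgroup[OF RC])
 have sN': "subgroup ?N' ?F'" by (rule F'.generate_is_subgroup[OF RC'])
 have nN': "?N' \<lhd> ?F'" by (rule F'.normal_iff_subgroup[THEN iffD2, OF sN'])
 have "group (?F' Mod ?N')" by (rule normal.factorgroup_is_group[OF nN'])
 define p where "p x = ?N' #>\<^bsub>?F'\<^esub> h x" for x
 have "p = (%a. ?N' #>\<^bsub>?F'\<^esub> a) \<circ> h" by (rule ext) (simp only: p_def comp_apply)
 then have p: "p \<in> hom ?F (?F' Mod ?N')" using hom_compose[OF h(1) normal.r_coset_hom_Mod[OF nN']] by (simp only:)
 interpret p: group_hom ?F "?F' Mod ?N'" p
  by (rule group_hom.intro[OF F.group_axioms \<open>group (?F' Mod ?N')\<close> group_hom_axioms.intro[OF p]])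
 have "p ` carrier ?F = carrier (?F' Mod ?N')"
 proof -
  have "carrier ?F' \<subseteq> h ` carrier ?F"
  proof
   fix y assume "y \<in> carrier ?F'"
   then have "k y \<in> carrier ?F" "y = h (k y)" using kC[of y] hk[of y] by simp_all
   then show "y \<in> h ` carrier ?F" by (rule rev_image_eqI)
  qed
  moreover have "h ` carrier ?F \<subseteq> carrier ?F'" using h.hom_closed by blast
  ultimately have "h ` carrier ?F = carrier ?F'" by (rule equalityI[rotated])
  then have "p ` carrier ?F = (%x. ?N' #>\<^bsub>?F'\<^esub> x) ` carrier ?F'" unfolding \<open>p = _ \<circ> h\<close> image_comp[symmetric] by (rule arg_cong)
  also have "\<dots> = carrier (?F' Mod ?N')" unfolding FactGroup_def RCOSETS_def partial_object.simps by blast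
  finally show ?thesis .
 qed
 from p.FactGroup_iso_set[OF this] have iso: "(%Y. the_elem (p ` Y)) \<in> iso (?F Mod (kernel ?F (?F' Mod ?N') p)) (?F' Mod ?N')" .
 have ker: "kernel ?F (?F' Mod ?N') p = ?N"
 proof -
  have "p x = \<one>\<^bsub>?F' Mod ?N'\<^esub> \<longleftrightarrow> x \<in> ?N" if x: "x \<in> carrier ?F" for x
  proof -
   have "p x = \<one>\<^bsub>?F' Mod ?N'\<^esub> \<longleftrightarrow> h x \<in> ?N'"
    unfolding p_def FactGroup_def monoid.simps using F'.coset_join1[OF _ h.hom_closed[OF x] sN'] F'.coset_join2[OF h.hom_closed[OF x] sN'] by blast
   also have "\<dots> \<longleftrightarrow> x \<in> ?N"
   proof
    assume "x \<in> ?N"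
    then show "h x \<in> ?N'" unfolding N[symmetric] by (rule imageI)
   next
    assume "h x \<in> ?N'"
    then obtain y where y: "y \<in> ?N" "h x = h y" unfolding N[symmetric] by blast
    then have "y \<in> carrier ?F" using subgroup.subset[OF sN] by blast
    then have "x = y" using kh[of x] kh[of y] x y(2) unfolding car by metis
    then show "x \<in> ?N" using y(1) by (simp only:)
   qed
   finally show ?thesis .
  qed
  then show ?thesis unfolding kernel_def using subgroup.subset[OF sN] by blast
 qed
 have val: "the_elem (p ` (?N #>\<^bsub>?F\<^esub> x)) = p x" if x: "x \<in> carrier ?F" for x
 proof -
  have "p y = p x" if y: "y \<in> ?N #>\<^bsub>?F\<^esub> x" for y
  proof -
   obtain n where n: "n \<in> ?N" "y = n \<otimes>\<^bsub>?F\<^esub> x" using y by (auto simp: r_coset_def)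
   then have "n \<in> kernel ?F (?F' Mod ?N') p" by (simp add: ker)
   then have "n \<in> carrier ?F" "p n = \<one>\<^bsub>?F' Mod ?N'\<^esub>" by (auto simp: kernel_def)
   then show ?thesis unfolding n(2) using p.hom_mult[OF _ x] p.H.l_one p.hom_closed[OF x] by metis
  qed
  moreover have "x \<in> ?N #>\<^bsub>?F\<^esub> x" by (rule F.rcos_self[OF x sN])
  ultimately have "p ` (?N #>\<^bsub>?F\<^esub> x) = {p x}" by blast
  then show ?thesis by simp
 qed
 have gg: "groth_group Ob eqv is_sum = ?F Mod ?N" "groth_group Ob' eqv' is_sum' = ?F' Mod ?N'"
  by (simp_all add: groth_group_def groth_free_def groth_rel_def C_def R_def C'_def R'_def)
 have gc: "groth_class Ob eqv is_sum V = ?N #>\<^bsub>?F\<^esub> frag_of (iso_class Ob eqv V)" for V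
  by (simp add: groth_class_def groth_free_def groth_rel_def C_def R_def)
 have gc': "groth_class Ob' eqv' is_sum' V = ?N' #>\<^bsub>?F'\<^esub> frag_of (iso_class Ob' eqv' V)" for V
  by (simp add: groth_class_def groth_free_def groth_rel_def C'_def R'_def)
 show ?thesis
 proof (rule bexI[OF _ iso[unfolded ker, folded gg]], intro allI impI)
  fix V assume V: "Ob V"
  have "the_elem (p ` groth_class Ob eqv is_sum V) = p (frag_of (iso_class Ob eqv V))"
   unfolding gc by (rule val) (simp add: inC V)
  also have "\<dots> = groth_class Ob' eqv' is_sum' (L V)" unfolding p_def gc' using V by (simp add: h(2) inC img)
  finally show "the_elem (p ` groth_class Ob eqv is_sum V) = groth_class Ob' eqv' is_sum' (L V)" .
 qed
qed

section \<open>Decomposition into strings\<close>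

definition FS :: "('m::cvec => 'm) => 'k set => ('k => nat) => ('k => 'm) => ('k => nat => complex) => 'm" where
 "FS f K m v c = (\<Sum>k\<in>K. \<Sum>j\<le>m k. c k j \<cdot> (f ^^ j) (v k))"

lemma FS_cong: "(!!k j. k \<in> K ==> j \<le> m k ==> c k j = d k j) ==> FS f K m v c = FS f K m v d"
 unfolding FS_def by (intro sum.cong) auto

lemma FS_add: "FS f K m v (%k j. c k j + d k j) = FS f K m v c + FS f K m v d"
 by (simp add: FS_def csc_add_left sum.distrib)

lemma FS_csc: "FS f K m v (%k j. a * c k j) = a \<cdot> FS f K m v c"
 by (simp only: FS_def cv.scale_sum_right csc_csc)

lemma FS_diff: "FS f K m v (%k j. c k j - d k j) = FS f K m v c - FS f K m v d"
 by (simp add: FS_def cv.scale_left_diff_distrib sum_subtractf)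

lemma FS_reindex:
 assumes "bij_betw \<sigma> K K'" "!!k. k \<in> K ==> m' (\<sigma> k) = m k"
 shows "FS f K' m' v' c = FS f K m (%k. v' (\<sigma> k)) (%k. c (\<sigma> k))"
 unfolding FS_def using assms(2) by (subst sum.reindex_bij_betw[OF assms(1), symmetric]) (rule sum.cong[OF refl], simp)

text \<open>A family of highest weight vectors whose strings \<open>f\<^sup>j v\<^sub>k\<close>, \<open>j \<le> m\<^sub>k\<close>,
form a basis. The action on coordinates depends on the function m alone.\<close>

locale sl2_frame = sl2_module S e f h for S :: "'m::cvec set" and e f h +
 fixes K :: "'k set" and m :: "'k => nat" and v :: "'k => 'm"
 assumes finK: "finite K"
  and hw: "!!k. k \<in> K ==> v k \<in> S & e (v k) = 0 & h (v k) = of_nat (m k) \<cdot> v k & (f ^^ Suc (m k)) (v k) = 0"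
  and spn: "!!u. u \<in> S ==> EX c. u = FS f K m v c"
  and ind: "!!c k j. FS f K m v c = 0 ==> k \<in> K ==> j \<le> m k ==> c k j = 0"
begin

lemma bv: "k \<in> K ==> (f ^^ j) (v k) \<in> S"
 using clin_in[OF clin_funpow[OF f]] hw by blast

lemma FS_inner: "k \<in> K ==> (\<Sum>j\<le>m k. c k j \<cdot> (f ^^ j) (v k)) \<in> S"
 by (intro cv.subspace_sum[OF S] cv.subspace_scale[OF S] bv)

lemma FS_in: "FS f K m v c \<in> S"
 unfolding FS_def by (intro cv.subspace_sum[OF S] FS_inner)

lemma clin_FS:
 assumes "clin S S' T"
 shows "T (FS f K m v c) = (\<Sum>k\<in>K. \<Sum>j\<le>m k. c k j \<cdot> T ((f ^^ j) (v k)))"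
proof -
 have "T (FS f K m v c) = (\<Sum>k\<in>K. T (\<Sum>j\<le>m k. c k j \<cdot> (f ^^ j) (v k)))"
  unfolding FS_def by (rule clin_sum[OF assms S FS_inner])
 also have "\<dots> = (\<Sum>k\<in>K. \<Sum>j\<le>m k. c k j \<cdot> T ((f ^^ j) (v k)))"
 proof (rule sum.cong[OF refl])
  fix k assume k: "k \<in> K"
  have "T (\<Sum>j\<le>m k. c k j \<cdot> (f ^^ j) (v k)) = (\<Sum>j\<le>m k. T (c k j \<cdot> (f ^^ j) (v k)))"
   by (rule clin_sum[OF assms S cv.subspace_scale[OF S bv[OF k]]])
  then show "T (\<Sum>j\<le>m k. c k j \<cdot> (f ^^ j) (v k)) = (\<Sum>j\<le>m k. c k j \<cdot> T ((f ^^ j) (v k)))"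
   by (simp only: clin_csc[OF assms bv[OF k]])
 qed
 finally show ?thesis .
qed

lemma f_FS: "f (FS f K m v c) = FS f K m v (%k j. if j = 0 then 0 else c k (j - 1))"
 unfolding clin_FS[OF f] unfolding FS_def
proof (rule sum.cong[OF refl])
 fix k assume "k \<in> K"
 then have z: "f ((f ^^ m k) (v k)) = 0" using hw by simp
 have "(\<Sum>j\<le>m k. c k j \<cdot> f ((f ^^ j) (v k))) = (\<Sum>j<m k. c k j \<cdot> f ((f ^^ j) (v k)))"
  unfolding lessThan_Suc_atMost[symmetric] sum.lessThan_Suc by (simp add: z)
 also have "\<dots> = (\<Sum>j\<le>m k. (if j = 0 then 0 else c k (j - 1)) \<cdot> (f ^^ j) (v k))"
  unfolding sum.atMost_shift by simp
 finally show "(\<Sum>j\<le>m k. c k j \<cdot> f ((f ^^ j) (v k))) = (\<Sum>j\<le>m k. (if j = 0 then 0 else c k (j - 1)) \<cdot> (f ^^ j) (v k))" .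
qed

lemma h_FS: "h (FS f K m v c) = FS f K m v (%k j. (of_nat (m k) - of_nat (2 * j)) * c k j)"
 unfolding clin_FS[OF h] unfolding FS_def
 by (intro sum.cong refl, subst eigen_f_funpow(1)[OF _ _ cas_hw], insert hw) (auto simp: csc_csc mult.commute)

lemma e_FS: "e (FS f K m v c) = FS f K m v (%k j. if j < m k then of_nat (Suc j) * (of_nat (m k) - of_nat j) * c k (Suc j) else 0)"
 unfolding clin_FS[OF e] unfolding FS_def
proof (rule sum.cong[OF refl])
 fix k assume k: "k \<in> K"
 have s: "e ((f ^^ Suc j) (v k)) = (of_nat (Suc j) * (of_nat (m k) - of_nat j)) \<cdot> (f ^^ j) (v k)" for j
  by (rule e_string) (use hw[OF k] in auto)
 have "(\<Sum>j\<le>m k. c k j \<cdot> e ((f ^^ j) (v k))) = (\<Sum>j<m k. c k (Suc j) \<cdot> e ((f ^^ Suc j) (v k)))"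
  using hw[OF k] by (simp add: sum.atMost_shift)
 also have "\<dots> = (\<Sum>j\<le>m k. (if j < m k then of_nat (Suc j) * (of_nat (m k) - of_nat j) * c k (Suc j) else 0) \<cdot> (f ^^ j) (v k))"
  unfolding s csc_csc lessThan_Suc_atMost[symmetric] sum.lessThan_Suc by (simp add: mult_ac)
 finally show "(\<Sum>j\<le>m k. c k j \<cdot> e ((f ^^ j) (v k))) = (\<Sum>j\<le>m k. (if j < m k then of_nat (Suc j) * (of_nat (m k) - of_nat j) * c k (Suc j) else 0) \<cdot> (f ^^ j) (v k))" .
qed

lemma FS_eqD: "FS f K m v c = FS f K m v d ==> k \<in> K ==> j \<le> m k ==> c k j = d k j"
 using ind[of "%k j. c k j - d k j" k j] by (simp add: FS_diff)

lemma FS_map: "\<exists>\<theta>. ALL c. \<theta> (FS f K m v c) = FS f' K m v' c"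
proof (intro exI allI)
 fix c
 let ?d = "SOME d. FS f K m v c = FS f K m v d"
 have "FS f K m v c = FS f K m v ?d" by (rule someI[of _ c]) simp
 then show "(%u. FS f' K m v' (SOME d. u = FS f K m v d)) (FS f K m v c) = FS f' K m v' c"
  using FS_eqD by (intro FS_cong) metis
qed

lemma frame_reindex:
 assumes \<sigma>: "bij_betw \<sigma> K' K" and m: "!!k. k \<in> K' ==> m (\<sigma> k) = m' k"
 shows "sl2_frame S e f h K' m' (%k. v (\<sigma> k))"
proof -
 note R = FS_reindex[where K = K' and K' = K and m' = m and m = m' and \<sigma> = \<sigma>, OF \<sigma> m]
 have in_K: "\<sigma> k \<in> K" if "k \<in> K'" for k using \<sigma> that by (auto simp: bij_betw_def)
 show ?thesis
 proof
  show "finite K'" using bij_betw_finite[OF \<sigma>] finK by simp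
  show "v (\<sigma> k) \<in> S & e (v (\<sigma> k)) = 0 & h (v (\<sigma> k)) = of_nat (m' k) \<cdot> v (\<sigma> k) & (f ^^ Suc (m' k)) (v (\<sigma> k)) = 0" if "k \<in> K'" for k
   using hw[OF in_K[OF that]] m[OF that] by simp
  show "EX c. u = FS f K' m' (%k. v (\<sigma> k)) c" if "u \<in> S" for u using spn[OF that] R[where f = f and v' = v] by metis
  fix c k j assume 0: "FS f K' m' (%k. v (\<sigma> k)) c = 0" and k: "k \<in> K'" "j \<le> m' k"
  let ?c = "%k. c (inv_into K' \<sigma> k)"
  have "FS f K m v ?c = FS f K' m' (%k. v (\<sigma> k)) (%k. ?c (\<sigma> k))" by (rule R)
  also have "\<dots> = FS f K' m' (%k. v (\<sigma> k)) c" using \<sigma> by (intro FS_cong) (simp add: bij_betw_inv_into_left)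
  finally have "?c (\<sigma> k) j = 0" using ind[of ?c "\<sigma> k" j] 0 in_K[OF k(1)] m[OF k(1)] k(2) by simp
  then show "c k j = 0" using \<sigma> k(1) by (simp add: bij_betw_inv_into_left)
 qed
qed

end

lemma fiber_bij:
 assumes "finite K" "finite K'" and card: "!!n. card {k\<in>K. m k = n} = card {k\<in>K'. m' k = n}"
 shows "\<exists>\<sigma>. bij_betw \<sigma> K K' & (\<forall>k\<in>K. m' (\<sigma> k) = m k)"
proof -
 have "\<exists>\<sigma>. bij_betw \<sigma> {k\<in>K. m k = n} {k\<in>K'. m' k = n}" for n
  by (rule finite_same_card_bij) (use assms in auto)
 then obtain \<sigma> where \<sigma>: "!!n. bij_betw (\<sigma> n) {k\<in>K. m k = n} {k\<in>K'. m' k = n}" by metis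
 have val: "\<sigma> (m k) k \<in> K' & m' (\<sigma> (m k) k) = m k" if "k \<in> K" for k
  using bij_betwE[OF \<sigma>[of "m k"]] that by auto
 have "bij_betw (%k. \<sigma> (m k) k) K K'"
  unfolding bij_betw_def
 proof
  show "inj_on (%k. \<sigma> (m k) k) K"
  proof (rule inj_onI)
   fix a b assume ab: "a \<in> K" "b \<in> K" "\<sigma> (m a) a = \<sigma> (m b) b"
   then have "m a = m b" using val by metis
   then show "a = b" using bij_betw_imp_inj_on[OF \<sigma>[of "m b"]] ab by (auto simp: inj_on_def)
  qed
  show "(%k. \<sigma> (m k) k) ` K = K'"
  proof
   show "K' \<subseteq> (%k. \<sigma> (m k) k) ` K"
   proof
    fix y assume "y \<in> K'"
    then have "y \<in> \<sigma> (m' y) ` {k\<in>K. m k = m' y}" using bij_betw_imp_surj_on[OF \<sigma>[of "m' y"]] by simp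
    then obtain k where "k \<in> K" "m k = m' y" "y = \<sigma> (m' y) k" by blast
    then show "y \<in> (%k. \<sigma> (m k) k) ` K" by (intro image_eqI[of _ _ k]) simp_all
   qed
  qed (use val in auto)
 qed
 then show ?thesis using val by blast
qed

definition intertwines :: "'a::cvec set => 'b::cvec set => ('a => 'b) => ('a => 'a) => ('a => 'a) => ('a => 'a) => ('b => 'b) => ('b => 'b) => ('b => 'b) => bool" where
 "intertwines S S' \<theta> e f h e' f' h' \<longleftrightarrow> clin S S' \<theta> & bij_betw \<theta> S S' & (\<forall>v\<in>S. \<theta> (e v) = e' (\<theta> v) & \<theta> (f v) = f' (\<theta> v) & \<theta> (h v) = h' (\<theta> v))"

lemma frame_iso:
 assumes A: "sl2_frame S e f h K m v" and B: "sl2_frame S' e' f' h' K' m' v'"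
  and card: "!!n. card {k\<in>K. m k = n} = card {k\<in>K'. m' k = n}"
 shows "\<exists>\<theta>. intertwines S S' \<theta> e f h e' f' h'"
proof -
 interpret A: sl2_frame S e f h K m v by (rule A)
 obtain \<sigma> where \<sigma>: "bij_betw \<sigma> K K'" "!!k. k \<in> K ==> m' (\<sigma> k) = m k"
  using fiber_bij[OF A.finK sl2_frame.finK[OF B] card] by blast
 define w where "w k = v' (\<sigma> k)" for k
 interpret B: sl2_frame S' e' f' h' K m w unfolding w_def[abs_def] by (rule sl2_frame.frame_reindex[OF B \<sigma>])
 obtain \<theta> where \<theta>: "!!c. \<theta> (FS f K m v c) = FS f' K m w c" using A.FS_map by blast
 obtain \<psi> where \<psi>: "!!c. \<psi> (FS f' K m w c) = FS f K m v c" using B.FS_map by blast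
 have "clin S S' \<theta>"
 proof (rule clinI)
  fix x y a assume x: "x \<in> S"
  obtain c where c: "x = FS f K m v c" using A.spn[OF x] by blast
  show "\<theta> x \<in> S'" unfolding c \<theta> by (rule B.FS_in)
  show "\<theta> (a \<cdot> x) = a \<cdot> \<theta> x" unfolding c \<theta> FS_csc[symmetric] ..
  assume y: "y \<in> S"
  obtain d where d: "y = FS f K m v d" using A.spn[OF y] by blast
  show "\<theta> (x + y) = \<theta> x + \<theta> y" unfolding c d \<theta> FS_add[symmetric] ..
 qed
 moreover have "bij_betw \<theta> S S'"
 proof (rule bij_betw_byWitness[where f' = \<psi>])
  show "\<forall>x\<in>S. \<psi> (\<theta> x) = x" using A.spn \<theta> \<psi> by metis
  show "\<forall>x\<in>S'. \<theta> (\<psi> x) = x" using B.spn \<theta> \<psi> by metis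
  show "\<theta> ` S \<subseteq> S'" using A.spn \<theta> B.FS_in by (metis image_subsetI)
  show "\<psi> ` S' \<subseteq> S" using B.spn \<psi> A.FS_in by (metis image_subsetI)
 qed
 moreover have "\<theta> (e x) = e' (\<theta> x) & \<theta> (f x) = f' (\<theta> x) & \<theta> (h x) = h' (\<theta> x)" if xS: "x \<in> S" for x
 proof -
  obtain c where c: "x = FS f K m v c" using A.spn[OF xS] by blast
  show ?thesis unfolding c \<theta> A.e_FS B.e_FS A.f_FS B.f_FS A.h_FS B.h_FS by simp
 qed
 ultimately show ?thesis unfolding intertwines_def by blast
qed

text \<open>A vector of weight n killed by e is a combination of the generators of weight
n, as its coordinates on all lower terms of strings vanish. An injective intertwiner therefore maps an
independent family into the span of another one, and the exchange lemma compares their sizes.\<close>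

lemma frame_count_le:
 assumes A: "sl2_frame S e f h K m v" and B: "sl2_frame S' e' f' h' K' m' v'"
  and i: "intertwines S S' \<theta> e f h e' f' h'"
 shows "card {k\<in>K. m k = n} \<le> card {k\<in>K'. m' k = n}"
proof -
 interpret A: sl2_frame S e f h K m v by (rule A)
 interpret B: sl2_frame S' e' f' h' K' m' v' by (rule B)
 have \<theta>: "clin S S' \<theta>" "inj_on \<theta> S" and eq: "!!v. v \<in> S ==> \<theta> (e v) = e' (\<theta> v) & \<theta> (f v) = f' (\<theta> v) & \<theta> (h v) = h' (\<theta> v)"
  using i by (auto simp: intertwines_def bij_betw_def)
 let ?J = "{k\<in>K. m k = n}" and ?J' = "{k\<in>K'. m' k = n}"
 have fin: "finite ?J" "finite ?J'" using A.finK B.finK by auto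
 have vS: "v k \<in> S" if "k \<in> ?J" for k using A.hw that by blast
 have zero: "u k = 0" if k: "k \<in> ?J" and z: "(\<Sum>k\<in>?J. u k \<cdot> \<theta> (v k)) = 0" for u k
 proof -
  have "\<theta> (\<Sum>k\<in>?J. u k \<cdot> v k) = \<theta> 0"
   using clin_sum[OF \<theta>(1) A.S, of ?J "%k. u k \<cdot> v k"] z vS cv.subspace_scale[OF A.S] by (simp add: clin_csc[OF \<theta>(1)] clin_0[OF \<theta>(1) A.S])
  moreover have "(\<Sum>k\<in>?J. u k \<cdot> v k) \<in> S" by (intro cv.subspace_sum[OF A.S] cv.subspace_scale[OF A.S] vS)
  ultimately have 0: "(\<Sum>k\<in>?J. u k \<cdot> v k) = 0" using \<theta>(2) cv.subspace_0[OF A.S] by (meson inj_onD)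
  have "FS f K m v (%k j. if j = 0 & m k = n then u k else 0) = (\<Sum>k\<in>K. if m k = n then u k \<cdot> v k else 0)"
   unfolding FS_def by (intro sum.cong refl) (auto simp: sum.atMost_shift)
  also have "\<dots> = (\<Sum>k\<in>?J. u k \<cdot> v k)" using A.finK by (simp add: sum.inter_filter)
  finally show ?thesis using A.ind[of "%k j. if j = 0 & m k = n then u k else 0" k 0] k unfolding 0 by simp
 qed
 have inj: "inj_on (%k. \<theta> (v k)) ?J"
 proof (rule inj_onI, rule ccontr)
  fix a b assume ab: "a \<in> ?J" "b \<in> ?J" "\<theta> (v a) = \<theta> (v b)" "a ~= b"
  let ?u = "%k. if k = a then 1 else if k = b then -1 else (0::complex)"
  have "(\<Sum>k\<in>?J. ?u k \<cdot> \<theta> (v k)) = (\<Sum>k\<in>{a,b}. ?u k \<cdot> \<theta> (v k))"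
   by (rule sum.mono_neutral_right[OF fin(1)]) (use ab in auto)
  also have "\<dots> = 0" using ab by simp
  finally show False using zero[OF ab(1), of ?u] by simp
 qed
 have "cv.independent ((%k. \<theta> (v k)) ` ?J)"
  unfolding cv.dependent_finite[OF finite_imageI[OF fin(1)]]
 proof
  assume "EX u. (\<exists>w\<in>(%k. \<theta> (v k)) ` ?J. u w ~= 0) & (\<Sum>w\<in>(%k. \<theta> (v k)) ` ?J. u w \<cdot> w) = 0"
  then obtain u k where k: "k \<in> ?J" "u (\<theta> (v k)) ~= 0" and s: "(\<Sum>w\<in>(%k. \<theta> (v k)) ` ?J. u w \<cdot> w) = 0" by blast
  have "(\<Sum>k\<in>?J. u (\<theta> (v k)) \<cdot> \<theta> (v k)) = 0" using s by (subst (asm) sum.reindex[OF inj]) simp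
  from zero[OF k(1) this] show False using k(2) by contradiction
 qed
 moreover have "(%k. \<theta> (v k)) ` ?J \<subseteq> cv.span (v' ` ?J')"
 proof
  fix w assume "w \<in> (%k. \<theta> (v k)) ` ?J"
  then obtain k where k: "k \<in> K" "m k = n" "w = \<theta> (v k)" by blast
  note hk = A.hw[OF k(1)]
  have w: "w \<in> S'" "e' w = 0" "h' w = of_nat n \<cdot> w"
   using hk k eq[of "v k"] clin_in[OF \<theta>(1)] clin_csc[OF \<theta>(1)] clin_0[OF \<theta>(1) A.S] by metis+
  obtain c where c: "w = FS f' K' m' v' c" using B.spn[OF w(1)] by blast
  have cj: "c k (Suc j) = 0" if "k \<in> K'" "Suc j \<le> m' k" for k j
  proof -
   have "(of_nat (Suc j) * (of_nat (m' k) - of_nat j) * c k (Suc j) :: complex) = 0"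
    using B.ind[OF w(2)[unfolded c B.e_FS] that(1), of j] that(2) by simp
   moreover have "(of_nat (m' k) :: complex) ~= of_nat j" using that(2) by (metis Suc_n_not_le_n of_nat_eq_iff)
   moreover have "(of_nat (Suc j) :: complex) ~= 0" by (rule of_nat_neq_0)
   ultimately show ?thesis by (metis mult_eq_0_iff eq_iff_diff_eq_0)
  qed
  have "FS f' K' m' v' (%k j. (of_nat (m' k) - of_nat (2 * j)) * c k j) = FS f' K' m' v' (%k j. of_nat n * c k j)"
   using w(3) unfolding c B.h_FS FS_csc .
  note h0 = B.FS_eqD[OF this, of _ 0]
  have c0: "c k 0 = 0" if "k \<in> K'" "m' k ~= n" for k using h0[OF that(1)] that(2) by simp
  have "w = (\<Sum>k\<in>K'. c k 0 \<cdot> v' k)"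
   unfolding c FS_def by (intro sum.cong refl) (simp add: sum.atMost_shift cj)
  also have "\<dots> = (\<Sum>k\<in>?J'. c k 0 \<cdot> v' k)"
   by (rule sum.mono_neutral_right) (use B.finK c0 in auto)
  finally have w': "w = (\<Sum>k\<in>?J'. c k 0 \<cdot> v' k)" .
  show "w \<in> cv.span (v' ` ?J')" unfolding w' by (intro cv.span_sum cv.span_scale cv.span_base imageI)
 qed
 ultimately have "card ((%k. \<theta> (v k)) ` ?J) \<le> card (v' ` ?J')" using cv.independent_span_bound[of "v' ` ?J'"] fin by blast
 then show ?thesis using card_image[OF inj] card_image_le[OF fin(2), of v'] by linarith
qed

lemma intertwines_inv:
 assumes i: "intertwines S S' \<theta> e f h e' f' h'" and S: "cv.subspace S" and cl: "clin S S e" "clin S S f" "clin S S h"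
 shows "intertwines S' S (inv_into S \<theta>) e' f' h' e f h"
proof -
 let ?i = "inv_into S \<theta>"
 have \<theta>: "clin S S' \<theta>" "bij_betw \<theta> S S'" and eq: "!!v. v \<in> S ==> \<theta> (e v) = e' (\<theta> v) & \<theta> (f v) = f' (\<theta> v) & \<theta> (h v) = h' (\<theta> v)"
  using i by (auto simp: intertwines_def)
 have iS: "?i y \<in> S" "\<theta> (?i y) = y" if "y \<in> S'" for y using \<theta>(2) that by (auto simp: bij_betw_def inv_into_into f_inv_into_f)
 have li: "?i (\<theta> x) = x" if "x \<in> S" for x using \<theta>(2) that by (simp add: bij_betw_inv_into_left)
 have "?i (x + y) = ?i x + ?i y" if "x \<in> S'" "y \<in> S'" for x y
  using li[of "?i x + ?i y"] clin_add[OF \<theta>(1), of "?i x" "?i y"] iS that cv.subspace_add[OF S] by simp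
 moreover have "?i (a \<cdot> x) = a \<cdot> ?i x" if "x \<in> S'" for a x
  using li[of "a \<cdot> ?i x"] clin_csc[OF \<theta>(1), of "?i x" a] iS that cv.subspace_scale[OF S] by simp
 ultimately have "clin S' S ?i" using iS by (intro clinI) auto
 moreover have "?i (e' y) = e (?i y) & ?i (f' y) = f (?i y) & ?i (h' y) = h (?i y)" if "y \<in> S'" for y
  using eq[OF iS(1)[OF that]] li[OF clin_in[OF cl(1) iS(1)[OF that]]] li[OF clin_in[OF cl(2) iS(1)[OF that]]] li[OF clin_in[OF cl(3) iS(1)[OF that]]] iS(2)[OF that] by metis
 ultimately show ?thesis using bij_betw_inv_into[OF \<theta>(2)] by (auto simp: intertwines_def)
qed

lemma frame_count_eq:
 assumes A: "sl2_frame S e f h K m v" and B: "sl2_frame S' e' f' h' K' m' v'"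
  and i: "intertwines S S' \<theta> e f h e' f' h'"
 shows "card {k\<in>K. m k = n} = card {k\<in>K'. m' k = n}"
proof -
 interpret A: sl2_frame S e f h K m v by (rule A)
 show ?thesis using frame_count_le[OF A B i] frame_count_le[OF B A intertwines_inv[OF i A.S A.e A.f A.h]] by (rule antisym)
qed

lemma frame_exists:
 assumes "sl2_module S e f h" "fd S"
 shows "\<exists>(K :: nat set) m v. sl2_frame S e f h K m v"
proof -
 interpret sl2_module S e f h by fact
 show ?thesis
 proof (rule frame[OF assms(2)], goal_cases)
  case (1 L)
  have "sl2_frame S e f h {..<length L} (%i. fst (L ! i)) (%i. snd (L ! i))"
  proof
   show "snd (L ! k) \<in> S & e (snd (L ! k)) = 0 & h (snd (L ! k)) = of_nat (fst (L ! k)) \<cdot> snd (L ! k) & (f ^^ Suc (fst (L ! k))) (snd (L ! k)) = 0"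
    if "k \<in> {..<length L}" for k using 1(1)[of "L ! k"] that by simp
  qed (use 1(2,3) in \<open>simp_all add: FS_def\<close>)
  then show ?thesis by blast
 qed
qed

lemma subframe:
 assumes A: "sl2_frame S e f h K m v" and K': "K' \<subseteq> K"
 shows "EX S'. S' \<subseteq> S & sl2_frame S' e f h K' m v"
proof -
 interpret A: sl2_frame S e f h K m v by (rule A)
 let ?F = "FS f K' m v"
 define S' where "S' = range ?F"
 have ex: "?F c = FS f K m v (%k j. if k \<in> K' then c k j else 0)" for c
  unfolding FS_def by (rule sum.mono_neutral_cong_left[OF A.finK K']) auto
 have res: "FS f K m v c = ?F c" if "!!k j. k \<notin> K' ==> c k j = 0" for c
  unfolding ex by (rule FS_cong) (use that in auto)
 have "S' \<subseteq> S" unfolding S'_def ex using A.FS_in by blast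
 moreover have sub: "cv.subspace S'"
 proof (rule cv.subspaceI)
  show "0 \<in> S'" unfolding S'_def using FS_csc[of f K' m v 0] by (metis cv.scale_zero_left rangeI)
  fix x y a assume "x \<in> S'"
  then obtain c where c: "x = ?F c" by (auto simp: S'_def)
  show "a \<cdot> x \<in> S'" unfolding c FS_csc[symmetric] S'_def by blast
  assume "y \<in> S'"
  then obtain d where d: "y = ?F d" by (auto simp: S'_def)
  show "x + y \<in> S'" unfolding c d FS_add[symmetric] S'_def by blast
 qed
 have cl: "e x \<in> S' & f x \<in> S' & h x \<in> S'" if xS: "x \<in> S'" for x
 proof -
  obtain c where c: "x = ?F c" using xS by (auto simp: S'_def)
  show ?thesis unfolding c ex A.e_FS A.f_FS A.h_FS
   by (intro conjI; subst res) (auto simp: S'_def)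
 qed
 have sl: "clin S' S' T" if "clin S S T" "!!x. x \<in> S' ==> T x \<in> S'" for T
  by (intro clinI) (use that \<open>S' \<subseteq> S\<close> clin_add[OF that(1)] clin_csc[OF that(1)] in blast)+
 moreover have "sl2_frame S' e f h K' m v"
 proof
  show "cv.subspace S'" by (rule sub)
  show "clin S' S' e" by (rule sl[OF A.e]) (use cl in blast)
  show "clin S' S' f" by (rule sl[OF A.f]) (use cl in blast)
  show "clin S' S' h" by (rule sl[OF A.h]) (use cl in blast)
  show "finite K'" by (rule finite_subset[OF K' A.finK])
  show "EX c. u = ?F c" if "u \<in> S'" for u using that by (auto simp: S'_def)
  show "c k j = 0" if "?F c = 0" "k \<in> K'" "j \<le> m k" for c k j
   using A.ind[of "%k j. if k \<in> K' then c k j else 0" k j] that K' unfolding ex by auto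
  fix k assume k: "k \<in> K'"
  have "?F (%l j. if l = k & j = 0 then 1 else 0) = (\<Sum>l\<in>K'. if l = k then v k else 0)"
   unfolding FS_def by (intro sum.cong refl) (auto simp: sum.atMost_shift csc_one)
  also have "\<dots> = v k" using k finite_subset[OF K' A.finK] by simp
  finally have "v k \<in> S'" unfolding S'_def by (metis rangeI)
  then show "v k \<in> S' & e (v k) = 0 & h (v k) = of_nat (m k) \<cdot> v k & (f ^^ Suc (m k)) (v k) = 0"
   using A.hw k K' by blast
 qed (use \<open>S' \<subseteq> S\<close> A.he A.hf A.ef in auto)
 ultimately show ?thesis by blast
qed

definition cw :: "nat => (nat => 'a => 'a) => (nat => 'a) => nat => 'a::zero" where
 "cw n e x = (%i. if i < n then e i (x i) else 0)"

lemma dsum_frame: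
 assumes F: "!!i. i < n ==> sl2_frame (S i) (e i) (f i) (h i) (K i) (m i) (v i)"
 shows "sl2_frame (dS n S) (cw n e) (cw n f) (cw n h) (Sigma {..<n} K) (%(i, k). m i k) (%(i, k). atv i (v i k))"
proof -
 note M = sl2_frame.axioms(1)[OF F]
 note sub = sl2_module.S[OF M]
 have cl: "clin (dS n S) (dS n S) (cw n T)" if "!!i. i < n ==> clin (S i) (S i) (T i)" for T
  using that by (auto simp: clin_def dS_def cw_def fun_eq_iff)
 have cwat: "cw n T (atv i x) = atv i (T i x)" if "!!k. k < n ==> clin (S k) (S k) (T k)" "i < n" for T i x
  using clin_0[OF that(1) sub] that(2) by (auto simp: cw_def atv_def fun_eq_iff)
 have pow: "(cw n f ^^ j) (atv i x) = atv i ((f i ^^ j) x)" if "i < n" for i j x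
  by (induction j) (simp_all add: cwat[OF sl2_module.f[OF M] that])
 have ats: "atv i (sum G A) = (\<Sum>a\<in>A. atv i (G a))" for i and G :: "'c => 'a" and A
  by (induction A rule: infinite_finite_induct) (simp_all add: atv_simps(1,3))
 have FSs: "FS (cw n f) (Sigma {..<n} K) (%(i, k). m i k) (%(i, k). atv i (v i k)) c = (\<Sum>i<n. atv i (FS (f i) (K i) (m i) (v i) (%k. c (i, k))))" for c
 proof -
  have "FS (cw n f) (Sigma {..<n} K) (%(i, k). m i k) (%(i, k). atv i (v i k)) c
   = (\<Sum>(i, k)\<in>Sigma {..<n} K. \<Sum>j\<le>m i k. c (i, k) j \<cdot> (cw n f ^^ j) (atv i (v i k)))"
   unfolding FS_def by (rule sum.cong[OF refl]) auto
  also have "\<dots> = (\<Sum>i<n. \<Sum>k\<in>K i. \<Sum>j\<le>m i k. c (i, k) j \<cdot> (cw n f ^^ j) (atv i (v i k)))"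
   by (rule sum.Sigma[symmetric]) (use sl2_frame.finK[OF F] in auto)
  also have "\<dots> = (\<Sum>i<n. atv i (FS (f i) (K i) (m i) (v i) (%k. c (i, k))))"
   unfolding FS_def ats by (intro sum.cong refl) (simp only: pow lessThan_iff atv_simps(2))
  finally show ?thesis .
 qed
 have comp: "(\<Sum>i<n. atv i (x i)) k = x k" if "k < n" for x k
 proof -
  have "(\<Sum>i<n. atv i (x i)) k = (\<Sum>i<n. if k = i then x i else 0)" by (induction n) (auto simp: atv_def)
  then show ?thesis using that by simp
 qed
 show ?thesis
 proof
  show "cv.subspace (dS n S)"
   using cv.subspace_add[OF sub] cv.subspace_scale[OF sub] cv.subspace_0[OF sub] by (intro cv.subspaceI) (auto simp: dS_def)
  show "clin (dS n S) (dS n S) (cw n e)" by (rule cl[OF sl2_module.e[OF M]])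
  show "clin (dS n S) (dS n S) (cw n f)" by (rule cl[OF sl2_module.f[OF M]])
  show "clin (dS n S) (dS n S) (cw n h)" by (rule cl[OF sl2_module.h[OF M]])
  show "cw n h (cw n e x) = cw n e (cw n h x) + 2 \<cdot> cw n e x" if x: "x \<in> dS n S" for x
  proof
   fix i
   have "i < n ==> x i \<in> S i" using x by (simp add: dS_def)
   then show "(cw n h (cw n e x)) i = (cw n e (cw n h x) + 2 \<cdot> cw n e x) i"
    using sl2_module.he[OF M, of i "x i"] by (cases "i < n") (simp_all add: cw_def)
  qed
  show "cw n h (cw n f x) = cw n f (cw n h x) - 2 \<cdot> cw n f x" if x: "x \<in> dS n S" for x
  proof
   fix i
   have "i < n ==> x i \<in> S i" using x by (simp add: dS_def)
   then show "(cw n h (cw n f x)) i = (cw n f (cw n h x) - 2 \<cdot> cw n f x) i"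
    using sl2_module.hf[OF M, of i "x i"] by (cases "i < n") (simp_all add: cw_def)
  qed
  show "cw n e (cw n f x) - cw n f (cw n e x) = cw n h x" if x: "x \<in> dS n S" for x
  proof
   fix i
   have "i < n ==> x i \<in> S i" using x by (simp add: dS_def)
   then show "(cw n e (cw n f x) - cw n f (cw n e x)) i = (cw n h x) i"
    using sl2_module.ef[OF M, of i "x i"] by (cases "i < n") (simp_all add: cw_def)
  qed
  show "finite (Sigma {..<n} K)" using sl2_frame.finK[OF F] by auto
  show "EX c. u = FS (cw n f) (Sigma {..<n} K) (%(i, k). m i k) (%(i, k). atv i (v i k)) c" if u: "u \<in> dS n S" for u
  proof -
   have "ALL i. EX c. i < n --> u i = FS (f i) (K i) (m i) (v i) c" using sl2_frame.spn[OF F] u by (auto simp: dS_def)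
   then obtain c where c: "!!i. i < n ==> u i = FS (f i) (K i) (m i) (v i) (c i)" by metis
   have "u = FS (cw n f) (Sigma {..<n} K) (%(i, k). m i k) (%(i, k). atv i (v i k)) (%(i, k). c i k)"
    by (subst dS_sum[OF u], subst FSs, rule sum.cong[OF refl]) (simp add: c)
   then show ?thesis by blast
  qed
  show "c p j = 0" if z: "FS (cw n f) (Sigma {..<n} K) (%(i, k). m i k) (%(i, k). atv i (v i k)) c = 0"
   and p: "p \<in> Sigma {..<n} K" and j: "j \<le> (case p of (i, k) => m i k)" for c p j
  proof -
   obtain i k where p': "p = (i, k)" "i < n" "k \<in> K i" using p by auto
   have "FS (f i) (K i) (m i) (v i) (%k. c (i, k)) = 0"
    using comp[OF p'(2), of "%i. FS (f i) (K i) (m i) (v i) (%k. c (i, k))"] z unfolding FSs by simp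
   then show ?thesis using sl2_frame.ind[OF F[OF p'(2)] _ p'(3)] j p'(1) by simp
  qed
  fix p assume "p \<in> Sigma {..<n} K"
  then obtain i k where p': "p = (i, k)" "i < n" "k \<in> K i" by auto
  note hw = sl2_frame.hw[OF F[OF p'(2)] p'(3)]
  have "atv i (v i k) \<in> dS n S" using hw p'(2) cv.subspace_0[OF sub] by (auto simp: atv_def dS_def)
  then show "(case p of (i, k) => atv i (v i k)) \<in> dS n S & cw n e (case p of (i, k) => atv i (v i k)) = 0 &
    cw n h (case p of (i, k) => atv i (v i k)) = of_nat (case p of (i, k) => m i k) \<cdot> (case p of (i, k) => atv i (v i k)) &
    (cw n f ^^ Suc (case p of (i, k) => m i k)) (case p of (i, k) => atv i (v i k)) = 0"
   using hw cwat[OF sl2_module.e[OF M] p'(2)] cwat[OF sl2_module.h[OF M] p'(2)] pow[OF p'(2), of "Suc (m i k)"]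
   unfolding p'(1) prod.case by (simp only: atv_simps(1,2))
 qed
qed

section \<open>Classification by highest weight multiplicities\<close>

abbreviation mk :: "'a::cvec set => ('a => 'a) => ('a => 'a) => ('a => 'a) => 'a sl2_rep" where
 "mk S e f h \<equiv> \<lparr>sspace = emod S, sact = slact S e f h\<rparr>"

lemma mk_iso_iff:
 assumes "sl2_module S e f h"
 shows "sl2_iso (mk S e f h) (mk S' e' f' h') \<longleftrightarrow> (\<exists>\<theta>. intertwines S S' \<theta> e f h e' f' h')"
proof -
 interpret sl2_module S e f h by fact
 show ?thesis unfolding intertwines_def by (rule sl2_iso_triple) (simp_all add: e f h S)
qed

text \<open>The type of a representation records how many strings of each length it has. The coordinate space \<open>\<nat>
\<rightarrow> \<complex>\<close> serves for all representations.\<close>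

definition has_type :: "'v sl2_rep => (nat => nat) => bool" where
 "has_type Y c \<longleftrightarrow> (\<exists>(S :: (nat => complex) set) e f h (K :: nat set) m v. fd S & sl2_frame S e f h K m v &
   sl2_iso Y (mk S e f h) & c = (%n. card {k\<in>K. m k = n}))"

lemma has_type_ex:
 assumes Y: "sl2_obj Y"
 shows "EX c. has_type Y c"
proof -
 obtain S :: "(nat => complex) set" and \<theta> Y1 where S: "fd S" and m: "mtrans (emod S) (sspace Y) \<theta>"
  and Y1: "sl2_obj Y1" "sspace Y1 = emod S" and eq: "Y = str \<theta> Y1 (sspace Y)" by (rule sl2_coord[OF Y])
 note t = triple_sl2_obj[OF Y1 fd_subspace[OF S]]
 obtain K :: "nat set" and n v where F: "sl2_frame S (sact Y1 matE) (sact Y1 matF) (sact Y1 matH) K n v"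
  using frame_exists[OF t(1) S] by blast
 have Y1_mk: "mk S (sact Y1 matE) (sact Y1 matF) (sact Y1 matH) = Y1"
  by (intro sl2_rep.equality) (simp_all only: sl2_rep.simps Y1(2) t(3)[symmetric], simp)
 have "sl2_iso Y1 Y" using mtrans.str_iso[OF m Y1] eq by (simp only:)
 then have "sl2_iso Y (mk S (sact Y1 matE) (sact Y1 matF) (sact Y1 matH))"
  unfolding Y1_mk by (rule sl2_iso_sym[OF Y1(1) Y])
 then show ?thesis unfolding has_type_def using S F by blast
qed

lemma has_type_unique:
 fixes S :: "'a::cvec set" and K :: "'k set"
 assumes Y: "sl2_obj Y" and iso: "sl2_iso Y (mk S e f h)" and F: "sl2_frame S e f h K m v" and S: "fd S" and c: "has_type Y c"
 shows "c = (%n. card {k\<in>K. m k = n})"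
proof -
 obtain S0 :: "(nat => complex) set" and e0 f0 h0 and K0 :: "nat set" and m0 v0 where 0: "fd S0" "sl2_frame S0 e0 f0 h0 K0 m0 v0"
  "sl2_iso Y (mk S0 e0 f0 h0)" "c = (%n. card {k\<in>K0. m0 k = n})" using c unfolding has_type_def by blast
 note M = sl2_frame.axioms(1)[OF F] and M0 = sl2_frame.axioms(1)[OF 0(2)]
 have "sl2_iso (mk S0 e0 f0 h0) (mk S e f h)"
  by (rule sl2_iso_trans[OF sl2_obj_triple[OF M0 0(1)] sl2_iso_sym[OF Y sl2_obj_triple[OF M0 0(1)] 0(3)] iso])
 then obtain \<theta> where "intertwines S0 S \<theta> e0 f0 h0 e f h" using mk_iso_iff[OF M0] by blast
 from frame_count_eq[OF 0(2) F this] show ?thesis unfolding 0(4) by blast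
qed

definition tp :: "'v sl2_rep => nat => nat" where "tp Y = (SOME c. has_type Y c)"

lemma has_type_tp: "sl2_obj Y ==> has_type Y (tp Y)"
 unfolding tp_def using has_type_ex someI_ex by metis

lemma tp_eq:
 fixes S :: "'a::cvec set" and K :: "'k set"
 assumes "sl2_obj Y" "sl2_iso Y (mk S e f h)" "sl2_frame S e f h K m v" "fd S"
 shows "tp Y = (%n. card {k\<in>K. m k = n})"
 using has_type_unique[OF assms has_type_tp[OF assms(1)]] .

lemma tp_obtain:
 assumes "sl2_obj Y"
 obtains S :: "(nat => complex) set" and e f h and K :: "nat set" and m v
 where "fd S" "sl2_frame S e f h K m v" "sl2_iso Y (mk S e f h)" "tp Y = (%n. card {k\<in>K. m k = n})"
 using has_type_tp[OF assms] unfolding has_type_def by blast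

lemma tp_iso:
 assumes Y: "sl2_obj Y" and Z: "sl2_obj Z"
 shows "sl2_iso Y Z \<longleftrightarrow> tp Y = tp Z"
proof -
 obtain S :: "(nat => complex) set" and e f h and K :: "nat set" and m v where A: "fd S" "sl2_frame S e f h K m v"
  "sl2_iso Y (mk S e f h)" "tp Y = (%n. card {k\<in>K. m k = n})" by (rule tp_obtain[OF Y])
 obtain S' :: "(nat => complex) set" and e' f' h' and K' :: "nat set" and m' v' where B: "fd S'" "sl2_frame S' e' f' h' K' m' v'"
  "sl2_iso Z (mk S' e' f' h')" "tp Z = (%n. card {k\<in>K'. m' k = n})" by (rule tp_obtain[OF Z])
 note M = sl2_frame.axioms(1)[OF A(2)] and M' = sl2_frame.axioms(1)[OF B(2)]
 show ?thesis
 proof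
  assume "sl2_iso Y Z"
  then have "sl2_iso Z (mk S e f h)" by (rule sl2_iso_trans[OF Z sl2_iso_sym[OF Y Z] A(3)])
  from tp_eq[OF Z this A(2,1)] show "tp Y = tp Z" unfolding A(4) by simp
 next
  assume "tp Y = tp Z"
  then have "card {k\<in>K. m k = n} = card {k\<in>K'. m' k = n}" for n unfolding A(4) B(4) by (rule fun_cong)
  from frame_iso[OF A(2) B(2) this] have "sl2_iso (mk S e f h) (mk S' e' f' h')" unfolding mk_iso_iff[OF M] .
  then show "sl2_iso Y Z"
   by (rule sl2_iso_trans[OF Y A(3) sl2_iso_trans[OF sl2_obj_triple[OF M A(1)] _ sl2_iso_sym[OF Z sl2_obj_triple[OF M' B(1)] B(3)]]])
 qed
qed

lemma tp_fin: "sl2_obj Y ==> finite {n. tp Y n ~= 0}"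
proof (erule tp_obtain)
 fix S :: "(nat => complex) set" and e f h and K :: "nat set" and m v
 assume F: "sl2_frame S e f h K m v" and t: "tp Y = (%n. card {k\<in>K. m k = n})"
 have "{n. tp Y n ~= 0} \<subseteq> m ` K"
 proof
  fix n assume "n \<in> {n. tp Y n ~= 0}"
  then have "{k\<in>K. m k = n} ~= {}" unfolding t by (metis (mono_tags, lifting) card.empty mem_Collect_eq)
  then show "n \<in> m ` K" by blast
 qed
 then show "finite {n. tp Y n ~= 0}" using finite_surj[OF sl2_frame.finK[OF F]] by blast
qed

lemma tp_zero:
 assumes Y: "sl2_obj Y"
 shows "tp Y = (%_. 0) \<longleftrightarrow> carrier (sspace Y) = {\<zero>\<^bsub>sspace Y\<^esub>}"
proof -
 obtain S :: "(nat => complex) set" and e f h and K :: "nat set" and m v where A: "fd S" "sl2_frame S e f h K m v"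
  "sl2_iso Y (mk S e f h)" "tp Y = (%n. card {k\<in>K. m k = n})" by (rule tp_obtain[OF Y])
 interpret F: sl2_frame S e f h K m v by (rule A(2))
 have "tp Y = (%_. 0) \<longleftrightarrow> K = {}"
 proof
  assume z: "tp Y = (%_. 0)"
  have "k \<notin> K" for k
  proof
   assume "k \<in> K"
   then have "card {l\<in>K. m l = m k} ~= 0" using F.finK by auto
   then show False using fun_cong[OF z, of "m k"] unfolding A(4) by simp
  qed
  then show "K = {}" by blast
 qed (simp add: A(4))
 also have "\<dots> \<longleftrightarrow> S = {0}"
 proof
  assume "K = {}"
  then have "u = 0" if "u \<in> S" for u using F.spn[OF that] by (auto simp: FS_def)
  then show "S = {0}" using cv.subspace_0[OF F.S] by blast
 next
  assume z: "S = {0}"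
  have "k \<notin> K" for k
  proof
   assume k: "k \<in> K"
   have "FS f K m v (%_ _. 1) = 0" using F.FS_in z by blast
   from F.ind[OF this k, of 0] show False by simp
  qed
  then show "K = {}" by blast
 qed
 also have "\<dots> \<longleftrightarrow> carrier (sspace Y) = {\<zero>\<^bsub>sspace Y\<^esub>}"
 proof -
  obtain \<phi> where b: "bij_betw \<phi> (carrier (sspace Y)) S" using A(3) by (auto simp: sl2_iso_def)
  have zc: "\<zero>\<^bsub>sspace Y\<^esub> \<in> carrier (sspace Y)" by (rule vmod_zero[OF sl2_space(1)[OF Y]])
  show ?thesis
  proof
   assume z: "S = {0}"
   have "x = \<zero>\<^bsub>sspace Y\<^esub>" if "x \<in> carrier (sspace Y)" for x
   proof -
    have "\<phi> x = \<phi> \<zero>\<^bsub>sspace Y\<^esub>" using bij_betwE[OF b] that zc z by simp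
    then show ?thesis using bij_betw_imp_inj_on[OF b] that zc by (meson inj_onD)
   qed
   then show "carrier (sspace Y) = {\<zero>\<^bsub>sspace Y\<^esub>}" using zc by blast
  next
   assume "carrier (sspace Y) = {\<zero>\<^bsub>sspace Y\<^esub>}"
   then have "S = {\<phi> \<zero>\<^bsub>sspace Y\<^esub>}" using bij_betw_imp_surj_on[OF b] by simp
   then show "S = {0}" using cv.subspace_0[OF F.S] by auto
  qed
 qed
 finally show ?thesis .
qed

text \<open>Part of a family of strings spans a subrepresentation; it lives on the same carrier type as the given representation.\<close>

lemma tp_sub:
 fixes Y :: "'v sl2_rep"
 assumes Y: "sl2_obj Y" and c: "!!n. c n \<le> tp Y n"
 shows "\<exists>Z :: 'v sl2_rep. sl2_obj Z & tp Z = c"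
proof -
 obtain S :: "(nat => complex) set" and \<theta> Y1 where S: "fd S" and mt: "mtrans (emod S) (sspace Y) \<theta>"
  and Y1: "sl2_obj Y1" "sspace Y1 = emod S" and eq: "Y = str \<theta> Y1 (sspace Y)" by (rule sl2_coord[OF Y])
 interpret t: mtrans "emod S" "sspace Y" \<theta> by (rule mt)
 let ?e = "sact Y1 matE" and ?f = "sact Y1 matF" and ?h = "sact Y1 matH"
 note tr = triple_sl2_obj[OF Y1 fd_subspace[OF S]]
 obtain K :: "nat set" and m v where F: "sl2_frame S ?e ?f ?h K m v" using frame_exists[OF tr(1) S] by blast
 have Y1_mk: "mk S ?e ?f ?h = Y1" by (intro sl2_rep.equality) (simp_all only: sl2_rep.simps Y1(2) tr(3)[symmetric], simp)
 have "sl2_iso Y1 Y" using t.str_iso[OF Y1] eq by (simp only:)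
 then have "sl2_iso Y (mk S ?e ?f ?h)" unfolding Y1_mk by (rule sl2_iso_sym[OF Y1(1) Y])
 from tp_eq[OF Y this F S] c have "c n \<le> card {k\<in>K. m k = n}" for n by simp
 then have "EX A. A \<subseteq> {k\<in>K. m k = n} & card A = c n" for n using obtain_subset_with_card_n by metis
 then obtain A where A: "!!n. A n \<subseteq> {k\<in>K. m k = n} & card (A n) = c n" by metis
 define K' where "K' = (\<Union>n. A n)"
 have K': "K' \<subseteq> K" and fib: "{k\<in>K'. m k = n} = A n" for n unfolding K'_def using A by blast+
 obtain S' where S': "S' \<subseteq> S" "sl2_frame S' ?e ?f ?h K' m v" using subframe[OF F K'] by blast
 note M' = sl2_frame.axioms(1)[OF S'(2)]
 note sub' = sl2_module.S[OF M'] 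
 note fd' = fd_subset[OF S sub' S'(1)]
 define V' where "V' = (sspace Y)\<lparr>carrier := \<theta> ` S'\<rparr>"
 have inS: "x \<in> carrier (emod S)" if "x \<in> S'" for x using that S'(1) by auto
 have "inj_on \<theta> S'" using t.li inS by (metis inj_onI)
 then have "bij_betw \<theta> S' (\<theta> ` S')" by (simp add: bij_betw_def)
 moreover have "\<theta> (x + y) = \<theta> x \<oplus>\<^bsub>sspace Y\<^esub> \<theta> y" if "x \<in> S'" "y \<in> S'" for x y using t.th_add[OF inS[OF that(1)] inS[OF that(2)]] by simp
 moreover have "\<theta> (a \<cdot> x) = a \<odot>\<^bsub>sspace Y\<^esub> \<theta> x" if "x \<in> S'" for x a using t.th_smult[OF inS[OF that]] by simp
 ultimately have mi: "miso (emod S') V' \<theta>" by (simp add: miso_def V'_def)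
 have z: "\<zero>\<^bsub>V'\<^esub> = \<theta> 0" using t.th_zero by (simp add: V'_def)
 have vV': "vmod V'" by (rule vmod_transfer, rule sub', rule mi, rule z)
 interpret t': mtrans "emod S'" V' \<theta> by (rule mtrans.intro[OF module_emod[OF sub'] vV' mi])
 note ob = sl2_obj_triple[OF M' fd']
 have sp: "sspace (mk S' ?e ?f ?h) = emod S'" by simp
 note Z = t'.str_obj[OF ob sp]
 have "tp (str \<theta> (mk S' ?e ?f ?h) V') = (%n. card {k\<in>K'. m k = n})"
  by (rule tp_eq[OF Z sl2_iso_sym[OF ob Z t'.str_iso[OF ob sp]] S'(2) fd'])
 also have "\<dots> = c" unfolding fib using A by blast
 finally show ?thesis using Z by blast
qed

lemma tp_dsum:
 assumes Y: "\<forall>Y\<in>set Ys. sl2_obj Y"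
 shows "tp (sl2_dsum Ys) = (%k. \<Sum>i<length Ys. tp (Ys ! i) k)"
proof -
 let ?n = "length Ys" and ?D = "mod_dsum (map sspace Ys)"
 have Yi: "sl2_obj (Ys ! i)" if "i < ?n" for i using Y that by simp
 define dat where "dat i = (\<lambda>(S :: (nat => complex) set, e, f, h, K :: nat set, m, v, \<phi>).
   fd S & sl2_frame S e f h K m v & \<phi> \<in> sl2_hom (Ys ! i) (mk S e f h) & bij_betw \<phi> (carrier (sspace (Ys ! i))) S &
   sl2_iso (Ys ! i) (mk S e f h) & tp (Ys ! i) = (%n. card {k\<in>K. m k = n}))" for i
 have "EX p. dat i p" if i: "i < ?n" for i
 proof (rule tp_obtain[OF Yi[OF i]])
  fix S :: "(nat => complex) set" and e f h and K :: "nat set" and m v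
  assume *: "fd S" "sl2_frame S e f h K m v" "sl2_iso (Ys ! i) (mk S e f h)" "tp (Ys ! i) = (%n. card {k\<in>K. m k = n})"
  obtain \<phi> where "\<phi> \<in> sl2_hom (Ys ! i) (mk S e f h)" "bij_betw \<phi> (carrier (sspace (Ys ! i))) S"
   using *(3) unfolding sl2_iso_def sl2_rep.simps emod_simps by blast
  then have "dat i (S, e, f, h, K, m, v, \<phi>)" using * unfolding dat_def prod.case by blast
  then show ?thesis by (rule exI)
 qed
 then obtain p where p: "!!i. i < ?n ==> dat i (p i)" by metis
 define S where "S i = fst (p i)" for i
 define e where "e i = fst (snd (p i))" for i
 define f where "f i = fst (snd (snd (p i)))" for i
 define h where "h i = fst (snd (snd (snd (p i))))" for i
 define K where "K i = fst (snd (snd (snd (snd (p i)))))" for i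
 define m where "m i = fst (snd (snd (snd (snd (snd (p i))))))" for i
 define v where "v i = fst (snd (snd (snd (snd (snd (snd (p i)))))))" for i
 define \<phi> where "\<phi> i = snd (snd (snd (snd (snd (snd (snd (p i)))))))" for i
 have pi: "p i = (S i, e i, f i, h i, K i, m i, v i, \<phi> i)" for i
  unfolding S_def e_def f_def h_def K_def m_def v_def \<phi>_def by (simp only: prod.collapse)
 have A: "fd (S i) & sl2_frame (S i) (e i) (f i) (h i) (K i) (m i) (v i) & sl2_iso (Ys ! i) (mk (S i) (e i) (f i) (h i)) &
   tp (Ys ! i) = (%n. card {k\<in>K i. m i k = n})"
  and \<phi>: "\<phi> i \<in> sl2_hom (Ys ! i) (mk (S i) (e i) (f i) (h i)) & bij_betw (\<phi> i) (carrier (sspace (Ys ! i))) (S i)" if "i < ?n" for i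
  using p[OF that] unfolding pi dat_def prod.case by blast+
 have F: "sl2_frame (dS ?n S) (cw ?n e) (cw ?n f) (cw ?n h) (Sigma {..<?n} K) (%(i, k). m i k) (%(i, k). atv i (v i k))"
  by (rule dsum_frame) (use A in blast)
 have fdD: "fd (dS ?n S)" by (rule fd_dS) (use A in blast)
 note D = sl2_dsum_obj[OF Y]
 have xi: "x i \<in> carrier (sspace (Ys ! i))" if "x \<in> carrier ?D" "i < ?n" for x i using that by (simp add: ds_carrier)
 have lin: "\<phi> i x \<in> S i" "\<phi> i (x \<oplus>\<^bsub>sspace (Ys ! i)\<^esub> y) = \<phi> i x + \<phi> i y" "\<phi> i (a \<odot>\<^bsub>sspace (Ys ! i)\<^esub> x) = a \<cdot> \<phi> i x"
  if "i < ?n" "x \<in> carrier (sspace (Ys ! i))" "y \<in> carrier (sspace (Ys ! i))" for i x y a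
  using \<phi>[OF that(1)] that(2,3) by (auto simp: sl2_hom_def lin_maps_def)
 have pa: "\<phi> i (sact (Ys ! i) B x) = slact (S i) (e i) (f i) (h i) B (\<phi> i x)" if "i < ?n" "x \<in> carrier (sspace (Ys ! i))" "B \<in> sl2" for i x B
  using \<phi>[OF that(1)] that(2,3) by (auto simp: sl2_hom_def)
 define \<Phi> where "\<Phi> = (\<lambda>x\<in>carrier ?D. %i. if i < ?n then \<phi> i (x i) else 0)"
 define \<Psi> where "\<Psi> y = (\<lambda>i\<in>{..<?n}. inv_into (carrier (sspace (Ys ! i))) (\<phi> i) (y i))" for y
 have q: "inv_into (carrier (sspace (Ys ! i))) (\<phi> i) y \<in> carrier (sspace (Ys ! i))" "\<phi> i (inv_into (carrier (sspace (Ys ! i))) (\<phi> i) y) = y"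
  if "i < ?n" "y \<in> S i" for i y using \<phi>[OF that(1)] that(2) by (auto simp: bij_betw_def inv_into_into f_inv_into_f)
 have ql: "inv_into (carrier (sspace (Ys ! i))) (\<phi> i) (\<phi> i x) = x" if "i < ?n" "x \<in> carrier (sspace (Ys ! i))" for i x
  by (rule bij_betw_inv_into_left[OF conjunct2[OF \<phi>[OF that(1)]] that(2)])
 note Dv = sl2_space(1)[OF D, unfolded sl2_dsum_def sl2_rep.simps]
 have Pin: "\<Phi> x \<in> dS ?n S" if "x \<in> carrier ?D" for x using that lin(1)[OF _ xi xi] by (simp add: \<Phi>_def dS_def)
 have "bij_betw \<Phi> (carrier ?D) (dS ?n S)"
 proof (rule bij_betw_byWitness[where f' = \<Psi>])
  have Psi_in: "\<Psi> y \<in> carrier ?D" if "y \<in> dS ?n S" for y using that q(1) by (simp add: \<Psi>_def ds_carrier dS_def)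
  show "\<forall>x\<in>carrier ?D. \<Psi> (\<Phi> x) = x"
  proof
   fix x assume x: "x \<in> carrier ?D"
   show "\<Psi> (\<Phi> x) = x"
    by (rule ds_eqI[of _ ?n]) (use x ql[OF _ xi[OF x]] in \<open>simp_all add: \<Psi>_def \<Phi>_def ds_carrier\<close>)
  qed
  show "\<forall>y\<in>dS ?n S. \<Phi> (\<Psi> y) = y"
  proof
   fix y assume y: "y \<in> dS ?n S"
   show "\<Phi> (\<Psi> y) = y"
    using y Psi_in[OF y] q(2) by (intro ext) (simp add: \<Phi>_def \<Psi>_def dS_def)
  qed
  show "\<Phi> ` carrier ?D \<subseteq> dS ?n S" using Pin by blast
  show "\<Psi> ` dS ?n S \<subseteq> carrier ?D" using Psi_in by blast
 qed
 moreover have "\<Phi> \<in> sl2_hom (sl2_dsum Ys) (mk (dS ?n S) (cw ?n e) (cw ?n f) (cw ?n h))"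
 proof -
  have "\<Phi> \<in> carrier ?D \<rightarrow>\<^sub>E dS ?n S" by (rule PiE_I) (use Pin in \<open>auto simp: \<Phi>_def\<close>)
  moreover have "\<Phi> (x \<oplus>\<^bsub>?D\<^esub> y) = \<Phi> x + \<Phi> y" if "x \<in> carrier ?D" "y \<in> carrier ?D" for x y
  proof
   fix i show "\<Phi> (x \<oplus>\<^bsub>?D\<^esub> y) i = (\<Phi> x + \<Phi> y) i"
    using that vmod_add[OF Dv that] lin(2)[OF _ xi[OF that(1)] xi[OF that(2)], of i] by (cases "i < ?n") (simp_all add: \<Phi>_def ds_add)
  qed
  moreover have "\<Phi> (a \<odot>\<^bsub>?D\<^esub> x) = a \<cdot> \<Phi> x" if "x \<in> carrier ?D" for x a
  proof
   fix i show "\<Phi> (a \<odot>\<^bsub>?D\<^esub> x) i = (a \<cdot> \<Phi> x) i"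
    using that vmod_smult[OF Dv that] lin(3)[OF _ xi[OF that] xi[OF that], of i] by (cases "i < ?n") (simp_all add: \<Phi>_def ds_smult)
  qed
  moreover have "\<Phi> (sact (sl2_dsum Ys) B x) = slact (dS ?n S) (cw ?n e) (cw ?n f) (cw ?n h) B (\<Phi> x)" if B: "B \<in> sl2" and x: "x \<in> carrier ?D" for B x
  proof
   fix i
   have sx: "sact (sl2_dsum Ys) B x \<in> carrier ?D" using sact_in[OF D B, of x] x by (simp add: sl2_dsum_def)
   show "\<Phi> (sact (sl2_dsum Ys) B x) i = slact (dS ?n S) (cw ?n e) (cw ?n f) (cw ?n h) B (\<Phi> x) i"
   proof (cases "i < ?n")
    case True
    have "\<Phi> (sact (sl2_dsum Ys) B x) i = \<phi> i (sact (Ys ! i) B (x i))"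
     using sx True B x by (simp add: \<Phi>_def) (simp add: sl2_dsum_def)
    also have "\<dots> = slact (S i) (e i) (f i) (h i) B (\<phi> i (x i))" by (rule pa[OF True xi[OF x True] B])
    also have "\<dots> = slact (dS ?n S) (cw ?n e) (cw ?n f) (cw ?n h) B (\<Phi> x) i"
     using True B x Pin[OF x] lin(1)[OF True xi[OF x True] xi[OF x True]] by (simp add: slact_def) (simp add: cw_def \<Phi>_def)
    finally show ?thesis .
   next
    case False
    then show ?thesis using sx B x Pin[OF x] by (simp add: slact_def) (simp add: cw_def \<Phi>_def)
   qed
  qed
  ultimately show ?thesis by (simp add: sl2_hom_def lin_maps_def) (simp add: sl2_dsum_def)
 qed
 ultimately have "sl2_iso (sl2_dsum Ys) (mk (dS ?n S) (cw ?n e) (cw ?n f) (cw ?n h))"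
  unfolding sl2_iso_def by (intro bexI[of _ \<Phi>]) (simp_all add: sl2_dsum_def)
 note t0 = tp_eq[OF D this F fdD]
 have finK: "finite (K i)" if "i < ?n" for i using A[OF that] sl2_frame.finK by blast
 from t0 have "tp (sl2_dsum Ys) = (%N. card {p \<in> Sigma {..<?n} K. (case p of (i, k) => m i k) = N})" .
 also have "\<dots> = (%N. \<Sum>i<?n. tp (Ys ! i) N)"
 proof
  fix N
  have "{p \<in> Sigma {..<?n} K. (case p of (i, k) => m i k) = N} = Sigma {..<?n} (%i. {k\<in>K i. m i k = N})" by auto
  then have "card {p \<in> Sigma {..<?n} K. (case p of (i, k) => m i k) = N} = (\<Sum>i<?n. card {k\<in>K i. m i k = N})"
   using finK by (subst card_SigmaI[symmetric]) auto
  also have "\<dots> = (\<Sum>i<?n. tp (Ys ! i) N)" by (rule sum.cong[OF refl]) (use A in simp)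
  finally show "card {p \<in> Sigma {..<?n} K. (case p of (i, k) => m i k) = N} = (\<Sum>i<?n. tp (Ys ! i) N)" .
 qed
 finally show ?thesis .
qed

section \<open>Indecomposable representations and the Krull-Schmidt property\<close>

definition htp :: "nat => 'v hrep => nat => nat" where "htp g W = tp (class_lim g W)"

definition single :: "nat => nat => nat" where "single n = (%k. if k = n then 1 else 0)"

lemma single_inj: "single a = single b ==> a = b"
 unfolding single_def by (metis zero_neq_one)

lemma htp_iso:
 assumes "hrep_obj g V" "hrep_obj g W" "g \<ge> 1"
 shows "hrep_iso g V W \<longleftrightarrow> htp g V = htp g W"
 unfolding htp_def hrep_iso_iff[OF assms] by (rule tp_iso[OF class_lim_obj class_lim_obj]) (use assms in auto)

lemma htp_dsum:
 assumes W: "\<forall>W\<in>set Ws. hrep_obj g W" and g: "g \<ge> 1"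
 shows "htp g (hrep_dsum g Ws) = (%k. \<Sum>i<length Ws. htp g (Ws ! i) k)"
proof -
 have "\<forall>Y\<in>set (map (class_lim g) Ws). sl2_obj Y" using class_lim_obj[OF _ g] W unfolding set_map by blast
 from tp_dsum[OF this] show ?thesis unfolding htp_def class_lim_dsum[OF W] by simp
qed

lemma htp_iso_dsum:
 assumes V: "hrep_obj g V" and W: "\<forall>W\<in>set Ws. hrep_obj g W" and g: "g \<ge> 1"
 shows "hrep_iso g V (hrep_dsum g Ws) \<longleftrightarrow> htp g V = (%k. \<Sum>i<length Ws. htp g (Ws ! i) k)"
 unfolding htp_iso[OF V hrep_dsum_obj(1)[OF W] g] htp_dsum[OF W g] ..

lemma htp_iso_dsum2:
 assumes V: "hrep_obj g V" and W: "hrep_obj g A" "hrep_obj g B" and g: "g \<ge> 1"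
 shows "hrep_iso g V (hrep_dsum g [A, B]) \<longleftrightarrow> htp g V = (%k. htp g A k + htp g B k)"
 using htp_iso_dsum[OF V, of "[A, B]"] W g by (simp add: numeral_2_eq_2)

lemma htp_zero: "hrep_obj g W ==> g \<ge> 1 ==> htp g W = (%_. 0) \<longleftrightarrow> carrier (hspace W) = {\<zero>\<^bsub>hspace W\<^esub>}"
 using tp_zero[OF class_lim_obj] by (auto simp: htp_def class_lim_def)

lemma htp_sub:
 fixes W :: "'v hrep"
 assumes W: "hrep_obj g W" and g: "g \<ge> 1" and "!!n. c n \<le> htp g W n"
 shows "\<exists>A :: 'v hrep. hrep_obj g A & htp g A = c"
proof -
 obtain Z :: "'v sl2_rep" where "sl2_obj Z" "tp Z = c" using tp_sub[OF class_lim_obj[OF W g], of c] assms(3) by (auto simp: htp_def)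
 then show ?thesis using deformation_exists[of Z g] g by (auto simp: htp_def)
qed

text \<open>A type with an entry at n splits off single n, and the two parts of the type are
realised by representations. Conversely single n is not a sum of two nonzero types.\<close>

lemma indecomposable_iff:
 fixes W :: "'v hrep"
 assumes g: "g \<ge> 1"
 shows "hrep_indecomposable g W \<longleftrightarrow> hrep_obj g W & (EX n. htp g W = single n)"
proof
 assume I: "hrep_indecomposable g W"
 then have W: "hrep_obj g W" and "carrier (hspace W) ~= {\<zero>\<^bsub>hspace W\<^esub>}" by (auto simp: hrep_indecomposable_def)
 then have "htp g W ~= (%_. 0)" using htp_zero[OF W g] by simp
 then obtain n where n: "htp g W n ~= 0" by blast
 obtain A :: "'v hrep" where A: "hrep_obj g A" "htp g A = single n"
 proof -
  have "single n k \<le> htp g W k" for k using n by (simp add: single_def)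
  then show thesis using htp_sub[OF W g, of "single n"] that by blast
 qed
 obtain B :: "'v hrep" where B: "hrep_obj g B" "htp g B = (%k. htp g W k - single n k)"
  using htp_sub[OF W g, of "%k. htp g W k - single n k"] by auto
 have "htp g W = (%k. htp g A k + htp g B k)" unfolding A(2) B(2) using n by (auto simp: single_def)
 then have "hrep_iso g W (hrep_dsum g [A, B])" using htp_iso_dsum2[OF W A(1) B(1) g] by simp
 then have "carrier (hspace A) = {\<zero>\<^bsub>hspace A\<^esub>} \<or> carrier (hspace B) = {\<zero>\<^bsub>hspace B\<^esub>}"
  using I A(1) B(1) unfolding hrep_indecomposable_def by blast
 then have "htp g A = (%_. 0) \<or> htp g B = (%_. 0)" using htp_zero[OF A(1) g] htp_zero[OF B(1) g] by simp
 moreover have "htp g A ~= (%_. 0)" unfolding A(2) single_def by (metis zero_neq_one)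
 ultimately have "htp g W = single n" using \<open>htp g W = (%k. htp g A k + htp g B k)\<close> A(2) by simp
 then show "hrep_obj g W & (EX n. htp g W = single n)" using W by blast
next
 assume "hrep_obj g W & (EX n. htp g W = single n)"
 then obtain n where W: "hrep_obj g W" and n: "htp g W = single n" by blast
 have "htp g W ~= (%_. 0)" unfolding n single_def by (metis zero_neq_one)
 moreover have "carrier (hspace A) = {\<zero>\<^bsub>hspace A\<^esub>} \<or> carrier (hspace B) = {\<zero>\<^bsub>hspace B\<^esub>}"
  if A: "hrep_obj g A" and B: "hrep_obj g B" and i: "hrep_iso g W (hrep_dsum g [A, B])" for A B :: "'v hrep"
 proof -
  have s: "single n k = htp g A k + htp g B k" for k
   using fun_cong[OF iffD1[OF htp_iso_dsum2[OF W A B g] i], of k] unfolding n .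
  have "htp g A = (%_. 0) \<or> htp g B = (%_. 0)"
  proof (cases "htp g A n = 0")
   case True
   then have "htp g A k = 0" for k using s[of k] by (cases "k = n") (auto simp: single_def)
   then show ?thesis by auto
  next
   case False
   then have "htp g B k = 0" for k using s[of k] by (cases "k = n") (auto simp: single_def)
   then show ?thesis by auto
  qed
  then show ?thesis using htp_zero[OF A g] htp_zero[OF B g] by simp
 qed
 ultimately show "hrep_indecomposable g W" unfolding hrep_indecomposable_def using W htp_zero[OF W g] by simp
qed

lemma krull_schmidt_holds:
 assumes g: "g \<ge> 1"
 shows "krull_schmidt g TYPE('v)"
 unfolding krull_schmidt_def
proof (intro allI impI conjI)
 fix V :: "'v hrep" assume V: "hrep_obj g V"
 have "finite {n. 0 < htp g V n}" using tp_fin[OF class_lim_obj[OF V g]] by (simp add: htp_def)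
 then have cnt: "count (Abs_multiset (htp g V)) = htp g V" by (rule count_Abs_multiset)
 obtain ns where ns: "mset ns = Abs_multiset (htp g V)" using ex_mset by blast
 have "\<exists>A :: 'v hrep. n \<in> set ns --> hrep_obj g A & htp g A = single n" for n
 proof (cases "n \<in> set ns")
  case True
  then have "count (mset ns) n ~= 0" by simp
  then have "0 < htp g V n" unfolding ns cnt by simp
  then show ?thesis using htp_sub[OF V g, of "single n"] by (auto simp: single_def)
 qed simp
 then obtain A :: "nat => 'v hrep" where A: "!!n. n \<in> set ns ==> hrep_obj g (A n) & htp g (A n) = single n" by metis
 have cs: "(\<Sum>i<length xs. single (xs ! i) k) = count (mset xs) k" for xs k
 proof (induction xs)
  case (Cons x xs)
  then show ?case by (simp add: sum.lessThan_Suc_shift single_def del: sum.lessThan_Suc)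
 qed simp
 have "htp g V = (%k. \<Sum>i<length (map A ns). htp g (map A ns ! i) k)"
  using cs[of ns] A unfolding ns cnt by (auto simp: fun_eq_iff)
 then have "hrep_iso g V (hrep_dsum g (map A ns))" using htp_iso_dsum[OF V _ g, of "map A ns"] A by auto
 moreover have "\<forall>B\<in>set (map A ns). hrep_indecomposable g B" using A by (auto simp: indecomposable_iff[OF g])
 ultimately show "\<exists>As :: 'v hrep list. (\<forall>A\<in>set As. hrep_indecomposable g A) & hrep_iso g V (hrep_dsum g As)" by blast
next
 fix V :: "'v hrep" and As Bs :: "'v hrep list"
 assume V: "hrep_obj g V"
 assume "(\<forall>A\<in>set As. hrep_indecomposable g A) & (\<forall>B\<in>set Bs. hrep_indecomposable g B) &
      hrep_iso g V (hrep_dsum g As) & hrep_iso g V (hrep_dsum g Bs)"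
 then have A: "\<forall>A\<in>set As. hrep_indecomposable g A" and B: "\<forall>B\<in>set Bs. hrep_indecomposable g B"
  and iA: "hrep_iso g V (hrep_dsum g As)" and iB: "hrep_iso g V (hrep_dsum g Bs)" by auto
 have ob: "\<forall>A\<in>set As. hrep_obj g A" "\<forall>B\<in>set Bs. hrep_obj g B" using A B by (simp_all add: indecomposable_iff[OF g])
 have "ALL i. EX n. i < length As --> htp g (As ! i) = single n" "ALL i. EX n. i < length Bs --> htp g (Bs ! i) = single n"
  using A B nth_mem unfolding indecomposable_iff[OF g] by blast+
 then obtain a b where a: "!!i. i < length As ==> htp g (As ! i) = single (a i)" and b: "!!i. i < length Bs ==> htp g (Bs ! i) = single (b i)" by metis
 have cf: "(\<Sum>i<n. single (c i) k) = card {i\<in>{..<n}. c i = k}" for n :: nat and c k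
 proof -
  have "(\<Sum>i<n. single (c i) k) = (\<Sum>i\<in>{..<n}. if c i = k then 1 else 0)" unfolding single_def by (rule sum.cong) auto
  also have "\<dots> = card {i\<in>{..<n}. c i = k}" by (subst sum.inter_filter[symmetric]) auto
  finally show ?thesis .
 qed
 have "card {i\<in>{..<length As}. a i = k} = card {i\<in>{..<length Bs}. b i = k}" for k
 proof -
  have "htp g V k = (\<Sum>i<length As. single (a i) k)" using fun_cong[OF iffD1[OF htp_iso_dsum[OF V ob(1) g] iA], of k] a by simp
  moreover have "htp g V k = (\<Sum>i<length Bs. single (b i) k)" using fun_cong[OF iffD1[OF htp_iso_dsum[OF V ob(2) g] iB], of k] b by simp
  ultimately show ?thesis unfolding cf by simp
 qed
 then obtain \<pi> where \<pi>: "bij_betw \<pi> {..<length As} {..<length Bs}" "!!i. i < length As ==> b (\<pi> i) = a i"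
  using fiber_bij[of "{..<length As}" "{..<length Bs}" a b] by auto
 show "length As = length Bs" using bij_betw_same_card[OF \<pi>(1)] by simp
 have "hrep_iso g (As ! i) (Bs ! \<pi> i)" if i: "i < length As" for i
 proof -
  have "\<pi> i < length Bs" using bij_betwE[OF \<pi>(1)] i by blast
  then show ?thesis using htp_iso[of g "As ! i" "Bs ! \<pi> i"] ob i g a[OF i] b \<pi>(2)[OF i] by simp
 qed
 then show "\<exists>\<pi>. bij_betw \<pi> {..<length As} {..<length Bs} & (\<forall>i<length As. hrep_iso g (As ! i) (Bs ! \<pi> i))" using \<pi>(1) by blast
qed

section \<open>The representations \<open>L\<^sup>h\<^sup>,\<^sup>h\<^sup>'(n,g)\<close>\<close>

definition Lf :: "nat => (nat => complex) => nat => complex" where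
 "Lf n x = (%j. if j = 0 \<or> j > n then 0 else x (j - 1))"

definition Le :: "nat => (nat => complex) => nat => complex" where
 "Le n x = (%j. if j < n then of_nat (Suc j) * (of_nat n - of_nat j) * x (Suc j) else 0)"

definition Lh :: "nat => (nat => complex) => nat => complex" where
 "Lh n x = (%j. if j \<le> n then (of_nat n - 2 * of_nat j) * x j else 0)"

definition Lv :: "nat => nat => nat => complex" where
 "Lv n j = (%i. if i = j & j \<le> n then 1 else 0)"

lemma Lf_pow: "(Lf n ^^ j) (Lv n 0) = Lv n j"
 by (induction j) (auto simp: Lf_def Lv_def fun_eq_iff)

lemma L_module: "sl2_module (Cr (Suc n)) (Le n) (Lf n) (Lh n)"
proof
 show "cv.subspace (Cr (Suc n))" by (rule subspace_Cr)
 show "clin (Cr (Suc n)) (Cr (Suc n)) (Le n)" "clin (Cr (Suc n)) (Cr (Suc n)) (Lf n)" "clin (Cr (Suc n)) (Cr (Suc n)) (Lh n)"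
  by (auto simp: clin_def Cr_def Le_def Lf_def Lh_def fun_eq_iff csc_complex_def algebra_simps)
 fix x :: "nat => complex" assume x: "x \<in> Cr (Suc n)"
 show "Lh n (Le n x) = Le n (Lh n x) + 2 \<cdot> Le n x"
  by (auto simp: Le_def Lh_def fun_eq_iff csc_complex_def algebra_simps)
 show "Lh n (Lf n x) = Lf n (Lh n x) - 2 \<cdot> Lf n x"
 proof
  fix j show "Lh n (Lf n x) j = (Lf n (Lh n x) - 2 \<cdot> Lf n x) j"
   by (cases j) (auto simp: Lf_def Lh_def csc_complex_def algebra_simps)
 qed
 show "Le n (Lf n x) - Lf n (Le n x) = Lh n x"
 proof
  fix j
  show "(Le n (Lf n x) - Lf n (Le n x)) j = Lh n x j"
  proof (cases "j \<le> n")
   case True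
   have "Le n (Lf n x) j = of_nat (Suc j) * (of_nat n - of_nat j) * x j" using True by (cases "j = n") (auto simp: Le_def Lf_def)
   moreover have "Lf n (Le n x) j = of_nat j * (of_nat n - of_nat j + 1) * x j" using True by (cases j) (auto simp: Le_def Lf_def algebra_simps)
   ultimately have "(Le n (Lf n x) - Lf n (Le n x)) j = of_nat (Suc j) * (of_nat n - of_nat j) * x j - of_nat j * (of_nat n - of_nat j + 1) * x j" by simp
   also have "\<dots> = Lh n x j" using True by (simp add: Lh_def algebra_simps)
   finally show ?thesis .
  next
   case False
   then show ?thesis by (simp add: Le_def Lf_def Lh_def)
  qed
 qed
qed

lemma L_frame: "sl2_frame (Cr (Suc n)) (Le n) (Lf n) (Lh n) {()} (%_. n) (%_. Lv n 0)"
proof -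
 interpret sl2_module "Cr (Suc n)" "Le n" "Lf n" "Lh n" by (rule L_module)
 have FS: "FS (Lf n) {()} (%_. n) (%_. Lv n 0) c = (%i. if i \<le> n then c () i else 0)" for c
 proof
  fix i
  have "FS (Lf n) {()} (%_. n) (%_. Lv n 0) c i = (\<Sum>j\<le>n. c () j \<cdot> Lv n j) i" by (simp add: FS_def Lf_pow)
  also have "\<dots> = (\<Sum>j\<in>{..n}. if i = j then c () i else 0)"
  proof -
   have "(\<Sum>j\<in>A. c () j \<cdot> Lv n j) i = (\<Sum>j\<in>A. if i = j then c () i else 0)" if "A \<subseteq> {..n}" "finite A" for A
    using that(2,1) by (induction A rule: finite_induct) (auto simp: Lv_def csc_complex_def)
   then show ?thesis by blast
  qed
  finally show "FS (Lf n) {()} (%_. n) (%_. Lv n 0) c i = (if i \<le> n then c () i else 0)" by simp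
 qed
 show ?thesis
 proof
  show "Lv n 0 \<in> Cr (Suc n) & Le n (Lv n 0) = 0 & Lh n (Lv n 0) = of_nat n \<cdot> Lv n 0 & (Lf n ^^ Suc n) (Lv n 0) = 0"
   unfolding Lf_pow by (auto simp: Lv_def Le_def Lh_def Cr_def fun_eq_iff csc_complex_def)
  show "EX c. u = FS (Lf n) {()} (%_. n) (%_. Lv n 0) c" if "u \<in> Cr (Suc n)" for u
   unfolding FS using that by (intro exI[of _ "%_. u"]) (auto simp: Cr_def fun_eq_iff)
  show "c k j = 0" if "FS (Lf n) {()} (%_. n) (%_. Lv n 0) c = 0" "j \<le> n" for c k j
   using fun_cong[OF that(1)[unfolded FS], of j] that(2) by simp
 qed simp
qed

lemma L_space_emod: "L_space n = emod (Cr (Suc n))"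
 unfolding L_space_def emod_def Cr_def by (auto simp: fun_eq_iff csc_complex_def plus_fun_def zero_fun_def Suc_le_eq)

lemma L_basis_mconst: "L_basis n j = mconst (Lv n j)"
 unfolding L_basis_def L_space_emod ps_const_emod Lv_def ..

lemma kop_ext:
 assumes S: "cv.subspace S" and T: "kop S S' T" and T': "kop S S' T'" and eq: "!!v. v \<in> S ==> T (mconst v) = T' (mconst v)" and f: "f \<in> MS S"
 shows "T f = T' f"
proof -
 have "(%x. T x - T' x) f = 0"
 proof (rule module_map_zero[OF S _ _ _ _ f])
  show "T (x + y) - T' (x + y) = (T x - T' x) + (T y - T' y)" if "x \<in> MS S" "y \<in> MS S" for x y
   by (simp only: clin_add[OF kop_clin[OF T] that] clin_add[OF kop_clin[OF T'] that] add_diff_add)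
  show "T (hsh x) - T' (hsh x) = hsh (T x - T' x)" "T (vsh x) - T' (vsh x) = vsh (T x - T' x)" if "x \<in> MS S" for x
   by (simp_all only: kop_hsh[OF T that] kop_hsh[OF T' that] kop_vsh[OF T that] kop_vsh[OF T' that] hsh_diff vsh_diff)
  show "T (mconst v) - T' (mconst v) = 0" if "v \<in> S" for v by (simp only: eq[OF that] diff_self)
 qed
 then show ?thesis by (simp only: right_minus_eq)
qed

lemma ext0_mconst: "\<theta> 0 = 0 ==> ext0 \<theta> (mconst v) = mconst (\<theta> v)"
 by (auto simp: ext0_def mconst_def fun_eq_iff)

lemma (in hops) ser_eigen:
 assumes F: "F \<in> MS S" and "T Gen_H F = x \<cdot> F" "T Gen_C F = y \<cdot> F"
 shows "Phi (HCact T) p F = Phi csc (hmapc (evalHC x y) p) F"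
 by (rule Phi_cong) (simp add: hc.act_eigen[OF assms])

text \<open>The characterisation that defines the action on \<open>L\<^sup>h\<^sup>,\<^sup>h\<^sup>'(n,g)\<close>.\<close>

definition L_spec :: "nat => nat => (free_alg fps fps set => (nat => nat => nat => complex) => nat => nat => nat => complex) => bool" where
 "L_spec g n \<rho> \<longleftrightarrow> hrep_obj g \<lparr>hspace = L_space n, hact = \<rho>\<rparr> &
    (\<forall>j\<le>n.
     \<rho> (ucls g (gen_el Gen_H)) (L_basis n j) =
      (of_nat n - 2 * of_nat j) \<odot>\<^bsub>ps_mod (L_space n)\<^esub> L_basis n j &
     \<rho> (ucls g (gen_el Gen_C)) (L_basis n j) =
      (of_nat (n + 1))\<^sup>2 \<odot>\<^bsub>ps_mod (L_space n)\<^esub> L_basis n j &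
     \<rho> (ucls g (gen_el Gen_Xm)) (L_basis n j) = L_basis n (j + 1) &
     \<rho> (ucls g (gen_el Gen_Xp)) (L_basis n j) =
      (if j = 0 then \<zero>\<^bsub>ps_mod (L_space n)\<^esub>
       else (qbracket (%c. c) g (of_nat j) * qbracket (%c. c) g (of_nat (n - j + 1)))
          \<odot>\<^bsub>ps_mod (L_space n)\<^esub> L_basis n (j - 1)))"

text \<open>The four operators are determined by their values on a basis, and they determine the representation: the identity is a
morphism between any two candidates.\<close>

lemma L_spec_unique:
 assumes "L_spec g n \<rho>" "L_spec g n \<rho>'"
 shows "\<rho> = \<rho>'"
proof -
 let ?S = "Cr (Suc n)" and ?W = "\<lparr>hspace = L_space n, hact = \<rho>\<rparr>" and ?W' = "\<lparr>hspace = L_space n, hact = \<rho>'\<rparr>"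
 interpret F: sl2_frame ?S "Le n" "Lf n" "Lh n" "{()}" "%_. n" "%_. Lv n 0" by (rule L_frame)
 have W: "hrep_obj g ?W" "hspace ?W = emod ?S" and W': "hrep_obj g ?W'" "hspace ?W' = emod ?S"
  using assms by (auto simp: L_spec_def L_space_emod)
 note G = hrep_gens(1)[OF W F.S] and G' = hrep_gens(1)[OF W' F.S]
 have basis: "hgen g ?W x (mconst (Lv n j)) = hgen g ?W' x (mconst (Lv n j))" if "j \<le> n" for x j
  using assms that unfolding L_spec_def hgen_def hrep.simps L_basis_mconst by (cases x) simp_all
 have eq: "hgen g ?W x f = hgen g ?W' x f" if f: "f \<in> MS ?S" for x f
 proof (rule kop_ext[OF F.S gens.kT[OF G] gens.kT[OF G'] _ f])
  fix w assume "w \<in> ?S"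
  then obtain c where c: "w = FS (Lf n) {()} (%_. n) (%_. Lv n 0) c" using F.spn by blast
  have cl: "clin ?S (MS ?S) (%w. R (mconst w))" if R: "kop ?S ?S R" for R
   by (intro clinI) (simp_all add: kop_in[OF R] MS_mconst[OF F.S] mconst_add mconst_csc clin_add[OF kop_clin[OF R]] clin_csc[OF kop_clin[OF R]])
  show "hgen g ?W x (mconst w) = hgen g ?W' x (mconst w)"
   unfolding c F.clin_FS[OF cl[OF gens.kT[OF G]]] F.clin_FS[OF cl[OF gens.kT[OF G']]]
   by (intro sum.cong refl) (simp add: Lf_pow basis)
 qed
 have "(\<lambda>f\<in>MS ?S. f) \<in> hrep_hom g ?W ?W'"
  unfolding hrep_hom_emod[OF W F.S W' F.S]
 proof (intro conjI allI ballI)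
  show "kop ?S ?S (\<lambda>f\<in>MS ?S. f)" by (rule kop_cong[OF F.S kop_id]) simp
  fix x f assume f: "f \<in> MS ?S"
  have "hgen g ?W x f \<in> MS ?S" by (rule kop_in[OF gens.kT[OF G] f])
  then have "(\<lambda>f\<in>MS ?S. f) (hgen g ?W x f) = hgen g ?W x f" by (rule restrict_apply')
  then show "(\<lambda>f\<in>MS ?S. f) (hgen g ?W x f) = hgen g ?W' x ((\<lambda>f\<in>MS ?S. f) f)"
   unfolding restrict_apply'[OF f] eq[OF f, symmetric] .
 qed simp
 then have idh: "(\<lambda>f\<in>MS ?S. f) (\<rho> u f) = \<rho>' u ((\<lambda>f\<in>MS ?S. f) f)" if "u \<in> carrier (Uhh g)" "f \<in> MS ?S" for u f
  using that by (simp add: hrep_hom_def L_space_emod)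
 have val: "\<rho> u f = \<rho>' u f" if "u \<in> carrier (Uhh g)" "f \<in> MS ?S" for u f
 proof -
  have "\<rho> u f \<in> MS ?S" using that hact_in[OF W(1) that(1), of f] by (simp add: L_space_emod)
  then show ?thesis using idh[OF that] by (simp only: restrict_apply' that(2))
 qed
 show ?thesis
 proof (rule extensionalityI[of _ "carrier (Uhh g)"])
  show "\<rho> \<in> extensional (carrier (Uhh g))" "\<rho>' \<in> extensional (carrier (Uhh g))"
   using W(1) W'(1) by (simp_all add: hrep_obj_def)
  fix u assume u: "u \<in> carrier (Uhh g)"
  have "\<rho> u \<in> extensional (MS ?S)" "\<rho>' u \<in> extensional (MS ?S)"
   using hact_lin[OF W(1) u] hact_lin[OF W'(1) u] by (simp_all add: L_space_emod lin_maps_emod[OF F.S F.S])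
  then show "\<rho> u = \<rho>' u" by (rule extensionalityI) (rule val[OF u])
 qed
qed

text \<open>The deformation of the classical simple module has the required matrix coefficients: \<open>X\<^sup>+ m\<^sub>j =
X\<^sup>+ X\<^sup>- m\<^sub>j\<^sub>-\<^sub>1\<close> is the prescribed series in H and
C, evaluated at H = n - 2(j-1) and \<open>\<surd>C = n + 1\<close>.\<close>

lemma L_spec_exists:
 fixes n :: nat
 assumes g: "g \<ge> 1"
 defines "W \<equiv> mk_hrep g (Cr (Suc n)) (deform_ops g (Le n) (Lf n) (Lh n))"
 shows "L_spec g n (hact W)" "hrep_obj g W" "hspace W = L_space n"
  "class_lim g W = mk (Cr (Suc n)) (Le n) (Lf n) (Lh n)"
proof -
 let ?S = "Cr (Suc n)" and ?T = "deform_ops g (Le n) (Lf n) (Lh n)"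
 interpret F: sl2_frame ?S "Le n" "Lf n" "Lh n" "{()}" "%_. n" "%_. Lv n 0" by (rule L_frame)
 note dh = deform_hops[OF F.sl2_module_axioms fd_Cr g]
 interpret hops ?S ?T g by (rule dh(1))
 show ob: "hrep_obj g W" and sp: "hspace W = L_space n" unfolding W_def L_space_emod by (rule mk_hrep)+
 have gen: "hgen g W x f = ?T x f" if "f \<in> MS ?S" for x f unfolding W_def by (rule mk_hrep_gen[OF that])
 have lim: "lim0 (hgen g W x) v = lim0 (?T x) v" if "v \<in> ?S" for x v
  unfolding lim0_def by (simp add: gen MS_mconst F.S that)
 have "lim0 (?T Gen_Xm) v = Lf n v" "lim0 (?T Gen_H) v = Lh n v" for v by (auto simp: deform_ops_def lim0_def ext0_def)
 then have "slact ?S (lim0 (hgen g W Gen_Xp)) (lim0 (hgen g W Gen_Xm)) (lim0 (hgen g W Gen_H)) = slact ?S (Le n) (Lf n) (Lh n)"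
  unfolding slact_def by (intro restrict_ext) (simp only: lim dh(2))
 then show "class_lim g W = mk ?S (Le n) (Lf n) (Lh n)"
  using sp unfolding L_space_emod by (subst class_lim_emod) simp_all
 have cas0: "F.cas 0 = 0" using clin_0[OF F.cas_clin F.S] .
 have ops0: "Le n 0 = 0" "Lf n 0 = 0" "Lh n 0 = 0" using clin_0[OF F.e F.S] clin_0[OF F.f F.S] clin_0[OF F.h F.S] by simp_all
 have vS: "Lv n j \<in> ?S" for j using F.bv[of "()" j] by (simp add: Lf_pow)
 have mv: "mconst (Lv n j) \<in> MS ?S" for j by (rule MS_mconst[OF F.S vS])
 have hv: "Lh n (Lv n j) = (of_nat n - 2 * of_nat j) \<cdot> Lv n j" for j
  by (auto simp: Lh_def Lv_def fun_eq_iff csc_complex_def)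
 have hw0: "Lv n 0 \<in> ?S" "Le n (Lv n 0) = 0" "Lh n (Lv n 0) = of_nat n \<cdot> Lv n 0" using F.hw[of "()"] by auto
 have cv': "F.cas (Lv n j) = (of_nat (Suc n) * of_nat (Suc n)) \<cdot> Lv n j" for j
  using F.eigen_f_funpow(2)[OF hw0(1,3) F.cas_hw[OF hw0], of j] unfolding Lf_pow .
 have TH: "?T Gen_H (mconst (Lv n j)) = (of_nat n - 2 * of_nat j) \<cdot> mconst (Lv n j)" for j
  by (simp add: deform_ops_def ext0_mconst ops0 hv mconst_csc)
 have TC: "?T Gen_C (mconst (Lv n j)) = (of_nat (Suc n) * of_nat (Suc n)) \<cdot> mconst (Lv n j)" for j
  by (simp add: deform_ops_def ext0_mconst cas0 cv' mconst_csc)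
 have TF: "?T Gen_Xm (mconst (Lv n j)) = mconst (Lv n (Suc j))" for j
 proof -
  have "Lf n (Lv n j) = Lv n (Suc j)" by (auto simp: Lf_def Lv_def fun_eq_iff)
  then show ?thesis by (simp add: deform_ops_def ext0_mconst ops0)
 qed
 have Txp0: "?T Gen_Xp (mconst (Lv n 0)) = 0"
 proof -
  have ke: "kop ?S ?S (ext0 (Le n))" by (rule ext0_kop[OF F.S F.e])
  have "?T Gen_Xp (mconst (Lv n 0)) = ext0 (Le n) (Phi (HCact ?T) (Ucas g) (mconst (Lv n 0)))"
   by (simp add: deform_ops_def HCact_def)
  also have "\<dots> = ext0 (Le n) (Phi csc (hmapc (evalHC (of_nat n - 2 * of_nat 0) (of_nat (Suc n) * of_nat (Suc n))) (Ucas g)) (mconst (Lv n 0)))"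
   by (simp only: ser_eigen[OF mv TH TC])
  also have "\<dots> = Phi csc (hmapc (evalHC (of_nat n - 2 * of_nat 0) (of_nat (Suc n) * of_nat (Suc n))) (Ucas g)) (ext0 (Le n) (mconst (Lv n 0)))"
   using ke mv unfolding kop_iff_linear[OF F.S F.S] by blast
  also have "ext0 (Le n) (mconst (Lv n 0)) = 0" by (simp add: ext0_mconst ops0 hw0(2))
  also have "Phi csc c (0 :: nat => nat => nat => complex) = 0" for c
   using clin_0[OF kop_clin[OF kract.Phi_kop[OF kract_csc[OF F.S]]] subspace_MS[OF F.S]] .
  finally show ?thesis .
 qed
 have TxpS: "?T Gen_Xp (mconst (Lv n (Suc j))) = Phi csc (qbracket (%c. c) g (of_nat (Suc j)) * qbracket (%c. c) g (of_nat (n - Suc j + 1))) (mconst (Lv n j))"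
  if "Suc j \<le> n" for j
 proof -
  have x1: "(of_nat (Suc n) + (of_nat n - 2 * of_nat j) - 1) / 2 = (of_nat (n - Suc j + 1) :: complex)"
   using that by (simp add: of_nat_diff field_simps)
  have x2: "(of_nat (Suc n) - (of_nat n - 2 * of_nat j) + 1) / 2 = (of_nat (Suc j) :: complex)" by (simp add: field_simps)
  have "?T Gen_Xp (mconst (Lv n (Suc j))) = ?T Gen_Xp (?T Gen_Xm (mconst (Lv n j)))" by (simp only: TF)
  also have "\<dots> = Phi (HCact ?T) (relG g 1) (mconst (Lv n j))" by (rule XpXm[OF mv])
  also have "\<dots> = Phi csc (hmapc (evalHC (of_nat n - 2 * of_nat j) (of_nat (Suc n) * of_nat (Suc n))) (relG g 1)) (mconst (Lv n j))"
   by (rule ser_eigen[OF mv TH TC])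
  also have "hmapc (evalHC (of_nat n - 2 * of_nat j) (of_nat (Suc n) * of_nat (Suc n))) (relG g 1) = qbracket (%c. c) g (of_nat (Suc j)) * qbracket (%c. c) g (of_nat (n - Suc j + 1))"
   unfolding relG_eval[OF g] x1 x2 by (rule mult.commute)
  finally show ?thesis .
 qed
 have sm: "c \<odot>\<^bsub>ps_mod (L_space n)\<^esub> mconst (Lv n j) = Phi csc c (mconst (Lv n j))" for c j unfolding L_space_emod by (rule ps_smult[OF F.S mv])
 have smi: "of_int a \<odot>\<^bsub>ps_mod (L_space n)\<^esub> mconst (Lv n j) = of_int a \<cdot> mconst (Lv n j)" for a j
  unfolding sm of_int_hconst by (rule kract.Phi_const[OF kract_csc[OF F.S] mv])
 have W_eq: "\<lparr>hspace = L_space n, hact = hact W\<rparr> = W" by (intro hrep.equality) (simp_all add: sp)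
 have act: "hact W (ucls g (gen_el x)) (L_basis n j) = ?T x (mconst (Lv n j))" for x j
  using gen[OF mv] by (simp add: hgen_def L_basis_mconst)
 show "L_spec g n (hact W)"
  unfolding L_spec_def W_eq act
 proof (intro conjI allI impI ob)
  fix j assume j: "j \<le> n"
  show "?T Gen_H (mconst (Lv n j)) = (of_nat n - 2 * of_nat j) \<odot>\<^bsub>ps_mod (L_space n)\<^esub> L_basis n j"
   using smi[of "int n - 2 * int j" j] unfolding TH L_basis_mconst by simp
  show "?T Gen_C (mconst (Lv n j)) = (of_nat (n + 1))\<^sup>2 \<odot>\<^bsub>ps_mod (L_space n)\<^esub> L_basis n j"
   using smi[of "int (n + 1) * int (n + 1)" j] unfolding TC L_basis_mconst by (simp add: power2_eq_square)
  show "?T Gen_Xm (mconst (Lv n j)) = L_basis n (j + 1)" unfolding TF L_basis_mconst by simp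
  show "?T Gen_Xp (mconst (Lv n j)) = (if j = 0 then \<zero>\<^bsub>ps_mod (L_space n)\<^esub>
       else (qbracket (%c. c) g (of_nat j) * qbracket (%c. c) g (of_nat (n - j + 1))) \<odot>\<^bsub>ps_mod (L_space n)\<^esub> L_basis n (j - 1))"
  proof (cases j)
   case 0
   then show ?thesis using Txp0 by (simp add: L_space_emod)
  next
   case (Suc i)
   then show ?thesis using TxpS[of i] j by (simp only: L_basis_mconst sm diff_Suc_1 nat.distinct if_False)
  qed
 qed
qed

lemma L_rep_type:
 assumes g: "g \<ge> 1"
 shows "hrep_obj g (L_rep g n)" "htp g (L_rep g n) = single n"
proof -
 note L = L_spec_exists[OF g, of n]
 let ?W = "mk_hrep g (Cr (Suc n)) (deform_ops g (Le n) (Lf n) (Lh n))"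
 have "(THE \<rho>. L_spec g n \<rho>) = hact ?W" by (rule the_equality[where P = "L_spec g n", OF L(1)]) (rule L_spec_unique[OF _ L(1)])
 then have "L_rep g n = \<lparr>hspace = L_space n, hact = hact ?W\<rparr>" unfolding L_rep_def L_spec_def by (simp only:)
 also have "\<dots> = ?W" by (intro hrep.equality) (simp_all add: L(3))
 finally have eq: "L_rep g n = ?W" .
 show "hrep_obj g (L_rep g n)" unfolding eq by (rule L(2))
 have ob: "sl2_obj (mk (Cr (Suc n)) (Le n) (Lf n) (Lh n))" by (rule sl2_obj_triple[OF L_module fd_Cr])
 have "tp (mk (Cr (Suc n)) (Le n) (Lf n) (Lh n)) = (%k. card {u\<in>{()}. n = k})"
  by (rule tp_eq[OF ob sl2_iso_refl[OF ob] L_frame fd_Cr])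
 then show "htp g (L_rep g n) = single n" unfolding htp_def eq L(4) by (auto simp: single_def fun_eq_iff)
qed

section \<open>The theorem\<close>

theorem mainTheorem5:
  fixes g :: nat
  assumes "g \<ge> 1"
  shows
    "(\<forall>V :: 'v sl2_rep. sl2_obj V \<longrightarrow>
        (\<exists>W :: 'v hrep. hrep_obj g W \<and> class_lim g W = V)) \<and>
     (\<forall>(V :: 'v hrep) (W :: 'v hrep). hrep_obj g V \<and> hrep_obj g W \<longrightarrow>
        (hrep_iso g V W \<longleftrightarrow> sl2_iso (class_lim g V) (class_lim g W))) \<and>
     ((\<forall>V :: 'v hrep. hrep_obj g V \<longrightarrow>
          sl2_obj (class_lim g V) \<and>
          class_lim_mor V (\<lambda>f\<in>carrier (ps_mod (hspace V)). f) =
            (\<lambda>v\<in>carrier (sspace (class_lim g V)). v)) \<and>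
      (\<forall>(V :: 'v hrep) (W :: 'v hrep) (Z :: 'v hrep). \<forall>\<phi>\<in>hrep_hom g V W. \<forall>\<psi>\<in>hrep_hom g W Z.
          hrep_obj g V \<and> hrep_obj g W \<and> hrep_obj g Z \<longrightarrow>
          class_lim_mor V \<phi> \<in> sl2_hom (class_lim g V) (class_lim g W) \<and>
          class_lim_mor V (compose (carrier (ps_mod (hspace V))) \<psi> \<phi>) =
            compose (carrier (sspace (class_lim g V))) (class_lim_mor W \<psi>) (class_lim_mor V \<phi>)) \<and>
      (\<exists>\<Phi>\<in>iso (Rep_hh g) Rep_sl2. \<forall>V :: 'v hrep. hrep_obj g V \<longrightarrow>
          \<Phi> (Rep_hh_class g V) = Rep_sl2_class (class_lim g V))) \<and>
     krull_schmidt g TYPE('v) \<and>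
     (\<forall>n. hrep_indecomposable g (L_rep g n)) \<and>
     (\<forall>V :: 'v hrep. hrep_indecomposable g V \<longrightarrow> (\<exists>!n. hrep_iso g V (L_rep g n))) \<and>
     (\<forall>V :: 'v hrep. hrep_obj g V \<longrightarrow> weight_rep g V)"
proof -
 note g = assms
 have sum2: "hrep_iso g D (hrep_dsum g [A, B]) \<longleftrightarrow> sl2_iso (class_lim g D) (sl2_dsum [class_lim g A, class_lim g B])"
  if "hrep_obj g D" "hrep_obj g A" "hrep_obj g B" for D A B :: "'v hrep"
 proof -
  have AB: "\<forall>W\<in>set [A, B]. hrep_obj g W" using that by simp
  show ?thesis using hrep_iso_iff[OF that(1) hrep_dsum_obj(1)[OF AB] g] class_lim_dsum[OF AB] by simp
 qed
 have gr: "\<exists>\<Phi>\<in>iso (Rep_hh g) Rep_sl2. \<forall>V :: 'v hrep. hrep_obj g V --> \<Phi> (Rep_hh_class g V) = Rep_sl2_class (class_lim g V)"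
  unfolding Rep_hh_def Rep_sl2_def Rep_hh_class_def Rep_sl2_class_def
 proof (rule groth_iso)
  show "\<exists>V :: 'v hrep. hrep_obj g V & class_lim g V = Y" if "sl2_obj Y" for Y :: "'v sl2_rep" by (rule deformation_exists[OF that g])
  show "hrep_iso g V W = sl2_iso (class_lim g V) (class_lim g W)" if "hrep_obj g V" "hrep_obj g W" for V W :: "'v hrep"
   by (rule hrep_iso_iff[OF that g])
  show "hrep_iso g D (hrep_dsum g [A, B]) = sl2_iso (class_lim g D) (sl2_dsum [class_lim g A, class_lim g B])"
   if "hrep_obj g D" "hrep_obj g A" "hrep_obj g B" for D A B :: "'v hrep" by (rule sum2[OF that])
 qed (fact hrep_iso_refl hrep_iso_sym sl2_iso_refl sl2_iso_sym | erule hrep_iso_trans sl2_iso_trans, assumption+ | erule class_lim_obj[OF _ g])+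
 have uniq: "\<exists>!n. hrep_iso g V (L_rep g n)" if V: "hrep_indecomposable g V" for V :: "'v hrep"
 proof -
  obtain n where n: "hrep_obj g V" "htp g V = single n" using V unfolding indecomposable_iff[OF g] by blast
  have "hrep_iso g V (L_rep g k) \<longleftrightarrow> n = k" for k
   unfolding htp_iso[OF n(1) L_rep_type(1)[OF g] g] L_rep_type(2)[OF g] n(2) using single_inj by blast
  then show ?thesis by simp
 qed
 show ?thesis
 proof (intro conjI allI impI ballI)
  show "\<exists>W :: 'v hrep. hrep_obj g W & class_lim g W = V" if "sl2_obj V" for V by (rule deformation_exists[OF that g])
  show "hrep_iso g V W \<longleftrightarrow> sl2_iso (class_lim g V) (class_lim g W)" if "hrep_obj g V & hrep_obj g W" for V W :: "'v hrep"
   using hrep_iso_iff[OF _ _ g] that by blast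
  show "sl2_obj (class_lim g V)" if "hrep_obj g V" for V :: "'v hrep" by (rule class_lim_obj[OF that g])
  show "class_lim_mor V (\<lambda>f\<in>psc (hspace V). f) = (\<lambda>v\<in>carrier (sspace (class_lim g V)). v)" if "hrep_obj g V" for V :: "'v hrep"
   by (rule class_lim_mor_id[OF that])
  fix V W Z :: "'v hrep" and \<phi> \<psi>
  assume \<phi>: "\<phi> \<in> hrep_hom g V W" and \<psi>: "\<psi> \<in> hrep_hom g W Z" and ob: "hrep_obj g V & hrep_obj g W & hrep_obj g Z"
  show "class_lim_mor V \<phi> \<in> sl2_hom (class_lim g V) (class_lim g W)" using class_lim_mor_hom \<phi> ob by blast
  show "class_lim_mor V (compose (psc (hspace V)) \<psi> \<phi>) =
      compose (carrier (sspace (class_lim g V))) (class_lim_mor W \<psi>) (class_lim_mor V \<phi>)"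
   using class_lim_mor_comp \<phi> \<psi> ob by blast
 next
  show "hrep_indecomposable g (L_rep g n)" for n using L_rep_type[OF g] unfolding indecomposable_iff[OF g] by blast
  show "weight_rep g V" if "hrep_obj g V" for V :: "'v hrep" by (rule all_weight_rep[OF that g])
 qed (rule gr krull_schmidt_holds[OF g] uniq, assumption?)+
qed

end
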